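(* Let $M$ be a Kähler manifold (with real analytic metric), $p\in M$, $K:=\exp_p^{-1}\circ\mathrm{knc}_p$, and let $\Phi(X)$ be the inverse of the backward parallel transport $\Phi^{-1}(X)$. The Taylor series of the inverse difference element $K^{-1}$ in $0\in T_pM$ satisfies the recursion formula $$\Big[(N\otimes\mathrm{id}+\mathrm{Der}_I\otimes I)\,K^{-1}\Big](X)=I\,DK^{-1}(X)\Big((\mathrm{id}-\Phi(X))\,IX\Big)=\sum_{k\ge0}\frac{k+1}{(k+3)!}\,(\nabla^k_{X,\ldots,X}R)_{X,IX}IX+O(R^2)$$ as an identity of formal power series in $X\in T_pM$, where $O(R^2)$ stands for composition polynomials which are at least quadratic in $R,\nabla R,\nabla^2R,\ldots$.
   Context: A Kähler manifold is a smooth manifold $M$ with a Riemannian metric $g$ and an orthogonal almost complex structure $I$ with $\nabla I=0$ for the Levi-Civita connection $\nabla$; $\omega(X,Y)=g(IX,Y)$. Curvature: $R_{X,Y}Z=\nabla_X\nabla_YZ-\nabla_Y\nabla_XZ-\nabla_{[X,Y]}Z$; iterated covariant derivatives satisfy $\nabla^{k+1}_{Z,X_1,\ldots,X_k}=(\nabla_Z\nabla^k)_{X_1,\ldots,X_k}$; all tensors are evaluated at $p$ and $I=I_p$. Kähler normal coordinates: $\mathrm{Sym}^{\kappa,\overline\kappa}T_p^*M$ is the space of complex valued polynomials $\eta$ on $T_pM$, homogeneous of degree $\kappa+\overline\kappa$, with $\frac d{dt}|_0\eta(X+tI_pX)=i(\kappa-\overline\kappa)\eta(X)$; $\overline{\mathrm{Sym}}^{\ge(2,2)}T_p^*M$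 is the space of real formal power series on $T_pM$ all of whose bihomogeneous components have $\kappa,\overline\kappa\ge2$. A local potential is a real function $\theta^{\mathrm{loc}}$ with $\omega=\frac i2\partial\overline\partial\theta^{\mathrm{loc}}$. Anchored coordinates centered in $p$ are a smooth map $\varphi$ from a neighborhood of $0\in T_pM$ to $M$, diffeomorphic onto a neighborhood of $p$, with $\varphi(0)=p$ and differential $\mathrm{id}_{T_pM}$ at $0$. There are (Bochner) unique (as germs) anchored coordinates $\mathrm{knc}_p$, holomorphic with respect to $I_p$ on $T_pM$ and $I$ on $M$, and a unique local potential $\theta_p^{\mathrm{loc}}$ near $p$ such that the Taylor series of $\theta_p^{\mathrm{loc}}\circ\mathrm{knc}_p$ in $0$ is congruent to $g_p(X,X)$ modulo $\overline{\mathrm{Sym}}^{\ge(2,2)}T_p^*M$. Backward parallel transport: $\Phi^{-1}(X):=\mathrm{PT}^\nabla(X)^{-1}\circ(\exp_p)_{*,X}\in\mathrm{End}\,T_pM$, where $\mathrm{PT}^\nabla(X):T_pM\to T_{\exp_pX}M$ is parallel transport along $t\mapsto\exp_p(tX)$, $0\le t\le1$, and $T_X(T_pM)\cong T_pM$. Operators: for a formal power series $F$ on $T_pM$ with values in $T_pM$, $DF(X)Y:=\frac d{dt}|_0F(X+tY)$, $[(N\otimes\mathrm{id})F](X)=DF(X)X$ (multiplication of the degree $n$ component by $n$) and $[(\mathrm{Der}_I\otimes I)F](X)=I\,DF(X)(IX)$. Composition polynomials: multilinear maps $T_pM\times\cdots\times T_pM\to T_pM$ that are finite real linear combinations of iterated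 compositions (inserting one multilinear map into an argument of another) of $I_p$ and of the multilinear maps $(Y_1,\ldots,Y_k,X,Y,Z)\mapsto(\nabla^k_{Y_1,\ldots,Y_k}R)_{X,Y}Z$; they are considered as polynomials in $X$ by inserting $X$ into all arguments. At least quadratic means that each iterated composition occurring contains at least two factors among $R,\nabla R,\nabla^2R,\ldots$. The $O(R^2)$ term is a formal sum of such terms, finitely many in each degree in $X$. *)

theory Defs
  imports "HOL-Analysis.Analysis"
begin

section \<open>Smooth and real analytic maps between Euclidean spaces\<close>

primrec Ck_on :: "nat \<Rightarrow> 'a::euclidean_space set \<Rightarrow> ('a \<Rightarrow> 'b::real_normed_vector) \<Rightarrow> bool" where
  "Ck_on 0 S f \<longleftrightarrow> continuous_on S f"
| "Ck_on (Suc k) S f \<longleftrightarrow> (\<forall>x\<in>S. f differentiable (at x)) \<and>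
     (\<forall>v. Ck_on k S (\<lambda>x. frechet_derivative f (at x) v))"

text \<open>Only used for open \<open>S\<close>.\<close>

definition smooth_on :: "'a::euclidean_space set \<Rightarrow> ('a \<Rightarrow> 'b::real_normed_vector) \<Rightarrow> bool" where
  "smooth_on S f \<longleftrightarrow> (\<forall>k. Ck_on k S f)"

definition multi_indices :: "('a::euclidean_space \<Rightarrow> nat) set" where
  "multi_indices = PiE Basis (\<lambda>_. UNIV)"

definition monomial :: "('a::euclidean_space \<Rightarrow> nat) \<Rightarrow> 'a \<Rightarrow> real" where
  "monomial m X = (\<Prod>b\<in>Basis. (X \<bullet> b) ^ m b)"

definition real_analytic_on ::
    "'a::euclidean_space set \<Rightarrow> ('a \<Rightarrow> 'b::real_normed_vector) \<Rightarrow> bool" where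
  "real_analytic_on S f \<longleftrightarrow> (\<forall>x\<in>S. \<exists>r>0. \<exists>a. \<forall>y\<in>ball x r.
     ((\<lambda>m. monomial m (y - x) *\<^sub>R a m) has_sum f y) multi_indices)"

definition homogeneous_polynomial ::
    "nat \<Rightarrow> ('a::euclidean_space \<Rightarrow> 'b::real_normed_vector) \<Rightarrow> bool" where
  "homogeneous_polynomial n f \<longleftrightarrow> (\<exists>a. \<forall>X.
     f X = (\<Sum>m\<in>{m \<in> multi_indices. (\<Sum>b\<in>Basis. m b) = n}. monomial m X *\<^sub>R a m))"


section \<open>Manifolds\<close>

record ('m, 'a) chart =
  chart_dom :: "'m set"
  chart_map :: "'m \<Rightarrow> 'a"

definition chart_img :: "('m, 'a) chart \<Rightarrow> 'a set" where
  "chart_img c = chart_map c ` chart_dom c"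

definition chart_inv :: "('m, 'a) chart \<Rightarrow> 'a \<Rightarrow> 'm" where
  "chart_inv c = inv_into (chart_dom c) (chart_map c)"

definition is_chart :: "('m::topological_space, 'a::euclidean_space) chart \<Rightarrow> bool" where
  "is_chart c \<longleftrightarrow> open (chart_dom c) \<and> open (chart_img c) \<and>
     homeomorphism (chart_dom c) (chart_img c) (chart_map c) (chart_inv c)"

definition transition :: "('m, 'a) chart \<Rightarrow> ('m, 'a) chart \<Rightarrow> 'a \<Rightarrow> 'a" where
  "transition c d = chart_map d \<circ> chart_inv c"

definition overlap :: "('m, 'a) chart \<Rightarrow> ('m, 'a) chart \<Rightarrow> 'a set" where
  "overlap c d = chart_map c ` (chart_dom c \<inter> chart_dom d)"

definition smooth_atlas :: "('m::topological_space, 'a::euclidean_space) chart set \<Rightarrow> bool" where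
  "smooth_atlas A \<longleftrightarrow> (\<forall>c\<in>A. is_chart c) \<and>
     (\<forall>c\<in>A. \<forall>d\<in>A. smooth_on (overlap c d) (transition c d))"

definition carrier :: "('m, 'a) chart set \<Rightarrow> 'm set" where
  "carrier A = (\<Union>c\<in>A. chart_dom c)"

text \<open>
  Tangent vectors and tensors are given by their components: a chart \<open>c\<close> identifies the tangent
  spaces at the points of its domain with the model space \<open>'a\<close>, and a tensor field is a
  family of component functions on the chart images, indexed by the charts of the atlas and
  compatible with the differentials of the transition maps.
\<close>

type_synonym ('m, 'a) metric = "('m, 'a) chart \<Rightarrow> 'a \<Rightarrow> 'a \<Rightarrow> 'a \<Rightarrow> real"
type_synonym ('m, 'a) endo_field = "('m, 'a) chart \<Rightarrow> 'a \<Rightarrow> 'a \<Rightarrow> 'a"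

definition riemannian_metric ::
    "('m::topological_space, 'a::euclidean_space) chart set \<Rightarrow> ('m, 'a) metric \<Rightarrow> bool" where
  "riemannian_metric A g \<longleftrightarrow>
     (\<forall>c\<in>A. \<forall>x\<in>chart_img c. bilinear (g c x) \<and> (\<forall>u v. g c x u v = g c x v u) \<and>
        (\<forall>u. u \<noteq> 0 \<longrightarrow> g c x u u > 0)) \<and>
     (\<forall>c\<in>A. \<forall>u v. smooth_on (chart_img c) (\<lambda>x. g c x u v)) \<and>
     (\<forall>c\<in>A. \<forall>d\<in>A. \<forall>x\<in>overlap c d. \<forall>u v.
        g d (transition c d x) (frechet_derivative (transition c d) (at x) u)
          (frechet_derivative (transition c d) (at x) v) = g c x u v)"

definition almost_complex_structure ::
    "('m::topological_space, 'a::euclidean_space) chart set \<Rightarrow> ('m, 'a) endo_field \<Rightarrow> bool" where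
  "almost_complex_structure A J \<longleftrightarrow>
     (\<forall>c\<in>A. \<forall>x\<in>chart_img c. linear (J c x) \<and> (\<forall>u. J c x (J c x u) = - u)) \<and>
     (\<forall>c\<in>A. \<forall>u. smooth_on (chart_img c) (\<lambda>x. J c x u)) \<and>
     (\<forall>c\<in>A. \<forall>d\<in>A. \<forall>x\<in>overlap c d. \<forall>u.
        J d (transition c d x) (frechet_derivative (transition c d) (at x) u)
          = frechet_derivative (transition c d) (at x) (J c x u))"

text \<open>
  The metric is real analytic with respect to some real analytic structure compatible with the
  smooth one. As \<open>A\<close> need not be maximal, asking for the analytic charts to lie in \<open>A\<close> is no
  restriction.
\<close>

definition real_analytic_metric ::
    "('m::topological_space, 'a::euclidean_space) chart set \<Rightarrow> ('m, 'a) metric \<Rightarrow> bool" where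
  "real_analytic_metric A g \<longleftrightarrow> (\<exists>B\<subseteq>A. carrier B = carrier A \<and>
     (\<forall>c\<in>B. \<forall>d\<in>B. real_analytic_on (overlap c d) (transition c d)) \<and>
     (\<forall>c\<in>B. \<forall>u v. real_analytic_on (chart_img c) (\<lambda>x. g c x u v)))"


section \<open>Levi-Civita connection and curvature in a chart\<close>

text \<open>
  The Levi-Civita connection is the torsion-free metric connection. In a chart
  \<open>\<nabla>\<^sub>u V = DV(u) + \<Gamma>(u, V)\<close>, where torsion-freeness is the symmetry of \<open>\<Gamma>\<close>.
\<close>

definition christoffel ::
    "('a \<Rightarrow> 'a \<Rightarrow> 'a \<Rightarrow> real) \<Rightarrow> 'a::euclidean_space \<Rightarrow> 'a \<Rightarrow> 'a \<Rightarrow> 'a" where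
  "christoffel g x = (THE \<Gamma>. bilinear \<Gamma> \<and> (\<forall>u v. \<Gamma> u v = \<Gamma> v u) \<and>
     (\<forall>u v w. frechet_derivative (\<lambda>y. g y v w) (at x) u = g x (\<Gamma> u v) w + g x v (\<Gamma> u w)))"

definition nabla_vf ::
    "('a \<Rightarrow> 'a \<Rightarrow> 'a \<Rightarrow> 'a) \<Rightarrow> ('a \<Rightarrow> 'a) \<Rightarrow> 'a::euclidean_space \<Rightarrow> 'a \<Rightarrow> 'a" where
  "nabla_vf \<Gamma> V x u = frechet_derivative V (at x) u + \<Gamma> x u (V x)"

text \<open>The vectors \<open>u\<close>, \<open>v\<close>, \<open>w\<close> are extended to constant vector fields, which commute.\<close>

definition curvature ::
    "('a \<Rightarrow> 'a \<Rightarrow> 'a \<Rightarrow> 'a) \<Rightarrow> 'a::euclidean_space \<Rightarrow> 'a \<Rightarrow> 'a \<Rightarrow> 'a \<Rightarrow> 'a" where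
  "curvature \<Gamma> x u v w =
     nabla_vf \<Gamma> (\<lambda>y. nabla_vf \<Gamma> (\<lambda>_. w) y v) x u - nabla_vf \<Gamma> (\<lambda>y. nabla_vf \<Gamma> (\<lambda>_. w) y u) x v"

text \<open>
  A vector-valued covariant \<open>k\<close>-tensor field \<open>T\<close> takes a point and the list of its \<open>k\<close> arguments.
  The direction of differentiation becomes the first argument of the covariant derivative.
\<close>

fun cov_deriv :: "('a \<Rightarrow> 'a \<Rightarrow> 'a \<Rightarrow> 'a) \<Rightarrow> ('a::euclidean_space \<Rightarrow> 'a list \<Rightarrow> 'a) \<Rightarrow>
    'a \<Rightarrow> 'a list \<Rightarrow> 'a" where
  "cov_deriv \<Gamma> T x [] = 0"
| "cov_deriv \<Gamma> T x (Z # Ys) = frechet_derivative (\<lambda>y. T y Ys) (at x) Z + \<Gamma> x Z (T x Ys)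
     - (\<Sum>i<length Ys. T x (Ys[i := \<Gamma> x Z (Ys ! i)]))"

definition curvature_deriv ::
    "('a \<Rightarrow> 'a \<Rightarrow> 'a \<Rightarrow> 'a) \<Rightarrow> nat \<Rightarrow> 'a::euclidean_space \<Rightarrow> 'a list \<Rightarrow> 'a" where
  "curvature_deriv \<Gamma> k =
     (cov_deriv \<Gamma> ^^ k) (\<lambda>x xs. curvature \<Gamma> x (xs ! 0) (xs ! 1) (xs ! 2))"

definition kaehler_manifold ::
    "('m::{t2_space,second_countable_topology}, 'a::euclidean_space) chart set \<Rightarrow>
      ('m, 'a) metric \<Rightarrow> ('m, 'a) endo_field \<Rightarrow> bool" where
  "kaehler_manifold A g J \<longleftrightarrow>
     smooth_atlas A \<and> riemannian_metric A g \<and> almost_complex_structure A J \<and>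
     (\<forall>c\<in>A. \<forall>x\<in>chart_img c. \<forall>u v. g c x (J c x u) (J c x v) = g c x u v) \<and>
     (\<forall>c\<in>A. \<forall>x\<in>chart_img c. \<forall>Z Y.
        cov_deriv (christoffel (g c)) (\<lambda>y ys. J c y (ys ! 0)) x [Z, Y] = 0)"

definition kaehler_form ::
    "('m, 'a) metric \<Rightarrow> ('m, 'a) endo_field \<Rightarrow> ('m, 'a) chart \<Rightarrow> 'a \<Rightarrow> 'a \<Rightarrow> 'a \<Rightarrow> real" where
  "kaehler_form g J c x u v = g c x (J c x u) v"


section \<open>Formal power series\<close>

text \<open>
  A formal power series on \<open>'a\<close> with values in \<open>'b\<close> is the sequence of its homogeneous
  components, regarded as functions. The Taylor series is centered in \<open>0\<close>; its component of degree
  \<open>n\<close> is the \<open>n\<close>-th derivative of \<open>t \<mapsto> f (t X)\<close> in \<open>t = 0\<close>, divided by \<open>n!\<close>.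
\<close>

type_synonym ('a, 'b) formal_series = "nat \<Rightarrow> 'a \<Rightarrow> 'b"

primrec nth_vector_deriv :: "nat \<Rightarrow> (real \<Rightarrow> 'b::real_normed_vector) \<Rightarrow> real \<Rightarrow> 'b" where
  "nth_vector_deriv 0 f = f"
| "nth_vector_deriv (Suc n) f = (\<lambda>t. vector_derivative (nth_vector_deriv n f) (at t))"

definition taylor ::
    "('a::real_vector \<Rightarrow> 'b::real_normed_vector) \<Rightarrow> ('a, 'b) formal_series" where
  "taylor f n X = (1 / fact n) *\<^sub>R nth_vector_deriv n (\<lambda>t. f (t *\<^sub>R X)) 0"

definition dir_deriv ::
    "('a::real_vector \<Rightarrow> 'b::real_normed_vector) \<Rightarrow> 'a \<Rightarrow> 'a \<Rightarrow> 'b" where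
  "dir_deriv f X Y = vector_derivative (\<lambda>t. f (X + t *\<^sub>R Y)) (at 0)"

text \<open>
  \<open>series_D F G\<close> is the series \<open>DF(X)(G(X))\<close>. The component of degree \<open>m\<close> of \<open>DF(\<cdot>)Y\<close> is
  the derivative of the component of degree \<open>m + 1\<close> of \<open>F\<close>.
\<close>

definition series_D ::
    "('a::real_vector, 'b::real_normed_vector) formal_series \<Rightarrow> ('a, 'a) formal_series \<Rightarrow>
      ('a, 'b) formal_series" where
  "series_D F G n X = (\<Sum>l\<le>n. dir_deriv (F (Suc (n - l))) X (G l X))"

definition op_N ::
    "('a::real_vector, 'b::real_normed_vector) formal_series \<Rightarrow> ('a, 'b) formal_series" where
  "op_N F n X = dir_deriv (F n) X X"

definition op_Der_I ::
    "('a \<Rightarrow> 'a) \<Rightarrow> ('a::real_normed_vector, 'a) formal_series \<Rightarrow> ('a, 'a) formal_series" where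
  "op_Der_I I F n X = I (dir_deriv (F n) X (I X))"

definition Sym_bideg ::
    "('a \<Rightarrow> 'a) \<Rightarrow> nat \<Rightarrow> nat \<Rightarrow> ('a::euclidean_space \<Rightarrow> complex) set" where
  "Sym_bideg I \<kappa> \<kappa>' = {\<eta>. homogeneous_polynomial (\<kappa> + \<kappa>') \<eta> \<and>
     (\<forall>X. ((\<lambda>t. \<eta> (X + t *\<^sub>R I X)) has_vector_derivative
        \<i> * (of_nat \<kappa> - of_nat \<kappa>') * \<eta> X) (at 0))}"

definition Sym_ge_2_2 :: "('a \<Rightarrow> 'a) \<Rightarrow> ('a::euclidean_space, real) formal_series set" where
  "Sym_ge_2_2 I = {F. \<exists>\<eta>. (\<forall>\<kappa> \<kappa>'. \<eta> \<kappa> \<kappa>' \<in> Sym_bideg I \<kappa> \<kappa>') \<and>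
     (\<forall>\<kappa> \<kappa>'. \<kappa> < 2 \<or> \<kappa>' < 2 \<longrightarrow> \<eta> \<kappa> \<kappa>' = (\<lambda>X. 0)) \<and>
     (\<forall>n X. complex_of_real (F n X) = (\<Sum>\<kappa>\<le>n. \<eta> \<kappa> (n - \<kappa>) X))}"


section \<open>Anchored coordinates\<close>

text \<open>
  In the sequel \<open>T\<^sub>pM\<close> is identified with \<open>'a\<close> by means of a chart \<open>c\<close> around \<open>p\<close>.
\<close>

definition smooth_into ::
    "('m::topological_space, 'a::euclidean_space) chart set \<Rightarrow> 'a set \<Rightarrow> ('a \<Rightarrow> 'm) \<Rightarrow> bool" where
  "smooth_into A U \<phi> \<longleftrightarrow> \<phi> ` U \<subseteq> carrier A \<and> continuous_on U \<phi> \<and>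
     (\<forall>d\<in>A. smooth_on (U \<inter> \<phi> -` chart_dom d) (chart_map d \<circ> \<phi>))"

definition smooth_on_mfd :: "('m::topological_space, 'a::euclidean_space) chart set \<Rightarrow>
    'm set \<Rightarrow> ('m \<Rightarrow> 'b::real_normed_vector) \<Rightarrow> bool" where
  "smooth_on_mfd A W f \<longleftrightarrow>
     (\<forall>d\<in>A. smooth_on (chart_map d ` (chart_dom d \<inter> W)) (f \<circ> chart_inv d))"

definition anchored_coordinates ::
    "('m::topological_space, 'a::euclidean_space) chart set \<Rightarrow> ('m, 'a) chart \<Rightarrow> 'm \<Rightarrow>
      'a set \<Rightarrow> ('a \<Rightarrow> 'm) \<Rightarrow> bool" where
  "anchored_coordinates A c p U \<phi> \<longleftrightarrow> open U \<and> 0 \<in> U \<and> smooth_into A U \<phi> \<and>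
     inj_on \<phi> U \<and> open (\<phi> ` U) \<and> smooth_on_mfd A (\<phi> ` U) (inv_into U \<phi>) \<and>
     \<phi> 0 = p \<and> ((chart_map c \<circ> \<phi>) has_derivative (\<lambda>v. v)) (at 0)"

definition geodesic_at ::
    "('m::topological_space, 'a::euclidean_space) chart set \<Rightarrow> ('m, 'a) metric \<Rightarrow>
      (real \<Rightarrow> 'm) \<Rightarrow> real \<Rightarrow> bool" where
  "geodesic_at A g \<gamma> t \<longleftrightarrow> isCont \<gamma> t \<and> (\<forall>d\<in>A. \<gamma> t \<in> chart_dom d \<longrightarrow>
     (let x = chart_map d \<circ> \<gamma>; x' = (\<lambda>s. vector_derivative x (at s)) in
        (\<forall>\<^sub>F s in nhds t. x differentiable (at s)) \<and>
        (x' has_vector_derivative - christoffel (g d) (x t) (x' t) (x' t)) (at t)))"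

text \<open>
  The exponential map in \<open>p\<close>, restricted to a star-shaped neighborhood \<open>U\<close> of \<open>0\<close> on which it is
  a diffeomorphism: \<open>t \<mapsto> exp\<^sub>p (t X)\<close> is the geodesic with initial velocity \<open>X\<close>. Together with
  \<open>exp\<^sub>p 0 = p\<close> and the differential \<open>id\<close> in \<open>0\<close> this determines the values on \<open>U\<close>.
\<close>

definition exponential_coordinates ::
    "('m::topological_space, 'a::euclidean_space) chart set \<Rightarrow> ('m, 'a) metric \<Rightarrow>
      ('m, 'a) chart \<Rightarrow> 'm \<Rightarrow> 'a set \<Rightarrow> ('a \<Rightarrow> 'm) \<Rightarrow> bool" where
  "exponential_coordinates A g c p U expp \<longleftrightarrow> anchored_coordinates A c p U expp \<and>
     (\<forall>X\<in>U. \<forall>t\<in>{0..1}. t *\<^sub>R X \<in> U \<and> geodesic_at A g (\<lambda>s. expp (s *\<^sub>R X)) t)"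

definition holomorphic_coordinates ::
    "('m::topological_space, 'a::euclidean_space) chart set \<Rightarrow> ('m, 'a) endo_field \<Rightarrow>
      ('m, 'a) chart \<Rightarrow> 'm \<Rightarrow> 'a set \<Rightarrow> ('a \<Rightarrow> 'm) \<Rightarrow> bool" where
  "holomorphic_coordinates A J c p U \<phi> \<longleftrightarrow>
     (\<forall>d\<in>A. \<forall>X\<in>U. \<phi> X \<in> chart_dom d \<longrightarrow> (\<forall>v.
        frechet_derivative (chart_map d \<circ> \<phi>) (at X) (J c (chart_map c p) v) =
        J d (chart_map d (\<phi> X)) (frechet_derivative (chart_map d \<circ> \<phi>) (at X) v)))"

text \<open>
  For a real function \<open>f\<close>, \<open>del_bar_f J f\<close> is the \<open>(0,1)\<close>-part of \<open>df\<close>, and \<open>del_del_bar\<close> is the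
  \<open>(1,1)\<close>-part of its exterior derivative, with \<open>d\<beta>(X,Y) = X \<beta>(Y) - Y \<beta>(X) - \<beta>([X,Y])\<close>.
\<close>

definition del_bar_f ::
    "('a \<Rightarrow> 'a \<Rightarrow> 'a) \<Rightarrow> ('a::euclidean_space \<Rightarrow> real) \<Rightarrow> 'a \<Rightarrow> 'a \<Rightarrow> complex" where
  "del_bar_f J f x v =
     (of_real (frechet_derivative f (at x) v)
        + \<i> * of_real (frechet_derivative f (at x) (J x v))) / 2"

definition ext_deriv ::
    "('a::euclidean_space \<Rightarrow> 'a \<Rightarrow> complex) \<Rightarrow> 'a \<Rightarrow> 'a \<Rightarrow> 'a \<Rightarrow> complex" where
  "ext_deriv \<beta> x u v =
     frechet_derivative (\<lambda>y. \<beta> y v) (at x) u - frechet_derivative (\<lambda>y. \<beta> y u) (at x) v"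

definition del_del_bar ::
    "('a \<Rightarrow> 'a \<Rightarrow> 'a) \<Rightarrow> ('a::euclidean_space \<Rightarrow> real) \<Rightarrow> 'a \<Rightarrow> 'a \<Rightarrow> 'a \<Rightarrow> complex" where
  "del_del_bar J f x u v =
     (ext_deriv (del_bar_f J f) x u v + ext_deriv (del_bar_f J f) x (J x u) (J x v)) / 2"

definition local_potential ::
    "('m::topological_space, 'a::euclidean_space) chart set \<Rightarrow> ('m, 'a) metric \<Rightarrow>
      ('m, 'a) endo_field \<Rightarrow> 'm set \<Rightarrow> ('m \<Rightarrow> real) \<Rightarrow> bool" where
  "local_potential A g J W \<theta> \<longleftrightarrow> open W \<and> W \<subseteq> carrier A \<and> smooth_on_mfd A W \<theta> \<and>
     (\<forall>d\<in>A. \<forall>x\<in>chart_map d ` (chart_dom d \<inter> W). \<forall>u v.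
        complex_of_real (kaehler_form g J d x u v) =
          \<i> / 2 * del_del_bar (J d) (\<theta> \<circ> chart_inv d) x u v)"

definition kaehler_normal_coordinates ::
    "('m::topological_space, 'a::euclidean_space) chart set \<Rightarrow> ('m, 'a) metric \<Rightarrow>
      ('m, 'a) endo_field \<Rightarrow> ('m, 'a) chart \<Rightarrow> 'm \<Rightarrow> 'a set \<Rightarrow> ('a \<Rightarrow> 'm) \<Rightarrow> bool" where
  "kaehler_normal_coordinates A g J c p U knc \<longleftrightarrow> anchored_coordinates A c p U knc \<and>
     holomorphic_coordinates A J c p U knc \<and>
     (\<exists>\<theta> W. p \<in> W \<and> local_potential A g J W \<theta> \<and>
        (\<lambda>n X. taylor (\<theta> \<circ> knc) n X - (if n = 2 then g c (chart_map c p) X X else 0))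
          \<in> Sym_ge_2_2 (J c (chart_map c p)))"

text \<open>\<open>K = exp\<^sub>p\<^sup>-\<^sup>1 \<circ> knc\<^sub>p\<close> and its inverse, both defined near \<open>0\<close>.\<close>

definition difference_element ::
    "'a set \<Rightarrow> ('a \<Rightarrow> 'm) \<Rightarrow> ('a \<Rightarrow> 'm) \<Rightarrow> 'a \<Rightarrow> 'a" where
  "difference_element UE expp knc = inv_into UE expp \<circ> knc"

definition inverse_difference_element ::
    "'a set \<Rightarrow> ('a \<Rightarrow> 'm) \<Rightarrow> 'a set \<Rightarrow> ('a \<Rightarrow> 'm) \<Rightarrow> 'a \<Rightarrow> 'a" where
  "inverse_difference_element UE expp UK knc =
     inv_into (UK \<inter> knc -` (expp ` UE)) (difference_element UE expp knc)"


section \<open>Parallel transport\<close>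

text \<open>
  Parallel transport along the curve \<open>x t\<close>, \<open>0 \<le> t \<le> 1\<close>, in the image of a chart. For sufficiently
  small \<open>X\<close> the geodesic \<open>exp\<^sub>p (t X)\<close>, \<open>0 \<le> t \<le> 1\<close>, remains in the domain of the chart \<open>c\<close>, so that
  \<open>backward_PT\<close> and \<open>forward_PT\<close> below have the correct germs in \<open>X = 0\<close>.
\<close>

definition parallel_along ::
    "('a \<Rightarrow> 'a \<Rightarrow> 'a \<Rightarrow> 'a) \<Rightarrow> (real \<Rightarrow> 'a::euclidean_space) \<Rightarrow> (real \<Rightarrow> 'a) \<Rightarrow> bool" where
  "parallel_along \<Gamma> x V \<longleftrightarrow> (\<forall>t\<in>{0..1}. (V has_vector_derivative
     - \<Gamma> (x t) (vector_derivative x (at t)) (V t)) (at t within {0..1}))"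

definition parallel_transport ::
    "('a \<Rightarrow> 'a \<Rightarrow> 'a \<Rightarrow> 'a) \<Rightarrow> (real \<Rightarrow> 'a::euclidean_space) \<Rightarrow> 'a \<Rightarrow> 'a" where
  "parallel_transport \<Gamma> x v = (THE w. \<exists>V. parallel_along \<Gamma> x V \<and> V 0 = v \<and> V 1 = w)"

definition backward_PT ::
    "('m, 'a) metric \<Rightarrow> ('m, 'a::euclidean_space) chart \<Rightarrow> ('a \<Rightarrow> 'm) \<Rightarrow> 'a \<Rightarrow> 'a \<Rightarrow> 'a" where
  "backward_PT g c expp X =
     inv (parallel_transport (christoffel (g c)) (\<lambda>t. chart_map c (expp (t *\<^sub>R X))))
       \<circ> frechet_derivative (chart_map c \<circ> expp) (at X)"

definition forward_PT ::
    "('m, 'a) metric \<Rightarrow> ('m, 'a::euclidean_space) chart \<Rightarrow> ('a \<Rightarrow> 'm) \<Rightarrow> 'a \<Rightarrow> 'a \<Rightarrow> 'a" where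
  "forward_PT g c expp X = inv (backward_PT g c expp X)"


section \<open>Composition polynomials\<close>

text \<open>
  \<open>iterated_composition I R n r F\<close>: \<open>F\<close> is an iterated composition with \<open>n\<close> arguments, supplied as
  a list, of \<open>I\<close> and the \<open>(k + 3)\<close>-linear maps \<open>R k\<close>, with \<open>r\<close> factors among \<open>R 0, R 1, \<dots>\<close>.
\<close>

inductive iterated_composition ::
    "('a \<Rightarrow> 'a) \<Rightarrow> (nat \<Rightarrow> 'a list \<Rightarrow> 'a) \<Rightarrow> nat \<Rightarrow> nat \<Rightarrow> ('a list \<Rightarrow> 'a) \<Rightarrow> bool"
  for I R where
  complex_structure: "iterated_composition I R 1 0 (\<lambda>xs. I (xs ! 0))"
| curvature: "iterated_composition I R (k + 3) 1 (R k)"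
| insertion: "iterated_composition I R m r F \<Longrightarrow> iterated_composition I R n s G \<Longrightarrow> j < m \<Longrightarrow>
    iterated_composition I R (m + n - 1) (r + s)
      (\<lambda>xs. F (take j xs @ [G (take n (drop j xs))] @ drop (j + n) xs))"

text \<open>
  Formal sums of at least quadratic composition polynomials, finitely many in each degree. An
  iterated composition with \<open>n\<close> arguments contributes to the component of degree \<open>n\<close>.
\<close>

definition O_R2 ::
    "('a \<Rightarrow> 'a) \<Rightarrow> (nat \<Rightarrow> 'a list \<Rightarrow> 'a) \<Rightarrow> ('a::real_vector, 'a) formal_series set" where
  "O_R2 I R = {Q. \<forall>n. \<exists>(N::nat) a F r.
     (\<forall>i<N. iterated_composition I R n (r i) (F i) \<and> 2 \<le> r i) \<and>
     (\<forall>X. Q n X = (\<Sum>i<N. a i *\<^sub>R F i (replicate n X)))}"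

text \<open>The part \<open>\<Sum>k. (k+1)/(k+3)! (\<nabla>\<^sup>k\<^sub>X\<^sub>,\<^sub>\<dots>\<^sub>,\<^sub>X R)\<^sub>X\<^sub>,\<^sub>I\<^sub>X IX\<close>, with \<open>k\<close>-th summand in degree \<open>k + 3\<close>.\<close>

definition linear_term ::
    "('a \<Rightarrow> 'a) \<Rightarrow> (nat \<Rightarrow> 'a list \<Rightarrow> 'a) \<Rightarrow> ('a::real_vector, 'a) formal_series" where
  "linear_term I R n X = (\<Sum>k\<in>{k. k + 3 = n}.
     (real (k + 1) / fact (k + 3)) *\<^sub>R R k (replicate k X @ [X, I X, I X]))"

end

theory Submission
  imports Defs "HOL-Computational_Algebra.Polynomial"
begin

text \<open>
  Write \<open>K\<inverse> = knc\<inverse> \<circ> exp\<close>. Since \<open>knc\<close> is holomorphic and parallel transport commutes with the parallel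
  structure \<open>I\<close>, one has \<open>I \<circ> DK\<inverse> = DK\<inverse> \<circ> \<Phi> \<circ> I \<circ> \<Phi>\<inverse>\<close>; together with \<open>\<Phi>(X) X = X\<close> this is the first
  identity. The Jacobi equation along a ray, read in a parallel frame, shows that the Taylor
  coefficients of \<open>\<Phi>\<close> are composition polynomials, with the stated part linear in the curvature.

  For the second identity the recursion must determine \<open>K\<inverse>\<close>. Its left hand side is diagonal on the
  frequencies of \<open>\<phi> \<mapsto> K\<inverse>(exp(\<phi> I) X)\<close> in each degree, and its kernel is the extreme frequency. The
  Euler-Lagrange equation of geodesics in Kaehler normal coordinates, taken modulo extreme
  frequencies, shows that this frequency is absent, because all components of the potential have
  bidegree at least \<open>(2,2)\<close>. Hence the components of \<open>K\<inverse>\<close> of degree at least 2 are composition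
  polynomials that are at least linear in the curvature, and the factor \<open>DK\<inverse> - id\<close> contributes only
  to \<open>O(R\<^sup>2)\<close>.
\<close>

section \<open>Calculus of smooth maps\<close>

text \<open>Composition polynomials are closed under sums, compositions and derivatives, but there
  is no reason why inverting an operator should preserve them. What rescues the recursion is a
  spectral bound: on degree n frequency \<nu> is multiplied by n - \<nu>, and once |\<nu>| <= n - 1
  is known the multipliers are among the integers 1, ..., 2n - 1. On finitely many nonzero numbers
  inversion is a polynomial, so each component of the inverse difference element is a polynomial in
  the operator applied to the right hand side. The recursion cannot give this bound itself. It comes
  from \<open>M\<close>, four times the metric pulled back by the normal coordinates: in holomorphic
  coordinates this is a plain second-order expression in the potential, without Christoffel symbols,
  so that frequencies of the potential control geodesics. The constant (k+1)/(k+3)! comes from the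
  Jacobi equation in degree k + 1: two integrations divide by (k+2)(k+3), and the Taylor coefficient
  of the curvature contributes 1/k!.\<close>

definition pd :: "'a::real_normed_vector \<Rightarrow> ('a \<Rightarrow> 'b::real_normed_vector) \<Rightarrow> 'a \<Rightarrow> 'b" where
  "pd v f = (\<lambda>x. frechet_derivative f (at x) v)"

lemma pd_eqI: "(f has_derivative f') (at x) \<Longrightarrow> pd v f x = f' v"
  unfolding pd_def using frechet_derivative_at by metis

lemma has_derivative_pd: "f differentiable (at x) \<Longrightarrow> (f has_derivative (\<lambda>v. pd v f x)) (at x)"
  unfolding pd_def using frechet_derivative_works by blast

lemma pd_const [simp]: "pd v (\<lambda>x. c) = (\<lambda>x. 0)"
  by (simp add: pd_def)

lemma pd_cong_open:
  assumes "open S" "x \<in> S" "\<And>y. y \<in> S \<Longrightarrow> f y = g y"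
  shows "pd v f x = pd v g x"
proof -
  have "(f has_derivative D) (at x) \<longleftrightarrow> (g has_derivative D) (at x)" for D
    using assms by (metis has_derivative_transform_within_open)
  then show ?thesis unfolding pd_def frechet_derivative_def by simp
qed

lemma differentiable_cong_open:
  assumes "open S" "x \<in> S" "\<And>y. y \<in> S \<Longrightarrow> f y = g y" "f differentiable (at x)"
  shows "g differentiable (at x)"
  using assms unfolding differentiable_def by (metis has_derivative_transform_within_open)

lemma Ck_on_Suc_pd:
  "Ck_on (Suc k) S f \<longleftrightarrow> (\<forall>x\<in>S. f differentiable (at x)) \<and> (\<forall>v. Ck_on k S (pd v f))"
  by (simp add: pd_def)

lemma Ck_on_cong:
  assumes "open S" "\<And>x. x \<in> S \<Longrightarrow> f x = g x" "Ck_on k S f"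
  shows "Ck_on k S g"
  using assms(2,3)
proof (induction k arbitrary: f g)
  case 0
  then show ?case by (metis Ck_on.simps(1) continuous_on_cong)
next
  case (Suc k)
  have "Ck_on k S (pd v g)" for v
    using Suc.IH[of "pd v f" "pd v g"] Suc.prems pd_cong_open[OF assms(1)] Ck_on_Suc_pd by metis
  moreover have "\<forall>x\<in>S. g differentiable (at x)"
    using Suc.prems differentiable_cong_open[OF assms(1)] Ck_on_Suc_pd by metis
  ultimately show ?case unfolding Ck_on_Suc_pd by blast
qed

lemma Ck_on_subset: "Ck_on k S f \<Longrightarrow> T \<subseteq> S \<Longrightarrow> Ck_on k T f"
proof (induction k arbitrary: f)
  case 0
  then show ?case using continuous_on_subset by auto
next
  case (Suc k)
  then show ?case unfolding Ck_on_Suc_pd by blast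
qed

lemma Ck_on_Suc_imp: "Ck_on (Suc k) S f \<Longrightarrow> Ck_on k S f"
proof (induction k arbitrary: f)
  case 0
  then show ?case
    by (auto simp: continuous_on_eq_continuous_within
        intro!: differentiable_imp_continuous_within intro: differentiable_at_withinI)
next
  case (Suc k)
  then show ?case unfolding Ck_on_Suc_pd[of "Suc k"] Ck_on_Suc_pd[of k] by blast
qed

lemma Ck_on_const: "Ck_on k S (\<lambda>x. c)"
  by (induction k arbitrary: c) (auto simp: Ck_on_Suc_pd simp del: Ck_on.simps(2))

lemma pd_bounded_linear:
  assumes "bounded_linear h" "f differentiable (at x)"
  shows "pd v (\<lambda>x. h (f x)) x = h (pd v f x)"
  using bounded_linear.has_derivative[OF assms(1) has_derivative_pd[OF assms(2)]] by (rule pd_eqI)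

lemma Ck_on_bounded_linear:
  assumes "open S" "bounded_linear h" "Ck_on k S f"
  shows "Ck_on k S (\<lambda>x. h (f x))"
  using assms(3)
proof (induction k arbitrary: f)
  case 0
  then show ?case using bounded_linear.continuous_on[OF assms(2)] by auto
next
  case (Suc k)
  have "Ck_on k S (pd v (\<lambda>x. h (f x)))" for v
    by (rule Ck_on_cong[OF assms(1) _ Suc.IH[of "pd v f"]])
      (use Suc.prems in \<open>auto simp: pd_bounded_linear[OF assms(2)] Ck_on_Suc_pd simp del: Ck_on.simps(2)\<close>)
  moreover have "\<forall>x\<in>S. (\<lambda>x. h (f x)) differentiable (at x)"
    using Suc.prems bounded_linear.has_derivative[OF assms(2)] unfolding Ck_on_Suc_pd differentiable_def by blast
  ultimately show ?case unfolding Ck_on_Suc_pd by blast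
qed

lemma pd_add:
  assumes "f differentiable (at x)" "g differentiable (at x)"
  shows "pd v (\<lambda>x. f x + g x) x = pd v f x + pd v g x"
  using has_derivative_add[OF assms[THEN has_derivative_pd]] by (rule pd_eqI)

lemma Ck_on_add:
  assumes "open S" "Ck_on k S f" "Ck_on k S g"
  shows "Ck_on k S (\<lambda>x. f x + g x)"
  using assms(2,3)
proof (induction k arbitrary: f g)
  case 0
  then show ?case by (auto intro: continuous_on_add)
next
  case (Suc k)
  have "Ck_on k S (pd v (\<lambda>x. f x + g x))" for v
    by (rule Ck_on_cong[OF assms(1) _ Suc.IH[of "pd v f" "pd v g"]])
      (use Suc.prems in \<open>auto simp: pd_add Ck_on_Suc_pd simp del: Ck_on.simps(2)\<close>)
  then show ?case using Suc.prems unfolding Ck_on_Suc_pd by auto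
qed

lemma pd_bilinear:
  assumes "bounded_bilinear h" "f differentiable (at x)" "g differentiable (at x)"
  shows "pd v (\<lambda>x. h (f x) (g x)) x = h (f x) (pd v g x) + h (pd v f x) (g x)"
  using bounded_bilinear.FDERIV[OF assms(1) assms(2,3)[THEN has_derivative_pd]] by (rule pd_eqI)

lemma Ck_on_bilinear:
  assumes "open S" "bounded_bilinear h" "Ck_on k S f" "Ck_on k S g"
  shows "Ck_on k S (\<lambda>x. h (f x) (g x))"
  using assms(3,4)
proof (induction k arbitrary: f g)
  case 0
  then show ?case using bounded_bilinear.continuous_on[OF assms(2)] by auto
next
  case (Suc k)
  have "Ck_on k S (pd v (\<lambda>x. h (f x) (g x)))" for v
  proof (rule Ck_on_cong[OF assms(1)])
    show "Ck_on k S (\<lambda>x. h (f x) (pd v g x) + h (pd v f x) (g x))"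
      using Suc.prems Suc.prems[THEN Ck_on_Suc_imp]
      by (intro Ck_on_add[OF assms(1)] Suc.IH) (auto simp: Ck_on_Suc_pd simp del: Ck_on.simps(2))
  qed (use Suc.prems in \<open>auto simp: pd_bilinear[OF assms(2)] Ck_on_Suc_pd simp del: Ck_on.simps(2)\<close>)
  moreover have "\<forall>x\<in>S. (\<lambda>x. h (f x) (g x)) differentiable (at x)"
    using Suc.prems bounded_bilinear.FDERIV[OF assms(2)] unfolding Ck_on_Suc_pd differentiable_def by blast
  ultimately show ?case unfolding Ck_on_Suc_pd by blast
qed

lemma smooth_onD: "smooth_on S f \<Longrightarrow> x \<in> S \<Longrightarrow> f differentiable (at x)"
  unfolding smooth_on_def by (meson Ck_on.simps(2))

lemma smooth_on_continuous: "smooth_on S f \<Longrightarrow> continuous_on S f"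
  unfolding smooth_on_def by (meson Ck_on.simps(1))

lemma smooth_on_pd: "smooth_on S f \<Longrightarrow> smooth_on S (pd v f)"
  unfolding smooth_on_def by (metis Ck_on_Suc_pd)

lemma smooth_on_iff_pd:
  "smooth_on S f \<longleftrightarrow> (\<forall>x\<in>S. f differentiable (at x)) \<and> (\<forall>v. smooth_on S (pd v f))"
  unfolding smooth_on_def by (metis Ck_on_Suc_pd Ck_on_Suc_imp)

lemma smooth_on_pow_pd: "smooth_on S f \<Longrightarrow> smooth_on S ((pd v ^^ n) f)"
  by (induction n) (auto intro: smooth_on_pd)

lemma smooth_on_cong:
  "open S \<Longrightarrow> (\<And>x. x \<in> S \<Longrightarrow> f x = g x) \<Longrightarrow> smooth_on S f \<Longrightarrow> smooth_on S g"
  unfolding smooth_on_def using Ck_on_cong by blast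

lemma smooth_on_subset: "smooth_on S f \<Longrightarrow> T \<subseteq> S \<Longrightarrow> smooth_on T f"
  unfolding smooth_on_def using Ck_on_subset by blast

lemma smooth_on_const [intro, simp]: "smooth_on S (\<lambda>x. c)"
  unfolding smooth_on_def using Ck_on_const by blast

lemma smooth_on_bounded_linear:
  "open S \<Longrightarrow> bounded_linear h \<Longrightarrow> smooth_on S f \<Longrightarrow> smooth_on S (\<lambda>x. h (f x))"
  unfolding smooth_on_def using Ck_on_bounded_linear by blast

lemma smooth_on_add:
  "open S \<Longrightarrow> smooth_on S f \<Longrightarrow> smooth_on S g \<Longrightarrow> smooth_on S (\<lambda>x. f x + g x)"
  unfolding smooth_on_def using Ck_on_add by blast

lemma smooth_on_bilinear:
  "open S \<Longrightarrow> bounded_bilinear h \<Longrightarrow> smooth_on S f \<Longrightarrow> smooth_on S g \<Longrightarrow> smooth_on S (\<lambda>x. h (f x) (g x))"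
  unfolding smooth_on_def using Ck_on_bilinear by blast

lemma smooth_on_minus: "open S \<Longrightarrow> smooth_on S f \<Longrightarrow> smooth_on S (\<lambda>x. - f x)"
  by (rule smooth_on_bounded_linear[OF _ bounded_linear_minus[OF bounded_linear_ident]])

lemma smooth_on_diff:
  "open S \<Longrightarrow> smooth_on S f \<Longrightarrow> smooth_on S g \<Longrightarrow> smooth_on S (\<lambda>x. f x - g x)"
  using smooth_on_add[of S f "\<lambda>x. - g x"] smooth_on_minus[of S g] by simp

lemma Ck_on_sum:
  assumes "open S" "\<And>i. i \<in> A \<Longrightarrow> Ck_on k S (f i)"
  shows "Ck_on k S (\<lambda>x. \<Sum>i\<in>A. f i x)"
  using assms(2)
proof (induction A rule: infinite_finite_induct)
  case (insert a A)
  then show ?case by (simp add: Ck_on_add[OF assms(1)])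
qed (auto simp: Ck_on_const)

lemma smooth_on_sum:
  "open S \<Longrightarrow> (\<And>i. i \<in> A \<Longrightarrow> smooth_on S (f i)) \<Longrightarrow> smooth_on S (\<lambda>x. \<Sum>i\<in>A. f i x)"
  unfolding smooth_on_def using Ck_on_sum by metis

lemma smooth_on_linear: "open S \<Longrightarrow> bounded_linear h \<Longrightarrow> smooth_on S h"
proof -
  assume a: "open S" "bounded_linear h"
  have "pd v h = (\<lambda>x. h v)" for v
    using pd_eqI[OF bounded_linear_imp_has_derivative[OF a(2)]] by blast
  then show ?thesis
    using a(2) by (simp add: smooth_on_iff_pd[of S h] bounded_linear_imp_differentiable)
qed

lemma smooth_on_ident: "open S \<Longrightarrow> smooth_on S (\<lambda>x. x)"
  by (simp add: smooth_on_linear bounded_linear_ident)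

lemma smooth_on_scaleR:
  "open S \<Longrightarrow> smooth_on S f \<Longrightarrow> smooth_on S g \<Longrightarrow> smooth_on S (\<lambda>x. f x *\<^sub>R g x)"
  by (rule smooth_on_bilinear[OF _ bounded_bilinear_scaleR])

text \<open>Writes a derivative in a direction that may vary with the point through derivatives in
  the fixed directions of \<open>Basis\<close>; only the latter are covered by the recursion in
  \<open>Ck_on\<close>.\<close>

lemma pd_sum_Basis:
  fixes f :: "'a::euclidean_space \<Rightarrow> 'b::real_normed_vector"
  assumes "f differentiable (at x)"
  shows "pd v f x = (\<Sum>b\<in>Basis. (v \<bullet> b) *\<^sub>R pd b f x)"
proof -
  have l: "linear (\<lambda>v. pd v f x)"
    using has_derivative_pd[OF assms] has_derivative_linear by blast
  have "pd v f x = pd (\<Sum>b\<in>Basis. (v \<bullet> b) *\<^sub>R b) f x" by (simp add: euclidean_representation)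
  also have "\<dots> = (\<Sum>b\<in>Basis. (v \<bullet> b) *\<^sub>R pd b f x)"
    using linear_sum[OF l, of "\<lambda>b. (v \<bullet> b) *\<^sub>R b" Basis] linear_scale[OF l] by simp
  finally show ?thesis .
qed

lemma pd_linear: "f differentiable (at x) \<Longrightarrow> linear (\<lambda>v. pd v f x)"
  using has_derivative_pd has_derivative_linear by blast

lemma pd_compose:
  assumes "f differentiable (at x)" "g differentiable (at (f x))"
  shows "pd v (\<lambda>x. g (f x)) x = pd (pd v f x) g (f x)"
  using diff_chain_at[OF has_derivative_pd[OF assms(1)] has_derivative_pd[OF assms(2)]]
  by (intro pd_eqI[where f'="\<lambda>v. pd (pd v f x) g (f x)"]) (simp add: o_def)

lemma Ck_on_compose:
  fixes f :: "'a::euclidean_space \<Rightarrow> 'b::euclidean_space"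
  assumes "open S" "open T" "f ` S \<subseteq> T" "Ck_on k S f" "Ck_on k T g"
  shows "Ck_on k S (\<lambda>x. g (f x))"
  using assms(4,5)
proof (induction k arbitrary: g)
  case 0
  then show ?case using continuous_on_compose2[OF _ _ assms(3)] by auto
next
  case (Suc k)
  have df: "\<And>x. x \<in> S \<Longrightarrow> f differentiable (at x)" and dg: "\<And>x. x \<in> S \<Longrightarrow> g differentiable (at (f x))"
    using Suc.prems assms(3) by (auto simp: Ck_on_Suc_pd simp del: Ck_on.simps(2))
  have "Ck_on k S (pd v (\<lambda>x. g (f x)))" for v
  proof (rule Ck_on_cong[OF assms(1)])
    show "Ck_on k S (\<lambda>x. \<Sum>b\<in>Basis. (pd v f x \<bullet> b) *\<^sub>R pd b g (f x))"
    proof (intro Ck_on_sum[OF assms(1)] Ck_on_bilinear[OF assms(1) bounded_bilinear_scaleR])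
      fix b
      show "Ck_on k S (\<lambda>x. pd v f x \<bullet> b)"
        using Suc.prems(1) unfolding Ck_on_Suc_pd
        by (intro Ck_on_bounded_linear[OF assms(1) bounded_linear_inner_left]) blast
      show "Ck_on k S (\<lambda>x. pd b g (f x))"
        using Suc.IH[of "pd b g"] Suc.prems Ck_on_Suc_imp[of k S f]
        by (auto simp: Ck_on_Suc_pd simp del: Ck_on.simps(2))
    qed
    fix x assume "x \<in> S"
    then show "(\<Sum>b\<in>Basis. (pd v f x \<bullet> b) *\<^sub>R pd b g (f x)) = pd v (\<lambda>x. g (f x)) x"
      using pd_compose df dg pd_sum_Basis by metis
  qed
  moreover have "\<forall>x\<in>S. (\<lambda>x. g (f x)) differentiable (at x)"
    using df dg differentiable_chain_at[unfolded o_def] by blast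
  ultimately show ?case unfolding Ck_on_Suc_pd by blast
qed

lemma smooth_on_compose:
  fixes f :: "'a::euclidean_space \<Rightarrow> 'b::euclidean_space"
  shows "open S \<Longrightarrow> open T \<Longrightarrow> f ` S \<subseteq> T \<Longrightarrow> smooth_on S f \<Longrightarrow> smooth_on T g \<Longrightarrow>
    smooth_on S (\<lambda>x. g (f x))"
  unfolding smooth_on_def using Ck_on_compose by blast

section \<open>Symmetry of second derivatives\<close>

text \<open>Mean value inequality for the increment of f across h u, as the base point moves along v
  from 0 to h. The derivative of this increment is an increment of \<open>pd v f\<close>, which
  differentiability of \<open>pd v f\<close> at x predicts up to o(h).\<close>

lemma second_difference_bound:
  fixes f :: "'a::euclidean_space \<Rightarrow> 'b::real_normed_vector"
  assumes S: "open S" "x \<in> S" and f: "smooth_on S f" and e: "e > 0"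
  shows "\<exists>d>0. \<forall>h. 0 < h \<and> h < d \<longrightarrow>
    norm (f (x + h *\<^sub>R u + h *\<^sub>R v) - f (x + h *\<^sub>R u) - f (x + h *\<^sub>R v) + f x - (h * h) *\<^sub>R pd u (pd v f) x)
      \<le> e * (h * h)"
proof -
  define F where "F = pd v f"
  define L where "L = (\<lambda>w. pd w F x)"
  have dF: "(F has_derivative L) (at x)"
    unfolding L_def F_def using S f smooth_on_pd smooth_onD has_derivative_pd by blast
  interpret L: bounded_linear L using dF by (rule has_derivative_bounded_linear)
  \<comment> \<open>The two points at which \<open>F\<close> is compared with its linearization are
    displaced by at most h(|u| + |v|) and h|v|. The total error is then a multiple of h(|u| + 2|v|);
    the 1 keeps the denominator positive.\<close>
  define C where "C = norm u + 2 * norm v + 1"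
  have C: "C > 0" "norm u + norm v \<le> C" "norm v \<le> C"
    unfolding C_def by (smt (verit) norm_ge_zero)+
  define e' where "e' = e / (norm u + 2 * norm v + 1)"
  have e': "e' > 0" unfolding e'_def using e C by (simp add: C_def)
  obtain d1 where d1: "d1 > 0" "\<And>y. norm (y - x) < d1 \<Longrightarrow> norm (F y - F x - L (y - x)) \<le> e' * norm (y - x)"
    using dF e' unfolding has_derivative_at_alt by blast
  obtain d2 where d2: "d2 > 0" "ball x d2 \<subseteq> S" using S open_contains_ball by blast
  define d where "d = min d1 d2 / C"
  have d: "d > 0" unfolding d_def using C d1 d2 by simp
  have "norm (f (x + h *\<^sub>R u + h *\<^sub>R v) - f (x + h *\<^sub>R u) - f (x + h *\<^sub>R v) + f x - (h * h) *\<^sub>R L u)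
      \<le> e * (h * h)" if h: "0 < h" "h < d" for h
  proof -
    have hC: "h * C < d1" "h * C < d2" using h C unfolding d_def by (auto simp: field_simps)
    \<comment> \<open>The subtracted term makes \<open>G h - G 0\<close> the second difference minus
      its expected value.\<close>
    define G where "G = (\<lambda>t. f (x + h *\<^sub>R u + t *\<^sub>R v) - f (x + t *\<^sub>R v) - (t * h) *\<^sub>R L u)"
    have n1: "norm (h *\<^sub>R u + t *\<^sub>R v) \<le> h * (norm u + norm v)" and n2: "norm (t *\<^sub>R v) \<le> h * norm v"
      if "t \<in> {0..h}" for t
    proof -
      have "\<bar>t\<bar> * norm v \<le> h * norm v" using that h by (intro mult_right_mono) auto
      then show "norm (t *\<^sub>R v) \<le> h * norm v" by simp
      then show "norm (h *\<^sub>R u + t *\<^sub>R v) \<le> h * (norm u + norm v)"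
        using norm_triangle_ineq[of "h *\<^sub>R u" "t *\<^sub>R v"] h by (simp add: distrib_left)
    qed
    have n3: "h * (norm u + norm v) \<le> h * C" "h * norm v \<le> h * C"
      using h C by (auto intro: mult_left_mono)
    define G' where "G' = (\<lambda>t. F (x + h *\<^sub>R u + t *\<^sub>R v) - F (x + t *\<^sub>R v) - h *\<^sub>R L u)"
    have der: "(G has_derivative (\<lambda>s. s *\<^sub>R G' t)) (at t within {0..h})" if t: "t \<in> {0..h}" for t
    proof -
      have in1: "x + h *\<^sub>R u + t *\<^sub>R v \<in> S"
      proof (rule subsetD[OF d2(2)])
        have "x - (x + h *\<^sub>R u + t *\<^sub>R v) = - (h *\<^sub>R u + t *\<^sub>R v)" by simp
        then have "dist x (x + h *\<^sub>R u + t *\<^sub>R v) = norm (h *\<^sub>R u + t *\<^sub>R v)"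
          unfolding dist_norm by (metis norm_minus_cancel)
        then show "x + h *\<^sub>R u + t *\<^sub>R v \<in> ball x d2" using n1[OF t] n3 hC by simp
      qed
      have in2: "x + t *\<^sub>R v \<in> S"
        using n2[OF t] n3 hC d2 by (intro subsetD[OF d2(2)]) (simp add: dist_norm)
      have sm: "pd (s *\<^sub>R v) f y = s *\<^sub>R pd v f y" if "y \<in> S" for s y
        using linear_scale[OF pd_linear[OF smooth_onD[OF f that]]] by blast
      have "((\<lambda>t. f (x + h *\<^sub>R u + t *\<^sub>R v)) has_derivative (\<lambda>s. pd (s *\<^sub>R v) f (x + h *\<^sub>R u + t *\<^sub>R v))) (at t)"
        by (rule has_derivative_compose[of "\<lambda>t. x + h *\<^sub>R u + t *\<^sub>R v" "\<lambda>s. s *\<^sub>R v"])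
          (auto intro!: derivative_eq_intros has_derivative_pd smooth_onD[OF f in1])
      moreover have "((\<lambda>t. f (x + t *\<^sub>R v)) has_derivative (\<lambda>s. pd (s *\<^sub>R v) f (x + t *\<^sub>R v))) (at t)"
        by (rule has_derivative_compose[of "\<lambda>t. x + t *\<^sub>R v" "\<lambda>s. s *\<^sub>R v"])
          (auto intro!: derivative_eq_intros has_derivative_pd smooth_onD[OF f in2])
      moreover have "((\<lambda>t. (t * h) *\<^sub>R L u) has_derivative (\<lambda>s. (s * h) *\<^sub>R L u)) (at t)"
        by (auto intro!: derivative_eq_intros)
      ultimately have "(G has_derivative (\<lambda>s. pd (s *\<^sub>R v) f (x + h *\<^sub>R u + t *\<^sub>R v) - pd (s *\<^sub>R v) f (x + t *\<^sub>R v)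
          - (s * h) *\<^sub>R L u)) (at t)"
        unfolding G_def by (intro has_derivative_diff)
      then have "(G has_derivative (\<lambda>s. s *\<^sub>R G' t)) (at t)"
        unfolding sm[OF in1] sm[OF in2] by (simp add: G'_def F_def algebra_simps)
      then show ?thesis by (rule has_derivative_at_withinI)
    qed
    have bnd: "onorm (\<lambda>s. s *\<^sub>R G' t) \<le> e * h" if t: "t \<in> {0..h}" for t
    proof -
      have a1: "norm (F (x + h *\<^sub>R u + t *\<^sub>R v) - F x - L (h *\<^sub>R u + t *\<^sub>R v)) \<le> e' * (h * (norm u + norm v))"
      proof -
        have "norm (F (x + h *\<^sub>R u + t *\<^sub>R v) - F x - L (x + h *\<^sub>R u + t *\<^sub>R v - x)) \<le> e' * norm (x + h *\<^sub>R u + t *\<^sub>R v - x)"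
          using n1[OF t] n3 hC by (intro d1(2)) (simp add: add.assoc)
        also have "\<dots> \<le> e' * (h * (norm u + norm v))"
          using n1[OF t] e' by (intro mult_left_mono) (simp_all add: add.assoc)
        finally show ?thesis by (simp add: add.assoc)
      qed
      have a2: "norm (F (x + t *\<^sub>R v) - F x - L (t *\<^sub>R v)) \<le> e' * (h * norm v)"
      proof -
        have "norm (F (x + t *\<^sub>R v) - F x - L (x + t *\<^sub>R v - x)) \<le> e' * norm (x + t *\<^sub>R v - x)"
          using n2[OF t] n3 hC by (intro d1(2)) simp
        also have "\<dots> \<le> e' * (h * norm v)"
          using n2[OF t] e' by (intro mult_left_mono) simp_all
        finally show ?thesis by simp
      qed
      have "G' t = (F (x + h *\<^sub>R u + t *\<^sub>R v) - F x - L (h *\<^sub>R u + t *\<^sub>R v)) - (F (x + t *\<^sub>R v) - F x - L (t *\<^sub>R v))"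
        by (simp add: G'_def L.add L.scaleR)
      then have "norm (G' t) \<le> e' * (h * (norm u + norm v)) + e' * (h * norm v)"
        using a1 a2 by (simp only:) (rule order_trans[OF norm_triangle_ineq4 add_mono])
      also have "\<dots> = h * (e' * (norm u + 2 * norm v))" by (simp add: algebra_simps)
      also have "\<dots> \<le> h * e"
      proof (rule mult_left_mono)
        have "e' * (norm u + 2 * norm v) \<le> e' * (norm u + 2 * norm v + 1)"
          using e' by (intro mult_left_mono) auto
        also have "\<dots> = e" unfolding e'_def using C(1)[unfolded C_def] by simp
        finally show "e' * (norm u + 2 * norm v) \<le> e" .
      qed (use h in auto)
      finally have "norm (G' t) \<le> e * h" by (simp add: mult.commute)
      then show ?thesis
        by (intro onorm_le) (metis mult.commute mult_right_mono norm_ge_zero norm_scaleR real_norm_def)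
    qed
    have "norm (G h - G 0) \<le> e * h * norm (h - 0)"
      by (rule differentiable_bound[OF _ der bnd]) (use h in auto)
    then show ?thesis using h by (simp add: G_def algebra_simps)
  qed
  then show ?thesis using d unfolding L_def F_def by blast
qed

text \<open>The second difference is symmetric in u and v and, divided by h^2, approximates both
  mixed derivatives.\<close>

lemma pd_commute:
  fixes f :: "'a::euclidean_space \<Rightarrow> 'b::real_normed_vector"
  assumes S: "open S" "x \<in> S" and f: "smooth_on S f"
  shows "pd u (pd v f) x = pd v (pd u f) x"
proof (rule ccontr)
  assume ne: "pd u (pd v f) x \<noteq> pd v (pd u f) x"
  \<comment> \<open>A third of the gap: two errors of size e cannot bridge a gap of 3e.\<close>
  define e where "e = norm (pd u (pd v f) x - pd v (pd u f) x) / 3"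
  have e: "e > 0" using ne by (simp add: e_def)
  obtain d1 where d1: "d1 > 0" "\<And>h. 0 < h \<Longrightarrow> h < d1 \<Longrightarrow>
    norm (f (x + h *\<^sub>R u + h *\<^sub>R v) - f (x + h *\<^sub>R u) - f (x + h *\<^sub>R v) + f x - (h * h) *\<^sub>R pd u (pd v f) x) \<le> e * (h * h)"
    using second_difference_bound[OF S f e, of u v] by blast
  obtain d2 where d2: "d2 > 0" "\<And>h. 0 < h \<Longrightarrow> h < d2 \<Longrightarrow>
    norm (f (x + h *\<^sub>R v + h *\<^sub>R u) - f (x + h *\<^sub>R v) - f (x + h *\<^sub>R u) + f x - (h * h) *\<^sub>R pd v (pd u f) x) \<le> e * (h * h)"
    using second_difference_bound[OF S f e, of v u] by blast
  define h where "h = min d1 d2 / 2"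
  have h: "0 < h" "h < d1" "h < d2" unfolding h_def using d1 d2 by auto
  define A where "A = f (x + h *\<^sub>R u + h *\<^sub>R v) - f (x + h *\<^sub>R u) - f (x + h *\<^sub>R v) + f x"
  have A2: "A = f (x + h *\<^sub>R v + h *\<^sub>R u) - f (x + h *\<^sub>R v) - f (x + h *\<^sub>R u) + f x"
    unfolding A_def by (simp add: algebra_simps)
  have "norm ((A - (h * h) *\<^sub>R pd v (pd u f) x) - (A - (h * h) *\<^sub>R pd u (pd v f) x)) \<le> e * (h * h) + e * (h * h)"
    using d1(2)[OF h(1,2)] d2(2)[OF h(1,3)] unfolding A2[symmetric] A_def[symmetric]
    by (intro norm_triangle_le_diff) linarith
  moreover have "(A - (h * h) *\<^sub>R pd v (pd u f) x) - (A - (h * h) *\<^sub>R pd u (pd v f) x)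
      = (h * h) *\<^sub>R (pd u (pd v f) x - pd v (pd u f) x)" by (simp add: algebra_simps)
  ultimately have "norm ((h * h) *\<^sub>R (pd u (pd v f) x - pd v (pd u f) x)) \<le> (h * h) * (2 * e)"
    by (metis mult.commute mult_2_right distrib_left mult.assoc)
  then have "(h * h) * (3 * e) \<le> (h * h) * (2 * e)" using h by (simp add: e_def)
  then have "3 * e \<le> 2 * e" using h by (simp add: mult_le_cancel_left)
  then show False using e by simp
qed

lemma pow_pd_cong:
  assumes "open S" "\<And>y. y \<in> S \<Longrightarrow> f y = g y" "x \<in> S"
  shows "(pd v ^^ n) f x = (pd v ^^ n) g x"
  using assms(3)
proof (induction n arbitrary: x)
  case 0
  then show ?case using assms by simp
next
  case (Suc n)
  then show ?case using pd_cong_open[OF assms(1) Suc.prems, of "(pd v ^^ n) f" "(pd v ^^ n) g"] by simp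
qed

lemma pow_pd_commute:
  fixes f :: "'a::euclidean_space \<Rightarrow> 'b::real_normed_vector"
  assumes S: "open S" and f: "smooth_on S f" and x: "x \<in> S"
  shows "(pd u ^^ n) (pd v f) x = pd v ((pd u ^^ n) f) x"
  using x
proof (induction n arbitrary: x)
  case (Suc n)
  have "pd u ((pd u ^^ n) (pd v f)) x = pd u (pd v ((pd u ^^ n) f)) x"
    by (rule pd_cong_open[OF S Suc.prems]) (rule Suc.IH)
  also have "\<dots> = pd v (pd u ((pd u ^^ n) f)) x"
    by (rule pd_commute[OF S Suc.prems]) (rule smooth_on_pow_pd[OF f])
  finally show ?case by simp
qed simp

lemma pd_sum_scaleR:
  assumes "\<And>i. i \<in> A \<Longrightarrow> f i differentiable (at x)"
  shows "pd v (\<lambda>y. \<Sum>i\<in>A. c i *\<^sub>R f i y) x = (\<Sum>i\<in>A. c i *\<^sub>R pd v (f i) x)"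
  by (rule pd_eqI) (auto intro!: derivative_eq_intros has_derivative_pd assms)

lemma pow_pd_sum_scaleR:
  assumes S: "open S" and f: "\<And>i. i \<in> A \<Longrightarrow> smooth_on S (f i)" and x: "x \<in> S"
  shows "(pd v ^^ n) (\<lambda>y. \<Sum>i\<in>A. c i *\<^sub>R f i y) x = (\<Sum>i\<in>A. c i *\<^sub>R (pd v ^^ n) (f i) x)"
  using x
proof (induction n arbitrary: x)
  case (Suc n)
  have "pd v ((pd v ^^ n) (\<lambda>y. \<Sum>i\<in>A. c i *\<^sub>R f i y)) x = pd v (\<lambda>x. \<Sum>i\<in>A. c i *\<^sub>R (pd v ^^ n) (f i) x) x"
    by (rule pd_cong_open[OF S Suc.prems]) (rule Suc.IH)
  also have "\<dots> = (\<Sum>i\<in>A. c i *\<^sub>R pd v ((pd v ^^ n) (f i)) x)"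
    by (rule pd_sum_scaleR) (use smooth_onD[OF smooth_on_pow_pd[OF f]] Suc.prems in blast)
  finally show ?case by simp
qed simp

lemma pow_pd_Suc_Basis:
  fixes f :: "'a::euclidean_space \<Rightarrow> 'b::real_normed_vector"
  assumes S: "open S" and f: "smooth_on S f" and x: "x \<in> S"
  shows "(pd u ^^ n) (pd v f) x = (\<Sum>b\<in>Basis. (v \<bullet> b) *\<^sub>R (pd u ^^ n) (pd b f) x)"
proof -
  have "(pd u ^^ n) (pd v f) x = (pd u ^^ n) (\<lambda>y. \<Sum>b\<in>Basis. (v \<bullet> b) *\<^sub>R pd b f y) x"
    by (rule pow_pd_cong[OF S _ x]) (rule pd_sum_Basis[OF smooth_onD[OF f]])
  then show ?thesis using pow_pd_sum_scaleR[OF S _ x, of Basis "\<lambda>b. pd b f"] smooth_on_pd[OF f] by simp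
qed

text \<open>All n directions move at once, and by symmetry each contributes the same amount, hence
  the factor n. The induction peels off one direction in coordinates, because
  \<open>pd (A s)\<close> itself varies with s.\<close>

lemma pow_pd_has_vector_derivative:
  fixes f :: "'a::euclidean_space \<Rightarrow> 'b::real_normed_vector"
  assumes S: "open S" and f: "smooth_on S f" and x: "x \<in> S"
    and A: "(A has_vector_derivative A') (at s)"
  shows "((\<lambda>s. (pd (A s) ^^ n) f x) has_vector_derivative real n *\<^sub>R (pd (A s) ^^ (n - 1)) (pd A' f) x) (at s)"
  using f
proof (induction n arbitrary: f)
  case (Suc n)
  have "((\<lambda>s. \<Sum>b\<in>Basis. (A s \<bullet> b) *\<^sub>R (pd (A s) ^^ n) (pd b f) x) has_vector_derivative
      (\<Sum>b\<in>Basis. (A s \<bullet> b) *\<^sub>R (real n *\<^sub>R (pd (A s) ^^ (n - 1)) (pd A' (pd b f)) x)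
        + (A' \<bullet> b) *\<^sub>R (pd (A s) ^^ n) (pd b f) x)) (at s)"
  proof (intro has_vector_derivative_sum has_vector_derivative_scaleR)
    fix b
    show "((\<lambda>s. A s \<bullet> b) has_field_derivative A' \<bullet> b) (at s)"
      using bounded_linear.has_vector_derivative[OF bounded_linear_inner_left A]
      by (simp add: has_real_derivative_iff_has_vector_derivative)
    show "((\<lambda>s. (pd (A s) ^^ n) (pd b f) x) has_vector_derivative
        real n *\<^sub>R (pd (A s) ^^ (n - 1)) (pd A' (pd b f)) x) (at s)"
      by (rule Suc.IH[OF smooth_on_pd[OF Suc.prems]])
  qed
  moreover have "(\<Sum>b\<in>Basis. (A s \<bullet> b) *\<^sub>R (pd (A s) ^^ n) (pd b f) x) = (pd (A s) ^^ Suc n) f x" for s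
    using pow_pd_Suc_Basis[OF S Suc.prems x, of n "A s" "A s"] by (simp add: funpow_swap1)
  moreover have "(\<Sum>b\<in>Basis. (A s \<bullet> b) *\<^sub>R (real n *\<^sub>R (pd (A s) ^^ (n - 1)) (pd A' (pd b f)) x)
        + (A' \<bullet> b) *\<^sub>R (pd (A s) ^^ n) (pd b f) x) = real (Suc n) *\<^sub>R (pd (A s) ^^ n) (pd A' f) x"
  proof -
    have "(\<Sum>b\<in>Basis. (A s \<bullet> b) *\<^sub>R (real n *\<^sub>R (pd (A s) ^^ (n - 1)) (pd A' (pd b f)) x))
        = real n *\<^sub>R (\<Sum>b\<in>Basis. (A s \<bullet> b) *\<^sub>R (pd (A s) ^^ (n - 1)) (pd b (pd A' f)) x)"
      unfolding scaleR_sum_right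
      by (intro sum.cong refl)
        (simp add: pow_pd_cong[OF S pd_commute[OF S _ Suc.prems, where u=A'] x] scaleR_left_commute)
    also have "\<dots> = real n *\<^sub>R (pd (A s) ^^ (n - 1)) (pd (A s) (pd A' f)) x"
      using pow_pd_Suc_Basis[OF S smooth_on_pd[OF Suc.prems] x, of "n - 1" "A s" "A s" A'] by simp
    also have "\<dots> = real n *\<^sub>R (pd (A s) ^^ n) (pd A' f) x"
      by (cases n) (simp_all add: funpow_swap1)
    finally show ?thesis
      using pow_pd_Suc_Basis[OF S Suc.prems x, of n "A s" A'] by (simp add: sum.distrib scaleR_add_left)
  qed
  ultimately show ?case by simp
qed simp

section \<open>Families of linear maps depending on a point\<close>

lemma linear_euclidean_sum:
  fixes h :: "'e::euclidean_space \<Rightarrow> 'f::real_vector"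
  assumes "linear h"
  shows "h v = (\<Sum>b\<in>Basis. (v \<bullet> b) *\<^sub>R h b)"
  using linear_sum[OF assms, of "\<lambda>b. (v \<bullet> b) *\<^sub>R b" Basis] linear_scale[OF assms]
  by (simp add: euclidean_representation)

text \<open>Product rule for a linear map applied to a vector, both varying with y.
  Differentiability of h is asked for fixed vectors only; expansion in \<open>Basis\<close> makes
  this sufficient.\<close>

lemma has_derivative_family:
  fixes h :: "'d::real_normed_vector \<Rightarrow> 'e::euclidean_space \<Rightarrow> 'f::real_normed_vector"
  assumes S: "open S" "x \<in> S" and lin: "\<And>y. y \<in> S \<Longrightarrow> linear (h y)"
    and h: "\<And>v. (\<lambda>y. h y v) differentiable (at x)" and V: "(V has_derivative V') (at x)"
  shows "((\<lambda>y. h y (V y)) has_derivative (\<lambda>w. pd w (\<lambda>y. h y (V x)) x + h x (V' w))) (at x)"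
proof -
  have e: "h y v = (\<Sum>b\<in>Basis. (v \<bullet> b) *\<^sub>R h y b)" if "y \<in> S" for y v
    by (rule linear_euclidean_sum[OF lin[OF that]])
  have "((\<lambda>y. \<Sum>b\<in>Basis. (V y \<bullet> b) *\<^sub>R h y b) has_derivative
      (\<lambda>w. \<Sum>b\<in>Basis. (V x \<bullet> b) *\<^sub>R pd w (\<lambda>y. h y b) x + (V' w \<bullet> b) *\<^sub>R h x b)) (at x)"
    by (intro has_derivative_sum has_derivative_scaleR has_derivative_inner_left V has_derivative_pd h)
  moreover have "pd w (\<lambda>y. h y (V x)) x = (\<Sum>b\<in>Basis. (V x \<bullet> b) *\<^sub>R pd w (\<lambda>y. h y b) x)" for w
  proof -
    have "pd w (\<lambda>y. h y (V x)) x = pd w (\<lambda>y. \<Sum>b\<in>Basis. (V x \<bullet> b) *\<^sub>R h y b) x"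
      by (rule pd_cong_open[OF S e])
    then show ?thesis using pd_sum_scaleR[of Basis "\<lambda>b y. h y b" x w, OF h] by simp
  qed
  ultimately have "((\<lambda>y. \<Sum>b\<in>Basis. (V y \<bullet> b) *\<^sub>R h y b) has_derivative
      (\<lambda>w. pd w (\<lambda>y. h y (V x)) x + h x (V' w))) (at x)"
    unfolding e[OF S(2), symmetric] by (simp only: sum.distrib e[OF S(2), symmetric])
  then show ?thesis
    by (rule has_derivative_transform_within_open[OF _ S]) (rule e[symmetric])
qed

lemma Ck_on_family:
  fixes h :: "'d::euclidean_space \<Rightarrow> 'e::euclidean_space \<Rightarrow> 'f::real_normed_vector"
  assumes S: "open S" and lin: "\<And>y. y \<in> S \<Longrightarrow> linear (h y)"
    and h: "\<And>v. Ck_on k S (\<lambda>y. h y v)" and V: "Ck_on k S V"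
  shows "Ck_on k S (\<lambda>y. h y (V y))"
proof (rule Ck_on_cong[OF S])
  show "Ck_on k S (\<lambda>y. \<Sum>b\<in>Basis. (V y \<bullet> b) *\<^sub>R h y b)"
    by (intro Ck_on_sum[OF S] Ck_on_bilinear[OF S bounded_bilinear_scaleR]
        Ck_on_bounded_linear[OF S bounded_linear_inner_left] h V)
qed (metis linear_euclidean_sum lin)

lemma smooth_on_family:
  fixes h :: "'d::euclidean_space \<Rightarrow> 'e::euclidean_space \<Rightarrow> 'f::real_normed_vector"
  shows "open S \<Longrightarrow> (\<And>y. y \<in> S \<Longrightarrow> linear (h y)) \<Longrightarrow> (\<And>v. smooth_on S (\<lambda>y. h y v)) \<Longrightarrow>
    smooth_on S V \<Longrightarrow> smooth_on S (\<lambda>y. h y (V y))"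
  unfolding smooth_on_def using Ck_on_family by metis

lemma linear_pd_family:
  fixes G :: "'d::euclidean_space \<Rightarrow> 'e::real_vector \<Rightarrow> 'f::real_normed_vector"
  assumes S: "open S" "x \<in> S" and lin: "\<And>y. y \<in> S \<Longrightarrow> linear (G y)"
    and G: "\<And>v. (\<lambda>y. G y v) differentiable (at x)"
  shows "linear (\<lambda>u. pd d (\<lambda>y. G y u) x)"
proof (rule linearI)
  fix u v :: 'e and r :: real
  have "pd d (\<lambda>y. G y (u + v)) x = pd d (\<lambda>y. G y u + G y v) x"
    by (rule pd_cong_open[OF S]) (simp add: lin linear_add)
  then show "pd d (\<lambda>y. G y (u + v)) x = pd d (\<lambda>y. G y u) x + pd d (\<lambda>y. G y v) x"
    by (simp add: pd_add G)
  have "pd d (\<lambda>y. G y (r *\<^sub>R u)) x = pd d (\<lambda>y. r *\<^sub>R G y u) x"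
    by (rule pd_cong_open[OF S]) (simp add: lin linear_scale)
  then show "pd d (\<lambda>y. G y (r *\<^sub>R u)) x = r *\<^sub>R pd d (\<lambda>y. G y u) x"
    by (simp add: pd_bounded_linear[OF bounded_linear_scaleR_right] G)
qed

text \<open>Only continuity is required of \<open>c\<close>, because \<open>a\<close> vanishes at the point.\<close>

lemma has_derivative_scaleR_vanishing:
  fixes a :: "'d::real_normed_vector \<Rightarrow> real"
  assumes a: "(a has_derivative a') (at x)" "a x = 0" and c: "isCont c x"
  shows "((\<lambda>y. a y *\<^sub>R c y) has_derivative (\<lambda>d. a' d *\<^sub>R c x)) (at x)"
proof -
  interpret a': bounded_linear a' using a(1) by (rule has_derivative_bounded_linear)
  obtain K where K: "\<And>d. norm (a' d) \<le> norm d * K" "K > 0" using a'.pos_bounded by blast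
  have 1: "((\<lambda>y. ((a y - a x) - a' (y - x)) /\<^sub>R norm (y - x)) \<longlongrightarrow> 0) (at x)"
    using a(1) unfolding has_derivative_at_within by simp
  have c': "(c \<longlongrightarrow> c x) (at x)" using c by (simp add: isCont_def)
  have "((\<lambda>y. (((a y - a x) - a' (y - x)) /\<^sub>R norm (y - x)) *\<^sub>R c y) \<longlongrightarrow> 0 *\<^sub>R c x) (at x)"
    by (intro tendsto_scaleR 1 c')
  moreover have "((\<lambda>y. (a' (y - x) /\<^sub>R norm (y - x)) *\<^sub>R (c y - c x)) \<longlongrightarrow> 0) (at x)"
  proof (rule tendsto_0_le[where K=K])
    show "((\<lambda>y. c y - c x) \<longlongrightarrow> 0) (at x)" using c' by (simp add: LIM_zero)
    show "\<forall>\<^sub>F y in at x. norm ((a' (y - x) /\<^sub>R norm (y - x)) *\<^sub>R (c y - c x)) \<le> norm (c y - c x) * K"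
    proof (rule always_eventually, rule allI)
      fix y
      have "norm (a' (y - x)) / norm (y - x) \<le> K"
        using K(1)[of "y - x"] K(2) by (cases "y = x") (auto simp: field_simps)
      then have "norm (a' (y - x)) / norm (y - x) * norm (c y - c x) \<le> K * norm (c y - c x)"
        by (rule mult_right_mono) simp
      then show "norm ((a' (y - x) /\<^sub>R norm (y - x)) *\<^sub>R (c y - c x)) \<le> norm (c y - c x) * K"
        by (simp add: abs_mult divide_inverse mult.commute)
    qed
  qed
  ultimately have "((\<lambda>y. (((a y - a x) - a' (y - x)) /\<^sub>R norm (y - x)) *\<^sub>R c y
      + (a' (y - x) /\<^sub>R norm (y - x)) *\<^sub>R (c y - c x)) \<longlongrightarrow> 0) (at x)"
    using tendsto_add by fastforce
  moreover have "(\<lambda>y. (((a y - a x) - a' (y - x)) /\<^sub>R norm (y - x)) *\<^sub>R c y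
      + (a' (y - x) /\<^sub>R norm (y - x)) *\<^sub>R (c y - c x))
      = (\<lambda>y. ((a y *\<^sub>R c y - a x *\<^sub>R c x) - a' (y - x) *\<^sub>R c x) /\<^sub>R norm (y - x))"
    using a(2) by (auto simp: algebra_simps)
  ultimately show ?thesis
    unfolding has_derivative_at_within using a'.bounded_linear bounded_linear_scaleR_const by auto
qed

lemma linear_inverse:
  assumes "linear G" "\<And>w. G (N w) = w" "\<And>w. N (G w) = w"
  shows "linear N"
proof (rule linearI)
  show "N (a + b) = N a + N b" for a b
    using assms(3)[of "N a + N b"] by (simp add: linear_add[OF assms(1)] assms(2))
  show "N (r *\<^sub>R a) = r *\<^sub>R N a" for r a
    using assms(3)[of "r *\<^sub>R N a"] by (simp add: linear_scale[OF assms(1)] assms(2))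
qed

text \<open>With v = \<open>N x w\<close> one has N y w - N x w = - N y ((G y - G x) v). The
  argument (G y - G x) v vanishes at y = x, so continuity of \<open>N y b\<close> in y is enough to
  differentiate, and continuity follows from a uniform bound for N near x.\<close>

lemma inverse_family_has_derivative:
  fixes G :: "'d::euclidean_space \<Rightarrow> 'e::euclidean_space \<Rightarrow> 'e"
  assumes S: "open S" "x \<in> S" and lin: "\<And>y. y \<in> S \<Longrightarrow> linear (G y)"
    and G: "\<And>v. (\<lambda>y. G y v) differentiable (at x)"
    and N1: "\<And>y w. y \<in> S \<Longrightarrow> G y (N y w) = w" and N2: "\<And>y w. y \<in> S \<Longrightarrow> N y (G y w) = w"
  shows "((\<lambda>y. N y w) has_derivative (\<lambda>d. - N x (pd d (\<lambda>y. G y (N x w)) x))) (at x)"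
proof -
  have linN: "linear (N y)" if "y \<in> S" for y
    by (rule linear_inverse[OF lin[OF that] N1[OF that] N2[OF that]])
  obtain B where B: "B > 0" "\<And>v. norm (N x v) \<le> B * norm v"
    using linear_bounded_pos[OF linN[OF S(2)]] by blast
  define e where "e = (\<lambda>y. \<Sum>b\<in>Basis. norm (G y b - G x b))"
  have eG: "norm (G y v - G x v) \<le> e y * norm v" if "y \<in> S" for y v
  proof -
    have "G y v - G x v = (\<Sum>b\<in>Basis. (v \<bullet> b) *\<^sub>R (G y b - G x b))"
      using linear_euclidean_sum[OF lin[OF that], of v] linear_euclidean_sum[OF lin[OF S(2)], of v]
      by (simp add: scaleR_diff_right sum_subtractf)
    also have "norm \<dots> \<le> (\<Sum>b\<in>Basis. norm v * norm (G y b - G x b))"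
      by (intro sum_norm_le) (auto intro!: mult_right_mono Basis_le_norm)
    finally show ?thesis by (simp add: e_def sum_distrib_left mult.commute)
  qed
  have contG: "isCont (\<lambda>y. G y v) x" for v
    using G differentiable_imp_continuous_within by blast
  have "isCont e x" unfolding e_def by (intro continuous_intros contG)
  then have e0: "(e \<longlongrightarrow> 0) (at x)" by (simp add: isCont_def e_def)
  have evS: "\<forall>\<^sub>F y in at x. y \<in> S" using S eventually_at_topological by blast
  have eve: "\<forall>\<^sub>F y in at x. e y < 1 / (2 * B)" using order_tendstoD(2)[OF e0] B by simp
  \<comment> \<open>The difference between G x and G y contributes at most B e(y) |N y v| <= |N y v|
    / 2, which is absorbed on the left.\<close>
  have bnd: "norm (N y v) \<le> 2 * B * norm v" if "y \<in> S" "e y < 1 / (2 * B)" for y v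
  proof -
    have "norm (N y v) = norm (N x (G x (N y v)))" by (simp add: N2 S)
    also have "\<dots> \<le> B * norm (G x (N y v))" by (rule B)
    also have "\<dots> \<le> B * (norm v + e y * norm (N y v))"
      using eG[OF that(1), of "N y v"] B N1[OF that(1), of v] norm_triangle_ineq4[of v "v - G x (N y v)"]
      by (intro mult_left_mono) auto
    also have "\<dots> \<le> B * norm v + norm (N y v) / 2"
    proof -
      have "B * e y \<le> 1 / 2" using that(2) B by (simp add: field_simps)
      then have "B * e y * norm (N y v) \<le> 1 / 2 * norm (N y v)" by (rule mult_right_mono) simp
      then show ?thesis by (simp add: algebra_simps)
    qed
    finally show ?thesis by simp
  qed
  have rep: "N y w - N x w = - N y (G y (N x w) - G x (N x w))" if "y \<in> S" for y w
    unfolding linear_diff[OF linN[OF that]] N1[OF S(2)] N2[OF that] by simp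
  have cont: "isCont (\<lambda>y. N y w) x" for w
  proof -
    have "((\<lambda>y. N y w - N x w) \<longlongrightarrow> 0) (at x)"
    proof (rule tendsto_0_le[where K="2 * B * norm (N x w)"])
      show "(e \<longlongrightarrow> 0) (at x)" by (rule e0)
      show "\<forall>\<^sub>F y in at x. norm (N y w - N x w) \<le> norm (e y) * (2 * B * norm (N x w))"
        using evS eve
      proof eventually_elim
        case (elim y)
        have "norm (N y w - N x w) \<le> 2 * B * norm (G y (N x w) - G x (N x w))"
          using rep[OF elim(1)] bnd[OF elim] by simp
        also have "\<dots> \<le> 2 * B * (e y * norm (N x w))"
          using eG[OF elim(1)] B by (intro mult_left_mono) auto
        also have "\<dots> \<le> norm (e y) * (2 * B * norm (N x w))" 
          using B by (simp add: e_def sum_nonneg)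
        finally show ?case .
      qed
    qed
    then show ?thesis by (simp add: isCont_def LIM_zero_iff)
  qed
  define v where "v = N x w"
  define a where "a = (\<lambda>b y. (G y v - G x v) \<bullet> b)"
  have da: "(a b has_derivative (\<lambda>d. pd d (\<lambda>y. G y v) x \<bullet> b)) (at x)" for b
    unfolding a_def by (auto intro!: derivative_eq_intros has_derivative_pd G)
  have "((\<lambda>y. N x w - (\<Sum>b\<in>Basis. a b y *\<^sub>R N y b)) has_derivative
      (\<lambda>d. 0 - (\<Sum>b\<in>Basis. (pd d (\<lambda>y. G y v) x \<bullet> b) *\<^sub>R N x b))) (at x)"
    by (intro has_derivative_diff has_derivative_const has_derivative_sum
        has_derivative_scaleR_vanishing da cont) (simp add: a_def)
  then have "((\<lambda>y. N x w - (\<Sum>b\<in>Basis. a b y *\<^sub>R N y b)) has_derivative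
      (\<lambda>d. - N x (pd d (\<lambda>y. G y v) x))) (at x)"
    unfolding linear_euclidean_sum[OF linN[OF S(2)], symmetric] by simp
  then have "((\<lambda>y. N y w) has_derivative (\<lambda>d. - N x (pd d (\<lambda>y. G y v) x))) (at x)"
  proof (rule has_derivative_transform_within_open[OF _ S])
    fix y assume y: "y \<in> S"
    show "N x w - (\<Sum>b\<in>Basis. a b y *\<^sub>R N y b) = N y w"
      using rep[OF y, of w] linear_euclidean_sum[OF linN[OF y], of "G y v - G x v"]
      unfolding a_def v_def by (simp add: algebra_simps)
  qed
  then show ?thesis by (simp add: v_def)
qed

text \<open>Bootstrap: the derivative of N is built from N and the derivative of G, so if N is C^k
  then so is its derivative.\<close>

lemma smooth_on_inverse_family:
  fixes G :: "'d::euclidean_space \<Rightarrow> 'e::euclidean_space \<Rightarrow> 'e"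
  assumes S: "open S" and lin: "\<And>y. y \<in> S \<Longrightarrow> linear (G y)"
    and G: "\<And>v. smooth_on S (\<lambda>y. G y v)"
    and N1: "\<And>y w. y \<in> S \<Longrightarrow> G y (N y w) = w" and N2: "\<And>y w. y \<in> S \<Longrightarrow> N y (G y w) = w"
  shows "smooth_on S (\<lambda>y. N y w)"
proof -
  have d: "((\<lambda>y. N y w) has_derivative (\<lambda>d. - N x (pd d (\<lambda>y. G y (N x w)) x))) (at x)"
    if "x \<in> S" for x w
    by (rule inverse_family_has_derivative[OF S that lin smooth_onD[OF G that] N1 N2])
  have linN: "linear (N y)" if "y \<in> S" for y
    by (rule linear_inverse[OF lin[OF that] N1[OF that] N2[OF that]])
  have diff: "(\<lambda>y. N y w) differentiable (at x)" if "x \<in> S" for x w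
    using d[OF that, of w] unfolding differentiable_def by blast
  have linpd: "linear (\<lambda>u. pd d (\<lambda>y. G y u) x)" if "x \<in> S" for d x
    by (rule linear_pd_family[OF S that lin smooth_onD[OF G that]])
  have "Ck_on k S (\<lambda>y. N y w)" for k
  proof (induction k arbitrary: w)
    case 0
    then show ?case
      by (simp add: continuous_on_eq_continuous_at[OF S] differentiable_imp_continuous_within[OF diff])
  next
    case (Suc k)
    have "Ck_on k S (pd d (\<lambda>y. N y w))" for d
    proof (rule Ck_on_cong[OF S])
      have "Ck_on k S (\<lambda>x. pd d (\<lambda>y. G y (N x w)) x)"
      proof (rule Ck_on_family[where h="\<lambda>x u. pd d (\<lambda>y. G y u) x" and V="\<lambda>x. N x w", OF S])
        show "Ck_on k S (\<lambda>y. pd d (\<lambda>y. G y v) y)" for v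
          using smooth_on_pd[OF G] unfolding smooth_on_def by blast
      qed (rule linpd Suc.IH, assumption?)+
      from linN Suc.IH this have "Ck_on k S (\<lambda>x. N x (pd d (\<lambda>y. G y (N x w)) x))"
        by (rule Ck_on_family[where h=N and V="\<lambda>x. pd d (\<lambda>y. G y (N x w)) x", OF S])
      then show "Ck_on k S (\<lambda>x. - N x (pd d (\<lambda>y. G y (N x w)) x))"
        by (rule Ck_on_bounded_linear[OF S bounded_linear_minus[OF bounded_linear_ident]])
      show "- N x (pd d (\<lambda>y. G y (N x w)) x) = pd d (\<lambda>y. N y w) x" if "x \<in> S" for x
        using pd_eqI[OF d[OF that]] by simp
    qed
    then show ?case using diff unfolding Ck_on_Suc_pd by blast
  qed
  then show ?thesis unfolding smooth_on_def by blast
qed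

section \<open>Germs of curves and their Taylor coefficients\<close>

definition smooth_at_0 :: "(real \<Rightarrow> 'b::real_normed_vector) \<Rightarrow> bool" where
  "smooth_at_0 f \<longleftrightarrow> (\<exists>e>0. smooth_on (ball 0 e) f)"

text \<open>The series \<open>taylor\<close> is taken along rays, so computations with it reduce to
  coefficients of curves in one real variable.\<close>

definition taylor_coeff :: "nat \<Rightarrow> (real \<Rightarrow> 'b::real_normed_vector) \<Rightarrow> 'b" where
  "taylor_coeff n f = (1 / fact n) *\<^sub>R nth_vector_deriv n f 0"

lemma taylor_eq_taylor_coeff: "taylor f n X = taylor_coeff n (\<lambda>t. f (t *\<^sub>R X))"
  by (simp add: taylor_def taylor_coeff_def)

lemma smooth_at_0I: "open S \<Longrightarrow> 0 \<in> S \<Longrightarrow> smooth_on S f \<Longrightarrow> smooth_at_0 f"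
  unfolding smooth_at_0_def using smooth_on_subset open_contains_ball by metis

lemma has_vector_derivative_pd:
  "f differentiable (at t) \<Longrightarrow> (f has_vector_derivative pd 1 f t) (at t)"
  by (simp add: pd_def frechet_derivative_eq_vector_derivative flip: vector_derivative_works)

lemma vector_derivative_eq_pd: "f differentiable (at t) \<Longrightarrow> vector_derivative f (at t) = pd 1 f t"
  using has_vector_derivative_pd vector_derivative_at by blast

lemma pd_1_eqI: "(f has_vector_derivative D) (at t) \<Longrightarrow> pd 1 f t = D"
  using pd_eqI[of f "\<lambda>s. s *\<^sub>R D" t 1] by (simp add: has_vector_derivative_def)

lemma eventually_nhds_0_ball: "(\<forall>\<^sub>F t in nhds (0::real). P t) \<longleftrightarrow> (\<exists>e>0. \<forall>t\<in>ball 0 e. P t)"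
  by (auto simp: eventually_nhds_metric dist_commute)

lemma nth_vector_deriv_cong_open:
  assumes "open S" "\<And>t. t \<in> S \<Longrightarrow> f t = g t" "t \<in> S"
  shows "nth_vector_deriv n f t = nth_vector_deriv n g t"
  using assms(3)
proof (induction n arbitrary: t)
  case (Suc n)
  have "(nth_vector_deriv n f has_vector_derivative D) (at t) \<longleftrightarrow>
      (nth_vector_deriv n g has_vector_derivative D) (at t)" for D
    using Suc assms(1) by (metis has_vector_derivative_transform_within_open)
  then show ?case by (simp add: vector_derivative_def)
qed (use assms in simp)

lemma taylor_coeff_cong:
  assumes "\<forall>\<^sub>F t in nhds 0. f t = g t"
  shows "taylor_coeff n f = taylor_coeff n g"
proof -
  obtain e where "e > 0" "\<forall>t\<in>ball 0 e. f t = g t" using assms eventually_nhds_0_ball by blast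
  then show ?thesis unfolding taylor_coeff_def
    using nth_vector_deriv_cong_open[of "ball 0 e" f g 0 n] by simp
qed

lemma nth_vector_deriv_eq_pow_pd:
  assumes "open S" "smooth_on S f" "t \<in> S"
  shows "nth_vector_deriv n f t = (pd 1 ^^ n) f t"
  using assms(3)
proof (induction n arbitrary: t)
  case (Suc n)
  have "nth_vector_deriv (Suc n) f t = vector_derivative ((pd 1 ^^ n) f) (at t)"
  proof -
    have "(nth_vector_deriv n f has_vector_derivative D) (at t) \<longleftrightarrow>
      ((pd 1 ^^ n) f has_vector_derivative D) (at t)" for D
      using Suc assms(1) by (metis has_vector_derivative_transform_within_open)
    then show ?thesis by (simp add: vector_derivative_def)
  qed
  then show ?case
    using vector_derivative_eq_pd[OF smooth_onD[OF smooth_on_pow_pd[OF assms(2)] Suc.prems]] by simp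
qed simp

lemma taylor_coeff_0 [simp]: "taylor_coeff 0 f = f 0"
  by (simp add: taylor_coeff_def)

lemma taylor_coeff_pd:
  assumes "smooth_at_0 f"
  shows "taylor_coeff n (pd 1 f) = real (Suc n) *\<^sub>R taylor_coeff (Suc n) f"
proof -
  obtain e where e: "e > 0" "smooth_on (ball 0 e) f" using assms unfolding smooth_at_0_def by blast
  have "nth_vector_deriv n (pd 1 f) 0 = nth_vector_deriv (Suc n) f 0"
    using nth_vector_deriv_eq_pow_pd[OF _ e(2), of 0 "Suc n"]
      nth_vector_deriv_eq_pow_pd[OF _ smooth_on_pd[OF e(2)], of 0 n] e(1)
    by (simp add: funpow_swap1)
  then show ?thesis by (simp add: taylor_coeff_def)
qed

lemma taylor_coeff_Suc:
  "smooth_at_0 f \<Longrightarrow> taylor_coeff (Suc n) f = (1 / real (Suc n)) *\<^sub>R taylor_coeff n (pd 1 f)"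
  by (simp add: taylor_coeff_pd)

lemma smooth_at_0_pd: "smooth_at_0 f \<Longrightarrow> smooth_at_0 (pd v f)"
  unfolding smooth_at_0_def using smooth_on_pd by blast

lemma smooth_at_0_eventually_differentiable:
  "smooth_at_0 f \<Longrightarrow> \<forall>\<^sub>F t in nhds 0. f differentiable (at t)"
  unfolding smooth_at_0_def eventually_nhds_0_ball using smooth_onD by blast

lemma smooth_at_0_cong:
  assumes "smooth_at_0 f" "\<forall>\<^sub>F t in nhds 0. f t = g t"
  shows "smooth_at_0 g"
proof -
  obtain e1 e2 where e: "e1 > 0" "smooth_on (ball 0 e1) f" "e2 > 0" "\<forall>t\<in>ball 0 e2. f t = g t"
    using assms unfolding smooth_at_0_def eventually_nhds_0_ball by blast
  have "smooth_on (ball 0 (min e1 e2)) f" by (rule smooth_on_subset[OF e(2)]) auto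
  then have "smooth_on (ball 0 (min e1 e2)) g" by (rule smooth_on_cong[OF open_ball, rotated]) (use e in auto)
  then show ?thesis unfolding smooth_at_0_def using e by (intro exI[of _ "min e1 e2"]) auto
qed

lemma smooth_at_0_const [simp]: "smooth_at_0 (\<lambda>t. c)"
  unfolding smooth_at_0_def by (rule exI[of _ 1]) simp

lemma smooth_at_0_bounded_linear: "bounded_linear h \<Longrightarrow> smooth_at_0 f \<Longrightarrow> smooth_at_0 (\<lambda>t. h (f t))"
  unfolding smooth_at_0_def using smooth_on_bounded_linear open_ball by metis

lemma smooth_at_0_linear: "bounded_linear h \<Longrightarrow> smooth_at_0 h"
  unfolding smooth_at_0_def using smooth_on_linear open_ball zero_less_one by metis

lemma smooth_at_0_bilinear:
  assumes "bounded_bilinear h" "smooth_at_0 f" "smooth_at_0 g"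
  shows "smooth_at_0 (\<lambda>t. h (f t) (g t))"
proof -
  obtain e1 e2 where e: "e1 > 0" "smooth_on (ball 0 e1) f" "e2 > 0" "smooth_on (ball 0 e2) g"
    using assms unfolding smooth_at_0_def by blast
  have "smooth_on (ball 0 (min e1 e2)) (\<lambda>t. h (f t) (g t))"
    by (rule smooth_on_bilinear[OF open_ball assms(1)]; rule smooth_on_subset[OF e(2)] smooth_on_subset[OF e(4)]) auto
  then show ?thesis unfolding smooth_at_0_def using e by (intro exI[of _ "min e1 e2"]) auto
qed

lemma smooth_at_0_add:
  assumes "smooth_at_0 f" "smooth_at_0 g"
  shows "smooth_at_0 (\<lambda>t. f t + g t)"
proof -
  obtain e1 e2 where e: "e1 > 0" "smooth_on (ball 0 e1) f" "e2 > 0" "smooth_on (ball 0 e2) g"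
    using assms unfolding smooth_at_0_def by blast
  have "smooth_on (ball 0 (min e1 e2)) (\<lambda>t. f t + g t)"
    by (rule smooth_on_add[OF open_ball]; rule smooth_on_subset[OF e(2)] smooth_on_subset[OF e(4)]) auto
  then show ?thesis unfolding smooth_at_0_def using e by (intro exI[of _ "min e1 e2"]) auto
qed

lemma smooth_at_0_sum:
  "(\<And>i. i \<in> A \<Longrightarrow> smooth_at_0 (f i)) \<Longrightarrow> smooth_at_0 (\<lambda>t. \<Sum>i\<in>A. f i t)"
  by (induction A rule: infinite_finite_induct) (auto simp: smooth_at_0_add)

lemma smooth_at_0_scaleR: "smooth_at_0 f \<Longrightarrow> smooth_at_0 g \<Longrightarrow> smooth_at_0 (\<lambda>t. f t *\<^sub>R g t)"
  by (rule smooth_at_0_bilinear[OF bounded_bilinear_scaleR])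

lemma smooth_at_0_minus: "smooth_at_0 f \<Longrightarrow> smooth_at_0 (\<lambda>t. - f t)"
  by (rule smooth_at_0_bounded_linear[OF bounded_linear_minus[OF bounded_linear_ident]])

lemma smooth_at_0_ident: "smooth_at_0 (\<lambda>t. t)"
  by (rule smooth_at_0_linear[OF bounded_linear_ident])

lemma smooth_at_0_compose:
  fixes x :: "real \<Rightarrow> 'a::euclidean_space"
  assumes "smooth_at_0 x" "open S" "x 0 \<in> S" "smooth_on S \<psi>"
  shows "smooth_at_0 (\<lambda>t. \<psi> (x t))"
    and "\<forall>\<^sub>F t in nhds 0. x t \<in> S"
    and "\<forall>\<^sub>F t in nhds 0. pd 1 (\<lambda>t. \<psi> (x t)) t = pd (pd 1 x t) \<psi> (x t)"
proof -
  obtain e1 where e1: "e1 > 0" "smooth_on (ball 0 e1) x" using assms unfolding smooth_at_0_def by blast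
  have "open (ball 0 e1 \<inter> x -` S)"
    using continuous_open_preimage[OF smooth_on_continuous[OF e1(2)] open_ball assms(2)] .
  then obtain e2 where e2: "e2 > 0" "ball 0 e2 \<subseteq> ball 0 e1 \<inter> x -` S"
    using e1 assms(3) open_contains_ball[of "ball 0 e1 \<inter> x -` S"] by (metis IntI centre_in_ball vimageI)
  have sx: "smooth_on (ball 0 e2) x" using smooth_on_subset[OF e1(2)] e2 by blast
  have sub: "x ` ball 0 e2 \<subseteq> S" using e2 by blast
  show "smooth_at_0 (\<lambda>t. \<psi> (x t))"
    unfolding smooth_at_0_def using smooth_on_compose[OF open_ball assms(2) sub sx assms(4)] e2 by blast
  show "\<forall>\<^sub>F t in nhds 0. x t \<in> S" unfolding eventually_nhds_0_ball using e2 by blast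
  show "\<forall>\<^sub>F t in nhds 0. pd 1 (\<lambda>t. \<psi> (x t)) t = pd (pd 1 x t) \<psi> (x t)"
    unfolding eventually_nhds_0_ball
    using e2 sub smooth_onD[OF sx] smooth_onD[OF assms(4)] by (intro exI[of _ e2]) (auto intro!: pd_compose)
qed

lemma taylor_coeff_bounded_linear:
  assumes h: "bounded_linear h" and "smooth_at_0 f"
  shows "taylor_coeff n (\<lambda>t. h (f t)) = h (taylor_coeff n f)"
  using assms(2)
proof (induction n arbitrary: f)
  case (Suc n)
  have "taylor_coeff n (pd 1 (\<lambda>t. h (f t))) = taylor_coeff n (\<lambda>t. h (pd 1 f t))"
    by (rule taylor_coeff_cong, rule eventually_mono[OF smooth_at_0_eventually_differentiable[OF Suc.prems]])
      (rule pd_bounded_linear[OF h])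
  then show ?case
    using Suc.IH[OF smooth_at_0_pd[OF Suc.prems, of 1]] Suc.prems smooth_at_0_bounded_linear[OF h Suc.prems]
    by (simp add: taylor_coeff_Suc linear_scale[OF bounded_linear.linear[OF h]] del: of_nat_Suc)
qed simp

lemma taylor_coeff_add:
  assumes "smooth_at_0 f" "smooth_at_0 g"
  shows "taylor_coeff n (\<lambda>t. f t + g t) = taylor_coeff n f + taylor_coeff n g"
  using assms
proof (induction n arbitrary: f g)
  case (Suc n)
  have "taylor_coeff n (pd 1 (\<lambda>t. f t + g t)) = taylor_coeff n (\<lambda>t. pd 1 f t + pd 1 g t)"
    by (rule taylor_coeff_cong, rule eventually_mono[OF eventually_conj[OF
          Suc.prems[THEN smooth_at_0_eventually_differentiable]]]) (auto intro: pd_add)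
  then show ?case
    using Suc.IH[OF Suc.prems[THEN smooth_at_0_pd[where v=1]]] Suc.prems smooth_at_0_add[OF Suc.prems]
    by (simp add: taylor_coeff_Suc scaleR_add_right del: of_nat_Suc)
qed simp

lemma taylor_coeff_const: "taylor_coeff n (\<lambda>t. c) = (if n = 0 then c else 0)"
proof -
  have "nth_vector_deriv (Suc m) (\<lambda>t. c) = (\<lambda>t. 0)" for m by (induction m) auto
  then show ?thesis by (cases n) (auto simp: taylor_coeff_def simp del: nth_vector_deriv.simps(2))
qed

lemma taylor_coeff_sum:
  "(\<And>i. i \<in> A \<Longrightarrow> smooth_at_0 (f i)) \<Longrightarrow>
    taylor_coeff n (\<lambda>t. \<Sum>i\<in>A. f i t) = (\<Sum>i\<in>A. taylor_coeff n (f i))"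
  by (induction A rule: infinite_finite_induct)
    (auto simp: taylor_coeff_const taylor_coeff_add smooth_at_0_sum)

lemma taylor_coeff_minus: "smooth_at_0 f \<Longrightarrow> taylor_coeff n (\<lambda>t. - f t) = - taylor_coeff n f"
  by (rule taylor_coeff_bounded_linear[OF bounded_linear_minus[OF bounded_linear_ident]])

text \<open>Leibniz rule by induction on the degree: both sums arising from the product rule are
  brought to the range \<open>l \<le> Suc n\<close>, where their weights \<open>Suc n - l\<close>
  and \<open>l\<close> add up to \<open>Suc n\<close>.\<close>

lemma taylor_coeff_bilinear:
  assumes h: "bounded_bilinear h" and "smooth_at_0 f" "smooth_at_0 g"
  shows "taylor_coeff n (\<lambda>t. h (f t) (g t)) = (\<Sum>l\<le>n. h (taylor_coeff l f) (taylor_coeff (n - l) g))"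
  using assms(2,3)
proof (induction n arbitrary: f g)
  case (Suc n)
  interpret h: bounded_bilinear h by (rule h)
  note f = Suc.prems(1) and g = Suc.prems(2)
  define H where "H = (\<lambda>l m. h (taylor_coeff l f) (taylor_coeff m g))"
  have "taylor_coeff n (pd 1 (\<lambda>t. h (f t) (g t))) = taylor_coeff n (\<lambda>t. h (f t) (pd 1 g t) + h (pd 1 f t) (g t))"
    by (rule taylor_coeff_cong, rule eventually_mono[OF eventually_conj[OF
          Suc.prems[THEN smooth_at_0_eventually_differentiable]]]) (auto intro: pd_bilinear[OF h])
  also have "\<dots> = (\<Sum>l\<le>n. real (Suc (n - l)) *\<^sub>R H l (Suc (n - l))) + (\<Sum>l\<le>n. real (Suc l) *\<^sub>R H (Suc l) (n - l))"
    using Suc.IH[OF f smooth_at_0_pd[OF g]] Suc.IH[OF smooth_at_0_pd[OF f] g] f g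
    by (simp add: taylor_coeff_add smooth_at_0_bilinear[OF h] smooth_at_0_pd taylor_coeff_pd h.scaleR_left
        h.scaleR_right H_def del: of_nat_Suc)
  also have "(\<Sum>l\<le>n. real (Suc (n - l)) *\<^sub>R H l (Suc (n - l))) = (\<Sum>l\<le>Suc n. real (Suc n - l) *\<^sub>R H l (Suc n - l))"
    by (simp add: Suc_diff_le del: of_nat_Suc of_nat_diff)
  also have "(\<Sum>l\<le>n. real (Suc l) *\<^sub>R H (Suc l) (n - l)) = (\<Sum>l\<le>Suc n. real l *\<^sub>R H l (Suc n - l))"
    by (subst sum.atMost_Suc_shift) (simp del: of_nat_Suc)
  also have "(\<Sum>l\<le>Suc n. real (Suc n - l) *\<^sub>R H l (Suc n - l)) + (\<Sum>l\<le>Suc n. real l *\<^sub>R H l (Suc n - l))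
      = (\<Sum>l\<le>Suc n. real (Suc n) *\<^sub>R H l (Suc n - l))"
    unfolding sum.distrib[symmetric]
  proof (rule sum.cong[OF refl])
    fix l assume "l \<in> {..Suc n}"
    then have "real (Suc n - l) + real l = real (Suc n)" by (simp add: of_nat_diff)
    then show "real (Suc n - l) *\<^sub>R H l (Suc n - l) + real l *\<^sub>R H l (Suc n - l) = real (Suc n) *\<^sub>R H l (Suc n - l)"
      by (simp only: scaleR_add_left[symmetric])
  qed
  finally show ?case
    using smooth_at_0_bilinear[OF h Suc.prems]
    by (simp add: taylor_coeff_Suc scaleR_sum_right[symmetric] H_def del: of_nat_Suc sum.atMost_Suc)
qed simp

lemma taylor_coeff_ident: "taylor_coeff n (\<lambda>t. t) = (if n = 1 then 1 else 0)"
proof (cases n)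
  case (Suc m)
  have "pd 1 (\<lambda>t::real. t) = (\<lambda>t. 1)"
    by (auto intro!: pd_1_eqI has_vector_derivative_id[unfolded id_def])
  then show ?thesis using Suc by (simp add: taylor_coeff_Suc smooth_at_0_ident taylor_coeff_const)
qed simp

lemma taylor_coeff_scaleR_ident:
  assumes "smooth_at_0 f"
  shows "taylor_coeff n (\<lambda>t. t *\<^sub>R f t) = (if n = 0 then 0 else taylor_coeff (n - 1) f)"
proof -
  have "taylor_coeff n (\<lambda>t. t *\<^sub>R f t) = (\<Sum>l\<le>n. if l = 1 then taylor_coeff (n - l) f else 0)"
    using taylor_coeff_bilinear[OF bounded_bilinear_scaleR smooth_at_0_ident assms, of n]
    by (simp add: taylor_coeff_ident if_distrib[where f="\<lambda>r. r *\<^sub>R _"] cong: if_cong)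
  then show ?thesis by (simp add: sum.delta' cong: if_cong)
qed

lemma taylor_coeff_ident_scaleR: "taylor_coeff n (\<lambda>t. t *\<^sub>R v) = (if n = 1 then v else 0)"
  by (simp add: taylor_coeff_scaleR_ident taylor_coeff_const)

section \<open>Taylor series along rays\<close>

lemma smooth_at_0_ray: "open S \<Longrightarrow> 0 \<in> S \<Longrightarrow> smooth_on S f \<Longrightarrow> smooth_at_0 (\<lambda>t. f (t *\<^sub>R (X::'a::euclidean_space)))"
  by (rule smooth_at_0_compose(1)[of _ S]) (auto intro: smooth_at_0_linear bounded_linear_scaleR_left)

lemma eventually_ray: "open S \<Longrightarrow> 0 \<in> S \<Longrightarrow> \<forall>\<^sub>F t in nhds 0. t *\<^sub>R (X::'a::euclidean_space) \<in> S"
  by (rule smooth_at_0_compose(2)[of _ S "\<lambda>_. 0::real"]) (auto intro: smooth_at_0_linear bounded_linear_scaleR_left)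

lemma pd_ray:
  assumes "f differentiable (at (t *\<^sub>R X))"
  shows "pd 1 (\<lambda>t. f (t *\<^sub>R X)) t = pd X f (t *\<^sub>R X)"
proof -
  have d: "((\<lambda>t. t *\<^sub>R X) has_derivative (\<lambda>s. s *\<^sub>R X)) (at t)"
    by (auto intro!: derivative_eq_intros)
  show ?thesis
    using pd_eqI[OF has_derivative_compose[OF d has_derivative_pd[OF assms]], of 1] by simp
qed

lemma taylor_eq_pow_pd:
  assumes S: "open S" "0 \<in> S" and f: "smooth_on S (f::'a::euclidean_space \<Rightarrow> 'b::real_normed_vector)"
  shows "taylor f n X = (1 / fact n) *\<^sub>R (pd X ^^ n) f 0"
  using f
proof (induction n arbitrary: f)
  case (Suc n)
  have "taylor_coeff n (pd 1 (\<lambda>t. f (t *\<^sub>R X))) = taylor_coeff n (\<lambda>t. pd X f (t *\<^sub>R X))"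
    by (rule taylor_coeff_cong, rule eventually_mono[OF eventually_ray[OF S, of X]])
      (rule pd_ray[OF smooth_onD[OF Suc.prems]])
  then show ?case
    using Suc.IH[OF smooth_on_pd[OF Suc.prems]]
      taylor_coeff_Suc[OF smooth_at_0_ray[OF S Suc.prems, of X], of n]
    by (simp add: taylor_eq_taylor_coeff funpow_swap1)
qed (simp add: taylor_def)

text \<open>The factor \<open>Suc m\<close> from \<open>pow_pd_has_vector_derivative\<close> cancels
  against the factorial. The statement for curves includes differentiability of the component, about
  which \<open>dir_deriv\<close> alone says nothing.\<close>

lemma taylor_has_vector_derivative:
  assumes S: "open S" "0 \<in> S" and f: "smooth_on S (f::'a::euclidean_space \<Rightarrow> 'b::real_normed_vector)"
    and A: "(A has_vector_derivative A') (at s)"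
  shows "((\<lambda>s. taylor f (Suc m) (A s)) has_vector_derivative taylor (pd A' f) m (A s)) (at s)"
proof -
  have "((\<lambda>s. (1 / fact (Suc m)) *\<^sub>R (pd (A s) ^^ Suc m) f 0) has_vector_derivative
      (1 / fact (Suc m)) *\<^sub>R (real (Suc m) *\<^sub>R (pd (A s) ^^ (Suc m - 1)) (pd A' f) 0)) (at s)"
    by (rule bounded_linear.has_vector_derivative[OF bounded_linear_scaleR_right
        pow_pd_has_vector_derivative[OF S(1) f S(2) A]])
  then show ?thesis
    using taylor_eq_pow_pd[OF S f] taylor_eq_pow_pd[OF S smooth_on_pd[OF f]] by simp
qed

lemma dir_deriv_taylor:
  assumes S: "open S" "0 \<in> S" and f: "smooth_on S (f::'a::euclidean_space \<Rightarrow> 'b::real_normed_vector)"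
  shows "dir_deriv (taylor f (Suc m)) X Y = taylor (pd Y f) m X"
proof -
  have "((\<lambda>t. X + t *\<^sub>R Y) has_vector_derivative Y) (at 0)"
    by (auto intro!: derivative_eq_intros simp: has_vector_derivative_def)
  from taylor_has_vector_derivative[OF S f this, of m]
  show ?thesis unfolding dir_deriv_def by (simp add: vector_derivative_at)
qed

lemma dir_deriv_taylor_0: "dir_deriv (taylor f 0) X Y = 0"
  by (simp add: dir_deriv_def taylor_def)

lemma linear_taylor_pd:
  assumes S: "open S" "0 \<in> S" and f: "smooth_on S (f::'a::euclidean_space \<Rightarrow> 'b::real_normed_vector)"
  shows "linear (\<lambda>Y. taylor (pd Y f) m X)"
proof -
  have "taylor (pd Y f) m X = (\<Sum>b\<in>Basis. (Y \<bullet> b) *\<^sub>R taylor (pd b f) m X)" for Y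
    unfolding taylor_eq_pow_pd[OF S smooth_on_pd[OF f]] pow_pd_Suc_Basis[OF S(1) f S(2), of m X Y]
    by (simp add: scaleR_sum_right scaleR_left_commute)
  then have "(\<lambda>Y. taylor (pd Y f) m X) = (\<lambda>Y. \<Sum>b\<in>Basis. (Y \<bullet> b) *\<^sub>R taylor (pd b f) m X)" by blast
  moreover have "linear (\<lambda>Y. \<Sum>b\<in>Basis. (Y \<bullet> b) *\<^sub>R taylor (pd b f) m X)"
    by (rule linearI) (simp_all add: inner_add_left sum.distrib scaleR_add_left scaleR_sum_right)
  ultimately show ?thesis by simp
qed

text \<open>The right hand side is \<open>series_D\<close> when the coefficients of \<open>G\<close>
  are the components of a series at X. This is the passage from identities along rays to identities
  of formal power series.\<close>

lemma taylor_coeff_pd_along: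
  assumes S: "open S" "0 \<in> S" and f: "smooth_on S (f::'a::euclidean_space \<Rightarrow> 'b::real_normed_vector)"
    and G: "smooth_at_0 G"
  shows "taylor_coeff n (\<lambda>t. pd (G t) f (t *\<^sub>R X))
    = (\<Sum>l\<le>n. dir_deriv (taylor f (Suc (n - l))) X (taylor_coeff l G))"
proof -
  have "taylor_coeff n (\<lambda>t. pd (G t) f (t *\<^sub>R X)) = taylor_coeff n (\<lambda>t. \<Sum>b\<in>Basis. (G t \<bullet> b) *\<^sub>R pd b f (t *\<^sub>R X))"
    by (rule taylor_coeff_cong, rule eventually_mono[OF eventually_ray[OF S, of X]])
      (rule pd_sum_Basis[OF smooth_onD[OF f]])
  also have "\<dots> = (\<Sum>b\<in>Basis. \<Sum>l\<le>n. (taylor_coeff l G \<bullet> b) *\<^sub>R taylor (pd b f) (n - l) X)"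
    using G smooth_at_0_ray[OF S smooth_on_pd[OF f]]
    by (simp add: taylor_coeff_sum taylor_coeff_bilinear[OF bounded_bilinear_scaleR] taylor_eq_taylor_coeff
        taylor_coeff_bounded_linear[OF bounded_linear_inner_left] smooth_at_0_scaleR
        smooth_at_0_bounded_linear[OF bounded_linear_inner_left])
  also have "\<dots> = (\<Sum>l\<le>n. \<Sum>b\<in>Basis. (taylor_coeff l G \<bullet> b) *\<^sub>R taylor (pd b f) (n - l) X)"
    by (rule sum.swap)
  also have "\<dots> = (\<Sum>l\<le>n. taylor (pd (taylor_coeff l G) f) (n - l) X)"
    by (rule sum.cong[OF refl]) (rule linear_euclidean_sum[OF linear_taylor_pd[OF S f], symmetric])
  finally show ?thesis by (simp add: dir_deriv_taylor[OF S f])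
qed

section \<open>Linear ordinary differential equations\<close>

lemma linear_ode_smooth:
  fixes A :: "real \<Rightarrow> 'a::euclidean_space \<Rightarrow> 'a"
  assumes S: "open S" and lin: "\<And>t. t \<in> S \<Longrightarrow> linear (A t)" and A: "\<And>v. smooth_on S (\<lambda>t. A t v)"
    and u: "\<And>t. t \<in> S \<Longrightarrow> (u has_vector_derivative A t (u t)) (at t)"
  shows "smooth_on S u"
proof -
  have diff: "u differentiable (at t)" if "t \<in> S" for t
    using u[OF that] unfolding has_vector_derivative_def differentiable_def by blast
  have pdu: "pd v u t = v *\<^sub>R A t (u t)" if "t \<in> S" for v t
    using pd_eqI[OF u[OF that, unfolded has_vector_derivative_def]] .
  have "Ck_on k S u" for k
  proof (induction k)
    case 0
    then show ?case
      using diff by (simp add: continuous_on_eq_continuous_at[OF S] differentiable_imp_continuous_within)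
  next
    case (Suc k)
    have "Ck_on k S (\<lambda>t. A t (u t))"
      using A by (intro Ck_on_family[where h=A and V=u, OF S lin _ Suc]) (simp_all add: smooth_on_def)
    then have scaled: "Ck_on k S (\<lambda>t. v *\<^sub>R A t (u t))" for v
      by (rule Ck_on_bounded_linear[OF S bounded_linear_scaleR_right])
    have "Ck_on k S (pd v u)" for v
      by (rule Ck_on_cong[OF S _ scaled[of v]]) (simp add: pdu)
    then show ?case unfolding Ck_on_Suc_pd using diff by blast
  qed
  then show ?thesis unfolding smooth_on_def by blast
qed

text \<open>Picard's fixed point argument in the complete space of bounded continuous functions on
  the real line; eC <= 1/2 makes the integral operator a contraction.\<close>

lemma linear_ode_solution:
  fixes A :: "real \<Rightarrow> 'a::euclidean_space \<Rightarrow> 'a"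
  assumes e: "0 < e" and lin: "\<And>t. t \<in> {-e..e} \<Longrightarrow> linear (A t)"
    and A: "\<And>v. continuous_on {-e..e} (\<lambda>t. A t v)"
    and C: "\<And>t v. t \<in> {-e..e} \<Longrightarrow> norm (A t v) \<le> C * norm v" and eC: "e * C \<le> 1 / 2" "0 \<le> C"
  shows "\<exists>u. u 0 = v \<and> (\<forall>t\<in>{-e<..<e}. (u has_vector_derivative A t (u t)) (at t))"
proof -
  define K where "K = {-e..e}"
  have contA: "continuous_on K (\<lambda>t. A t (u t))" if "continuous_on K u" for u
  proof (rule continuous_on_eq)
    show "continuous_on K (\<lambda>t. \<Sum>b\<in>Basis. (u t \<bullet> b) *\<^sub>R A t b)"
      unfolding K_def using that A by (intro continuous_intros) (auto simp: K_def)
    show "(\<Sum>b\<in>Basis. (u t \<bullet> b) *\<^sub>R A t b) = A t (u t)" if "t \<in> K" for t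
      using linear_euclidean_sum[OF lin] that by (simp add: K_def)
  qed
  \<comment> \<open>The antiderivative of \<open>A t (u t)\<close> on K that vanishes at 0 takes the
    place of the integral.\<close>
  have "\<exists>h. h 0 = 0 \<and> (\<forall>t\<in>K. (h has_vector_derivative A t (u t)) (at t within K))"
    if "continuous_on UNIV u" for u
  proof -
    have cu: "continuous_on {-e..e} (\<lambda>t. A t (u t))"
      using contA[of u] continuous_on_subset[OF that] by (simp add: K_def)
    obtain h where "\<And>t. t \<in> K \<Longrightarrow> (h has_vector_derivative A t (u t)) (at t within K)"
      using antiderivative_continuous[OF cu] unfolding K_def by blast
    then show ?thesis
      by (intro exI[of _ "\<lambda>t. h t - h 0"]) (auto intro!: derivative_eq_intros)
  qed
  then obtain H where H0: "\<And>u. continuous_on UNIV u \<Longrightarrow> H u 0 = 0"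
    and H: "\<And>u t. continuous_on UNIV u \<Longrightarrow> t \<in> K \<Longrightarrow> (H u has_vector_derivative A t (u t)) (at t within K)"
    by metis
  \<comment> \<open>Elements of the function space are defined for all real times; clamping the time
    to [-e, e] continues the iterates constantly beyond K.\<close>
  define cl where "cl = (\<lambda>t::real. max (-e) (min e t))"
  have cl: "cl t \<in> K" "t \<in> K \<Longrightarrow> cl t = t" for t using e by (auto simp: cl_def K_def)
  define T where "T = (\<lambda>u::real \<Rightarrow>\<^sub>C 'a. Bcontfun (\<lambda>t. v + H (apply_bcontfun u) (cl t)))"
  have contH: "continuous_on K (H u)" if "continuous_on UNIV u" for u
    using H[OF that] continuous_on_eq_continuous_within has_vector_derivative_continuous by blast
  have Tin: "(\<lambda>t. v + H (apply_bcontfun u) (cl t)) \<in> bcontfun" for u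
  proof -
    have "continuous_on UNIV (\<lambda>t. H (apply_bcontfun u) (cl t))"
      by (rule continuous_on_compose2[OF contH[OF continuous_on_apply_bcontfun]])
        (auto simp: cl intro!: continuous_intros simp: cl_def[abs_def] intro: cl(1)[unfolded cl_def])
    moreover have "bounded (range (\<lambda>t. v + H (apply_bcontfun u) (cl t)))"
    proof -
      have "bounded ((\<lambda>t. v + H (apply_bcontfun u) t) ` K)"
        by (rule compact_imp_bounded, rule compact_continuous_image)
          (auto simp: K_def intro!: continuous_intros contH[unfolded K_def])
      then show ?thesis by (rule bounded_subset) (use cl in auto)
    qed
    ultimately show ?thesis by (auto simp: bcontfun_def intro!: continuous_intros)
  qed
  have Tapp: "apply_bcontfun (T u) t = v + H (apply_bcontfun u) (cl t)" for u t
    unfolding T_def using Bcontfun_inverse[OF Tin] by simp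
  have "dist (T u) (T w) \<le> 1 / 2 * dist u w" for u w
  proof (rule dist_bound)
    fix t
    define D where "D = (\<lambda>t. H (apply_bcontfun u) t - H (apply_bcontfun w) t)"
    have "norm (D (cl t) - D 0) \<le> C * dist u w * norm (cl t - 0)"
    proof (rule differentiable_bound)
      show "convex K" by (simp add: K_def)
      fix s assume s: "s \<in> K"
      show "(D has_derivative (\<lambda>r. r *\<^sub>R (A s (apply_bcontfun u s) - A s (apply_bcontfun w s)))) (at s within K)"
        unfolding D_def has_vector_derivative_def[symmetric]
        by (intro has_vector_derivative_diff H s continuous_on_apply_bcontfun)
      have "norm (A s (apply_bcontfun u s) - A s (apply_bcontfun w s)) \<le> C * norm (apply_bcontfun u s - apply_bcontfun w s)"
        using C[of s "apply_bcontfun u s - apply_bcontfun w s"] linear_diff[OF lin] s by (simp add: K_def)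
      also have "\<dots> \<le> C * dist u w"
        using dist_bounded[of u s w] eC by (intro mult_left_mono) (auto simp: dist_norm)
      finally show "onorm (\<lambda>r. r *\<^sub>R (A s (apply_bcontfun u s) - A s (apply_bcontfun w s))) \<le> C * dist u w"
        by (intro onorm_le) (metis mult.commute mult_right_mono norm_ge_zero norm_scaleR real_norm_def)
    qed (use cl e in \<open>auto simp: K_def\<close>)
    also have "\<dots> \<le> C * dist u w * e"
      using cl[of t] eC by (intro mult_left_mono) (auto simp: K_def abs_le_iff)
    also have "\<dots> \<le> 1 / 2 * dist u w"
      using mult_right_mono[OF eC(1), of "dist u w"] by (simp add: algebra_simps)
    finally show "dist (apply_bcontfun (T u) t) (apply_bcontfun (T w) t) \<le> 1 / 2 * dist u w"
      by (simp add: Tapp dist_norm D_def H0)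
  qed
  then obtain u where u: "T u = u" using banach_fix_type[of "1/2" T] by auto
  have ut: "apply_bcontfun u t = v + H (apply_bcontfun u) (cl t)" for t using Tapp[of u t] u by simp
  show ?thesis
  proof (intro exI[of _ "apply_bcontfun u"] conjI ballI)
    show "apply_bcontfun u 0 = v" using ut[of 0] cl(2)[of 0] e H0 by (simp add: K_def)
    fix t assume t: "t \<in> {-e<..<e}"
    have "(H (apply_bcontfun u) has_vector_derivative A t (apply_bcontfun u t)) (at t within {-e<..<e})"
      by (rule has_vector_derivative_within_subset[OF H]) (use t in \<open>auto simp: K_def\<close>)
    then have "(H (apply_bcontfun u) has_vector_derivative A t (apply_bcontfun u t)) (at t)"
      using t at_within_open[of t "{-e<..<e}"] by simp
    then have "((\<lambda>t. v + H (apply_bcontfun u) t) has_vector_derivative A t (apply_bcontfun u t)) (at t)"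
      by (auto intro!: derivative_eq_intros)
    then show "(apply_bcontfun u has_vector_derivative A t (apply_bcontfun u t)) (at t)"
      by (rule has_vector_derivative_transform_within_open[where S="{-e<..<e}"])
        (use t ut cl(2) in \<open>auto simp: K_def\<close>)
  qed
qed

text \<open>One interval serves all initial values, because the length required by the contraction
  depends only on a bound for the linear maps \<open>A t\<close>.\<close>

lemma linear_ode_fundamental_solution:
  fixes A :: "real \<Rightarrow> 'a::euclidean_space \<Rightarrow> 'a"
  assumes r: "0 < r" and lin: "\<And>t. t \<in> ball 0 r \<Longrightarrow> linear (A t)"
    and A: "\<And>v. smooth_on (ball 0 r) (\<lambda>t. A t v)"
  shows "\<exists>e>0. \<exists>P. e \<le> r \<and> (\<forall>v. P 0 v = v) \<and> (\<forall>v. smooth_on (ball 0 e) (\<lambda>t. P t v)) \<and>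
    (\<forall>v. \<forall>t\<in>ball 0 e. ((\<lambda>t. P t v) has_vector_derivative A t (P t v)) (at t))"
proof -
  have sub: "{-(r/2)..r/2} \<subseteq> ball 0 r" using r by auto
  have cont: "continuous_on {-(r/2)..r/2} (\<lambda>t. A t v)" for v
    using continuous_on_subset[OF smooth_on_continuous[OF A] sub] .
  have "\<exists>M. \<forall>t\<in>{-(r/2)..r/2}. norm (A t v) \<le> M" for v
    using compact_imp_bounded[OF compact_continuous_image[OF cont compact_Icc]]
    unfolding bounded_iff by blast
  then obtain M where M: "\<And>v t. t \<in> {-(r/2)..r/2} \<Longrightarrow> norm (A t v) \<le> M v" by metis
  \<comment> \<open>Compactness bounds \<open>A t b\<close> for each fixed b; summing over
    \<open>Basis\<close> gives a bound uniform in the vector, and the 1 makes C positive.\<close>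
  define C where "C = (\<Sum>b\<in>Basis. \<bar>M b\<bar>) + 1"
  have C: "C > 0" unfolding C_def by (smt (verit) sum_nonneg abs_ge_zero)
  have AC: "norm (A t v) \<le> C * norm v" if t: "t \<in> {-(r/2)..r/2}" for t v
  proof -
    have "norm (A t v) = norm (\<Sum>b\<in>Basis. (v \<bullet> b) *\<^sub>R A t b)"
      using linear_euclidean_sum[OF lin] t sub by (metis subsetD)
    also have "\<dots> \<le> (\<Sum>b\<in>Basis. \<bar>M b\<bar> * norm v)"
    proof (rule sum_norm_le)
      fix b :: 'a assume b: "b \<in> Basis"
      have "\<bar>v \<bullet> b\<bar> * norm (A t b) \<le> norm v * \<bar>M b\<bar>"
        using M[OF t, of b] Basis_le_norm[OF b] by (intro mult_mono) auto
      then show "norm ((v \<bullet> b) *\<^sub>R A t b) \<le> \<bar>M b\<bar> * norm v" by (simp add: mult.commute)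
    qed
    also have "\<dots> \<le> C * norm v" by (simp add: C_def sum_distrib_right[symmetric] mult_right_mono)
    finally show ?thesis .
  qed
  define e where "e = min (r / 2) (1 / (2 * C))"
  have e: "0 < e" "e \<le> r / 2" "e * C \<le> 1 / 2"
  proof -
    show "0 < e" "e \<le> r / 2" using r C by (auto simp: e_def)
    have "e * C \<le> 1 / (2 * C) * C" using C by (intro mult_right_mono) (auto simp: e_def)
    then show "e * C \<le> 1 / 2" using C by simp
  qed
  have sub2: "{-e..e} \<subseteq> {-(r/2)..r/2}" using e by auto
  have "\<exists>u. u 0 = v \<and> (\<forall>t\<in>{-e<..<e}. (u has_vector_derivative A t (u t)) (at t))" for v
    by (rule linear_ode_solution[where C=C])
      (use e C AC sub sub2 lin continuous_on_subset[OF cont sub2] in auto)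
  then obtain U where U: "\<And>v. U v 0 = v"
    "\<And>v t. t \<in> {-e<..<e} \<Longrightarrow> (U v has_vector_derivative A t (U v t)) (at t)" by metis
  have b: "ball 0 e = {-e<..<e}" by (auto simp: ball_eq_greaterThanLessThan)
  have "smooth_on (ball 0 e) (U v)" for v
    by (rule linear_ode_smooth[where A=A])
      (use e r U lin in \<open>auto simp: b intro!: smooth_on_subset[OF A]\<close>)
  then show ?thesis
    using e r U by (intro exI[of _ e] conjI exI[of _ "\<lambda>t v. U v t"]) (auto simp: b)
qed

section \<open>Multilinear maps and tensor fields\<close>

definition mlin :: "nat \<Rightarrow> ('a::real_vector list \<Rightarrow> 'b::real_vector) \<Rightarrow> bool" where
  "mlin k F \<longleftrightarrow> (\<forall>us ws. length us + length ws + 1 = k \<longrightarrow> linear (\<lambda>v. F (us @ v # ws)))"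

definition tensor_field :: "'a::euclidean_space set \<Rightarrow> nat \<Rightarrow> ('a \<Rightarrow> 'a list \<Rightarrow> 'b::real_normed_vector) \<Rightarrow> bool" where
  "tensor_field S k T \<longleftrightarrow> (\<forall>x\<in>S. mlin k (T x)) \<and> (\<forall>vs. length vs = k \<longrightarrow> smooth_on S (\<lambda>x. T x vs))"

lemma tensor_field_linear:
  "tensor_field S k T \<Longrightarrow> x \<in> S \<Longrightarrow> length us + length ws + 1 = k \<Longrightarrow> linear (\<lambda>v. T x (us @ v # ws))"
  by (simp add: tensor_field_def mlin_def)

lemma tensor_field_smooth: "tensor_field S k T \<Longrightarrow> length vs = k \<Longrightarrow> smooth_on S (\<lambda>x. T x vs)"
  by (simp add: tensor_field_def)

lemma mlin_update:
  assumes "mlin k F" "length vs = k" "i < k"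
  shows "linear (\<lambda>v. F (vs[i := v]))"
  using assms(1)[unfolded mlin_def, rule_format, of "take i vs" "drop (Suc i) vs"] assms(2,3)
  by (simp add: upd_conv_take_nth_drop)

lemma mlinI_update:
  assumes "\<And>vs i. length vs = k \<Longrightarrow> i < k \<Longrightarrow> linear (\<lambda>v. F (vs[i := v]))"
  shows "mlin k F"
  unfolding mlin_def
proof (intro allI impI)
  fix us ws :: "'a list" assume "length us + length ws + 1 = k"
  then show "linear (\<lambda>v. F (us @ v # ws))"
    using assms[of "us @ 0 # ws" "length us"] by simp
qed

text \<open>Product rule for a tensor with moving point and moving arguments. The arguments are
  treated one after another, with the constant ones collected in \<open>us\<close>: expanding the
  first moving argument in \<open>Basis\<close> turns it into constant slots with scalar
  coefficients.\<close>

lemma tensor_field_along: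
  fixes x :: "real \<Rightarrow> 'a::euclidean_space"
  assumes S: "open S" and T: "tensor_field S k T"
    and x: "(x has_vector_derivative x') (at t within I)" "x t \<in> S" and t: "t \<in> I"
  shows "length Vs = length Ds \<Longrightarrow> length us + length Vs = k \<Longrightarrow>
    (\<And>i. i < length Vs \<Longrightarrow> (Vs ! i has_vector_derivative Ds ! i) (at t within I)) \<Longrightarrow>
    ((\<lambda>s. T (x s) (us @ map (\<lambda>V. V s) Vs)) has_vector_derivative
      pd x' (\<lambda>y. T y (us @ map (\<lambda>V. V t) Vs)) (x t)
      + (\<Sum>i<length Vs. T (x t) (us @ (map (\<lambda>V. V t) Vs)[i := Ds ! i]))) (at t within I)"
proof (induction Vs Ds arbitrary: us rule: list_induct2)
  case Nil
  have "((\<lambda>y. T y us) has_derivative (\<lambda>v. pd v (\<lambda>y. T y us) (x t))) (at (x t))"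
    using Nil x by (intro has_derivative_pd smooth_onD[OF tensor_field_smooth[OF T]]) auto
  from has_derivative_compose[OF x(1)[unfolded has_vector_derivative_def] has_derivative_at_withinI[OF this]]
  have "((\<lambda>s. T (x s) us) has_derivative (\<lambda>s. pd (s *\<^sub>R x') (\<lambda>y. T y us) (x t))) (at t within I)"
    by simp
  moreover have "pd (s *\<^sub>R x') (\<lambda>y. T y us) (x t) = s *\<^sub>R pd x' (\<lambda>y. T y us) (x t)" for s
    using linear_scale[OF pd_linear[OF smooth_onD[OF tensor_field_smooth[OF T] x(2)]]] Nil by simp
  ultimately show ?case by (simp add: has_vector_derivative_def)
next
  case (Cons V Vs D Ds)
  define rest where "rest = (\<lambda>s. map (\<lambda>V. V s) Vs)"
  have lr: "length (rest s) = length Vs" for s by (simp add: rest_def)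
  have V: "(V has_vector_derivative D) (at t within I)" using Cons.prems(2)[of 0] by simp
  have Vs: "(Vs ! i has_vector_derivative Ds ! i) (at t within I)" if "i < length Vs" for i
    using Cons.prems(2)[of "Suc i"] that by simp
  have k: "length us + length Vs + 1 = k" using Cons.prems(1) by simp
  have lin: "linear (\<lambda>v. T y (us @ v # ws))" if "y \<in> S" "length ws = length Vs" for y ws
    by (rule tensor_field_linear[OF T that(1)]) (use k that in simp)
  have ex: "T y (us @ v # ws) = (\<Sum>b\<in>Basis. (v \<bullet> b) *\<^sub>R T y (us @ b # ws))"
    if "y \<in> S" "length ws = length Vs" for y v ws
    by (rule linear_euclidean_sum[OF lin[OF that]])
  have IH: "((\<lambda>s. T (x s) (us @ b # rest s)) has_vector_derivative
      pd x' (\<lambda>y. T y (us @ b # rest t)) (x t)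
      + (\<Sum>i<length Vs. T (x t) (us @ b # (rest t)[i := Ds ! i]))) (at t within I)" for b
    using Cons.IH[of "us @ [b]"] k Vs by (simp add: rest_def)
  have "((\<lambda>s. \<Sum>b\<in>Basis. (V s \<bullet> b) *\<^sub>R T (x s) (us @ b # rest s)) has_vector_derivative
     (\<Sum>b\<in>Basis. (V t \<bullet> b) *\<^sub>R (pd x' (\<lambda>y. T y (us @ b # rest t)) (x t)
      + (\<Sum>i<length Vs. T (x t) (us @ b # (rest t)[i := Ds ! i])))
      + (D \<bullet> b) *\<^sub>R T (x t) (us @ b # rest t))) (at t within I)"
  proof (intro has_vector_derivative_sum has_vector_derivative_scaleR IH)
    show "((\<lambda>s. V s \<bullet> b) has_field_derivative D \<bullet> b) (at t within I)" for b
      using bounded_linear.has_vector_derivative[OF bounded_linear_inner_left V]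
      by (simp add: has_real_derivative_iff_has_vector_derivative)
  qed
  moreover have "(\<Sum>b\<in>Basis. (V t \<bullet> b) *\<^sub>R (pd x' (\<lambda>y. T y (us @ b # rest t)) (x t)
      + (\<Sum>i<length Vs. T (x t) (us @ b # (rest t)[i := Ds ! i])))
      + (D \<bullet> b) *\<^sub>R T (x t) (us @ b # rest t))
      = pd x' (\<lambda>y. T y (us @ V t # rest t)) (x t)
        + (\<Sum>i<Suc (length Vs). T (x t) (us @ (V t # rest t)[i := (D # Ds) ! i]))"
  proof -
    have "pd x' (\<lambda>y. T y (us @ V t # rest t)) (x t)
        = (\<Sum>b\<in>Basis. (V t \<bullet> b) *\<^sub>R pd x' (\<lambda>y. T y (us @ b # rest t)) (x t))"
      by (rule linear_euclidean_sum[OF linear_pd_family[OF S x(2)]])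
        (use x k in \<open>auto intro!: lin smooth_onD[OF tensor_field_smooth[OF T]] simp: lr\<close>)
    moreover have "(\<Sum>i<length Vs. T (x t) (us @ V t # (rest t)[i := Ds ! i]))
        = (\<Sum>b\<in>Basis. (V t \<bullet> b) *\<^sub>R (\<Sum>i<length Vs. T (x t) (us @ b # (rest t)[i := Ds ! i])))"
      unfolding scaleR_sum_right
      by (subst sum.swap, rule sum.cong[OF refl], rule ex) (use x lr in auto)
    moreover have "T (x t) (us @ D # rest t) = (\<Sum>b\<in>Basis. (D \<bullet> b) *\<^sub>R T (x t) (us @ b # rest t))"
      by (rule ex) (use x lr in auto)
    ultimately show ?thesis
      by (simp add: sum.lessThan_Suc_shift scaleR_add_right sum.distrib del: sum.lessThan_Suc)
  qed
  ultimately have d: "((\<lambda>s. \<Sum>b\<in>Basis. (V s \<bullet> b) *\<^sub>R T (x s) (us @ b # rest s)) has_vector_derivative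
      pd x' (\<lambda>y. T y (us @ V t # rest t)) (x t)
        + (\<Sum>i<Suc (length Vs). T (x t) (us @ (V t # rest t)[i := (D # Ds) ! i]))) (at t within I)"
    by simp
  \<comment> \<open>The expansion in \<open>Basis\<close> is available at points of S only, so x s
    must be kept in S for all s in I near t.\<close>
  have "continuous (at t within I) x" using x(1) has_vector_derivative_continuous by blast
  then obtain d' where d': "d' > 0" "\<And>s. s \<in> I \<Longrightarrow> dist s t < d' \<Longrightarrow> x s \<in> S"
  proof -
    obtain e where e: "e > 0" "ball (x t) e \<subseteq> S" using S x(2) open_contains_ball by blast
    then obtain d' where "d' > 0" "\<forall>s\<in>I. dist s t < d' \<longrightarrow> dist (x s) (x t) < e"
      using \<open>continuous (at t within I) x\<close> unfolding continuous_within_eps_delta by blast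
    then show ?thesis using e that[of d'] by (metis dist_commute mem_ball subsetD)
  qed
  have "((\<lambda>s. T (x s) (us @ V s # rest s)) has_vector_derivative
      pd x' (\<lambda>y. T y (us @ V t # rest t)) (x t)
        + (\<Sum>i<Suc (length Vs). T (x t) (us @ (V t # rest t)[i := (D # Ds) ! i]))) (at t within I)"
    by (rule has_vector_derivative_transform_within[OF d d'(1) t])
      (rule ex[symmetric], auto simp: lr d')
  then show ?case by (simp add: rest_def)
qed

lemma bilinear_along:
  fixes x :: "real \<Rightarrow> 'a::euclidean_space" and B :: "'a \<Rightarrow> 'a \<Rightarrow> 'a \<Rightarrow> 'b::real_normed_vector"
  assumes S: "open S" and B: "\<And>y. y \<in> S \<Longrightarrow> bilinear (B y)" "\<And>u v. smooth_on S (\<lambda>y. B y u v)"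
    and x: "(x has_vector_derivative x') (at t within I)" "x t \<in> S" and t: "t \<in> I"
    and U: "(U has_vector_derivative U') (at t within I)" and V: "(V has_vector_derivative V') (at t within I)"
  shows "((\<lambda>s. B (x s) (U s) (V s)) has_vector_derivative
    pd x' (\<lambda>y. B y (U t) (V t)) (x t) + B (x t) U' (V t) + B (x t) (U t) V') (at t within I)"
proof -
  have "tensor_field S 2 (\<lambda>y l. B y (l ! 0) (l ! 1))"
    unfolding tensor_field_def
  proof (intro conjI ballI allI impI mlinI_update)
    fix y :: 'a and vs :: "'a list" and i assume "y \<in> S" "length vs = 2" "i < (2::nat)"
    moreover from this have "i = 0 \<or> i = 1" by auto
    ultimately show "linear (\<lambda>v. B y (vs[i := v] ! 0) (vs[i := v] ! 1))"
      using B(1)[of y] by (auto simp: bilinear_def)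
  qed (rule B(2))
  note * = tensor_field_along[OF S this x t, of "[U, V]" "[U', V']" "[]"]
  have "([U, V] ! i has_vector_derivative [U', V'] ! i) (at t within I)" if "i < length [U, V]" for i
    using that U V by (auto simp: less_Suc_eq)
  from *[OF _ _ this] show ?thesis by (simp add: numeral_2_eq_2 add.assoc)
qed

section \<open>The Levi-Civita connection\<close>

locale local_metric =
  fixes \<Omega> :: "'a::euclidean_space set" and g :: "'a \<Rightarrow> 'a \<Rightarrow> 'a \<Rightarrow> real"
  assumes open_dom: "open \<Omega>"
    and g_bilinear: "x \<in> \<Omega> \<Longrightarrow> bilinear (g x)"
    and g_sym: "x \<in> \<Omega> \<Longrightarrow> g x u v = g x v u"
    and g_pos: "x \<in> \<Omega> \<Longrightarrow> u \<noteq> 0 \<Longrightarrow> g x u u > 0"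
    and g_smooth: "smooth_on \<Omega> (\<lambda>x. g x u v)"
begin

text \<open>The Koszul formula for constant vector fields, whose brackets vanish.\<close>

definition koszul :: "'a \<Rightarrow> 'a \<Rightarrow> 'a \<Rightarrow> 'a \<Rightarrow> real" where
  "koszul x u v w = (pd u (\<lambda>y. g y v w) x + pd v (\<lambda>y. g y u w) x - pd w (\<lambda>y. g y u v) x) / 2"

abbreviation \<Gamma> :: "'a \<Rightarrow> 'a \<Rightarrow> 'a \<Rightarrow> 'a" where
  "\<Gamma> \<equiv> christoffel g"

text \<open>Lowering the index by g, with covectors identified with vectors by the Euclidean inner
  product.\<close>

definition flat :: "'a \<Rightarrow> 'a \<Rightarrow> 'a" where
  "flat x v = (\<Sum>b\<in>Basis. g x v b *\<^sub>R b)"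

definition sharp :: "'a \<Rightarrow> 'a \<Rightarrow> 'a" where
  "sharp x = inv (flat x)"

lemma g_linear: "x \<in> \<Omega> \<Longrightarrow> linear (g x u)" "x \<in> \<Omega> \<Longrightarrow> linear (\<lambda>u. g x u v)"
  using g_bilinear by (auto simp: bilinear_def)

lemma g_nondegenerate:
  assumes "x \<in> \<Omega>" "\<And>w. g x u w = g x v w"
  shows "u = v"
proof (rule ccontr)
  assume "u \<noteq> v"
  then have "g x (u - v) (u - v) > 0" using g_pos assms by simp
  then show False using assms(2) linear_diff[OF g_linear(2)[OF assms(1)]] by simp
qed

lemma flat_inner: "x \<in> \<Omega> \<Longrightarrow> flat x v \<bullet> w = g x v w"
  using linear_euclidean_sum[OF g_linear(1), of x v w]
  by (simp add: flat_def inner_sum_left inner_commute[of w] mult.commute)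

lemma flat_linear: "x \<in> \<Omega> \<Longrightarrow> linear (flat x)"
  unfolding flat_def
  by (rule linearI)
    (simp_all add: linear_add[OF g_linear(2)] linear_scale[OF g_linear(2)] scaleR_add_left sum.distrib scaleR_sum_right)

lemma flat_sharp: "x \<in> \<Omega> \<Longrightarrow> flat x (sharp x w) = w" and sharp_flat: "x \<in> \<Omega> \<Longrightarrow> sharp x (flat x w) = w"
proof -
  assume x: "x \<in> \<Omega>"
  have inj: "inj (flat x)" using flat_inner[OF x] g_nondegenerate[OF x] by (metis injI)
  then have "surj (flat x)" using linear_injective_imp_surjective flat_linear[OF x] by blast
  then show "flat x (sharp x w) = w" by (simp add: sharp_def surj_f_inv_f)
  show "sharp x (flat x w) = w" using inj by (simp add: sharp_def)
qed

lemma g_sharp: "x \<in> \<Omega> \<Longrightarrow> g x (sharp x w) u = w \<bullet> u"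
  using flat_inner flat_sharp by metis

lemma pd_g_sym: "x \<in> \<Omega> \<Longrightarrow> pd w (\<lambda>y. g y u v) x = pd w (\<lambda>y. g y v u) x"
  by (rule pd_cong_open[OF open_dom]) (assumption, rule g_sym)

lemma koszul_linear:
  assumes x: "x \<in> \<Omega>"
  shows "linear (koszul x u v)" "linear (\<lambda>v. koszul x u v w)" "linear (\<lambda>u. koszul x u v w)"
proof -
  note d = smooth_onD[OF g_smooth x]
  have l: "linear (\<lambda>w. pd w (\<lambda>y. g y u v) x)" "linear (\<lambda>u. pd w (\<lambda>y. g y u v) x)"
    "linear (\<lambda>v. pd w (\<lambda>y. g y u v) x)" for u v w
    by (rule pd_linear[OF d], rule linear_pd_family[OF open_dom x g_linear(2) d], assumption,
        rule linear_pd_family[OF open_dom x g_linear(1) d], assumption)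
  show "linear (koszul x u v)" "linear (\<lambda>v. koszul x u v w)" "linear (\<lambda>u. koszul x u v w)"
    unfolding koszul_def[abs_def]
    by (rule linearI; simp add: linear_add[OF l(1)] linear_scale[OF l(1)] linear_add[OF l(2)] linear_scale[OF l(2)]
      linear_add[OF l(3)] linear_scale[OF l(3)] add_divide_distrib diff_divide_distrib right_diff_distrib distrib_left)+
qed

definition levi_civita :: "'a \<Rightarrow> 'a \<Rightarrow> 'a \<Rightarrow> 'a" where
  "levi_civita x u v = sharp x (\<Sum>b\<in>Basis. koszul x u v b *\<^sub>R b)"

lemma g_levi_civita: "x \<in> \<Omega> \<Longrightarrow> g x (levi_civita x u v) w = koszul x u v w"
  using linear_euclidean_sum[OF koszul_linear(1), of x u v w]
  by (simp add: levi_civita_def g_sharp inner_sum_left inner_commute[of w] mult.commute)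

lemma bilinear_levi_civita:
  assumes x: "x \<in> \<Omega>"
  shows "bilinear (levi_civita x)"
  unfolding bilinear_def
  by (intro conjI allI linearI; rule g_nondegenerate[OF x])
    (simp_all add: linear_add[OF g_linear(2)[OF x]] linear_scale[OF g_linear(2)[OF x]] g_levi_civita[OF x]
      linear_add[OF koszul_linear(2)[OF x]] linear_scale[OF koszul_linear(2)[OF x]]
      linear_add[OF koszul_linear(3)[OF x]] linear_scale[OF koszul_linear(3)[OF x]])

text \<open>\<open>christoffel\<close> is a definite description, so existence and uniqueness are
  both at stake. For uniqueness, the alternating sum of three permuted compatibility conditions
  leaves only 2 g(G u v, w).\<close>

lemma christoffel_eq_levi_civita:
  assumes x: "x \<in> \<Omega>"
  shows "christoffel g x = levi_civita x"
  unfolding christoffel_def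
proof (rule the_equality)
  note bilinear_levi_civita[OF x]
  moreover have "levi_civita x u v = levi_civita x v u" for u v
    by (rule g_nondegenerate[OF x]) (simp add: g_levi_civita[OF x], simp add: koszul_def pd_g_sym[OF x, of _ u v])
  moreover have "frechet_derivative (\<lambda>y. g y v w) (at x) u = g x (levi_civita x u v) w + g x v (levi_civita x u w)" for u v w
    using pd_g_sym[OF x, of u v w] pd_g_sym[OF x, of v u w] pd_g_sym[OF x, of w u v]
    unfolding g_sym[OF x, of v] g_levi_civita[OF x] koszul_def by (simp add: pd_def field_simps)
  ultimately show "bilinear (levi_civita x) \<and> (\<forall>u v. levi_civita x u v = levi_civita x v u) \<and>
     (\<forall>u v w. frechet_derivative (\<lambda>y. g y v w) (at x) u = g x (levi_civita x u v) w + g x v (levi_civita x u w))"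
    by blast
next
  fix G assume G: "bilinear G \<and> (\<forall>u v. G u v = G v u) \<and>
     (\<forall>u v w. frechet_derivative (\<lambda>y. g y v w) (at x) u = g x (G u v) w + g x v (G u w))"
  then have m: "pd u (\<lambda>y. g y v w) x = g x (G u v) w + g x v (G u w)" for u v w by (simp add: pd_def)
  have s: "G u v = G v u" for u v using G by blast
  show "G = levi_civita x"
  proof (intro ext, rule g_nondegenerate[OF x])
    fix u v w
    show "g x (G u v) w = g x (levi_civita x u v) w"
      unfolding g_levi_civita[OF x] koszul_def m
      using s[of u v] s[of u w] s[of v w] g_sym[OF x] by simp
  qed
qed

lemma bilinear_\<Gamma>: "x \<in> \<Omega> \<Longrightarrow> bilinear (\<Gamma> x)"
  by (simp add: christoffel_eq_levi_civita bilinear_levi_civita)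

lemma linear_\<Gamma>: "x \<in> \<Omega> \<Longrightarrow> linear (\<Gamma> x u)" "x \<in> \<Omega> \<Longrightarrow> linear (\<lambda>u. \<Gamma> x u v)"
  using bilinear_\<Gamma> by (auto simp: bilinear_def)

lemma g_\<Gamma>: "x \<in> \<Omega> \<Longrightarrow> g x (\<Gamma> x u v) w = koszul x u v w"
  by (simp add: christoffel_eq_levi_civita g_levi_civita)

lemma \<Gamma>_sym: "x \<in> \<Omega> \<Longrightarrow> \<Gamma> x u v = \<Gamma> x v u"
  by (rule g_nondegenerate, assumption) (simp add: g_\<Gamma>, simp add: koszul_def pd_g_sym[of _ _ u v])

lemma g_compatible: "x \<in> \<Omega> \<Longrightarrow> pd u (\<lambda>y. g y v w) x = g x (\<Gamma> x u v) w + g x v (\<Gamma> x u w)"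
  using pd_g_sym[of x u v w] pd_g_sym[of x v u w] pd_g_sym[of x w u v]
  by (simp add: g_sym[of x v "\<Gamma> x u w"] g_\<Gamma> koszul_def field_simps)

lemma smooth_\<Gamma>: "smooth_on \<Omega> (\<lambda>x. \<Gamma> x u v)"
proof (rule smooth_on_cong[OF open_dom])
  have flat: "smooth_on \<Omega> (\<lambda>x. flat x w)" for w
    unfolding flat_def by (intro smooth_on_sum smooth_on_scaleR open_dom g_smooth smooth_on_const)
  have 1: "smooth_on \<Omega> (\<lambda>x. sharp x w)" for w
    by (rule smooth_on_inverse_family[OF open_dom flat_linear flat flat_sharp sharp_flat])
  have 2: "linear (sharp x)" if "x \<in> \<Omega>" for x
    by (rule linear_inverse[OF flat_linear[OF that] flat_sharp[OF that] sharp_flat[OF that]])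
  have 3: "smooth_on \<Omega> (\<lambda>x. koszul x u v b)" for b
    unfolding koszul_def
    by (rule smooth_on_bounded_linear[OF open_dom bounded_linear_divide])
      (intro smooth_on_add smooth_on_diff open_dom smooth_on_pd[OF g_smooth])
  show "smooth_on \<Omega> (\<lambda>x. levi_civita x u v)"
    unfolding levi_civita_def
    by (rule smooth_on_family[OF open_dom 2 1], assumption) (intro smooth_on_sum smooth_on_scaleR open_dom smooth_on_const 3)
qed (simp add: christoffel_eq_levi_civita)

text \<open>Compatibility with the metric makes g(D, D) constant along the curve; it vanishes at s0,
  and g is definite. Applied to differences of parallel fields, this is the uniqueness of parallel
  transport.\<close>

lemma parallel_zero:
  assumes I: "convex I" "s0 \<in> I" and x: "\<And>t. t \<in> I \<Longrightarrow> x t \<in> \<Omega>"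
    "\<And>t. t \<in> I \<Longrightarrow> (x has_vector_derivative x' t) (at t within I)"
    and D: "\<And>t. t \<in> I \<Longrightarrow> (D has_vector_derivative - \<Gamma> (x t) (x' t) (D t)) (at t within I)" "D s0 = 0"
    and t: "t \<in> I"
  shows "D t = 0"
proof (rule ccontr)
  assume ne: "D t \<noteq> 0"
  have "((\<lambda>s. g (x s) (D s) (D s)) has_vector_derivative 0) (at s within I)" if s: "s \<in> I" for s
  proof -
    note lin = g_linear(1)[OF x(1)[OF s]] g_linear(2)[OF x(1)[OF s]]
    have "((\<lambda>s. g (x s) (D s) (D s)) has_vector_derivative
        pd (x' s) (\<lambda>y. g y (D s) (D s)) (x s) + g (x s) (- \<Gamma> (x s) (x' s) (D s)) (D s)
        + g (x s) (D s) (- \<Gamma> (x s) (x' s) (D s))) (at s within I)"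
      by (rule bilinear_along[OF open_dom g_bilinear g_smooth x(2)[OF s] x(1)[OF s] s D(1)[OF s] D(1)[OF s]])
    then show ?thesis
      unfolding g_compatible[OF x(1)[OF s]] by (simp add: linear_neg[OF lin(1)] linear_neg[OF lin(2)])
  qed
  then obtain c where "\<And>s. s \<in> I \<Longrightarrow> g (x s) (D s) (D s) = c"
    by (rule has_vector_derivative_zero_constant[OF I(1)]) (assumption, rule that, assumption)
  then have "g (x t) (D t) (D t) = g (x s0) (D s0) (D s0)" using I(2) t by simp
  then show False using g_pos[OF x(1)[OF t] ne] D(2) linear_0[OF g_linear(1)[OF x(1)[OF I(2)]]] by simp
qed

lemma curvature_eq:
  assumes "x \<in> \<Omega>"
  shows "curvature \<Gamma> x u v w = pd u (\<lambda>y. \<Gamma> y v w) x + \<Gamma> x u (\<Gamma> x v w)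
    - (pd v (\<lambda>y. \<Gamma> y u w) x + \<Gamma> x v (\<Gamma> x u w))"
  by (simp add: curvature_def nabla_vf_def pd_def)

lemma linear_pd_\<Gamma>:
  assumes x: "x \<in> \<Omega>"
  shows "linear (\<lambda>d. pd d (\<lambda>y. \<Gamma> y u v) x)" "linear (\<lambda>u. pd d (\<lambda>y. \<Gamma> y u v) x)"
    "linear (\<lambda>v. pd d (\<lambda>y. \<Gamma> y u v) x)"
  by (rule pd_linear linear_pd_family[OF open_dom x] linear_\<Gamma> smooth_onD[OF smooth_\<Gamma> x]; assumption?)+

lemma tensor_field_curvature: "tensor_field \<Omega> 3 (\<lambda>x xs. curvature \<Gamma> x (xs ! 0) (xs ! 1) (xs ! 2))"
  unfolding tensor_field_def
proof (intro conjI ballI allI impI mlinI_update)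
  fix x :: 'a and vs :: "'a list" and i assume x: "x \<in> \<Omega>" and vs: "length vs = 3" and i: "i < (3::nat)"
  note l = linear_pd_\<Gamma>[OF x] linear_\<Gamma>[OF x]
  have a: "linear (\<lambda>u. curvature \<Gamma> x u v w)" "linear (\<lambda>v. curvature \<Gamma> x u v w)" "linear (curvature \<Gamma> x u v)" for u v w
    unfolding curvature_eq[OF x, abs_def]
    by (rule linearI; simp add: curvature_eq[OF x] linear_add[OF l(1)] linear_scale[OF l(1)] linear_add[OF l(2)] linear_scale[OF l(2)]
      linear_add[OF l(3)] linear_scale[OF l(3)] linear_add[OF l(4)] linear_scale[OF l(4)]
      linear_add[OF l(5)] linear_scale[OF l(5)] algebra_simps)+
  consider "i = 0" | "i = 1" | "i = 2" using i by linarith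
  then show "linear (\<lambda>v. curvature \<Gamma> x (vs[i := v] ! 0) (vs[i := v] ! 1) (vs[i := v] ! 2))"
    by cases (use vs a in \<open>auto simp: numeral_2_eq_2\<close>)
next
  fix vs :: "'a list"
  have s: "smooth_on \<Omega> (\<lambda>x. \<Gamma> x u (\<Gamma> x v w))" for u v w
    by (rule smooth_on_family[OF open_dom, where h="\<lambda>x. \<Gamma> x u"]) (auto intro: linear_\<Gamma> smooth_\<Gamma>)
  show "smooth_on \<Omega> (\<lambda>x. curvature \<Gamma> x (vs ! 0) (vs ! 1) (vs ! 2))"
    by (rule smooth_on_cong[OF open_dom curvature_eq[symmetric]])
      (auto intro!: smooth_on_add smooth_on_diff open_dom s smooth_on_pd[OF smooth_\<Gamma>])
qed

lemma tensor_field_cov_deriv: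
  assumes T: "tensor_field \<Omega> k T"
  shows "tensor_field \<Omega> (Suc k) (cov_deriv \<Gamma> T)"
  unfolding tensor_field_def
proof (intro conjI ballI allI impI mlinI_update)
  fix x :: 'a and vs :: "'a list" and i
  assume x: "x \<in> \<Omega>" and vs: "length vs = Suc k" and i: "i < Suc k"
  obtain Z Ys where zy: "vs = Z # Ys" "length Ys = k" using vs by (cases vs) auto
  have mx: "mlin k (T x)" using T x by (simp add: tensor_field_def)
  note G = linear_\<Gamma>[OF x]
  show "linear (\<lambda>v. cov_deriv \<Gamma> T x (vs[i := v]))"
  proof (cases i)
    case 0
    have "linear (\<lambda>v. T x (Ys[j := \<Gamma> x v (Ys ! j)]))" if "j < k" for j
      using linear_compose[OF G(2) mlin_update[OF mx zy(2) that]] by (simp add: o_def)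
    then have "linear (\<lambda>v. \<Sum>j<k. T x (Ys[j := \<Gamma> x v (Ys ! j)]))" by (intro linear_compose_sum) auto
    moreover have "linear (\<lambda>v. frechet_derivative (\<lambda>y. T y Ys) (at x) v)"
      by (rule linear_frechet_derivative[OF smooth_onD[OF tensor_field_smooth[OF T zy(2)] x]])
    ultimately show ?thesis using 0 zy G(2)
      by (simp add: linear_compose_add linear_compose_sub)
  next
    case (Suc m)
    then have m: "m < k" using i by simp
    have l1: "linear (\<lambda>v. pd Z (\<lambda>y. T y (Ys[m := v])) x)"
      by (rule linear_pd_family[OF open_dom x])
        (use T zy m in \<open>auto intro!: mlin_update smooth_onD[OF tensor_field_smooth[OF T] x] simp: tensor_field_def\<close>)
    have l2: "linear (\<lambda>v. \<Gamma> x Z (T x (Ys[m := v])))"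
      using linear_compose[OF mlin_update[OF mx zy(2) m] G(1)] by (simp add: o_def)
    \<comment> \<open>In slot m itself the correction is precomposed with \<Gamma>; in every other
      slot the two updates commute.\<close>
    have l3: "linear (\<lambda>v. T x ((Ys[m := v])[j := \<Gamma> x Z (Ys[m := v] ! j)]))" if j: "j < k" for j
    proof (cases "j = m")
      case True
      then show ?thesis using linear_compose[OF G(1) mlin_update[OF mx zy(2) m]] zy m by (simp add: o_def)
    next
      case False
      then have "linear (\<lambda>v. T x ((Ys[j := \<Gamma> x Z (Ys ! j)])[m := v]))"
        using mlin_update[OF mx _ m, of "Ys[j := \<Gamma> x Z (Ys ! j)]"] zy by simp
      then show ?thesis using False by (simp add: list_update_swap)
    qed
    then have "linear (\<lambda>v. \<Sum>j<k. T x ((Ys[m := v])[j := \<Gamma> x Z (Ys[m := v] ! j)]))"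
      by (intro linear_compose_sum) auto
    then show ?thesis using Suc zy l1 l2
      by (simp add: linear_compose_add linear_compose_sub pd_def)
  qed
next
  fix vs :: "'a list" assume vs: "length vs = Suc k"
  obtain Z Ys where zy: "vs = Z # Ys" "length Ys = k" using vs by (cases vs) auto
  note sT = tensor_field_smooth[OF T]
  have "smooth_on \<Omega> (\<lambda>x. \<Gamma> x Z (T x Ys))"
    by (rule smooth_on_family[OF open_dom, where h="\<lambda>x. \<Gamma> x Z"]) (auto intro: linear_\<Gamma> smooth_\<Gamma> sT zy)
  moreover have "smooth_on \<Omega> (\<lambda>x. T x (Ys[i := \<Gamma> x Z (Ys ! i)]))" if "i < k" for i
    by (rule smooth_on_family[OF open_dom, where h="\<lambda>x v. T x (Ys[i := v])" and V="\<lambda>x. \<Gamma> x Z (Ys ! i)"])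
      (use T that zy in \<open>auto intro!: mlin_update sT smooth_\<Gamma> simp: tensor_field_def\<close>)
  moreover have "smooth_on \<Omega> (pd Z (\<lambda>y. T y Ys))" by (rule smooth_on_pd[OF sT[OF zy(2)]])
  ultimately show "smooth_on \<Omega> (\<lambda>x. cov_deriv \<Gamma> T x vs)"
    using zy by (auto intro!: smooth_on_diff smooth_on_add smooth_on_sum open_dom simp: pd_def)
qed

lemma tensor_field_cov_deriv_pow: "tensor_field \<Omega> k T \<Longrightarrow> tensor_field \<Omega> (n + k) ((cov_deriv \<Gamma> ^^ n) T)"
  by (induction n) (auto intro: tensor_field_cov_deriv)

lemma tensor_field_curvature_deriv: "tensor_field \<Omega> (n + 3) (curvature_deriv \<Gamma> n)"
  unfolding curvature_deriv_def by (rule tensor_field_cov_deriv_pow[OF tensor_field_curvature])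

text \<open>The derivatives of the parallel arguments are exactly the slot corrections in
  \<open>cov_deriv\<close>, so that besides the covariant derivative only the \<Gamma> acting on the
  value survives.\<close>

lemma cov_deriv_along_parallel:
  assumes T: "tensor_field \<Omega> k T" and vs: "length Vs = k"
    and x: "(x has_vector_derivative x') (at t)" "x t \<in> \<Omega>"
    and V: "\<And>V. V \<in> set Vs \<Longrightarrow> (V has_vector_derivative - \<Gamma> (x t) x' (V t)) (at t)"
  shows "((\<lambda>s. T (x s) (map (\<lambda>V. V s) Vs)) has_vector_derivative
    cov_deriv \<Gamma> T (x t) (x' # map (\<lambda>V. V t) Vs) - \<Gamma> (x t) x' (T (x t) (map (\<lambda>V. V t) Vs))) (at t)"
proof -
  define Ys where "Ys = map (\<lambda>V. V t) Vs"
  have Ys: "length Ys = k" using vs by (simp add: Ys_def)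
  have mx: "mlin k (T (x t))" using T x by (simp add: tensor_field_def)
  have "((\<lambda>s. T (x s) ([] @ map (\<lambda>V. V s) Vs)) has_vector_derivative
      pd x' (\<lambda>y. T y ([] @ map (\<lambda>V. V t) Vs)) (x t) + (\<Sum>i<length Vs. T (x t) ([] @ (map (\<lambda>V. V t) Vs)[i :=
        map (\<lambda>V. - \<Gamma> (x t) x' (V t)) Vs ! i]))) (at t)"
    by (rule tensor_field_along[OF open_dom T x]) (use vs V in auto)
  then have "((\<lambda>s. T (x s) (map (\<lambda>V. V s) Vs)) has_vector_derivative
      pd x' (\<lambda>y. T y Ys) (x t) + (\<Sum>i<k. T (x t) (Ys[i := - \<Gamma> (x t) x' (Ys ! i)]))) (at t)"
    using vs by (simp add: Ys_def)
  moreover have "(\<Sum>i<k. T (x t) (Ys[i := - \<Gamma> (x t) x' (Ys ! i)])) = - (\<Sum>i<k. T (x t) (Ys[i := \<Gamma> (x t) x' (Ys ! i)]))"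
    unfolding sum_negf[symmetric]
    by (rule sum.cong[OF refl]) (simp add: linear_neg[OF mlin_update[OF mx Ys]])
  ultimately show ?thesis using Ys by (simp add: Ys_def[symmetric] pd_def)
qed

end

lemma ray_has_vector_derivative:
  assumes "f differentiable (at (t *\<^sub>R X))"
  shows "((\<lambda>t. f (t *\<^sub>R X)) has_vector_derivative pd X f (t *\<^sub>R X)) (at t)"
proof -
  have d: "((\<lambda>t. t *\<^sub>R X) has_derivative (\<lambda>s. s *\<^sub>R X)) (at t)"
    by (auto intro!: derivative_eq_intros)
  have "(\<lambda>s. pd (s *\<^sub>R X) f (t *\<^sub>R X)) = (\<lambda>s. s *\<^sub>R pd X f (t *\<^sub>R X))"
    using linear_scale[OF pd_linear[OF assms]] by blast
  then show ?thesis
    using has_derivative_compose[OF d has_derivative_pd[OF assms]] by (simp add: has_vector_derivative_def)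
qed

section \<open>Exponential map and parallel transport\<close>

text \<open>Everything is read in one chart: f is the exponential map, fi its inverse, and
  \<open>J_parallel\<close> is \<nabla>J = 0 written with \<Gamma>. \<open>f_geodesic\<close> covers
  all t and X with tX in the ball, so that the geodesic equation can be differentiated with respect
  to X.\<close>

locale kaehler_germ = local_metric \<Omega> g
  for \<Omega> :: "'a::euclidean_space set" and g :: "'a \<Rightarrow> 'a \<Rightarrow> 'a \<Rightarrow> real" +
  fixes J :: "'a \<Rightarrow> 'a \<Rightarrow> 'a" and x0 :: 'a and f fi :: "'a \<Rightarrow> 'a" and V :: "'a set" and \<rho> :: real
  assumes J_linear: "x \<in> \<Omega> \<Longrightarrow> linear (J x)"
    and J_square: "x \<in> \<Omega> \<Longrightarrow> J x (J x u) = - u"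
    and J_smooth: "smooth_on \<Omega> (\<lambda>x. J x u)"
    and J_parallel: "x \<in> \<Omega> \<Longrightarrow> pd Z (\<lambda>y. J y Y) x = J x (\<Gamma> x Z Y) - \<Gamma> x Z (J x Y)"
    and rho_pos: "0 < \<rho>"
    and f_smooth: "smooth_on (ball 0 \<rho>) f"
    and f_dom: "Z \<in> ball 0 \<rho> \<Longrightarrow> f Z \<in> \<Omega>"
    and f_0: "f 0 = x0"
    and pd_f_0: "pd v f 0 = v"
    and f_geodesic: "t *\<^sub>R X \<in> ball 0 \<rho> \<Longrightarrow>
      pd X (pd X f) (t *\<^sub>R X) = - \<Gamma> (f (t *\<^sub>R X)) (pd X f (t *\<^sub>R X)) (pd X f (t *\<^sub>R X))"
    and open_V: "open V"
    and f_V: "Z \<in> ball 0 \<rho> \<Longrightarrow> f Z \<in> V"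
    and fi_smooth: "smooth_on V fi"
    and fi_f: "Z \<in> ball 0 \<rho> \<Longrightarrow> fi (f Z) = Z"
begin

abbreviation I :: "'a \<Rightarrow> 'a" where "I \<equiv> J x0"

abbreviation R0 :: "'a \<Rightarrow> 'a list \<Rightarrow> 'a" where
  "R0 \<equiv> \<lambda>x xs. curvature \<Gamma> x (xs ! 0) (xs ! 1) (xs ! 2)"

definition bpt :: "'a \<Rightarrow> 'a \<Rightarrow> 'a" where
  "bpt Z = inv (parallel_transport \<Gamma> (\<lambda>s. f (s *\<^sub>R Z))) \<circ> frechet_derivative f (at Z)"

definition fpt :: "'a \<Rightarrow> 'a \<Rightarrow> 'a" where
  "fpt Z = inv (bpt Z)"

lemma x0_dom: "x0 \<in> \<Omega>"
  using f_dom[of 0] f_0 rho_pos by simp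

text \<open>The mixed second derivatives of y -> J y w are computed from \<open>J_parallel\<close>;
  their symmetry is the commutation of the curvature with J.\<close>

lemma curvature_J:
  assumes x: "x \<in> \<Omega>"
  shows "curvature \<Gamma> x u v (J x w) = J x (curvature \<Gamma> x u v w)"
proof -
  note G = linear_\<Gamma>[OF x] and lJ = J_linear[OF x]
  have key: "pd a (pd b (\<lambda>y. J y w)) x =
      (J x (\<Gamma> x a (\<Gamma> x b w)) - \<Gamma> x a (J x (\<Gamma> x b w))) + J x (pd a (\<lambda>y. \<Gamma> y b w) x)
      - (pd a (\<lambda>y. \<Gamma> y b (J x w)) x + \<Gamma> x b (J x (\<Gamma> x a w) - \<Gamma> x a (J x w)))" for a b
  proof -
    have "pd a (pd b (\<lambda>y. J y w)) x = pd a (\<lambda>y. J y (\<Gamma> y b w) - \<Gamma> y b (J y w)) x"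
      by (rule pd_cong_open[OF open_dom x]) (rule J_parallel)
    also have "((\<lambda>y. J y (\<Gamma> y b w) - \<Gamma> y b (J y w)) has_derivative
        (\<lambda>a. (pd a (\<lambda>y. J y (\<Gamma> x b w)) x + J x (pd a (\<lambda>y. \<Gamma> y b w) x))
          - (pd a (\<lambda>y. \<Gamma> y b (J x w)) x + \<Gamma> x b (pd a (\<lambda>y. J y w) x)))) (at x)"
      by (rule has_derivative_diff;
          rule has_derivative_family[OF open_dom x])
        (auto intro: J_linear linear_\<Gamma> smooth_onD[OF J_smooth x] smooth_onD[OF smooth_\<Gamma> x] has_derivative_pd)
    then have "pd a (\<lambda>y. J y (\<Gamma> y b w) - \<Gamma> y b (J y w)) x =
        (pd a (\<lambda>y. J y (\<Gamma> x b w)) x + J x (pd a (\<lambda>y. \<Gamma> y b w) x))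
          - (pd a (\<lambda>y. \<Gamma> y b (J x w)) x + \<Gamma> x b (pd a (\<lambda>y. J y w) x))"
      by (rule pd_eqI)
    finally show ?thesis by (simp add: J_parallel[OF x])
  qed
  have "pd u (pd v (\<lambda>y. J y w)) x = pd v (pd u (\<lambda>y. J y w)) x"
    by (rule pd_commute[OF open_dom x J_smooth])
  then show ?thesis
    unfolding key curvature_eq[OF x]
    by (simp add: linear_add[OF lJ] linear_diff[OF lJ] linear_diff[OF G(1)] algebra_simps)
qed

end

text \<open>P is parallel transport from time 0 to time t along one ray, on an interval around 0 so
  that Taylor coefficients at 0 make sense. Its linearity and injectivity follow from uniqueness of
  parallel fields.\<close>

locale kaehler_ray = kaehler_germ +
  fixes X :: 'a and e :: real and P :: "real \<Rightarrow> 'a \<Rightarrow> 'a"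
  assumes e_pos: "0 < e"
    and ray_dom: "t \<in> ball 0 e \<Longrightarrow> t *\<^sub>R X \<in> ball 0 \<rho>"
    and P_0: "P 0 v = v"
    and P_smooth: "smooth_on (ball 0 e) (\<lambda>t. P t v)"
    and P_parallel: "t \<in> ball 0 e \<Longrightarrow> ((\<lambda>t. P t v) has_vector_derivative
      - \<Gamma> (f (t *\<^sub>R X)) (pd X f (t *\<^sub>R X)) (P t v)) (at t)"
begin

abbreviation x :: "real \<Rightarrow> 'a" where "x t \<equiv> f (t *\<^sub>R X)"
abbreviation vel :: "real \<Rightarrow> 'a" where "vel t \<equiv> pd X f (t *\<^sub>R X)"

lemma f_diff: "t \<in> ball 0 e \<Longrightarrow> f differentiable (at (t *\<^sub>R X))"
  "t \<in> ball 0 e \<Longrightarrow> pd u f differentiable (at (t *\<^sub>R X))"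
  "t \<in> ball 0 e \<Longrightarrow> pd u (pd v f) differentiable (at (t *\<^sub>R X))"
  by (intro smooth_onD[where S="ball 0 \<rho>"] smooth_on_pd f_smooth ray_dom; assumption)+

lemma x_dom: "t \<in> ball 0 e \<Longrightarrow> x t \<in> \<Omega>"
  by (intro f_dom ray_dom)

lemma x_deriv: "t \<in> ball 0 e \<Longrightarrow> (x has_vector_derivative vel t) (at t)"
  by (intro ray_has_vector_derivative f_diff)

lemma vel_deriv: "t \<in> ball 0 e \<Longrightarrow> (vel has_vector_derivative - \<Gamma> (x t) (vel t) (vel t)) (at t)"
  using ray_has_vector_derivative[OF f_diff(2), of t X] f_geodesic[OF ray_dom] by simp

lemma parallel_unique:
  assumes U: "\<And>t. t \<in> ball 0 e \<Longrightarrow> (U has_vector_derivative - \<Gamma> (x t) (vel t) (U t)) (at t)"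
    and W: "\<And>t. t \<in> ball 0 e \<Longrightarrow> (W has_vector_derivative - \<Gamma> (x t) (vel t) (W t)) (at t)"
    and s: "s \<in> ball 0 e" "U s = W s" and t: "t \<in> ball 0 e"
  shows "U t = W t"
proof -
  have "U t - W t = 0"
  proof (rule parallel_zero[where I="ball 0 e" and x=x and x'=vel and ?s0.0=s and D="\<lambda>t. U t - W t"])
    fix r :: real assume r: "r \<in> ball 0 e"
    show "(x has_vector_derivative vel r) (at r within ball 0 e)"
      by (rule has_vector_derivative_at_within[OF x_deriv[OF r]])
    show "((\<lambda>t. U t - W t) has_vector_derivative - \<Gamma> (x r) (vel r) (U r - W r)) (at r within ball 0 e)"
      by (rule has_vector_derivative_at_within, rule has_vector_derivative_eq_rhs[OF has_vector_derivative_diff[OF U[OF r] W[OF r]]])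
        (simp add: linear_diff[OF linear_\<Gamma>(1)[OF x_dom[OF r]]])
  qed (use s t in \<open>simp_all add: x_dom\<close>)
  then show ?thesis by simp
qed

lemma zero_in: "0 \<in> ball 0 e"
  using e_pos by simp

lemma P_linear: "t \<in> ball 0 e \<Longrightarrow> linear (P t)"
proof (rule linearI)
  assume t: "t \<in> ball 0 e"
  show "P t (u + v) = P t u + P t v" for u v
    by (rule parallel_unique[OF P_parallel _ zero_in _ t])
      (auto intro!: derivative_eq_intros P_parallel simp: P_0 linear_add[OF linear_\<Gamma>(1)[OF x_dom]])
  show "P t (r *\<^sub>R u) = r *\<^sub>R P t u" for r u
    by (rule parallel_unique[OF P_parallel _ zero_in _ t])
      (auto intro!: bounded_linear.has_vector_derivative[OF bounded_linear_scaleR_right, THEN has_vector_derivative_eq_rhs] P_parallel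
        simp: P_0 linear_scale[OF linear_\<Gamma>(1)[OF x_dom]])
qed

lemma P_inj: "t \<in> ball 0 e \<Longrightarrow> inj (P t)"
proof (rule injI)
  fix u v assume t: "t \<in> ball 0 e" "P t u = P t v"
  have "P 0 u = P 0 v"
    by (rule parallel_unique[OF P_parallel P_parallel t(1) t(2) zero_in])
  then show "u = v" by (simp add: P_0)
qed

definition Q :: "real \<Rightarrow> 'a \<Rightarrow> 'a" where "Q t = inv (P t)"

lemma Q_P: "t \<in> ball 0 e \<Longrightarrow> Q t (P t v) = v"
  by (simp add: Q_def P_inj)

lemma P_Q: "t \<in> ball 0 e \<Longrightarrow> P t (Q t v) = v"
  unfolding Q_def
  by (rule surj_f_inv_f, rule linear_injective_imp_surjective) (auto intro: P_linear P_inj)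

lemma Q_linear: "t \<in> ball 0 e \<Longrightarrow> linear (Q t)"
  by (rule linear_inverse[OF P_linear P_Q Q_P])

lemma Q_0: "Q 0 v = v"
  using Q_P[OF zero_in, of v] by (simp add: P_0)

lemma Q_smooth: "smooth_on (ball 0 e) (\<lambda>t. Q t v)"
  by (rule smooth_on_inverse_family[OF open_ball P_linear P_smooth P_Q Q_P])

text \<open>In the parallel frame the covariant derivative along the ray becomes the ordinary
  derivative.\<close>

lemma Q_deriv:
  assumes t: "t \<in> ball 0 e" and W: "(W has_vector_derivative W') (at t)"
  shows "((\<lambda>s. Q s (W s)) has_vector_derivative Q t (W' + \<Gamma> (x t) (vel t) (W t))) (at t)"
proof -
  have "((\<lambda>s. Q s (W t)) has_derivative (\<lambda>d. - Q t (pd d (\<lambda>s. P s (Q t (W t))) t))) (at t)"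
    by (rule inverse_family_has_derivative[OF open_ball t P_linear smooth_onD[OF P_smooth t] P_Q Q_P])
  from pd_eqI[OF this, of 1]
  have 1: "pd 1 (\<lambda>s. Q s (W t)) t = Q t (\<Gamma> (x t) (vel t) (W t))"
    using pd_1_eqI[OF P_parallel[OF t, of "Q t (W t)"]] by (simp add: P_Q[OF t] linear_neg[OF Q_linear[OF t]])
  have "((\<lambda>s. Q s (W s)) has_derivative (\<lambda>w. pd w (\<lambda>s. Q s (W t)) t + Q t (w *\<^sub>R W'))) (at t)"
    by (rule has_derivative_family[OF open_ball t Q_linear smooth_onD[OF Q_smooth t]], assumption)
      (rule W[unfolded has_vector_derivative_def])
  moreover have "pd w (\<lambda>s. Q s (W t)) t = w *\<^sub>R pd 1 (\<lambda>s. Q s (W t)) t" for w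
    using linear_scale[OF pd_linear[OF smooth_onD[OF Q_smooth t, of "W t"]], of w 1] by simp
  ultimately show ?thesis
    unfolding has_vector_derivative_def 1
    by (simp add: linear_scale[OF Q_linear[OF t]] linear_add[OF Q_linear[OF t]] scaleR_add_right add.commute)
qed

lemma P_X: "t \<in> ball 0 e \<Longrightarrow> P t X = vel t"
  by (rule parallel_unique[OF P_parallel vel_deriv zero_in]) (simp_all add: P_0 pd_f_0)

text \<open>Both sides are parallel along the ray, the right one because of \<nabla>J = 0, and they
  agree at t = 0.\<close>

lemma P_I: "t \<in> ball 0 e \<Longrightarrow> P t (I v) = J (x t) (P t v)"
proof (rule parallel_unique[OF P_parallel _ zero_in])
  fix s :: real assume s: "s \<in> ball 0 e"
  note xs = x_dom[OF s]
  have "tensor_field \<Omega> 1 (\<lambda>y l. J y (l ! 0))"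
    unfolding tensor_field_def
    by (intro conjI ballI allI impI mlinI_update) (auto simp: J_smooth J_linear)
  from tensor_field_along[OF open_dom this x_deriv[OF s] xs, of "[\<lambda>t. P t v]" "[- \<Gamma> (x s) (vel s) (P s v)]" "[]"]
  have "((\<lambda>s. J (x s) (P s v)) has_vector_derivative
      pd (vel s) (\<lambda>y. J y (P s v)) (x s) + J (x s) (- \<Gamma> (x s) (vel s) (P s v))) (at s)"
    using P_parallel[OF s] by simp
  then show "((\<lambda>s. J (x s) (P s v)) has_vector_derivative - \<Gamma> (x s) (vel s) (J (x s) (P s v))) (at s)"
    by (simp add: J_parallel[OF xs] linear_neg[OF J_linear[OF xs]])
qed (auto simp: P_0 f_0)

text \<open>The tensor T along the ray, evaluated on parallel arguments and read in the parallel
  frame: a curve in a fixed vector space, which has Taylor coefficients.\<close>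

definition \<tau> :: "('a \<Rightarrow> 'a list \<Rightarrow> 'a) \<Rightarrow> 'a list \<Rightarrow> real \<Rightarrow> 'a" where
  "\<tau> T vs t = Q t (T (x t) (map (P t) vs))"

lemma \<tau>_deriv:
  assumes T: "tensor_field \<Omega> k T" "length vs = k" and t: "t \<in> ball 0 e"
  shows "(\<tau> T vs has_vector_derivative \<tau> (cov_deriv \<Gamma> T) (X # vs) t) (at t)"
proof -
  have "((\<lambda>s. T (x s) (map (\<lambda>V. V s) (map (\<lambda>v s. P s v) vs))) has_vector_derivative
    cov_deriv \<Gamma> T (x t) (vel t # map (\<lambda>V. V t) (map (\<lambda>v s. P s v) vs))
      - \<Gamma> (x t) (vel t) (T (x t) (map (\<lambda>V. V t) (map (\<lambda>v s. P s v) vs)))) (at t)"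
    by (rule cov_deriv_along_parallel[OF T(1) _ x_deriv[OF t] x_dom[OF t]]) (use T(2) t in \<open>auto intro: P_parallel\<close>)
  then have "((\<lambda>s. T (x s) (map (P s) vs)) has_vector_derivative
    cov_deriv \<Gamma> T (x t) (vel t # map (P t) vs) - \<Gamma> (x t) (vel t) (T (x t) (map (P t) vs))) (at t)"
    by (simp add: o_def)
  from Q_deriv[OF t this] show ?thesis by (simp add: \<tau>_def[abs_def] P_X[OF t] del: cov_deriv.simps)
qed

text \<open>The derivative of \<open>\<tau> T\<close> has the same form for the covariant derivative
  of T, so the induction runs over all tensor fields at once.\<close>

lemma \<tau>_smooth:
  assumes "tensor_field \<Omega> k T" "length vs = k"
  shows "smooth_on (ball 0 e) (\<tau> T vs)"
proof -
  have "Ck_on n (ball 0 e) (\<tau> T vs)" for n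
    using assms
  proof (induction n arbitrary: k T vs)
    case 0
    have "isCont (\<tau> T vs) t" if "t \<in> ball 0 e" for t
      by (rule has_vector_derivative_continuous[OF \<tau>_deriv[OF 0 that]])
    then show ?case by (simp add: continuous_on_eq_continuous_at)
  next
    case (Suc n)
    note d = \<tau>_deriv[OF Suc.prems]
    have "Ck_on n (ball 0 e) (\<lambda>t. v *\<^sub>R \<tau> (cov_deriv \<Gamma> T) (X # vs) t)" for v
      by (rule Ck_on_bounded_linear[OF open_ball bounded_linear_scaleR_right Suc.IH[OF tensor_field_cov_deriv]])
        (use Suc.prems in auto)
    note c = this
    have "Ck_on n (ball 0 e) (pd v (\<tau> T vs))" for v
      by (rule Ck_on_cong[OF open_ball _ c[of v]]) (simp add: pd_eqI[OF d[unfolded has_vector_derivative_def]])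
    moreover have "\<tau> T vs differentiable (at t)" if "t \<in> ball 0 e" for t
      by (rule differentiableI[OF d[OF that, unfolded has_vector_derivative_def]])
    ultimately show ?case unfolding Ck_on_Suc_pd by blast
  qed
  then show ?thesis by (simp add: smooth_on_def)
qed

lemma \<tau>_smooth_at_0: "tensor_field \<Omega> k T \<Longrightarrow> length vs = k \<Longrightarrow> smooth_at_0 (\<tau> T vs)"
  by (rule smooth_at_0I[OF open_ball zero_in \<tau>_smooth])

text \<open>Each differentiation prepends X and one covariant derivative; at t = 0 the frame is the
  identity, so only data at the centre remain.\<close>

lemma taylor_coeff_\<tau>:
  assumes "tensor_field \<Omega> k T" "length vs = k"
  shows "taylor_coeff n (\<tau> T vs) = (1 / fact n) *\<^sub>R (cov_deriv \<Gamma> ^^ n) T x0 (replicate n X @ vs)"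
  using assms
proof (induction n arbitrary: k T vs)
  case 0
  then show ?case by (simp add: \<tau>_def Q_0 f_0 P_0[abs_def])
next
  case (Suc n)
  have "taylor_coeff n (pd 1 (\<tau> T vs)) = taylor_coeff n (\<tau> (cov_deriv \<Gamma> T) (X # vs))"
    by (rule taylor_coeff_cong) (use e_pos pd_1_eqI[OF \<tau>_deriv[OF Suc.prems]] in \<open>auto simp: eventually_nhds_0_ball\<close>)
  then show ?case
    using Suc.IH[OF tensor_field_cov_deriv[OF Suc.prems(1)], of "X # vs"] Suc.prems
      taylor_coeff_Suc[OF \<tau>_smooth_at_0[OF Suc.prems], of n]
    by (simp add: funpow_swap1 replicate_app_Cons_same mult.commute)
qed

lemma taylor_coeff_\<tau>_curvature:
  "length vs = 3 \<Longrightarrow> taylor_coeff n (\<tau> R0 vs) = (1 / fact n) *\<^sub>R curvature_deriv \<Gamma> n x0 (replicate n X @ vs)"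
  unfolding curvature_deriv_def by (rule taylor_coeff_\<tau>[OF tensor_field_curvature])

text \<open>Read off from the Taylor coefficients of the curvature along the ray, where
  \<open>curvature_J\<close> and \<open>P_I\<close> act pointwise. This replaces an induction over
  iterated covariant derivatives.\<close>

lemma curvature_deriv_I:
  "curvature_deriv \<Gamma> n x0 (replicate n X @ [u, v, I w]) = I (curvature_deriv \<Gamma> n x0 (replicate n X @ [u, v, w]))"
proof -
  have s: "smooth_at_0 (\<tau> R0 [u, v, w])" by (rule \<tau>_smooth_at_0[OF tensor_field_curvature]) simp
  have bI: "bounded_linear I" using J_linear[OF x0_dom] by (rule linear_conv_bounded_linear[THEN iffD1])
  have "taylor_coeff n (\<tau> R0 [u, v, I w]) = taylor_coeff n (\<lambda>t. I (\<tau> R0 [u, v, w] t))"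
  proof (rule taylor_coeff_cong)
    have "\<tau> R0 [u, v, I w] t = I (\<tau> R0 [u, v, w] t)" if t: "t \<in> ball 0 e" for t
    proof -
      have "Q t (J (x t) z) = I (Q t z)" for z
        using P_I[OF t, of "Q t z"] Q_P[OF t] P_Q[OF t] by metis
      then show ?thesis by (simp add: \<tau>_def P_I[OF t] curvature_J[OF x_dom[OF t]])
    qed
    then show "\<forall>\<^sub>F t in nhds 0. \<tau> R0 [u, v, I w] t = I (\<tau> R0 [u, v, w] t)"
      using e_pos by (auto simp: eventually_nhds_0_ball)
  qed
  also have "\<dots> = I (taylor_coeff n (\<tau> R0 [u, v, w]))" by (rule taylor_coeff_bounded_linear[OF bI s])
  finally show ?thesis
    by (simp add: taylor_coeff_\<tau>_curvature linear_scale[OF J_linear[OF x0_dom]] del: One_nat_def)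
qed

subsection \<open>Jacobi fields\<close>

text \<open>\<open>S0 Y\<close> is the variation field at s = 0 of the geodesics with initial
  velocities X + sY; \<open>S1\<close> and \<open>S2\<close> are its first and second t-derivatives
  in chart coordinates.\<close>

abbreviation S0 :: "'a \<Rightarrow> real \<Rightarrow> 'a" where "S0 Y t \<equiv> t *\<^sub>R pd Y f (t *\<^sub>R X)"
abbreviation S1 :: "'a \<Rightarrow> real \<Rightarrow> 'a" where "S1 Y t \<equiv> pd Y f (t *\<^sub>R X) + t *\<^sub>R pd X (pd Y f) (t *\<^sub>R X)"
abbreviation S2 :: "'a \<Rightarrow> real \<Rightarrow> 'a" where
  "S2 Y t \<equiv> 2 *\<^sub>R pd X (pd Y f) (t *\<^sub>R X) + t *\<^sub>R pd X (pd X (pd Y f)) (t *\<^sub>R X)"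

lemma S0_deriv: "t \<in> ball 0 e \<Longrightarrow> (S0 Y has_vector_derivative S1 Y t) (at t)"
  using has_vector_derivative_scaleR[OF DERIV_ident ray_has_vector_derivative[OF f_diff(2)], of t Y]
  by (simp add: add.commute)

lemma S1_deriv: "t \<in> ball 0 e \<Longrightarrow> (S1 Y has_vector_derivative S2 Y t) (at t)"
  using has_vector_derivative_add[OF ray_has_vector_derivative[OF f_diff(2)]
      has_vector_derivative_scaleR[OF DERIV_ident ray_has_vector_derivative[OF f_diff(3)]], of t Y X Y]
  by (simp add: scaleR_2 add_ac)

text \<open>The s-derivative at s = 0 of the geodesic equation of f(t(X + sY)), with t
  fixed.\<close>

lemma geodesic_variation:
  assumes t: "t \<in> ball 0 e"
  shows "S2 Y t = - (pd (S0 Y t) (\<lambda>y. \<Gamma> y (vel t) (vel t)) (x t) + 2 *\<^sub>R \<Gamma> (x t) (vel t) (S1 Y t))"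
proof -
  define z where "z = (\<lambda>s. t *\<^sub>R (X + s *\<^sub>R Y))"
  note B = open_ball[of "0::'a" \<rho>] and tX = ray_dom[OF t]
  have z0: "z 0 = t *\<^sub>R X" by (simp add: z_def)
  have zd: "(z has_vector_derivative t *\<^sub>R Y) (at 0)"
    unfolding z_def by (auto intro!: derivative_eq_intros simp: has_vector_derivative_def)
  have comp: "((\<lambda>s. h (z s)) has_vector_derivative t *\<^sub>R pd Y h (t *\<^sub>R X)) (at 0)"
    if "h differentiable (at (t *\<^sub>R X))" for h :: "'a \<Rightarrow> 'a"
    using has_derivative_compose[OF zd[unfolded has_vector_derivative_def], of h "\<lambda>v. pd v h (t *\<^sub>R X)"]
      has_derivative_pd[OF that] linear_scale[OF pd_linear[OF that]]
    by (simp add: z0 has_vector_derivative_def)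
  have "continuous (at 0) z" using zd has_vector_derivative_continuous by blast
  then have "\<forall>\<^sub>F s in nhds 0. z s \<in> ball 0 \<rho>"
    using tX unfolding z0[symmetric]
    by (intro topological_tendstoD[OF _ B]) (simp_all add: continuous_at tendsto_at_iff_tendsto_nhds)
  then obtain d where d: "d > 0" "\<And>s. s \<in> ball 0 d \<Longrightarrow> z s \<in> ball 0 \<rho>"
    unfolding eventually_nhds_0_ball by blast
  have expand: "pd (X + s *\<^sub>R Y) h y = pd X h y + s *\<^sub>R pd Y h y" if "h differentiable (at y)" for h :: "'a \<Rightarrow> 'a" and s y
    using linear_add[OF pd_linear[OF that]] linear_scale[OF pd_linear[OF that]] by simp
  \<comment> \<open>u and l are the velocity and the acceleration at time t of the geodesic with
    initial velocity X + sY.\<close>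
  define u where "u = (\<lambda>s. pd X f (z s) + s *\<^sub>R pd Y f (z s))"
  define l where "l = (\<lambda>s. pd X (pd X f) (z s) + (2 * s) *\<^sub>R pd X (pd Y f) (z s) + (s * s) *\<^sub>R pd Y (pd Y f) (z s))"
  have ud: "(u has_vector_derivative S1 Y t) (at 0)"
  proof -
    have "(u has_vector_derivative t *\<^sub>R pd Y (pd X f) (t *\<^sub>R X) + (0 *\<^sub>R t *\<^sub>R pd Y (pd Y f) (t *\<^sub>R X) + 1 *\<^sub>R pd Y f (z 0))) (at 0)"
      unfolding u_def by (intro has_vector_derivative_add has_vector_derivative_scaleR comp f_diff t DERIV_ident)
    then show ?thesis by (simp add: z0 add.commute pd_commute[OF B tX f_smooth, of X Y])
  qed
  have "((\<lambda>s. l s) has_vector_derivative t *\<^sub>R pd Y (pd X (pd X f)) (t *\<^sub>R X)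
      + ((2 * 0) *\<^sub>R t *\<^sub>R pd Y (pd X (pd Y f)) (t *\<^sub>R X) + 2 *\<^sub>R pd X (pd Y f) (z 0))
      + ((0 * 0) *\<^sub>R t *\<^sub>R pd Y (pd Y (pd Y f)) (t *\<^sub>R X) + 0 *\<^sub>R pd Y (pd Y f) (z 0))) (at 0)"
    unfolding l_def
    by (intro has_vector_derivative_add has_vector_derivative_scaleR comp f_diff t)
      (auto intro!: derivative_eq_intros)
  moreover have "pd Y (pd X (pd X f)) (t *\<^sub>R X) = pd X (pd X (pd Y f)) (t *\<^sub>R X)"
    using pow_pd_commute[OF B f_smooth tX, where u=X and n=2 and v=Y] by (simp add: numeral_2_eq_2)
  ultimately have ld: "(l has_vector_derivative S2 Y t) (at 0)" by (simp add: z0 add.commute)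
  have eq: "l s = - \<Gamma> (f (z s)) (u s) (u s)" if s: "s \<in> ball 0 d" for s
  proof -
    note zs = d(2)[OF s]
    note dz = smooth_onD[OF f_smooth zs] smooth_onD[OF smooth_on_pd[OF f_smooth] zs]
      smooth_onD[OF smooth_on_pd[OF smooth_on_pd[OF f_smooth]] zs]
    have a: "pd (X + s *\<^sub>R Y) f (z s) = u s" unfolding u_def by (rule expand[OF dz(1)])
    have "pd (X + s *\<^sub>R Y) (pd (X + s *\<^sub>R Y) f) (z s) = pd (X + s *\<^sub>R Y) (\<lambda>y. pd X f y + s *\<^sub>R pd Y f y) (z s)"
      by (rule pd_cong_open[OF B zs]) (rule expand[OF smooth_onD[OF f_smooth]])
    also have "\<dots> = pd (X + s *\<^sub>R Y) (pd X f) (z s) + s *\<^sub>R pd (X + s *\<^sub>R Y) (pd Y f) (z s)"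
    proof -
      have "((\<lambda>y. pd X f y + s *\<^sub>R pd Y f y) has_derivative (\<lambda>v. pd v (pd X f) (z s) + s *\<^sub>R pd v (pd Y f) (z s))) (at (z s))"
        by (intro has_derivative_add has_derivative_scaleR_right has_derivative_pd dz)
      then show ?thesis by (rule pd_eqI)
    qed
    also have "\<dots> = l s"
      unfolding expand[OF dz(2)] pd_commute[OF B zs f_smooth, of Y X] l_def
      by (simp only: scaleR_add_right mult_2 scaleR_add_left scaleR_scaleR add.assoc)
    finally have b: "pd (X + s *\<^sub>R Y) (pd (X + s *\<^sub>R Y) f) (z s) = l s" .
    show ?thesis using f_geodesic[of t "X + s *\<^sub>R Y"] zs a b by (simp add: z_def)
  qed
  have fz: "((\<lambda>s. f (z s)) has_vector_derivative S0 Y t) (at 0)" by (rule comp[OF f_diff(1)[OF t]])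
  have "((\<lambda>s. - \<Gamma> (f (z s)) (u s) (u s)) has_vector_derivative
      - (pd (S0 Y t) (\<lambda>y. \<Gamma> y (u 0) (u 0)) (f (z 0)) + \<Gamma> (f (z 0)) (S1 Y t) (u 0) + \<Gamma> (f (z 0)) (u 0) (S1 Y t))) (at 0)"
    by (rule has_vector_derivative_minus, rule bilinear_along[OF open_dom bilinear_\<Gamma> smooth_\<Gamma> fz _ _ ud ud])
      (use t in \<open>auto simp: z0 intro: x_dom\<close>)
  then have "(l has_vector_derivative
      - (pd (S0 Y t) (\<lambda>y. \<Gamma> y (u 0) (u 0)) (f (z 0)) + \<Gamma> (f (z 0)) (S1 Y t) (u 0) + \<Gamma> (f (z 0)) (u 0) (S1 Y t))) (at 0)"
    by (rule has_vector_derivative_transform_within_open[where S="ball 0 d"]) (use d eq in auto)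
  from vector_derivative_unique_at[OF ld this] show ?thesis
    using \<Gamma>_sym[OF x_dom[OF t], of "S1 Y t" "vel t"] by (simp add: u_def z0 scaleR_2 add.assoc)
qed

definition jac :: "'a \<Rightarrow> real \<Rightarrow> 'a" where "jac Y t = Q t (S0 Y t)"

text \<open>The second part is the Jacobi equation in the parallel frame: the Christoffel terms from
  \<open>geodesic_variation\<close> and from differentiating \<Gamma> along the ray assemble to the
  curvature.\<close>

lemma jacobi:
  assumes t: "t \<in> ball 0 e"
  shows "(jac Y has_vector_derivative Q t (S1 Y t + \<Gamma> (x t) (vel t) (S0 Y t))) (at t)"
    and "((\<lambda>t. Q t (S1 Y t + \<Gamma> (x t) (vel t) (S0 Y t))) has_vector_derivative
      Q t (curvature \<Gamma> (x t) (vel t) (S0 Y t) (vel t))) (at t)"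
proof -
  show "(jac Y has_vector_derivative Q t (S1 Y t + \<Gamma> (x t) (vel t) (S0 Y t))) (at t)"
    unfolding jac_def[abs_def] by (rule Q_deriv[OF t S0_deriv[OF t]])
  note xt = x_dom[OF t]
  note G = linear_\<Gamma>[OF xt]
  have "((\<lambda>t. S1 Y t + \<Gamma> (x t) (vel t) (S0 Y t)) has_vector_derivative
    S2 Y t + (pd (vel t) (\<lambda>y. \<Gamma> y (vel t) (S0 Y t)) (x t) + \<Gamma> (x t) (- \<Gamma> (x t) (vel t) (vel t)) (S0 Y t)
      + \<Gamma> (x t) (vel t) (S1 Y t))) (at t)"
    by (intro has_vector_derivative_add S1_deriv[OF t]
        bilinear_along[OF open_dom bilinear_\<Gamma> smooth_\<Gamma> x_deriv[OF t] xt _ vel_deriv[OF t] S0_deriv[OF t]]) auto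
  from Q_deriv[OF t this]
  have "((\<lambda>t. Q t (S1 Y t + \<Gamma> (x t) (vel t) (S0 Y t))) has_vector_derivative
      Q t (S2 Y t + (pd (vel t) (\<lambda>y. \<Gamma> y (vel t) (S0 Y t)) (x t) + \<Gamma> (x t) (- \<Gamma> (x t) (vel t) (vel t)) (S0 Y t)
      + \<Gamma> (x t) (vel t) (S1 Y t)) + \<Gamma> (x t) (vel t) (S1 Y t + \<Gamma> (x t) (vel t) (S0 Y t)))) (at t)" .
  moreover have "S2 Y t + (pd (vel t) (\<lambda>y. \<Gamma> y (vel t) (S0 Y t)) (x t) + \<Gamma> (x t) (- \<Gamma> (x t) (vel t) (vel t)) (S0 Y t)
      + \<Gamma> (x t) (vel t) (S1 Y t)) + \<Gamma> (x t) (vel t) (S1 Y t + \<Gamma> (x t) (vel t) (S0 Y t))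
      = curvature \<Gamma> (x t) (vel t) (S0 Y t) (vel t)"
  proof -
    have "pd (vel t) (\<lambda>y. \<Gamma> y (S0 Y t) (vel t)) (x t) = pd (vel t) (\<lambda>y. \<Gamma> y (vel t) (S0 Y t)) (x t)"
      by (rule pd_cong_open[OF open_dom xt \<Gamma>_sym])
    then show ?thesis
      unfolding geodesic_variation[OF t] curvature_eq[OF xt]
      using \<Gamma>_sym[OF xt, of "S0 Y t" "vel t"] \<Gamma>_sym[OF xt, of "S0 Y t" "\<Gamma> (x t) (vel t) (vel t)"]
      by (simp add: linear_add[OF G(1)] linear_neg[OF G(2)] scaleR_2)
  qed
  ultimately show "((\<lambda>t. Q t (S1 Y t + \<Gamma> (x t) (vel t) (S0 Y t))) has_vector_derivative
      Q t (curvature \<Gamma> (x t) (vel t) (S0 Y t) (vel t))) (at t)" by simp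
qed

lemma smooth_ray: "smooth_on (ball 0 \<rho>) h \<Longrightarrow> smooth_on (ball 0 e) (\<lambda>t. h (t *\<^sub>R X))"
  by (rule smooth_on_compose[OF open_ball open_ball])
    (auto intro!: smooth_on_linear bounded_linear_scaleR_left dest: ray_dom)

lemma jac_smooth: "smooth_on (ball 0 e) (jac Y)"
proof -
  have "smooth_on (ball 0 e) (\<lambda>t. Q t (S0 Y t))"
    by (rule smooth_on_family[OF open_ball Q_linear Q_smooth])
      (auto intro!: smooth_on_scaleR smooth_on_ident smooth_ray smooth_on_pd f_smooth)
  then show ?thesis by (simp add: jac_def[abs_def])
qed

lemma jac_smooth_at_0: "smooth_at_0 (jac Y)"
  by (rule smooth_at_0I[OF open_ball zero_in jac_smooth])

lemma jac_taylor_coeff_0: "taylor_coeff 0 (jac Y) = 0"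
  by (simp add: jac_def Q_0)

lemma jac_taylor_coeff_1: "taylor_coeff (Suc 0) (jac Y) = Y"
proof -
  have "pd 1 (jac Y) 0 = Y"
    using pd_1_eqI[OF jacobi(1)[OF zero_in, of Y]] linear_0[OF linear_\<Gamma>(1)[OF x_dom[OF zero_in]]]
    by (simp add: Q_0 pd_f_0)
  then show ?thesis by (simp add: taylor_coeff_Suc[OF jac_smooth_at_0])
qed

text \<open>Coefficients of the Jacobi equation. The unknown field moves in the middle slot of the
  curvature, so it is expanded in \<open>Basis\<close> before the Leibniz rule and reassembled
  afterwards by linearity.\<close>

lemma jac_taylor_coeff_rec:
  "real ((n + 1) * (n + 2)) *\<^sub>R taylor_coeff (n + 2) (jac Y) =
    (\<Sum>l\<le>n. (1 / fact (n - l)) *\<^sub>R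
      curvature_deriv \<Gamma> (n - l) x0 (replicate (n - l) X @ [X, taylor_coeff l (jac Y), X]))"
proof -
  have "real ((n + 1) * (n + 2)) *\<^sub>R taylor_coeff (n + 2) (jac Y) = taylor_coeff n (pd 1 (pd 1 (jac Y)))"
  proof -
    have "real ((n + 1) * (n + 2)) = real (Suc n) * real (Suc (Suc n))" by (simp add: algebra_simps)
    then show ?thesis by (simp only: taylor_coeff_pd smooth_at_0_pd jac_smooth_at_0 scaleR_scaleR
        add_2_eq_Suc')
  qed
  also have "\<dots> = taylor_coeff n (\<lambda>t. \<Sum>b\<in>Basis. (jac Y t \<bullet> b) *\<^sub>R \<tau> R0 [X, b, X] t)"
  proof (rule taylor_coeff_cong, unfold eventually_nhds_0_ball, intro exI[of _ e] conjI e_pos ballI)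
    fix t :: real assume t: "t \<in> ball 0 e"
    have "pd 1 (pd 1 (jac Y)) t = pd 1 (\<lambda>t. Q t (S1 Y t + \<Gamma> (x t) (vel t) (S0 Y t))) t"
      by (rule pd_cong_open[OF open_ball t]) (rule pd_1_eqI[OF jacobi(1)])
    also have "\<dots> = Q t (curvature \<Gamma> (x t) (vel t) (S0 Y t) (vel t))" by (rule pd_1_eqI[OF jacobi(2)[OF t]])
    also have "\<dots> = Q t (R0 (x t) ([P t X] @ P t (jac Y t) # [P t X]))"
      by (simp add: jac_def P_Q[OF t] P_X[OF t])
    also have "\<dots> = (\<Sum>b\<in>Basis. (jac Y t \<bullet> b) *\<^sub>R Q t (R0 (x t) ([P t X] @ P t b # [P t X])))"
    proof -
      have "linear (\<lambda>v. R0 (x t) ([P t X] @ v # [P t X]))"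
        by (rule tensor_field_linear[OF tensor_field_curvature x_dom[OF t]]) simp
      from linear_compose[OF linear_compose[OF P_linear[OF t] this] Q_linear[OF t]]
      have "linear (\<lambda>v. Q t (R0 (x t) ([P t X] @ P t v # [P t X])))" by (simp add: o_def)
      from linear_euclidean_sum[OF this] show ?thesis .
    qed
    finally show "pd 1 (pd 1 (jac Y)) t = (\<Sum>b\<in>Basis. (jac Y t \<bullet> b) *\<^sub>R \<tau> R0 [X, b, X] t)" by (simp add: \<tau>_def)
  qed
  also have "\<dots> = (\<Sum>b\<in>Basis. \<Sum>l\<le>n. (taylor_coeff l (jac Y) \<bullet> b) *\<^sub>R taylor_coeff (n - l) (\<tau> R0 [X, b, X]))"
    using \<tau>_smooth_at_0[OF tensor_field_curvature] jac_smooth_at_0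
    by (simp add: taylor_coeff_sum taylor_coeff_bilinear[OF bounded_bilinear_scaleR]
        taylor_coeff_bounded_linear[OF bounded_linear_inner_left] smooth_at_0_scaleR
        smooth_at_0_bounded_linear[OF bounded_linear_inner_left])
  also have "\<dots> = (\<Sum>l\<le>n. \<Sum>b\<in>Basis. (taylor_coeff l (jac Y) \<bullet> b) *\<^sub>R ((1 / fact (n - l)) *\<^sub>R
      curvature_deriv \<Gamma> (n - l) x0 (replicate (n - l) X @ [X, b, X])))"
    by (subst sum.swap) (simp add: taylor_coeff_\<tau>_curvature del: One_nat_def)
  also have "\<dots> = (\<Sum>l\<le>n. (1 / fact (n - l)) *\<^sub>R
      curvature_deriv \<Gamma> (n - l) x0 (replicate (n - l) X @ [X, taylor_coeff l (jac Y), X]))"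
  proof (rule sum.cong[OF refl])
    fix l
    have "linear (\<lambda>v. curvature_deriv \<Gamma> (n - l) x0 ((replicate (n - l) X @ [X]) @ v # [X]))"
      by (rule tensor_field_linear[OF tensor_field_curvature_deriv x0_dom]) simp
    from linear_euclidean_sum[OF this, of "taylor_coeff l (jac Y)"]
    show "(\<Sum>b\<in>Basis. (taylor_coeff l (jac Y) \<bullet> b) *\<^sub>R ((1 / fact (n - l)) *\<^sub>R
      curvature_deriv \<Gamma> (n - l) x0 (replicate (n - l) X @ [X, b, X]))) = (1 / fact (n - l)) *\<^sub>R
      curvature_deriv \<Gamma> (n - l) x0 (replicate (n - l) X @ [X, taylor_coeff l (jac Y), X])"
      by (simp add: scaleR_sum_right scaleR_left_commute)
  qed
  finally show ?thesis .
qed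

section \<open>Parallel transport and its inverse along a ray\<close>

text \<open>Transport to tX over the fixed parameter interval from 0 to 1 is P reparametrized by the
  factor t. The definite description is resolved by applying \<open>parallel_zero\<close> to the
  difference of two solutions.\<close>

lemma parallel_transport_ray:
  assumes t: "t \<in> ball 0 e"
  shows "parallel_transport \<Gamma> (\<lambda>s. f (s *\<^sub>R t *\<^sub>R X)) = P t"
proof (rule ext)
  fix v
  have st: "s * t \<in> ball 0 e" if "s \<in> {0..1}" for s
  proof -
    have "\<bar>s * t\<bar> \<le> 1 * \<bar>t\<bar>" unfolding abs_mult using that by (intro mult_right_mono) auto
    then show ?thesis using t by simp
  qed
  define x' where "x' = (\<lambda>s. t *\<^sub>R vel (s * t))"
  have xd: "((\<lambda>s. f (s *\<^sub>R t *\<^sub>R X)) has_vector_derivative x' s) (at s)" if "s \<in> {0..1}" for s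
  proof -
    have "((\<lambda>s. s * t) has_vector_derivative t) (at s)"
      by (auto intro!: derivative_eq_intros simp: has_vector_derivative_def)
    from vector_diff_chain_at[OF this x_deriv[OF st[OF that]]] show ?thesis by (simp add: o_def x'_def)
  qed
  have xv: "vector_derivative (\<lambda>s. f (s *\<^sub>R t *\<^sub>R X)) (at s) = x' s" if "s \<in> {0..1}" for s
    by (rule vector_derivative_at[OF xd[OF that]])
  have in\<Omega>: "f (s *\<^sub>R t *\<^sub>R X) \<in> \<Omega>" if "s \<in> {0..1}" for s
    using x_dom[OF st[OF that]] by simp
  have par: "parallel_along \<Gamma> (\<lambda>s. f (s *\<^sub>R t *\<^sub>R X)) W \<longleftrightarrow>
      (\<forall>s\<in>{0..1}. (W has_vector_derivative - \<Gamma> (f (s *\<^sub>R t *\<^sub>R X)) (x' s) (W s)) (at s within {0..1}))" for W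
    unfolding parallel_along_def by (intro ball_cong refl) (simp only: xv)
  have Pp: "parallel_along \<Gamma> (\<lambda>s. f (s *\<^sub>R t *\<^sub>R X)) (\<lambda>s. P (s * t) v)"
    unfolding par
  proof
    fix s :: real assume s: "s \<in> {0..1}"
    have "((\<lambda>s. s * t) has_vector_derivative t) (at s)"
      by (auto intro!: derivative_eq_intros simp: has_vector_derivative_def)
    from vector_diff_chain_at[OF this P_parallel[OF st[OF s], of v]]
    have "((\<lambda>s. P (s * t) v) has_vector_derivative - \<Gamma> (f (s *\<^sub>R t *\<^sub>R X)) (x' s) (P (s * t) v)) (at s)"
      by (simp add: o_def x'_def linear_scale[OF linear_\<Gamma>(2)[OF x_dom[OF st[OF s]]]])
    then show "((\<lambda>s. P (s * t) v) has_vector_derivative - \<Gamma> (f (s *\<^sub>R t *\<^sub>R X)) (x' s) (P (s * t) v)) (at s within {0..1})"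
      by (rule has_vector_derivative_at_within)
  qed
  show "parallel_transport \<Gamma> (\<lambda>s. f (s *\<^sub>R t *\<^sub>R X)) v = P t v"
    unfolding parallel_transport_def
  proof (rule the_equality)
    show "\<exists>W. parallel_along \<Gamma> (\<lambda>s. f (s *\<^sub>R t *\<^sub>R X)) W \<and> W 0 = v \<and> W 1 = P t v"
      by (intro exI[of _ "\<lambda>s. P (s * t) v"] conjI Pp) (simp_all add: P_0)
    fix w assume "\<exists>W. parallel_along \<Gamma> (\<lambda>s. f (s *\<^sub>R t *\<^sub>R X)) W \<and> W 0 = v \<and> W 1 = w"
    then obtain W where W: "parallel_along \<Gamma> (\<lambda>s. f (s *\<^sub>R t *\<^sub>R X)) W" "W 0 = v" "W 1 = w" by blast
    have "W 1 - P (1 * t) v = 0"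
    proof (rule parallel_zero[where I="{0..1}" and ?s0.0=0 and x="\<lambda>s. f (s *\<^sub>R t *\<^sub>R X)" and x'=x'
          and D="\<lambda>s. W s - P (s * t) v"])
      fix s :: real assume s: "s \<in> {0..1}"
      show "((\<lambda>s. W s - P (s * t) v) has_vector_derivative
          - \<Gamma> (f (s *\<^sub>R t *\<^sub>R X)) (x' s) (W s - P (s * t) v)) (at s within {0..1})"
        using has_vector_derivative_diff[OF W(1)[unfolded par, rule_format, OF s] Pp[unfolded par, rule_format, OF s]]
        by (simp add: linear_diff[OF linear_\<Gamma>(1)[OF x_dom[OF st[OF s]]]])
    qed (use W in\<Omega> has_vector_derivative_at_within[OF xd] in \<open>auto simp: P_0\<close>)
    then show "w = P t v" using W by simp
  qed
qed

lemma bpt_ray: "t \<in> ball 0 e \<Longrightarrow> bpt (t *\<^sub>R X) v = Q t (pd v f (t *\<^sub>R X))"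
  unfolding bpt_def parallel_transport_ray by (simp add: Q_def pd_def)

text \<open>One identity is the chain rule for \<open>fi_f\<close>; the other follows because an
  injective endomorphism in finite dimension is onto.\<close>

lemma pd_fi_f:
  assumes "t \<in> ball 0 e"
  shows "pd (pd v f (t *\<^sub>R X)) fi (x t) = v" "pd (pd w fi (x t)) f (t *\<^sub>R X) = w"
proof -
  note Z = ray_dom[OF assms]
  note d = smooth_onD[OF f_smooth Z] smooth_onD[OF fi_smooth f_V[OF Z]]
  have 1: "pd (pd v f (t *\<^sub>R X)) fi (x t) = v" for v
  proof -
    have "pd (pd v f (t *\<^sub>R X)) fi (x t) = pd v (\<lambda>z. fi (f z)) (t *\<^sub>R X)" by (rule pd_compose[OF d, symmetric])
    also have "\<dots> = pd v (\<lambda>z. z) (t *\<^sub>R X)" by (rule pd_cong_open[OF open_ball Z]) (rule fi_f)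
    finally show ?thesis by (simp add: pd_def)
  qed
  then show "pd (pd v f (t *\<^sub>R X)) fi (x t) = v" .
  have "surj (\<lambda>v. pd v f (t *\<^sub>R X))"
    by (rule linear_injective_imp_surjective[OF pd_linear[OF d(1)]]) (rule injI, metis 1, simp)
  then obtain v' where "w = pd v' f (t *\<^sub>R X)" by (rule surjE)
  then show "pd (pd w fi (x t)) f (t *\<^sub>R X) = w" by (simp only: 1)
qed

lemma fpt_ray:
  assumes t: "t \<in> ball 0 e"
  shows "fpt (t *\<^sub>R X) w = pd (P t w) fi (x t)"
proof -
  have "inv (bpt (t *\<^sub>R X)) = (\<lambda>w. pd (P t w) fi (x t))"
    by (rule inv_equality) (simp_all add: bpt_ray[OF t] pd_fi_f[OF t] P_Q[OF t] Q_P[OF t])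
  then show ?thesis by (simp add: fpt_def)
qed

lemma jac_eq_bpt: "t \<in> ball 0 e \<Longrightarrow> jac Y t = bpt (t *\<^sub>R X) (t *\<^sub>R Y)"
  by (simp add: jac_def bpt_ray linear_scale[OF pd_linear[OF f_diff(1)]])

lemma fpt_ray_smooth: "smooth_at_0 (\<lambda>t. fpt (t *\<^sub>R X) (I (t *\<^sub>R X)))"
proof (rule smooth_at_0I[OF open_ball zero_in], rule smooth_on_cong[OF open_ball])
  have lin: "linear (\<lambda>v. pd v fi (x t))" if "t \<in> ball 0 e" for t
    by (rule pd_linear[OF smooth_onD[OF fi_smooth f_V[OF ray_dom[OF that]]]])
  have "smooth_on (ball 0 e) (\<lambda>t. pd v fi (x t))" for v
    by (rule smooth_on_compose[OF open_ball open_V _ smooth_ray[OF f_smooth] smooth_on_pd[OF fi_smooth]])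
      (auto intro!: f_V dest: ray_dom)
  note s1 = this
  have s2: "smooth_on (ball 0 e) (\<lambda>t. P t (I (t *\<^sub>R X)))"
  proof (rule smooth_on_family[OF open_ball P_linear P_smooth])
    show "smooth_on (ball 0 e) (\<lambda>t. I (t *\<^sub>R X))"
      using linear_compose[OF _ J_linear[OF x0_dom], of "\<lambda>t::real. t *\<^sub>R X"]
      by (intro smooth_on_linear open_ball) (simp add: linear_conv_bounded_linear[symmetric] o_def
          bounded_linear.linear[OF bounded_linear_scaleR_left])
  qed
  show "smooth_on (ball 0 e) (\<lambda>t. pd (P t (I (t *\<^sub>R X))) fi (x t))"
    by (rule smooth_on_family[where h="\<lambda>t v. pd v fi (x t)", OF open_ball lin s1 s2])
qed (simp add: fpt_ray)

text \<open>This is \<Phi>^{-1} applied to \<Phi>(tX)(I tX), multiplied by t because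
  \<open>jac\<close> contains that factor. Comparing coefficients determines those of \<Phi>(X)(IX)
  from those of the Jacobi fields.\<close>

lemma jac_fpt:
  "\<forall>\<^sub>F t in nhds 0. (\<Sum>b\<in>Basis. (fpt (t *\<^sub>R X) (I (t *\<^sub>R X)) \<bullet> b) *\<^sub>R jac b t) = (t * t) *\<^sub>R I X"
  unfolding eventually_nhds_0_ball
proof (intro exI[of _ e] conjI e_pos ballI)
  fix t :: real assume t: "t \<in> ball 0 e"
  define y where "y = fpt (t *\<^sub>R X) (I (t *\<^sub>R X))"
  have l: "linear (\<lambda>v. Q t (t *\<^sub>R pd v f (t *\<^sub>R X)))"
    using linear_compose[OF pd_linear[OF f_diff(1)[OF t]] linear_compose[OF linear_scaleR Q_linear[OF t]]]
    by (simp add: o_def)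
  have "(\<Sum>b\<in>Basis. (y \<bullet> b) *\<^sub>R jac b t) = Q t (t *\<^sub>R pd y f (t *\<^sub>R X))"
    unfolding jac_def by (rule linear_euclidean_sum[OF l, symmetric])
  also have "\<dots> = (t * t) *\<^sub>R I X"
    by (simp add: y_def fpt_ray[OF t] pd_fi_f[OF t] linear_scale[OF Q_linear[OF t]] Q_P[OF t]
        linear_scale[OF J_linear[OF x0_dom]])
  finally show "(\<Sum>b\<in>Basis. (y \<bullet> b) *\<^sub>R jac b t) = (t * t) *\<^sub>R I X" .
qed

text \<open>P carries X to the velocity and intertwines I with J. Once f is composed with the
  inverse of holomorphic coordinates, this becomes the first identity of the recursion.\<close>

lemma pd_fpt:
  "\<forall>\<^sub>F t in nhds 0. pd (fpt (t *\<^sub>R X) (I (t *\<^sub>R X))) f (t *\<^sub>R X) = J (x t) (pd (t *\<^sub>R X) f (t *\<^sub>R X))"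
  unfolding eventually_nhds_0_ball
  by (intro exI[of _ e] conjI e_pos ballI)
    (simp add: fpt_ray pd_fi_f P_I P_X linear_scale[OF P_linear] linear_scale[OF pd_linear[OF f_diff(1)]])

end

section \<open>Coefficients of the Jacobi fields and of \<Phi>\<close>

context kaehler_germ
begin

lemma kaehler_ray_exists: "\<exists>e P. kaehler_ray \<Omega> g J x0 f fi V \<rho> X e P"
proof -
  \<comment> \<open>The 1 covers the case X = 0.\<close>
  define r where "r = \<rho> / (norm X + 1)"
  have r: "r > 0" using rho_pos by (simp add: r_def add_nonneg_pos)
  have in_ball: "t *\<^sub>R X \<in> ball 0 \<rho>" if "t \<in> ball 0 r" for t
  proof -
    have "\<bar>t\<bar> * norm X \<le> \<bar>t\<bar> * (norm X + 1)" by (intro mult_left_mono) auto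
    also have "\<dots> < \<rho>" using that by (simp add: r_def pos_less_divide_eq add_nonneg_pos)
    finally show ?thesis by simp
  qed
  have sx: "smooth_on (ball 0 r) (\<lambda>t. h (t *\<^sub>R X))" if "smooth_on (ball 0 \<rho>) h" for h :: "'a \<Rightarrow> 'a"
    by (rule smooth_on_compose[OF open_ball open_ball _ _ that])
      (auto intro!: smooth_on_linear bounded_linear_scaleR_left dest: in_ball)
  have G: "smooth_on (ball 0 r) (\<lambda>t. \<Gamma> (f (t *\<^sub>R X)) u v)" for u v
    by (rule smooth_on_compose[OF open_ball open_dom _ sx[OF f_smooth] smooth_\<Gamma>])
      (auto intro!: f_dom dest: in_ball)
  have lin: "linear (\<lambda>v. - \<Gamma> (f (t *\<^sub>R X)) (pd X f (t *\<^sub>R X)) v)" if "t \<in> ball 0 r" for t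
    by (intro linear_compose_neg linear_\<Gamma>(1) f_dom in_ball that)
  have "smooth_on (ball 0 r) (\<lambda>t. - \<Gamma> (f (t *\<^sub>R X)) (pd X f (t *\<^sub>R X)) v)" for v
  proof (rule smooth_on_minus[OF open_ball])
    show "smooth_on (ball 0 r) (\<lambda>t. \<Gamma> (f (t *\<^sub>R X)) (pd X f (t *\<^sub>R X)) v)"
      by (rule smooth_on_family[where h="\<lambda>t u. \<Gamma> (f (t *\<^sub>R X)) u v", OF open_ball _ G sx[OF smooth_on_pd[OF f_smooth]]])
        (intro linear_\<Gamma>(2) f_dom in_ball)
  qed
  from linear_ode_fundamental_solution[OF r lin this]
  obtain e P where eP: "e > 0" "e \<le> r" "\<forall>v. P 0 v = v" "\<forall>v. smooth_on (ball 0 e) (\<lambda>t. P t v)"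
    "\<forall>v. \<forall>t\<in>ball 0 e. ((\<lambda>t. P t v) has_vector_derivative - \<Gamma> (f (t *\<^sub>R X)) (pd X f (t *\<^sub>R X)) (P t v)) (at t)"
    by blast
  have "kaehler_ray \<Omega> g J x0 f fi V \<rho> X e P"
    by unfold_locales (use eP in_ball in auto)
  then show ?thesis by blast
qed

text \<open>Defined through \<open>bpt\<close> and not through a frame, so that the coefficients do
  not depend on the interval and the frame chosen for a ray.\<close>

definition jc :: "nat \<Rightarrow> 'a \<Rightarrow> 'a \<Rightarrow> 'a" where
  "jc n X Y = taylor_coeff n (\<lambda>t. bpt (t *\<^sub>R X) (t *\<^sub>R Y))"

definition yc :: "nat \<Rightarrow> 'a \<Rightarrow> 'a" where
  "yc n X = taylor_coeff n (\<lambda>t. fpt (t *\<^sub>R X) (I (t *\<^sub>R X)))"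

lemma (in kaehler_ray) jc_eq: "jc n X Y = taylor_coeff n (jac Y)"
  unfolding jc_def
  by (rule taylor_coeff_cong) (use e_pos jac_eq_bpt in \<open>auto simp: eventually_nhds_0_ball\<close>)

lemma (in kaehler_ray) jc_linear_ray: "linear (jc n X)"
proof (rule linearI)
  fix u v and r :: real
  have a: "\<forall>\<^sub>F t in nhds 0. jac (u + v) t = jac u t + jac v t"
    unfolding eventually_nhds_0_ball
    by (intro exI[of _ e] conjI e_pos ballI)
      (simp add: jac_def linear_add[OF pd_linear[OF f_diff(1)]] linear_add[OF Q_linear] scaleR_add_right)
  show "jc n X (u + v) = jc n X u + jc n X v"
    using taylor_coeff_cong[OF a] by (simp add: jc_eq taylor_coeff_add jac_smooth_at_0)
  have b: "\<forall>\<^sub>F t in nhds 0. jac (r *\<^sub>R u) t = r *\<^sub>R jac u t"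
    unfolding eventually_nhds_0_ball
    by (intro exI[of _ e] conjI e_pos ballI)
      (simp add: jac_def linear_scale[OF pd_linear[OF f_diff(1)]] linear_scale[OF Q_linear] scaleR_left_commute)
  show "jc n X (r *\<^sub>R u) = r *\<^sub>R jc n X u"
    using taylor_coeff_cong[OF b]
    by (simp add: jc_eq taylor_coeff_bounded_linear[OF bounded_linear_scaleR_right] jac_smooth_at_0)
qed

text \<open>Coefficient comparison in \<open>jac_fpt\<close>, whose right hand side t^2 IX lives in
  degree 2.\<close>

lemma (in kaehler_ray) yc_rec_ray: "(\<Sum>l\<le>n. jc (n - l) X (yc l X)) = (if n = 2 then I X else 0)"
proof -
  define y where "y = (\<lambda>t. fpt (t *\<^sub>R X) (I (t *\<^sub>R X)))"
  have sy: "smooth_at_0 y" unfolding y_def by (rule fpt_ray_smooth)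
  have "(\<Sum>l\<le>n. jc (n - l) X (yc l X)) = (\<Sum>l\<le>n. \<Sum>b\<in>Basis. (taylor_coeff l y \<bullet> b) *\<^sub>R jc (n - l) X b)"
    unfolding yc_def y_def[symmetric]
    by (rule sum.cong[OF refl]) (rule linear_euclidean_sum[OF jc_linear_ray])
  also have "\<dots> = taylor_coeff n (\<lambda>t. \<Sum>b\<in>Basis. (y t \<bullet> b) *\<^sub>R jac b t)"
    by (subst sum.swap) (simp add: taylor_coeff_sum taylor_coeff_bilinear[OF bounded_bilinear_scaleR]
        taylor_coeff_bounded_linear[OF bounded_linear_inner_left] smooth_at_0_scaleR sy jac_smooth_at_0
        smooth_at_0_bounded_linear[OF bounded_linear_inner_left] jc_eq)
  also have "\<dots> = taylor_coeff n (\<lambda>t. t *\<^sub>R t *\<^sub>R I X)"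
    using taylor_coeff_cong[OF jac_fpt] by (simp add: y_def)
  also have "\<dots> = (if n = 2 then I X else 0)"
    unfolding taylor_coeff_scaleR_ident[OF smooth_at_0_scaleR[OF smooth_at_0_ident smooth_at_0_const]]
    by (auto simp: taylor_coeff_ident_scaleR)
  finally show ?thesis .
qed

lemma jc_linear: "linear (jc n X)"
proof -
  obtain e P where "kaehler_ray \<Omega> g J x0 f fi V \<rho> X e P" using kaehler_ray_exists by blast
  then interpret kaehler_ray \<Omega> g J x0 f fi V \<rho> X e P .
  show ?thesis by (rule jc_linear_ray)
qed

lemma jc_0: "jc 0 X Y = 0"
proof -
  obtain e P where "kaehler_ray \<Omega> g J x0 f fi V \<rho> X e P" using kaehler_ray_exists by blast
  then interpret kaehler_ray \<Omega> g J x0 f fi V \<rho> X e P .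
  show ?thesis unfolding jc_eq by (rule jac_taylor_coeff_0)
qed

lemma jc_1: "jc (Suc 0) X Y = Y"
proof -
  obtain e P where "kaehler_ray \<Omega> g J x0 f fi V \<rho> X e P" using kaehler_ray_exists by blast
  then interpret kaehler_ray \<Omega> g J x0 f fi V \<rho> X e P .
  show ?thesis unfolding jc_eq by (rule jac_taylor_coeff_1)
qed

lemma jc_rec:
  "real ((n + 1) * (n + 2)) *\<^sub>R jc (n + 2) X Y = (\<Sum>l\<le>n. (1 / fact (n - l)) *\<^sub>R
      curvature_deriv \<Gamma> (n - l) x0 (replicate (n - l) X @ [X, jc l X Y, X]))"
proof -
  obtain e P where "kaehler_ray \<Omega> g J x0 f fi V \<rho> X e P" using kaehler_ray_exists by blast
  then interpret kaehler_ray \<Omega> g J x0 f fi V \<rho> X e P .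
  show ?thesis using jac_taylor_coeff_rec by (simp add: jc_eq)
qed

lemma yc_rec: "(\<Sum>l\<le>n. jc (n - l) X (yc l X)) = (if n = 2 then I X else 0)"
proof -
  obtain e P where "kaehler_ray \<Omega> g J x0 f fi V \<rho> X e P" using kaehler_ray_exists by blast
  then interpret kaehler_ray \<Omega> g J x0 f fi V \<rho> X e P .
  show ?thesis by (rule yc_rec_ray)
qed

lemma curvature_deriv_commutes_I:
  "curvature_deriv \<Gamma> n x0 (replicate n X @ [u, v, I w]) = I (curvature_deriv \<Gamma> n x0 (replicate n X @ [u, v, w]))"
proof -
  obtain e P where "kaehler_ray \<Omega> g J x0 f fi V \<rho> X e P" using kaehler_ray_exists by blast
  then interpret kaehler_ray \<Omega> g J x0 f fi V \<rho> X e P .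
  show ?thesis by (rule curvature_deriv_I)
qed

lemma fpt_smooth_at_0: "smooth_at_0 (\<lambda>t. fpt (t *\<^sub>R X) (I (t *\<^sub>R X)))"
proof -
  obtain e P where "kaehler_ray \<Omega> g J x0 f fi V \<rho> X e P" using kaehler_ray_exists by blast
  then interpret kaehler_ray \<Omega> g J x0 f fi V \<rho> X e P .
  show ?thesis by (rule fpt_ray_smooth)
qed

lemma eventually_pd_fpt:
  "\<forall>\<^sub>F t in nhds 0. pd (fpt (t *\<^sub>R X) (I (t *\<^sub>R X))) f (t *\<^sub>R X) = J (f (t *\<^sub>R X)) (pd (t *\<^sub>R X) f (t *\<^sub>R X))"
proof -
  obtain e P where "kaehler_ray \<Omega> g J x0 f fi V \<rho> X e P" using kaehler_ray_exists by blast
  then interpret kaehler_ray \<Omega> g J x0 f fi V \<rho> X e P .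
  show ?thesis by (rule pd_fpt)
qed

end

section \<open>Composition polynomials\<close>

lemma mlinD: "mlin k F \<Longrightarrow> length us + length ws + 1 = k \<Longrightarrow> linear (\<lambda>v. F (us @ v # ws))"
  by (simp add: mlin_def)

text \<open>Adding one monomial at a time makes the closure properties accessible to induction; n is
  the degree and r a lower bound for the number of curvature factors in each monomial.\<close>

inductive comp_poly ::
    "('a::real_vector \<Rightarrow> 'a) \<Rightarrow> (nat \<Rightarrow> 'a list \<Rightarrow> 'a) \<Rightarrow> nat \<Rightarrow> nat \<Rightarrow> ('a \<Rightarrow> 'a) \<Rightarrow> bool"
  for I R n r where
  zero: "comp_poly I R n r (\<lambda>X. 0)"
| add_monomial: "comp_poly I R n r P \<Longrightarrow> iterated_composition I R n s F \<Longrightarrow> r \<le> s \<Longrightarrow>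
    comp_poly I R n r (\<lambda>X. P X + a *\<^sub>R F (replicate n X))"

text \<open>Composition polynomials with one further argument, inserted in a single slot of each term.\<close>

inductive comp_poly_slot ::
    "('a::real_vector \<Rightarrow> 'a) \<Rightarrow> (nat \<Rightarrow> 'a list \<Rightarrow> 'a) \<Rightarrow> nat \<Rightarrow> nat \<Rightarrow> ('a \<Rightarrow> 'a \<Rightarrow> 'a) \<Rightarrow> bool"
  for I R n r where
  zero: "comp_poly_slot I R n r (\<lambda>X Y. 0)"
| add_monomial: "comp_poly_slot I R n r P \<Longrightarrow> iterated_composition I R (Suc n) s F \<Longrightarrow> r \<le> s \<Longrightarrow> i \<le> n \<Longrightarrow>
    comp_poly_slot I R n r (\<lambda>X Y. P X Y + a *\<^sub>R F (replicate i X @ Y # replicate (n - i) X))"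

locale composition_algebra =
  fixes I :: "'a::euclidean_space \<Rightarrow> 'a" and R :: "nat \<Rightarrow> 'a list \<Rightarrow> 'a"
  assumes I_linear: "linear I" and I_square: "I (I u) = - u" and R_mlin: "mlin (k + 3) (R k)"
begin

abbreviation "iter \<equiv> iterated_composition I R"
abbreviation "cp \<equiv> comp_poly I R"
abbreviation "cps \<equiv> comp_poly_slot I R"

lemma iter_pos: "iter n r F \<Longrightarrow> 1 \<le> n"
  by (induction rule: iterated_composition.induct) auto

lemma iter_mlin: "iter n r F \<Longrightarrow> mlin n F"
proof (induction rule: iterated_composition.induct)
  case complex_structure
  show ?case by (rule mlinI_update) (simp add: I_linear)
next
  case (curvature k)
  show ?case by (rule R_mlin)
next
  case (insertion m r F n s G j)
  note n = iter_pos[OF insertion.hyps(2)]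
  show ?case
  proof (rule mlinI_update)
    fix vs :: "'a list" and i assume vs: "length vs = m + n - 1" and i: "i < m + n - 1"
    let ?ws = "take j vs @ [G (take n (drop j vs))] @ drop (j + n) vs"
    have ws: "length ?ws = m" using vs n insertion.hyps(3) by simp
    \<comment> \<open>The varied slot lies before, inside or behind the block of arguments consumed
      by G.\<close>
    consider "i < j" | "j \<le> i" "i < j + n" | "j + n \<le> i" by linarith
    then show "linear (\<lambda>v. F (take j (vs[i := v]) @ [G (take n (drop j (vs[i := v])))] @ drop (j + n) (vs[i := v])))"
    proof cases
      case 1
      have "linear (\<lambda>v. F (?ws[i := v]))" by (rule mlin_update[OF insertion.IH(1) ws]) (use 1 insertion.hyps(3) in simp)
      then show ?thesis using 1 vs i by (simp add: take_update_swap list_update_append)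
    next
      case 2
      have "linear (\<lambda>v. G ((take n (drop j vs))[i - j := v]))"
        by (rule mlin_update[OF insertion.IH(2)]) (use 2 vs insertion.hyps(3) in auto)
      moreover have "linear (\<lambda>w. F (take j vs @ w # drop (j + n) vs))"
        by (rule mlinD[OF insertion.IH(1)]) (use vs n insertion.hyps(3) in simp)
      ultimately have "linear ((\<lambda>w. F (take j vs @ w # drop (j + n) vs)) \<circ> (\<lambda>v. G ((take n (drop j vs))[i - j := v])))"
        by (rule linear_compose)
      moreover have "take j (vs[i := v]) = take j vs" "drop (j + n) (vs[i := v]) = drop (j + n) vs"
        "take n (drop j (vs[i := v])) = (take n (drop j vs))[i - j := v]" for v
        using 2 by simp_all (simp add: drop_update_swap take_update_swap)
      ultimately show ?thesis by (simp add: o_def)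
    next
      case 3
      have "linear (\<lambda>v. F (?ws[i - n + 1 := v]))" by (rule mlin_update[OF insertion.IH(1) ws]) (use 3 i n in simp)
      moreover have "?ws[i - n + 1 := v] = take j vs @ [G (take n (drop j vs))] @ (drop (j + n) vs)[i - (j + n) := v]" for v
      proof -
        have "length (take j vs) = j" "i - n + 1 = j + Suc (i - (j + n))"
          using 3 vs n insertion.hyps(3) by simp_all
        then show ?thesis by (simp add: list_update_append)
      qed
      ultimately show ?thesis using 3 n by (simp add: drop_update_swap)
    qed
  qed
qed

lemma cp_monomial: "iter n s F \<Longrightarrow> r \<le> s \<Longrightarrow> cp n r (\<lambda>X. F (replicate n X))"
  using comp_poly.add_monomial[OF comp_poly.zero, of I R n s F r 1] by simp

lemma cp_add:
  assumes "cp n r P" "cp n r P'"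
  shows "cp n r (\<lambda>X. P X + P' X)"
  using assms(2)
proof (induction rule: comp_poly.induct)
  case (add_monomial P' s F a)
  then show ?case using comp_poly.add_monomial[of I R n r "\<lambda>X. P X + P' X" s F a] by (simp add: add.assoc)
qed (use assms in simp)

lemma cp_scale: "cp n r P \<Longrightarrow> cp n r (\<lambda>X. c *\<^sub>R P X)"
proof (induction rule: comp_poly.induct)
  case (add_monomial P s F a)
  then show ?case using comp_poly.add_monomial[of I R n r "\<lambda>X. c *\<^sub>R P X" s F "c * a"]
    by (simp add: scaleR_add_right)
qed (simp add: comp_poly.zero)

lemma cp_mono: "cp n r P \<Longrightarrow> r' \<le> r \<Longrightarrow> cp n r' P"
  by (induction rule: comp_poly.induct) (auto intro: comp_poly.intros)

lemma cp_sum: "(\<And>i. i \<in> A \<Longrightarrow> cp n r (P i)) \<Longrightarrow> cp n r (\<lambda>X. \<Sum>i\<in>A. P i X)"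
  by (induction A rule: infinite_finite_induct) (auto intro: comp_poly.zero cp_add)

lemma cps_monomial: "iter (Suc n) s F \<Longrightarrow> r \<le> s \<Longrightarrow> i \<le> n \<Longrightarrow> cps n r (\<lambda>X Y. F (replicate i X @ Y # replicate (n - i) X))"
  using comp_poly_slot.add_monomial[OF comp_poly_slot.zero, of I R n s F r i 1] by simp

lemma cps_add:
  assumes "cps n r P" "cps n r P'"
  shows "cps n r (\<lambda>X Y. P X Y + P' X Y)"
  using assms(2)
proof (induction rule: comp_poly_slot.induct)
  case (add_monomial P' s F i a)
  then show ?case using comp_poly_slot.add_monomial[of I R n r "\<lambda>X Y. P X Y + P' X Y" s F i a] by (simp add: add.assoc)
qed (use assms in simp)

lemma cps_scale: "cps n r P \<Longrightarrow> cps n r (\<lambda>X Y. c *\<^sub>R P X Y)"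
proof (induction rule: comp_poly_slot.induct)
  case (add_monomial P s F i a)
  then show ?case using comp_poly_slot.add_monomial[of I R n r "\<lambda>X Y. c *\<^sub>R P X Y" s F i "c * a"]
    by (simp add: scaleR_add_right)
qed (simp add: comp_poly_slot.zero)

lemma cps_mono: "cps n r P \<Longrightarrow> r' \<le> r \<Longrightarrow> cps n r' P"
  by (induction rule: comp_poly_slot.induct) (auto intro: comp_poly_slot.intros)

lemma cps_sum: "(\<And>i. i \<in> A \<Longrightarrow> cps n r (P i)) \<Longrightarrow> cps n r (\<lambda>X Y. \<Sum>i\<in>A. P i X Y)"
  by (induction A rule: infinite_finite_induct) (auto intro: comp_poly_slot.zero cps_add)

lemma slot_linear: "iter (Suc m) s F \<Longrightarrow> i \<le> m \<Longrightarrow> linear (\<lambda>v. F (replicate i X @ v # replicate (m - i) X))"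
  by (rule mlinD[OF iter_mlin]) auto

lemma cp_insert:
  assumes F: "iter (Suc m) s F" "i \<le> m" and G: "cp n r G"
  shows "cp (m + n) (s + r) (\<lambda>X. F (replicate i X @ G X # replicate (m - i) X))"
  using G
proof (induction rule: comp_poly.induct)
  case zero
  show ?case using linear_0[OF slot_linear[OF F]] by (simp add: comp_poly.zero)
next
  case (add_monomial P s' G' a)
  have "iter (Suc m + n - 1) (s + s') (\<lambda>xs. F (take i xs @ [G' (take n (drop i xs))] @ drop (i + n) xs))"
    by (rule iterated_composition.insertion[OF F(1) add_monomial.hyps(2)]) (use F in simp)
  from comp_poly.add_monomial[OF add_monomial.IH this[simplified], of a]
  have "cp (m + n) (s + r) (\<lambda>X. F (replicate i X @ P X # replicate (m - i) X) + a *\<^sub>R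
      F (take i (replicate (m + n) X) @ G' (take n (drop i (replicate (m + n) X))) # drop (i + n) (replicate (m + n) X)))"
    using add_monomial.hyps(3) by simp
  moreover have "take i (replicate (m + n) X) = replicate i X" "take n (drop i (replicate (m + n) X)) = replicate n X"
    "drop (i + n) (replicate (m + n) X) = replicate (m - i) X" for X :: 'a
    using F(2) by (simp_all add: min_def)
  ultimately show ?case
    using F by (simp add: linear_add[OF slot_linear[OF F]] linear_scale[OF slot_linear[OF F]])
qed

text \<open>The slot variable occurs linearly in each term, so replacing it by a composition
  polynomial adds degrees and numbers of curvature factors.\<close>

lemma cps_apply:
  assumes P: "cps m r P" and G: "cp n s G"
  shows "cp (m + n) (r + s) (\<lambda>X. P X (G X))"
  using P
proof (induction rule: comp_poly_slot.induct)
  case (add_monomial P s' F i a)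
  have "cp (m + n) (s' + s) (\<lambda>X. F (replicate i X @ G X # replicate (m - i) X))"
    by (rule cp_insert[OF add_monomial.hyps(2,4) G])
  then have "cp (m + n) (r + s) (\<lambda>X. F (replicate i X @ G X # replicate (m - i) X))"
    by (rule cp_mono) (use add_monomial.hyps in simp)
  then show ?case by (intro cp_add add_monomial.IH cp_scale)
qed (rule comp_poly.zero)

lemma cps_insert:
  assumes F: "iter (Suc m) s F" "i \<le> m" and G: "cps n r G"
  shows "cps (m + n) (s + r) (\<lambda>X Y. F (replicate i X @ G X Y # replicate (m - i) X))"
  using G
proof (induction rule: comp_poly_slot.induct)
  case zero
  show ?case using linear_0[OF slot_linear[OF F]] by (simp add: comp_poly_slot.zero)
next
  case (add_monomial P s' G' j a)
  have it: "iter (Suc (m + n)) (s + s') (\<lambda>xs. F (take i xs @ [G' (take (Suc n) (drop i xs))] @ drop (i + Suc n) xs))"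
    using iterated_composition.insertion[OF F(1) add_monomial.hyps(2), of i] F(2) by simp
  have "cps (m + n) (s + r) (\<lambda>X Y. F (replicate i X @ P X Y # replicate (m - i) X) + a *\<^sub>R
      (\<lambda>xs. F (take i xs @ [G' (take (Suc n) (drop i xs))] @ drop (i + Suc n) xs))
        (replicate (i + j) X @ Y # replicate (m + n - (i + j)) X))"
    by (rule comp_poly_slot.add_monomial[OF add_monomial.IH it]) (use F(2) add_monomial.hyps in simp_all)
  moreover have "take i (replicate (i + j) X @ Y # replicate (m + n - (i + j)) X) = replicate i X"
    "take (Suc n) (drop i (replicate (i + j) X @ Y # replicate (m + n - (i + j)) X)) = replicate j X @ Y # replicate (n - j) X"
    "drop (i + Suc n) (replicate (i + j) X @ Y # replicate (m + n - (i + j)) X) = replicate (m - i) X" for X Y :: 'a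
    using F(2) add_monomial.hyps(4) by (simp_all add: min_def Suc_diff_le)
  ultimately show ?case
    using F by (simp add: linear_add[OF slot_linear[OF F]] linear_scale[OF slot_linear[OF F]])
qed

lemma cps_compose:
  assumes P: "cps m r P" and G: "cps n s G"
  shows "cps (m + n) (r + s) (\<lambda>X Y. P X (G X Y))"
  using P
proof (induction rule: comp_poly_slot.induct)
  case (add_monomial P s' F i a)
  have "cps (m + n) (s' + s) (\<lambda>X Y. F (replicate i X @ G X Y # replicate (m - i) X))"
    by (rule cps_insert[OF add_monomial.hyps(2,4) G])
  then have "cps (m + n) (r + s) (\<lambda>X Y. F (replicate i X @ G X Y # replicate (m - i) X))"
    by (rule cps_mono) (use add_monomial.hyps in simp)
  then show ?case by (intro cps_add add_monomial.IH cps_scale)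
qed (rule comp_poly_slot.zero)

lemma cps_I: "cps 0 0 (\<lambda>X Y. I Y)"
  using cps_monomial[of 0 0 "\<lambda>xs. I (xs ! 0)" 0 0] iterated_composition.complex_structure[of I R] by simp

lemma cp_I: "cp n r P \<Longrightarrow> cp n r (\<lambda>X. I (P X))"
  using cps_apply[OF cps_I, of n r P] by simp

text \<open>The identity is not among the generators; it is obtained as -I^2.\<close>

lemma cps_id: "cps 0 0 (\<lambda>X Y. Y)"
  using cps_scale[OF cps_compose[OF cps_I cps_I], of "-1"] by (simp add: I_square)

lemma cp_I_id: "cp 1 0 I"
  using cp_monomial[OF iterated_composition.complex_structure order_refl] by simp

lemma cp_id: "cp 1 0 (\<lambda>X. X)"
  using cp_scale[OF cp_I[OF cp_I_id], of "-1"] by (simp add: I_square)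

lemma cps_R: "cps (k + 2) 1 (\<lambda>X Y. R k (replicate k X @ [X, Y, X]))"
  using cps_monomial[of "k + 2" 1 "R k" 1 "Suc k"] iterated_composition.curvature[of I R k]
  by (simp add: numeral_3_eq_3 replicate_append_same[symmetric] Suc_diff_le)

text \<open>Differentiability along arbitrary curves is part of the claim, because
  \<open>dir_deriv\<close> has a value in any case. Each of the n equal arguments is varied in
  turn.\<close>

lemma cp_derivative:
  assumes "cp n r P"
  shows "\<exists>P'. cps (n - 1) r P' \<and> (\<forall>A A' s. (A has_vector_derivative A') (at s) \<longrightarrow>
    ((\<lambda>s. P (A s)) has_vector_derivative P' (A s) A') (at s))"
  using assms
proof (induction rule: comp_poly.induct)
  case zero
  show ?case by (rule exI[of _ "\<lambda>X Y. 0"]) (auto intro: comp_poly_slot.zero)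
next
  case (add_monomial P s F a)
  obtain P' where P': "cps (n - 1) r P'" "\<And>A A' s. (A has_vector_derivative A') (at s) \<Longrightarrow>
    ((\<lambda>s. P (A s)) has_vector_derivative P' (A s) A') (at s)" using add_monomial.IH by blast
  note n = iter_pos[OF add_monomial.hyps(2)]
  define F' where "F' = (\<lambda>X Y. \<Sum>i<n. F (replicate i X @ Y # replicate (n - 1 - i) X))"
  have "cps (n - 1) r F'"
    unfolding F'_def
    by (intro cps_sum cps_monomial[where s=s]) (use add_monomial.hyps n in auto)
  moreover have "((\<lambda>s. F (replicate n (A s))) has_vector_derivative F' (A s) A') (at s)"
    if A: "(A has_vector_derivative A') (at s)" for A A' s
  proof -
    have T: "tensor_field UNIV n (\<lambda>_::'a. F)"
      using iter_mlin[OF add_monomial.hyps(2)] by (simp add: tensor_field_def)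
    have "((\<lambda>s. F ([] @ map (\<lambda>V. V s) (replicate n A))) has_vector_derivative
      pd A' (\<lambda>y. F ([] @ map (\<lambda>V. V s) (replicate n A))) (A s) +
      (\<Sum>i<length (replicate n A). F ([] @ (map (\<lambda>V. V s) (replicate n A))[i := replicate n A' ! i]))) (at s)"
      by (rule tensor_field_along[OF open_UNIV T A]) (use A in auto)
    moreover have "(replicate n (A s))[i := A'] = replicate i (A s) @ A' # replicate (n - 1 - i) (A s)" if "i < n" for i
      using that by (simp add: upd_conv_take_nth_drop min_def)
    ultimately show ?thesis by (simp add: F'_def)
  qed
  ultimately show ?case
    by (intro exI[of _ "\<lambda>X Y. P' X Y + a *\<^sub>R F' X Y"] conjI cps_add cps_scale P' allI impI has_vector_derivative_add
        bounded_linear.has_vector_derivative[OF bounded_linear_scaleR_right]) auto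
qed

lemma dir_deriv_eqI:
  assumes "\<And>A A' s. (A has_vector_derivative A') (at s) \<Longrightarrow> ((\<lambda>s. P (A s)) has_vector_derivative P' (A s) A') (at s)"
  shows "dir_deriv P X Y = P' X Y"
proof -
  have "((\<lambda>t. X + t *\<^sub>R Y) has_vector_derivative Y) (at 0)"
    by (auto intro!: derivative_eq_intros simp: has_vector_derivative_def)
  from assms[OF this] show ?thesis by (simp add: dir_deriv_def vector_derivative_at)
qed

lemma cp_dir_deriv:
  assumes "cp n r P"
  shows "cps (n - 1) r (dir_deriv P)"
    and "(A has_vector_derivative A') (at s) \<Longrightarrow> ((\<lambda>s. P (A s)) has_vector_derivative dir_deriv P (A s) A') (at s)"
proof -
  obtain P' where P': "cps (n - 1) r P'" "\<And>A A' s. (A has_vector_derivative A') (at s) \<Longrightarrow>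
    ((\<lambda>s. P (A s)) has_vector_derivative P' (A s) A') (at s)" using cp_derivative[OF assms] by blast
  then have "dir_deriv P = P'" by (intro ext dir_deriv_eqI) auto
  then show "cps (n - 1) r (dir_deriv P)"
    "(A has_vector_derivative A') (at s) \<Longrightarrow> ((\<lambda>s. P (A s)) has_vector_derivative dir_deriv P (A s) A') (at s)"
    using P' by auto
qed

lemma cp_dir_deriv_apply:
  "cp (Suc n) r P \<Longrightarrow> cp m s G \<Longrightarrow> cp (n + m) (r + s) (\<lambda>X. dir_deriv P X (G X))"
  using cps_apply[OF cp_dir_deriv(1), of "Suc n" r P m s G] by simp

lemma cp_imp_linear_combination:
  assumes "cp n r P"
  shows "\<exists>(N::nat) a F s. (\<forall>i<N. iter n (s i) (F i) \<and> r \<le> s i) \<and> (\<forall>X. P X = (\<Sum>i<N. a i *\<^sub>R F i (replicate n X)))"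
  using assms
proof (induction rule: comp_poly.induct)
  case zero
  show ?case by (rule exI[of _ 0]) simp
next
  case (add_monomial P s' F' a')
  then obtain N :: nat and a F s where N: "\<forall>i<N. iter n (s i) (F i) \<and> r \<le> s i"
    "\<forall>X. P X = (\<Sum>i<N. a i *\<^sub>R F i (replicate n X))" by blast
  show ?case
    by (rule exI[of _ "Suc N"], rule exI[of _ "a(N := a')"], rule exI[of _ "F(N := F')"], rule exI[of _ "s(N := s')"])
      (use N add_monomial.hyps in \<open>auto simp: less_Suc_eq\<close>)
qed

end

section \<open>Trigonometric polynomials along rotations\<close>

text \<open>Real trigonometric polynomials of degree at most k: after multiplication by exp(i k
  \<phi>) only the powers 0 to 2k of exp(i \<phi>) occur, so products and degree bounds are those of
  ordinary polynomials.\<close>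

definition trig_poly :: "nat \<Rightarrow> (real \<Rightarrow> real) \<Rightarrow> bool" where
  "trig_poly k h \<longleftrightarrow> (\<exists>q::complex poly. degree q \<le> 2 * k \<and>
    (\<forall>\<phi>. complex_of_real (h \<phi>) * cis (real k * \<phi>) = poly q (cis \<phi>)))"

lemma trig_poly_const: "trig_poly k (\<lambda>\<phi>. c)"
  unfolding trig_poly_def
  by (rule exI[of _ "monom (complex_of_real c) k"]) (auto simp: poly_monom Complex.DeMoivre intro: order_trans[OF degree_monom_le])

lemma trig_poly_mult:
  assumes "trig_poly k h" "trig_poly l h'"
  shows "trig_poly (k + l) (\<lambda>\<phi>. h \<phi> * h' \<phi>)"
proof -
  obtain q q' where q: "degree q \<le> 2 * k" "\<And>\<phi>. complex_of_real (h \<phi>) * cis (real k * \<phi>) = poly q (cis \<phi>)"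
    "degree q' \<le> 2 * l" "\<And>\<phi>. complex_of_real (h' \<phi>) * cis (real l * \<phi>) = poly q' (cis \<phi>)"
    using assms unfolding trig_poly_def by metis
  show ?thesis unfolding trig_poly_def
  proof (intro exI[of _ "q * q'"] conjI allI)
    show "degree (q * q') \<le> 2 * (k + l)" using degree_mult_le[of q q'] q by simp
    fix \<phi>
    have "poly (q * q') (cis \<phi>) = (complex_of_real (h \<phi>) * cis (real k * \<phi>)) * (complex_of_real (h' \<phi>) * cis (real l * \<phi>))"
      by (simp add: q)
    also have "\<dots> = complex_of_real (h \<phi> * h' \<phi>) * cis (real (k + l) * \<phi>)"
      by (simp add: distrib_right cis_mult[symmetric])
    finally show "complex_of_real (h \<phi> * h' \<phi>) * cis (real (k + l) * \<phi>) = poly (q * q') (cis \<phi>)" by simp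
  qed
qed

lemma trig_poly_add:
  assumes "trig_poly k h" "trig_poly k h'"
  shows "trig_poly k (\<lambda>\<phi>. h \<phi> + h' \<phi>)"
proof -
  obtain q q' where q: "degree q \<le> 2 * k" "\<And>\<phi>. complex_of_real (h \<phi>) * cis (real k * \<phi>) = poly q (cis \<phi>)"
    "degree q' \<le> 2 * k" "\<And>\<phi>. complex_of_real (h' \<phi>) * cis (real k * \<phi>) = poly q' (cis \<phi>)"
    using assms unfolding trig_poly_def by metis
  show ?thesis unfolding trig_poly_def
    by (intro exI[of _ "q + q'"] conjI allI) (simp_all add: q(2,4)[symmetric] degree_add_le[OF q(1,3)] distrib_right)
qed

text \<open>Multiplication by the constant 1, regarded as a trigonometric polynomial of degree l -
  k.\<close>

lemma trig_poly_mono: "trig_poly k h \<Longrightarrow> k \<le> l \<Longrightarrow> trig_poly l h"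
  using trig_poly_mult[of k h "l - k" "\<lambda>\<phi>. 1"] trig_poly_const[of "l - k" 1] by simp

lemma trig_poly_scale: "trig_poly k h \<Longrightarrow> trig_poly k (\<lambda>\<phi>. c * h \<phi>)"
  using trig_poly_mult[OF trig_poly_const[of 0 c], of k h] by simp

lemma trig_poly_diff: "trig_poly k h \<Longrightarrow> trig_poly k h' \<Longrightarrow> trig_poly k (\<lambda>\<phi>. h \<phi> - h' \<phi>)"
  using trig_poly_add[of k h "\<lambda>\<phi>. -1 * h' \<phi>"] trig_poly_scale[of k h' "-1"] by simp

lemma trig_poly_sum: "(\<And>i. i \<in> A \<Longrightarrow> trig_poly k (h i)) \<Longrightarrow> trig_poly k (\<lambda>\<phi>. \<Sum>i\<in>A. h i \<phi>)"
  by (induction A rule: infinite_finite_induct) (auto intro: trig_poly_const trig_poly_add)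

lemma trig_poly_cos: "trig_poly 1 cos"
  unfolding trig_poly_def
proof (intro exI[of _ "[:1/2, 0, 1/2:]"] conjI allI)
  fix \<phi>
  have "complex_of_real (cos \<phi>) = (cis \<phi> + cis (- \<phi>)) / 2" by (simp add: complex_eq_iff)
  then show "complex_of_real (cos \<phi>) * cis (real 1 * \<phi>) = poly [:1/2, 0, 1/2:] (cis \<phi>)"
    by (simp add: field_simps cis_mult)
qed simp

lemma trig_poly_sin: "trig_poly 1 sin"
  unfolding trig_poly_def
proof (intro exI[of _ "[:\<i>/2, 0, - \<i>/2:]"] conjI allI)
  fix \<phi>
  have *: "complex_of_real (sin \<phi>) = \<i> / 2 * (cis (- \<phi>) - cis \<phi>)" by (simp add: complex_eq_iff)
  show "complex_of_real (sin \<phi>) * cis (real 1 * \<phi>) = poly [:\<i>/2, 0, - \<i>/2:] (cis \<phi>)"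
    unfolding * by (simp add: algebra_simps cis_mult)
qed simp

lemma trig_poly_derivative:
  assumes h: "trig_poly k h" and d: "\<And>\<phi>. (h has_real_derivative h' \<phi>) (at \<phi>)"
  shows "trig_poly k h'"
proof -
  obtain q where q: "degree q \<le> 2 * k" "\<And>\<phi>. complex_of_real (h \<phi>) * cis (real k * \<phi>) = poly q (cis \<phi>)"
    using h unfolding trig_poly_def by metis
  \<comment> \<open>With z = exp(i \<phi>), h is z^(-k) q(z), and its \<phi>-derivative is z^(-k) (i
    z q'(z) - i k q(z)).\<close>
  define p where "p = pCons 0 (smult \<i> (pderiv q)) - smult (\<i> * of_nat k) q"
  show ?thesis unfolding trig_poly_def
  proof (intro exI[of _ p] conjI allI)
    have "degree (pCons 0 (smult \<i> (pderiv q))) \<le> 2 * k"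
    proof (cases "pderiv q = 0")
      case False
      then have "degree q \<noteq> 0" by (simp add: pderiv_eq_0_iff)
      then show ?thesis using q(1) False by (simp add: degree_pderiv)
    qed simp
    moreover have "degree (smult (\<i> * of_nat k) q) \<le> 2 * k" using q(1) degree_smult_le order_trans by blast
    ultimately show "degree p \<le> 2 * k" unfolding p_def by (rule degree_diff_le)
    fix \<phi>
    have c: "((\<lambda>\<phi>. cis (c * \<phi>)) has_vector_derivative \<i> * of_real c * cis (c * \<phi>)) (at \<phi>)" for c \<phi>
    proof -
      have "((\<lambda>\<phi>. cis (c * \<phi>)) has_vector_derivative c *\<^sub>R (\<i> * cis (c * \<phi>))) (at \<phi>)"
        unfolding cis_conv_exp
        by (auto intro!: derivative_eq_intros has_vector_derivative_real_field simp: scaleR_conv_of_real)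
      then show ?thesis by (simp add: scaleR_conv_of_real mult_ac)
    qed
    have "((\<lambda>\<phi>. complex_of_real (h \<phi>) * cis (real k * \<phi>)) has_vector_derivative
        complex_of_real (h \<phi>) * (\<i> * of_real (real k) * cis (real k * \<phi>)) + complex_of_real (h' \<phi>) * cis (real k * \<phi>)) (at \<phi>)"
      by (intro has_vector_derivative_mult c has_vector_derivative_of_real d)
    moreover have "((\<lambda>\<phi>. poly q (cis \<phi>)) has_vector_derivative (\<i> * cis \<phi>) * poly (pderiv q) (cis \<phi>)) (at \<phi>)"
      using field_vector_diff_chain_at[OF c[of 1 \<phi>, simplified] poly_DERIV, of q] by (simp add: o_def mult_ac)
    ultimately have "complex_of_real (h \<phi>) * (\<i> * of_real (real k) * cis (real k * \<phi>)) + complex_of_real (h' \<phi>) * cis (real k * \<phi>)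
        = (\<i> * cis \<phi>) * poly (pderiv q) (cis \<phi>)"
      unfolding q by (rule vector_derivative_unique_at)
    then have "complex_of_real (h' \<phi>) * cis (real k * \<phi>) = (\<i> * cis \<phi>) * poly (pderiv q) (cis \<phi>)
        - \<i> * of_nat k * poly q (cis \<phi>)" unfolding q(2)[symmetric] by (simp add: algebra_simps)
    then show "complex_of_real (h' \<phi>) * cis (real k * \<phi>) = poly p (cis \<phi>)" by (simp add: p_def algebra_simps)
  qed
qed

text \<open>Index i stands for the frequency i - m.\<close>

lemma trig_poly_expansion:
  assumes "trig_poly m h"
  shows "\<exists>u v. \<forall>\<phi>. h \<phi> = (\<Sum>i\<le>2 * m. u i * cos ((real i - real m) * \<phi>) + v i * sin ((real i - real m) * \<phi>))"
proof -
  obtain q where q: "degree q \<le> 2 * m" "\<And>\<phi>. complex_of_real (h \<phi>) * cis (real m * \<phi>) = poly q (cis \<phi>)"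
    using assms unfolding trig_poly_def by metis
  have "h \<phi> = (\<Sum>i\<le>2 * m. Re (coeff q i) * cos ((real i - real m) * \<phi>) + - Im (coeff q i) * sin ((real i - real m) * \<phi>))" for \<phi>
  proof -
    have "poly q z = (\<Sum>i\<le>2 * m. coeff q i * z ^ i)" for z
      unfolding poly_altdef
      by (rule sum.mono_neutral_left) (use q(1) in \<open>auto simp: coeff_eq_0\<close>)
    then have "complex_of_real (h \<phi>) * cis (real m * \<phi>) * cis (- (real m * \<phi>))
        = (\<Sum>i\<le>2 * m. coeff q i * cis \<phi> ^ i) * cis (- (real m * \<phi>))" by (simp add: q(2))
    then have "complex_of_real (h \<phi>) = (\<Sum>i\<le>2 * m. coeff q i * cis ((real i - real m) * \<phi>))"
      by (simp add: mult.assoc cis_mult sum_distrib_right Complex.DeMoivre left_diff_distrib)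
    then have "h \<phi> = Re (\<Sum>i\<le>2 * m. coeff q i * cis ((real i - real m) * \<phi>))" by (metis Re_complex_of_real)
    then show ?thesis by simp
  qed
  then show ?thesis
    by (intro exI[of _ "\<lambda>i. Re (coeff q i)"] exI[of _ "\<lambda>i. - Im (coeff q i)"] allI)
qed

text \<open>The polynomial 1 - prod_y (1 - x/y) vanishes at 0 and equals 1 at x = 1, ..., M; its
  quotient by x is q. A diagonal operator with eigenvalues among these numbers is thus inverted by a
  polynomial in itself.\<close>

lemma polynomial_inverse_on_range:
  "\<exists>q::real poly. \<forall>x\<in>{1..M}. real x * poly q (real x) = 1"
proof -
  define p where "p = 1 - (\<Prod>y\<in>{1..M}. [:1, - 1 / real y:])"
  have "poly p 0 = 0" by (simp add: p_def poly_prod)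
  then have "[:-0, 1:] dvd p" using poly_eq_0_iff_dvd by blast
  then obtain q where q: "p = [:0, 1:] * q" by (auto simp: dvd_def)
  have "real x * poly q (real x) = 1" if x: "x \<in> {1..M}" for x
  proof -
    have "poly (\<Prod>y\<in>{1..M}. [:1, - 1 / real y:]) (real x) = 0"
      unfolding poly_prod by (rule prod_zero) (use x in auto)
    then have "poly p (real x) = 1" by (simp add: p_def)
    then show ?thesis by (simp add: q)
  qed
  then show ?thesis by blast
qed

section \<open>Inversion of the weight operator\<close>

context composition_algebra
begin

definition rot :: "real \<Rightarrow> 'a \<Rightarrow> 'a" where
  "rot \<phi> v = cos \<phi> *\<^sub>R v + sin \<phi> *\<^sub>R I v"

lemma rot_0 [simp]: "rot 0 v = v"
  by (simp add: rot_def)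

lemma I_rot: "I (rot \<phi> v) = cos \<phi> *\<^sub>R I v - sin \<phi> *\<^sub>R v"
  by (simp add: rot_def linear_add[OF I_linear] linear_scale[OF I_linear] I_square)

lemma rot_deriv: "((\<lambda>\<phi>. rot (c * \<phi>) v) has_vector_derivative c *\<^sub>R I (rot (c * \<phi>) v)) (at \<phi>)"
proof -
  have "((\<lambda>\<phi>. rot (c * \<phi>) v) has_vector_derivative (- sin (c * \<phi>) * c) *\<^sub>R v + (cos (c * \<phi>) * c) *\<^sub>R I v) (at \<phi>)"
    unfolding rot_def by (auto intro!: derivative_eq_intros simp: algebra_simps)
  then show ?thesis by (simp add: I_rot algebra_simps)
qed

lemma rot_deriv_1: "((\<lambda>\<phi>. rot \<phi> v) has_vector_derivative I (rot \<phi> v)) (at \<phi>)"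
  using rot_deriv[of 1] by simp

text \<open>The left hand side of the recursion on the component of degree n, with N replaced by its
  value n.\<close>

definition weight_op :: "nat \<Rightarrow> ('a \<Rightarrow> 'a) \<Rightarrow> 'a \<Rightarrow> 'a" where
  "weight_op n P X = real n *\<^sub>R P X + I (dir_deriv P X (I X))"

lemma cp_weight_op: "cp (Suc n) r P \<Longrightarrow> cp (Suc n) r (weight_op k P)"
  unfolding weight_op_def[abs_def]
  using cp_dir_deriv_apply[of n r P 1 0 I] cp_I_id by (intro cp_add cp_scale cp_I) auto

text \<open>On the span of the \<open>rot (\<nu> \<phi>)\<close> the operator is diagonal with eigenvalues \<open>n - \<nu>\<close>, because \<open>I\<^sup>2 = -1\<close>.\<close>

lemma weight_op_rot:
  assumes d: "\<And>A A' s. (A has_vector_derivative A') (at s) \<Longrightarrow> ((\<lambda>s. P (A s)) has_vector_derivative dir_deriv P (A s) A') (at s)"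
    and P: "\<And>\<phi>. P (rot \<phi> X) = (\<Sum>i\<in>K. rot (\<nu> i * \<phi>) (a i))"
  shows "weight_op n P (rot \<phi> X) = (\<Sum>i\<in>K. rot (\<nu> i * \<phi>) ((real n - \<nu> i) *\<^sub>R a i))"
proof -
  have "((\<lambda>\<phi>. P (rot \<phi> X)) has_vector_derivative dir_deriv P (rot \<phi> X) (I (rot \<phi> X))) (at \<phi>)"
    by (rule d[OF rot_deriv_1])
  moreover have "((\<lambda>\<phi>. P (rot \<phi> X)) has_vector_derivative (\<Sum>i\<in>K. \<nu> i *\<^sub>R I (rot (\<nu> i * \<phi>) (a i)))) (at \<phi>)"
    unfolding P by (intro has_vector_derivative_sum rot_deriv)
  ultimately have "dir_deriv P (rot \<phi> X) (I (rot \<phi> X)) = (\<Sum>i\<in>K. \<nu> i *\<^sub>R I (rot (\<nu> i * \<phi>) (a i)))"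
    by (rule vector_derivative_unique_at)
  then have "weight_op n P (rot \<phi> X) = (\<Sum>i\<in>K. real n *\<^sub>R rot (\<nu> i * \<phi>) (a i) + - (\<nu> i *\<^sub>R rot (\<nu> i * \<phi>) (a i)))"
    by (simp add: weight_op_def P scaleR_sum_right sum.distrib linear_sum[OF I_linear] linear_scale[OF I_linear]
        I_square sum_negf sum_subtractf)
  also have "\<dots> = (\<Sum>i\<in>K. rot (\<nu> i * \<phi>) ((real n - \<nu> i) *\<^sub>R a i))"
    by (rule sum.cong[OF refl]) (simp add: rot_def linear_scale[OF I_linear] linear_diff[OF I_linear] algebra_simps)
  finally show ?thesis .
qed

text \<open>I acts as an imaginary unit, so a cosine and a sine with arbitrary vector coefficients
  split into rotations with frequencies \<nu> and -\<nu>; the latter are regrouped by the reflection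
  of indices i -> 2m - i.\<close>

lemma trig_poly_rot_expansion:
  assumes "\<And>b. b \<in> Basis \<Longrightarrow> trig_poly m (\<lambda>\<phi>. h \<phi> \<bullet> b)"
  shows "\<exists>a. \<forall>\<phi>. (h \<phi> :: 'a) = (\<Sum>i\<le>2 * m. rot ((real i - real m) * \<phi>) (a i))"
proof -
  have "\<forall>b\<in>Basis. \<exists>u v. \<forall>\<phi>. h \<phi> \<bullet> b = (\<Sum>i\<le>2 * m. u i * cos ((real i - real m) * \<phi>) + v i * sin ((real i - real m) * \<phi>))"
    using trig_poly_expansion[OF assms] by blast
  from bchoice[OF this] obtain u where "\<forall>b\<in>Basis. \<exists>v. \<forall>\<phi>. h \<phi> \<bullet> b =
      (\<Sum>i\<le>2 * m. u b i * cos ((real i - real m) * \<phi>) + v i * sin ((real i - real m) * \<phi>))" ..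
  from bchoice[OF this] obtain v where "\<forall>b\<in>Basis. \<forall>\<phi>. h \<phi> \<bullet> b =
      (\<Sum>i\<le>2 * m. u b i * cos ((real i - real m) * \<phi>) + v b i * sin ((real i - real m) * \<phi>))" ..
  then have uv: "h \<phi> \<bullet> b = (\<Sum>i\<le>2 * m. u b i * cos ((real i - real m) * \<phi>) + v b i * sin ((real i - real m) * \<phi>))"
    if "b \<in> Basis" for b \<phi> using that by blast
  define U where "U = (\<lambda>i. \<Sum>b\<in>Basis. u b i *\<^sub>R b)"
  define V where "V = (\<lambda>i. \<Sum>b\<in>Basis. v b i *\<^sub>R b)"
  define al where "al = (\<lambda>i. (1/2) *\<^sub>R (U i - I (V i)))"
  define be where "be = (\<lambda>i. (1/2) *\<^sub>R (U i + I (V i)))"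
  have pair: "cos \<theta> *\<^sub>R U i + sin \<theta> *\<^sub>R V i = rot \<theta> (al i) + rot (- \<theta>) (be i)" for \<theta> i
    by (rule euclidean_eqI)
      (simp add: rot_def al_def be_def linear_add[OF I_linear] linear_diff[OF I_linear] linear_scale[OF I_linear] I_square
          inner_add_left inner_diff_left field_simps)
  have "h \<phi> = (\<Sum>i\<le>2 * m. rot ((real i - real m) * \<phi>) (al i + be (2 * m - i)))" for \<phi>
  proof -
    have "h \<phi> = (\<Sum>b\<in>Basis. (h \<phi> \<bullet> b) *\<^sub>R b)" by (simp add: euclidean_representation)
    also have "\<dots> = (\<Sum>b\<in>Basis. \<Sum>i\<le>2 * m. (u b i * cos ((real i - real m) * \<phi>) + v b i * sin ((real i - real m) * \<phi>)) *\<^sub>R b)"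
      by (simp add: uv scaleR_sum_left)
    also have "\<dots> = (\<Sum>i\<le>2 * m. cos ((real i - real m) * \<phi>) *\<^sub>R U i + sin ((real i - real m) * \<phi>) *\<^sub>R V i)"
      by (subst sum.swap)
        (simp add: U_def V_def scaleR_add_left sum.distrib scaleR_sum_right mult.commute)
    also have "\<dots> = (\<Sum>i\<le>2 * m. rot ((real i - real m) * \<phi>) (al i) + rot (- ((real i - real m) * \<phi>)) (be i))"
      unfolding pair ..
    also have "\<dots> = (\<Sum>i\<le>2 * m. rot ((real i - real m) * \<phi>) (al i)) + (\<Sum>i\<le>2 * m. rot (- ((real i - real m) * \<phi>)) (be i))"
      by (rule sum.distrib)
    also have "(\<Sum>i\<le>2 * m. rot (- ((real i - real m) * \<phi>)) (be i)) = (\<Sum>i\<le>2 * m. rot ((real i - real m) * \<phi>) (be (2 * m - i)))"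
      by (rule sum.reindex_bij_witness[of _ "\<lambda>i. 2 * m - i" "\<lambda>i. 2 * m - i"]) (auto simp: algebra_simps)
    also have "(\<Sum>i\<le>2 * m. rot ((real i - real m) * \<phi>) (al i)) + \<dots> = (\<Sum>i\<le>2 * m. rot ((real i - real m) * \<phi>) (al i + be (2 * m - i)))"
      unfolding sum.distrib[symmetric]
      by (rule sum.cong[OF refl]) (simp add: rot_def linear_add[OF I_linear] algebra_simps)
    finally show ?thesis .
  qed
  then show ?thesis by (intro exI[of _ "\<lambda>i. al i + be (2 * m - i)"] allI)
qed

text \<open>In degree m + 1 the frequencies i - m with i <= 2m have the eigenvalues 2m + 1 - i, all
  between 1 and 2m + 1, so P is a linear combination of iterates of \<open>weight_op\<close> on its
  image. Frequency m + 1 would have eigenvalue 0; this is why the bound in the second hypothesis is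
  m.\<close>

lemma cp_of_weight_op:
  assumes d: "\<And>A A' s. (A has_vector_derivative A') (at s) \<Longrightarrow> ((\<lambda>s. P (A s)) has_vector_derivative dir_deriv P (A s) A') (at s)"
    and T: "\<And>X b. b \<in> Basis \<Longrightarrow> trig_poly m (\<lambda>\<phi>. P (rot \<phi> X) \<bullet> b)"
    and S: "cp (Suc m) r (weight_op (Suc m) P)"
  shows "cp (Suc m) r P"
proof -
  obtain q :: "real poly" where q: "\<And>x. x \<in> {1..2 * m + 1} \<Longrightarrow> real x * poly q (real x) = 1"
    using polynomial_inverse_on_range by metis
  define S where "S = weight_op (Suc m) P"
  \<comment> \<open>\<open>L l\<close> is the (l + 1)-st power of the operator applied to P; the
    extra power supplies the factor x in x q(x) = 1.\<close>
  define L where "L = (\<lambda>l. (weight_op (Suc m) ^^ l) S)"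
  have cpL: "cp (Suc m) r (L l)" for l
    unfolding L_def S_def by (induction l) (auto intro: cp_weight_op assms(3))
  have "P X = (\<Sum>l\<le>degree q. coeff q l *\<^sub>R L l X)" for X
  proof -
    obtain a where a: "\<And>\<phi>. P (rot \<phi> X) = (\<Sum>i\<le>2 * m. rot ((real i - real m) * \<phi>) (a i))"
      using trig_poly_rot_expansion[OF T[of _ X]] by blast
    have e: "L l (rot \<phi> X) = (\<Sum>i\<le>2 * m. rot ((real i - real m) * \<phi>) ((real (Suc m) - (real i - real m)) ^ Suc l *\<^sub>R a i))" for l \<phi>
    proof (induction l arbitrary: \<phi>)
      case 0
      then show ?case unfolding L_def S_def using weight_op_rot[OF d a, of "Suc m" \<phi>] by simp
    next
      case (Suc l)
      have "L (Suc l) (rot \<phi> X) = weight_op (Suc m) (L l) (rot \<phi> X)" by (simp add: L_def)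
      then show ?case
        using weight_op_rot[OF cp_dir_deriv(2)[OF cpL] Suc.IH, of "Suc m" \<phi>] by (simp add: mult_ac)
    qed
    have "(\<Sum>l\<le>degree q. coeff q l *\<^sub>R L l X) = (\<Sum>l\<le>degree q. coeff q l *\<^sub>R L l (rot 0 X))" by simp
    also have "\<dots> = (\<Sum>i\<le>2 * m. (\<Sum>l\<le>degree q. coeff q l * (real (Suc m) - (real i - real m)) ^ Suc l) *\<^sub>R a i)"
      unfolding e by (simp add: scaleR_sum_right scaleR_sum_left) (rule sum.swap)
    also have "\<dots> = (\<Sum>i\<le>2 * m. a i)"
    proof (rule sum.cong[OF refl])
      fix i assume i: "i \<in> {..2 * m}"
      then have x: "real (Suc m) - (real i - real m) = real (2 * m + 1 - i)" by simp
      have "(\<Sum>l\<le>degree q. coeff q l * (real (Suc m) - (real i - real m)) ^ Suc l)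
          = real (2 * m + 1 - i) * poly q (real (2 * m + 1 - i))"
        unfolding x poly_altdef by (simp add: sum_distrib_left mult_ac)
      also have "\<dots> = 1" by (rule q) (use i in auto)
      finally show "(\<Sum>l\<le>degree q. coeff q l * (real (Suc m) - (real i - real m)) ^ Suc l) *\<^sub>R a i = a i" by simp
    qed
    also have "\<dots> = P X" using a[of 0] by simp
    finally show ?thesis by simp
  qed
  then have "P = (\<lambda>X. \<Sum>l\<le>degree q. coeff q l *\<^sub>R L l X)" by blast
  moreover have "cp (Suc m) r (\<lambda>X. \<Sum>l\<le>degree q. coeff q l *\<^sub>R L l X)"
    by (intro cp_sum cp_scale cpL)
  ultimately show ?thesis by simp
qed

end

section \<open>Vanishing of the extreme weights in Kaehler normal coordinates\<close>

text \<open>The case m = 0 is separate because truncated subtraction would admit constants, whose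
  frequency 0 is extreme in degree 0.\<close>

definition trig_low :: "nat \<Rightarrow> (real \<Rightarrow> real) \<Rightarrow> bool" where
  "trig_low m h \<longleftrightarrow> (if m = 0 then \<forall>\<phi>. h \<phi> = 0 else trig_poly (m - 1) h)"

text \<open>Congruence of coefficients of degree \<open>m\<close> modulo those without the extreme frequencies \<open>m\<close> and \<open>-m\<close>.\<close>

definition weight_cong :: "nat \<Rightarrow> (real \<Rightarrow> real) \<Rightarrow> (real \<Rightarrow> real) \<Rightarrow> bool" where
  "weight_cong m a a' \<longleftrightarrow> trig_low m (\<lambda>\<phi>. a \<phi> - a' \<phi>) \<and> trig_poly m a'"

lemma trig_low_imp_poly: "trig_low m h \<Longrightarrow> trig_poly m h"
proof (cases m)
  case 0
  moreover assume "trig_low m h"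
  ultimately have "h = (\<lambda>\<phi>. 0)" by (auto simp: trig_low_def)
  then show ?thesis by (simp add: trig_poly_const)
qed (auto simp: trig_low_def intro: trig_poly_mono)

lemma trig_low_0: "trig_low m (\<lambda>\<phi>. 0)"
  by (simp add: trig_low_def trig_poly_const)

lemma trig_low_add: "trig_low m h \<Longrightarrow> trig_low m h' \<Longrightarrow> trig_low m (\<lambda>\<phi>. h \<phi> + h' \<phi>)"
  by (auto simp: trig_low_def trig_poly_add split: if_splits)

lemma trig_low_sum: "(\<And>i. i \<in> A \<Longrightarrow> trig_low m (h i)) \<Longrightarrow> trig_low m (\<lambda>\<phi>. \<Sum>i\<in>A. h i \<phi>)"
  by (induction A rule: infinite_finite_induct) (auto intro: trig_low_0 trig_low_add)

lemma trig_low_mult: "trig_low m h \<Longrightarrow> trig_poly k h' \<Longrightarrow> trig_low (m + k) (\<lambda>\<phi>. h \<phi> * h' \<phi>)"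
  using trig_poly_mult[of "m - 1" h k h'] trig_poly_const[of "k - 1" 0]
  by (cases m) (auto simp: trig_low_def)

lemma trig_low_scale: "trig_low m h \<Longrightarrow> trig_low m (\<lambda>\<phi>. c * h \<phi>)"
  by (auto simp: trig_low_def trig_poly_scale split: if_splits)

lemma weight_cong_refl: "trig_poly m a \<Longrightarrow> weight_cong m a a"
  by (simp add: weight_cong_def trig_low_0)

lemma weight_cong_poly: "weight_cong m a a' \<Longrightarrow> trig_poly m a"
  using trig_poly_add[OF trig_low_imp_poly, of m "\<lambda>\<phi>. a \<phi> - a' \<phi>" a'] by (simp add: weight_cong_def)

text \<open>From a b - a' b' = (a - a') b + (b - b') a': a factor that misses its extreme frequency
  cannot produce the extreme frequency of the product.\<close>

lemma weight_cong_mult: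
  assumes "weight_cong l a a'" "weight_cong k b b'"
  shows "weight_cong (l + k) (\<lambda>\<phi>. a \<phi> * b \<phi>) (\<lambda>\<phi>. a' \<phi> * b' \<phi>)"
proof -
  have "trig_low (l + k) (\<lambda>\<phi>. (a \<phi> - a' \<phi>) * b \<phi>)"
    using assms weight_cong_poly[OF assms(2)] by (intro trig_low_mult) (auto simp: weight_cong_def)
  moreover have "trig_low (l + k) (\<lambda>\<phi>. (b \<phi> - b' \<phi>) * a' \<phi>)"
    using assms trig_low_mult[of k "\<lambda>\<phi>. b \<phi> - b' \<phi>" l a'] by (simp add: weight_cong_def add.commute)
  ultimately have "trig_low (l + k) (\<lambda>\<phi>. (a \<phi> - a' \<phi>) * b \<phi> + (b \<phi> - b' \<phi>) * a' \<phi>)" by (rule trig_low_add)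
  then show ?thesis
    using assms trig_poly_mult[of l a' k b'] by (simp add: weight_cong_def algebra_simps)
qed

lemma weight_cong_sum:
  "(\<And>i. i \<in> A \<Longrightarrow> weight_cong m (a i) (a' i)) \<Longrightarrow> weight_cong m (\<lambda>\<phi>. \<Sum>i\<in>A. a i \<phi>) (\<lambda>\<phi>. \<Sum>i\<in>A. a' i \<phi>)"
  unfolding weight_cong_def sum_subtractf[symmetric] by (auto intro: trig_low_sum trig_poly_sum)

lemma weight_cong_scale: "weight_cong m a a' \<Longrightarrow> weight_cong m (\<lambda>\<phi>. c * a \<phi>) (\<lambda>\<phi>. c * a' \<phi>)"
  unfolding weight_cong_def right_diff_distrib[symmetric] by (auto intro: trig_low_scale trig_poly_scale)

lemma taylor_coeff_mult:
  fixes f g :: "real \<Rightarrow> real"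
  shows "smooth_at_0 f \<Longrightarrow> smooth_at_0 g \<Longrightarrow>
    taylor_coeff n (\<lambda>t. f t * g t) = (\<Sum>l\<le>n. taylor_coeff l f * taylor_coeff (n - l) g)"
  by (rule taylor_coeff_bilinear[OF bounded_bilinear_mult])

lemma smooth_at_0_mult:
  fixes f g :: "real \<Rightarrow> real"
  shows "smooth_at_0 f \<Longrightarrow> smooth_at_0 g \<Longrightarrow> smooth_at_0 (\<lambda>t. f t * g t)"
  by (rule smooth_at_0_bilinear[OF bounded_bilinear_mult])

lemma smooth_at_0_inner: "smooth_at_0 f \<Longrightarrow> smooth_at_0 (\<lambda>t. f t \<bullet> b)"
  by (rule smooth_at_0_bounded_linear[OF bounded_linear_inner_left])

lemma taylor_coeff_inner: "smooth_at_0 f \<Longrightarrow> taylor_coeff n (\<lambda>t. f t \<bullet> b) = taylor_coeff n f \<bullet> b"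
  by (rule taylor_coeff_bounded_linear[OF bounded_linear_inner_left])

text \<open>The right hand side contains the composition only in degrees at most m, for the
  derivatives of \<psi>. This permits induction on the degree over all \<psi> at once.\<close>

lemma taylor_coeff_chain:
  fixes \<psi> :: "'a::euclidean_space \<Rightarrow> real"
  assumes z: "smooth_at_0 z" "open S" "z 0 \<in> S" and \<psi>: "smooth_on S \<psi>"
  shows "real (Suc m) * taylor_coeff (Suc m) (\<lambda>t. \<psi> (z t)) =
    (\<Sum>b\<in>Basis. \<Sum>l\<le>m. real (Suc l) * (taylor_coeff (Suc l) z \<bullet> b) * taylor_coeff (m - l) (\<lambda>t. pd b \<psi> (z t)))"
proof -
  note sz = smooth_at_0_compose[OF z(1,2,3)]
  have "real (Suc m) * taylor_coeff (Suc m) (\<lambda>t. \<psi> (z t)) = taylor_coeff m (pd 1 (\<lambda>t. \<psi> (z t)))"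
    by (simp add: taylor_coeff_pd[OF sz(1)[OF \<psi>]] del: of_nat_Suc)
  also have "\<dots> = taylor_coeff m (\<lambda>t. \<Sum>b\<in>Basis. (pd 1 z t \<bullet> b) * pd b \<psi> (z t))"
  proof (rule taylor_coeff_cong, rule eventually_mono[OF eventually_conj[OF sz(2)[OF \<psi>] sz(3)[OF \<psi>]]])
    fix t assume t: "z t \<in> S \<and> pd 1 (\<lambda>t. \<psi> (z t)) t = pd (pd 1 z t) \<psi> (z t)"
    then show "pd 1 (\<lambda>t. \<psi> (z t)) t = (\<Sum>b\<in>Basis. (pd 1 z t \<bullet> b) * pd b \<psi> (z t))"
      using pd_sum_Basis[OF smooth_onD[OF \<psi>], of "z t" "pd 1 z t"] by simp
  qed
  finally show ?thesis
    using z(1) sz(1)[OF smooth_on_pd[OF \<psi>]]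
    by (simp add: taylor_coeff_sum smooth_at_0_mult smooth_at_0_inner smooth_at_0_pd taylor_coeff_mult
        taylor_coeff_inner taylor_coeff_pd del: of_nat_Suc)
qed

text \<open>In the application M is four times the metric in Kaehler normal coordinates, and
  \<open>euler_lagrange\<close> is the geodesic equation as the Euler-Lagrange equation of M(z', z')
  / 2, tested against w. In \<open>potential_weights\<close> the degree is m + 2 and the frequency
  bound m + 1: exactly the extreme frequency is excluded.\<close>

locale knc_potential = composition_algebra I R for I :: "'a::euclidean_space \<Rightarrow> 'a" and R +
  fixes \<theta> :: "'a \<Rightarrow> real" and E :: "'a \<Rightarrow> 'a" and \<rho> :: real and M :: "'a \<Rightarrow> 'a \<Rightarrow> 'a \<Rightarrow> real"
  assumes rho_pos: "0 < \<rho>"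
    and \<theta>_smooth: "smooth_on (ball 0 \<rho>) \<theta>"
    and E_smooth: "smooth_on (ball 0 \<rho>) E"
    and E_0: "E 0 = 0"
    and pd_E_0: "pd v E 0 = v"
    and M_def: "M = (\<lambda>y u v. pd u (pd v \<theta>) y + pd (I u) (pd (I v) \<theta>) y)"
    and M_nondegenerate: "b \<in> Basis \<Longrightarrow> \<exists>w. \<forall>u. M 0 u w = u \<bullet> b"
    and euler_lagrange: "\<forall>\<^sub>F t in nhds 0. pd 1 (\<lambda>t. M (E (t *\<^sub>R X)) (pd 1 (\<lambda>t. E (t *\<^sub>R X)) t) w) t =
      pd w (\<lambda>y. M y (pd 1 (\<lambda>t. E (t *\<^sub>R X)) t) (pd 1 (\<lambda>t. E (t *\<^sub>R X)) t)) (E (t *\<^sub>R X)) / 2"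
    and potential_weights: "trig_poly (Suc m) (\<lambda>\<phi>. taylor (pd w \<theta>) (Suc (Suc m)) (rot \<phi> X))"
begin

abbreviation B :: "'a set" where "B \<equiv> ball 0 \<rho>"

lemma open_B: "open B" and zero_B: "0 \<in> B"
  using rho_pos by auto

lemma trig_poly_rot_inner: "trig_poly 1 (\<lambda>\<phi>. rot \<phi> X \<bullet> b)"
  unfolding rot_def inner_add_left inner_scaleR_left
  using trig_poly_add[OF trig_poly_scale[OF trig_poly_cos, of "X \<bullet> b"] trig_poly_scale[OF trig_poly_sin, of "I X \<bullet> b"]]
  by (simp add: mult.commute)

lemma ray_smooth_at_0: "smooth_at_0 (\<lambda>t. t *\<^sub>R (X::'a))"
  by (rule smooth_at_0_linear[OF bounded_linear_scaleR_left])

lemma E_ray_smooth: "smooth_at_0 (\<lambda>t. E (t *\<^sub>R X))"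
  by (rule smooth_at_0_ray[OF open_B zero_B E_smooth])

lemma taylor_E_1: "taylor E (Suc 0) X = X"
  using taylor_eq_pow_pd[OF open_B zero_B E_smooth, of "Suc 0" X] by (simp add: pd_E_0)

lemma pd_\<theta>_smooth: "smooth_on B (pd u (pd v \<theta>))"
  by (intro smooth_on_pd \<theta>_smooth)

lemma M_smooth: "smooth_on B (\<lambda>y. M y u v)"
  unfolding M_def by (intro smooth_on_add open_B pd_\<theta>_smooth)

lemma M_linear: "y \<in> B \<Longrightarrow> linear (\<lambda>u. M y u v)" "y \<in> B \<Longrightarrow> linear (\<lambda>v. M y u v)"
proof -
  assume y: "y \<in> B"
  have 1: "linear (\<lambda>u. pd u (pd v \<theta>) y)" for v
    by (rule pd_linear[OF smooth_onD[OF smooth_on_pd[OF \<theta>_smooth] y]])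
  have 2: "linear (\<lambda>v. pd u (pd v \<theta>) y)" for u
    by (rule linear_pd_family[OF open_B y pd_linear[OF smooth_onD[OF \<theta>_smooth]]
          smooth_onD[OF smooth_on_pd[OF \<theta>_smooth] y]])
  show "linear (\<lambda>u. M y u v)" unfolding M_def
    using linear_compose_add[OF 1 linear_compose[OF I_linear 1]] by (simp add: o_def)
  show "linear (\<lambda>v. M y u v)" unfolding M_def
    using linear_compose_add[OF 2 linear_compose[OF I_linear 2]] by (simp add: o_def)
qed

text \<open>Euler's identity for the homogeneous component of degree m + 1.\<close>

lemma taylor_pd_self:
  assumes "smooth_on B (\<psi> :: 'a \<Rightarrow> real)"
  shows "taylor (pd X \<psi>) m X = real (Suc m) * taylor \<psi> (Suc m) X"
  unfolding taylor_eq_pow_pd[OF open_B zero_B assms] taylor_eq_pow_pd[OF open_B zero_B smooth_on_pd[OF assms]]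
  by (simp add: funpow_swap1 del: of_nat_Suc)

lemma taylor_rot_derivative:
  assumes "smooth_on B (\<psi> :: 'a \<Rightarrow> real)"
  shows "((\<lambda>\<phi>. taylor \<psi> (Suc m) (rot \<phi> X)) has_real_derivative taylor (pd (I (rot \<phi> X)) \<psi>) m (rot \<phi> X)) (at \<phi>)"
  unfolding has_real_derivative_iff_has_vector_derivative
  by (rule taylor_has_vector_derivative[OF open_B zero_B assms rot_deriv_1])

text \<open>Differentiate \<open>potential_weights\<close> in \<phi>: the derivative of
  \<open>rot \<phi> X\<close> is I applied to it. The second differentiation also hits the direction
  I(rot \<phi> X), where I^2 = -1 and Euler's identity give a multiple of the original component,
  which obeys the same bound.\<close>

lemma rotated_weights:
  shows "trig_poly (Suc m) (\<lambda>\<phi>. taylor (pd (I (rot \<phi> X)) (pd w \<theta>)) (Suc m) (rot \<phi> X))"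
    and "trig_poly (Suc m) (\<lambda>\<phi>. taylor (pd (I (rot \<phi> X)) (pd (I (rot \<phi> X)) (pd w \<theta>))) m (rot \<phi> X))"
proof -
  define \<psi> where "\<psi> = pd w \<theta>"
  have s: "smooth_on B \<psi>" unfolding \<psi>_def by (rule smooth_on_pd[OF \<theta>_smooth])
  define v1 where "v1 = (\<lambda>\<phi>. taylor (pd (I (rot \<phi> X)) \<psi>) (Suc m) (rot \<phi> X))"
  define v2 where "v2 = (\<lambda>\<phi>. taylor (pd (I (rot \<phi> X)) (pd (I (rot \<phi> X)) \<psi>)) m (rot \<phi> X))"
  have t0: "trig_poly (Suc m) (\<lambda>\<phi>. taylor \<psi> (Suc (Suc m)) (rot \<phi> X))"
    unfolding \<psi>_def by (rule potential_weights)
  have t1: "trig_poly (Suc m) v1"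
    unfolding v1_def by (rule trig_poly_derivative[OF t0 taylor_rot_derivative[OF s]])
  have l: "linear (\<lambda>Y. taylor (pd Y h) k Z)" if "smooth_on B h" for h :: "'a \<Rightarrow> real" and k Z
    by (rule linear_taylor_pd[OF open_B zero_B that])
  have v1_eq: "v1 = (\<lambda>\<phi>. cos \<phi> * taylor (pd (I X) \<psi>) (Suc m) (rot \<phi> X) - sin \<phi> * taylor (pd X \<psi>) (Suc m) (rot \<phi> X))"
    unfolding v1_def I_rot by (simp add: linear_diff[OF l[OF s]] linear_scale[OF l[OF s]])
  have "(v1 has_real_derivative v2 \<phi> - real (Suc (Suc m)) * taylor \<psi> (Suc (Suc m)) (rot \<phi> X)) (at \<phi>)" for \<phi>
  proof -
    define A where "A = rot \<phi> X"
    have "(v1 has_real_derivative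
        (- sin \<phi> * taylor (pd (I X) \<psi>) (Suc m) A + taylor (pd (I A) (pd (I X) \<psi>)) m A * cos \<phi>)
        - (cos \<phi> * taylor (pd X \<psi>) (Suc m) A + taylor (pd (I A) (pd X \<psi>)) m A * sin \<phi>)) (at \<phi>)"
      unfolding v1_eq A_def
      by (intro DERIV_diff DERIV_mult DERIV_cos DERIV_sin taylor_rot_derivative smooth_on_pd s)
    moreover have "(- sin \<phi> * taylor (pd (I X) \<psi>) (Suc m) A + taylor (pd (I A) (pd (I X) \<psi>)) m A * cos \<phi>)
        - (cos \<phi> * taylor (pd X \<psi>) (Suc m) A + taylor (pd (I A) (pd X \<psi>)) m A * sin \<phi>)
        = v2 \<phi> - real (Suc (Suc m)) * taylor \<psi> (Suc (Suc m)) A"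
    proof -
      have c: "taylor (pd (I A) (pd Y \<psi>)) m A = taylor (pd Y (pd (I A) \<psi>)) m A" for Y
        unfolding taylor_eq_pow_pd[OF open_B zero_B smooth_on_pd[OF smooth_on_pd[OF s]]]
        using pow_pd_cong[OF open_B pd_commute[OF open_B _ s] zero_B] by simp
      have "v2 \<phi> = cos \<phi> * taylor (pd (I X) (pd (I A) \<psi>)) m A - sin \<phi> * taylor (pd X (pd (I A) \<psi>)) m A"
        unfolding v2_def A_def[symmetric]
        unfolding A_def I_rot[of \<phi> X, folded A_def]
        by (subst (1) I_rot) (simp add: linear_diff[OF l[OF smooth_on_pd[OF s]]] linear_scale[OF l[OF smooth_on_pd[OF s]]])
      moreover have "real (Suc (Suc m)) * taylor \<psi> (Suc (Suc m)) A
          = cos \<phi> * taylor (pd X \<psi>) (Suc m) A + sin \<phi> * taylor (pd (I X) \<psi>) (Suc m) A"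
        unfolding taylor_pd_self[OF s, symmetric]
        by (subst (1) A_def) (simp add: rot_def linear_add[OF l[OF s]] linear_scale[OF l[OF s]])
      ultimately show ?thesis by (simp add: c algebra_simps)
    qed
    ultimately show ?thesis by (simp add: A_def)
  qed
  from trig_poly_derivative[OF t1 this]
  have "trig_poly (Suc m) (\<lambda>\<phi>. v2 \<phi> - real (Suc (Suc m)) * taylor \<psi> (Suc (Suc m)) (rot \<phi> X))" .
  from trig_poly_add[OF this trig_poly_scale[OF t0, of "real (Suc (Suc m))"]]
  show "trig_poly (Suc m) (\<lambda>\<phi>. taylor (pd (I (rot \<phi> X)) (pd (I (rot \<phi> X)) (pd w \<theta>))) m (rot \<phi> X))"
    by (simp add: v2_def \<psi>_def del: of_nat_Suc)
  show "trig_poly (Suc m) (\<lambda>\<phi>. taylor (pd (I (rot \<phi> X)) (pd w \<theta>)) (Suc m) (rot \<phi> X))"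
    using t1 by (simp add: v1_def \<psi>_def)
qed

text \<open>E agrees with the identity in degrees 0 and 1, and by hypothesis its higher components
  contribute no extreme frequency.\<close>

lemma linear_part_cong:
  assumes IH: "\<And>k b. 2 \<le> k \<Longrightarrow> k < n \<Longrightarrow> b \<in> Basis \<Longrightarrow> trig_low k (\<lambda>\<phi>. taylor E k (rot \<phi> X) \<bullet> b)"
    and l: "l < n" and b: "b \<in> Basis"
  shows "weight_cong l (\<lambda>\<phi>. taylor E l (rot \<phi> X) \<bullet> b) (\<lambda>\<phi>. taylor_coeff l (\<lambda>t. t *\<^sub>R rot \<phi> X) \<bullet> b)"
proof -
  consider "l = 0" | "l = 1" | "2 \<le> l" by linarith
  then show ?thesis
  proof cases
    case 1
    then show ?thesis by (simp add: weight_cong_def taylor_eq_taylor_coeff E_0 trig_low_0 trig_poly_const)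
  next
    case 2
    then show ?thesis
      using weight_cong_refl[OF trig_poly_rot_inner, of X b] by (simp add: taylor_E_1 taylor_coeff_ident_scaleR)
  next
    case 3
    then show ?thesis
      using IH[OF 3 l b] by (simp add: weight_cong_def taylor_coeff_ident_scaleR trig_poly_const)
  qed
qed

text \<open>Inside any smooth function E may be replaced by the identity, modulo terms without
  extreme frequency. The induction runs over all \<psi>, since the chain rule passes to
  \<open>pd b \<psi>\<close>.\<close>

lemma composition_cong:
  assumes IH: "\<And>k b. 2 \<le> k \<Longrightarrow> k < n \<Longrightarrow> b \<in> Basis \<Longrightarrow> trig_low k (\<lambda>\<phi>. taylor E k (rot \<phi> X) \<bullet> b)"
    and m: "m < n" and \<psi>: "smooth_on B (\<psi> :: 'a \<Rightarrow> real)"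
  shows "weight_cong m (\<lambda>\<phi>. taylor_coeff m (\<lambda>t. \<psi> (E (t *\<^sub>R rot \<phi> X)))) (\<lambda>\<phi>. taylor \<psi> m (rot \<phi> X))"
  using m \<psi>
proof (induction m arbitrary: \<psi> rule: less_induct)
  case (less m)
  show ?case
  proof (cases m)
    case 0
    then show ?thesis by (simp add: weight_cong_def taylor_eq_taylor_coeff E_0 trig_low_0 trig_poly_const)
  next
    case (Suc k)
    define D where "D = (\<lambda>z (\<phi>::real). \<Sum>b\<in>Basis. \<Sum>l\<le>k. real (Suc l) * (taylor_coeff (Suc l) (z \<phi>) \<bullet> b)
      * taylor_coeff (k - l) (\<lambda>t. pd b \<psi> (z \<phi> t)))"
    have e1: "taylor_coeff m (\<lambda>t. \<psi> (E (t *\<^sub>R rot \<phi> X))) = 1 / real m * D (\<lambda>\<phi> t. E (t *\<^sub>R rot \<phi> X)) \<phi>" for \<phi>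
      using taylor_coeff_chain[OF E_ray_smooth open_B _ less.prems(2), of "rot \<phi> X" k] zero_B
      by (simp add: Suc D_def E_0 field_simps del: of_nat_Suc)
    have e2: "taylor \<psi> m (rot \<phi> X) = 1 / real m * D (\<lambda>\<phi> t. t *\<^sub>R rot \<phi> X) \<phi>" for \<phi>
      using taylor_coeff_chain[OF ray_smooth_at_0 open_B _ less.prems(2), of "rot \<phi> X" k] zero_B
      by (simp add: Suc D_def taylor_eq_taylor_coeff field_simps del: of_nat_Suc)
    have "weight_cong m (D (\<lambda>\<phi> t. E (t *\<^sub>R rot \<phi> X))) (D (\<lambda>\<phi> t. t *\<^sub>R rot \<phi> X))"
      unfolding D_def
    proof (intro weight_cong_sum)
      fix b :: 'a and l assume b: "b \<in> Basis" and l: "l \<in> {..k}"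
      have "weight_cong (Suc l + (k - l))
          (\<lambda>\<phi>. (real (Suc l) * (taylor E (Suc l) (rot \<phi> X) \<bullet> b)) * taylor_coeff (k - l) (\<lambda>t. pd b \<psi> (E (t *\<^sub>R rot \<phi> X))))
          (\<lambda>\<phi>. (real (Suc l) * (taylor_coeff (Suc l) (\<lambda>t. t *\<^sub>R rot \<phi> X) \<bullet> b)) * taylor (pd b \<psi>) (k - l) (rot \<phi> X))"
        using l less.prems(1) Suc
        by (intro weight_cong_mult weight_cong_scale linear_part_cong[OF IH _ b] less.IH smooth_on_pd less.prems) auto
      then show "weight_cong m
          (\<lambda>\<phi>. real (Suc l) * (taylor_coeff (Suc l) (\<lambda>t. E (t *\<^sub>R rot \<phi> X)) \<bullet> b) * taylor_coeff (k - l) (\<lambda>t. pd b \<psi> (E (t *\<^sub>R rot \<phi> X))))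
          (\<lambda>\<phi>. real (Suc l) * (taylor_coeff (Suc l) (\<lambda>t. t *\<^sub>R rot \<phi> X) \<bullet> b) * taylor_coeff (k - l) (\<lambda>t. pd b \<psi> (t *\<^sub>R rot \<phi> X)))"
        using l Suc by (simp add: taylor_eq_taylor_coeff)
    qed
    from weight_cong_scale[OF this, of "1 / real m"] show ?thesis unfolding e1 e2 .
  qed
qed

abbreviation velocity_coeff :: "(real \<Rightarrow> 'a) \<Rightarrow> nat \<Rightarrow> 'a \<Rightarrow> real" where
  "velocity_coeff z l b \<equiv> real (Suc l) * (taylor_coeff (Suc l) z \<bullet> b)"

text \<open>The coefficient of t^m in M(z', w) along z, as in \<open>force\<close> that of the
  w-derivative of M(z', z'). Both are written out as sums of products so that congruences apply
  factor by factor.\<close>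

definition kinetic :: "nat \<Rightarrow> 'a \<Rightarrow> (real \<Rightarrow> 'a) \<Rightarrow> real" where
  "kinetic m w z = (\<Sum>b\<in>Basis. \<Sum>l\<le>m. velocity_coeff z l b * taylor_coeff (m - l) (\<lambda>t. M (z t) b w))"

definition force :: "nat \<Rightarrow> 'a \<Rightarrow> (real \<Rightarrow> 'a) \<Rightarrow> real" where
  "force m w z = (\<Sum>b\<in>Basis. \<Sum>b'\<in>Basis. \<Sum>i\<le>m. velocity_coeff z i b * (\<Sum>j\<le>m - i. velocity_coeff z j b'
    * taylor_coeff (m - i - j) (\<lambda>t. pd w (\<lambda>y. M y b b') (z t))))"

lemma kinetic_eq:
  assumes "smooth_at_0 z" "z 0 \<in> B"
  shows "kinetic m w z = taylor_coeff m (\<lambda>t. M (z t) (pd 1 z t) w)"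
    and "smooth_at_0 (\<lambda>t. M (z t) (pd 1 z t) w)"
proof -
  note sz = smooth_at_0_compose[OF assms(1) open_B assms(2)]
  have ev: "\<forall>\<^sub>F t in nhds 0. (\<Sum>b\<in>Basis. (pd 1 z t \<bullet> b) * M (z t) b w) = M (z t) (pd 1 z t) w"
  proof (rule eventually_mono[OF sz(2)[OF \<theta>_smooth]])
    fix t assume "z t \<in> B"
    from linear_euclidean_sum[OF M_linear(1)[OF this], of "pd 1 z t" w]
    show "(\<Sum>b\<in>Basis. (pd 1 z t \<bullet> b) * M (z t) b w) = M (z t) (pd 1 z t) w" by simp
  qed
  have s: "smooth_at_0 (\<lambda>t. (pd 1 z t \<bullet> b) * M (z t) b w)" for b
    by (intro smooth_at_0_mult smooth_at_0_inner smooth_at_0_pd assms sz(1) M_smooth)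
  show "smooth_at_0 (\<lambda>t. M (z t) (pd 1 z t) w)"
    by (rule smooth_at_0_cong[OF smooth_at_0_sum[OF s] ev])
  have "taylor_coeff m (\<lambda>t. M (z t) (pd 1 z t) w) = taylor_coeff m (\<lambda>t. \<Sum>b\<in>Basis. (pd 1 z t \<bullet> b) * M (z t) b w)"
    by (rule taylor_coeff_cong[OF ev, symmetric])
  also have "\<dots> = kinetic m w z"
    unfolding kinetic_def using assms(1) sz(1)[OF M_smooth]
    by (simp add: taylor_coeff_sum s taylor_coeff_mult smooth_at_0_inner smooth_at_0_pd taylor_coeff_inner
        taylor_coeff_pd del: of_nat_Suc)
  finally show "kinetic m w z = taylor_coeff m (\<lambda>t. M (z t) (pd 1 z t) w)" by simp
qed

lemma pd_M_expand:
  assumes y: "y \<in> B"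
  shows "pd w (\<lambda>y. M y u u) y = (\<Sum>b\<in>Basis. \<Sum>b'\<in>Basis. (u \<bullet> b) * ((u \<bullet> b') * pd w (\<lambda>y. M y b b') y))"
proof -
  have 1: "linear (\<lambda>u. pd w (\<lambda>y. M y u v) y)" for v
    by (rule linear_pd_family[OF open_B y M_linear(1) smooth_onD[OF M_smooth y]])
  have 2: "linear (\<lambda>v. pd w (\<lambda>y. M y u v) y)" for u
    by (rule linear_pd_family[OF open_B y M_linear(2) smooth_onD[OF M_smooth y]])
  have "pd w (\<lambda>y. M y u u) y = (\<Sum>b\<in>Basis. (u \<bullet> b) *\<^sub>R pd w (\<lambda>y. M y b u) y)"
    by (rule linear_euclidean_sum[OF 1])
  also have "\<dots> = (\<Sum>b\<in>Basis. (u \<bullet> b) *\<^sub>R (\<Sum>b'\<in>Basis. (u \<bullet> b') *\<^sub>R pd w (\<lambda>y. M y b b') y))"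
    by (intro sum.cong refl arg_cong[where f="scaleR _"]) (rule linear_euclidean_sum[OF 2])
  finally show ?thesis by (simp add: sum_distrib_left)
qed

lemma force_eq:
  assumes "smooth_at_0 z" "z 0 \<in> B"
  shows "force m w z = taylor_coeff m (\<lambda>t. pd w (\<lambda>y. M y (pd 1 z t) (pd 1 z t)) (z t))"
proof -
  note sz = smooth_at_0_compose[OF assms(1) open_B assms(2)]
  have ev: "\<forall>\<^sub>F t in nhds 0. pd w (\<lambda>y. M y (pd 1 z t) (pd 1 z t)) (z t)
      = (\<Sum>b\<in>Basis. \<Sum>b'\<in>Basis. (pd 1 z t \<bullet> b) * ((pd 1 z t \<bullet> b') * pd w (\<lambda>y. M y b b') (z t)))"
    by (rule eventually_mono[OF sz(2)[OF \<theta>_smooth]]) (rule pd_M_expand)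
  have v: "smooth_at_0 (\<lambda>t. pd 1 z t \<bullet> b)" for b
    by (intro smooth_at_0_inner smooth_at_0_pd assms)
  have n: "smooth_at_0 (\<lambda>t. pd w (\<lambda>y. M y b b') (z t))" for b b'
    by (rule sz(1)[OF smooth_on_pd[OF M_smooth]])
  show ?thesis
    unfolding taylor_coeff_cong[OF ev] force_def using assms(1)
    by (simp add: taylor_coeff_sum v n smooth_at_0_mult smooth_at_0_sum taylor_coeff_mult
        taylor_coeff_inner smooth_at_0_pd taylor_coeff_pd del: of_nat_Suc)
qed

text \<open>On a straight line the velocity is A itself. Differentiation along A only multiplies by
  a degree, and differentiation along I A is covered by \<open>rotated_weights\<close>.\<close>

lemma kinetic_linear:
  "trig_poly (Suc m) (\<lambda>\<phi>. kinetic (Suc m) w (\<lambda>t. t *\<^sub>R rot \<phi> X))"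
proof -
  have "kinetic (Suc m) w (\<lambda>t. t *\<^sub>R A)
      = real (Suc (Suc m)) * taylor (pd w \<theta>) (Suc (Suc m)) A + taylor (pd (I A) (pd (I w) \<theta>)) (Suc m) A" for A
  proof -
    have "kinetic (Suc m) w (\<lambda>t. t *\<^sub>R A) = taylor_coeff (Suc m) (\<lambda>t. M (t *\<^sub>R A) A w)"
      using kinetic_eq(1)[OF ray_smooth_at_0, of A "Suc m" w] zero_B
        pd_1_eqI[OF ray_has_vector_derivative[of "\<lambda>x. x" _ A]] by (simp add: pd_def)
    also have "\<dots> = taylor (pd A (pd w \<theta>)) (Suc m) A + taylor (pd (I A) (pd (I w) \<theta>)) (Suc m) A"
      unfolding M_def taylor_eq_taylor_coeff
      by (rule taylor_coeff_add) (rule smooth_at_0_ray[OF open_B zero_B pd_\<theta>_smooth])+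
    finally show ?thesis by (simp add: taylor_pd_self[OF smooth_on_pd[OF \<theta>_smooth]] del: of_nat_Suc)
  qed
  then show ?thesis
    by (simp only:) (intro trig_poly_add trig_poly_scale potential_weights rotated_weights(1))
qed

lemma force_linear:
  "trig_poly (Suc m) (\<lambda>\<phi>. force m w (\<lambda>t. t *\<^sub>R rot \<phi> X))"
proof -
  have "force m w (\<lambda>t. t *\<^sub>R A) = real (Suc m) * (real (Suc (Suc m)) * taylor (pd w \<theta>) (Suc (Suc m)) A)
      + taylor (pd (I A) (pd (I A) (pd w \<theta>))) m A" for A
  proof -
    have c: "pd w (pd u (pd u \<theta>)) y = pd u (pd u (pd w \<theta>)) y" if "y \<in> B" for u y
      using pow_pd_commute[OF open_B \<theta>_smooth that, where u=u and n=2 and v=w] by (simp add: numeral_2_eq_2)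
    have "force m w (\<lambda>t. t *\<^sub>R A) = taylor_coeff m (\<lambda>t. pd w (\<lambda>y. M y A A) (t *\<^sub>R A))"
      using force_eq[OF ray_smooth_at_0, of A m w] zero_B
        pd_1_eqI[OF ray_has_vector_derivative[of "\<lambda>x. x" _ A]] by (simp add: pd_def)
    also have "\<dots> = taylor_coeff m (\<lambda>t. pd A (pd A (pd w \<theta>)) (t *\<^sub>R A) + pd (I A) (pd (I A) (pd w \<theta>)) (t *\<^sub>R A))"
    proof (rule taylor_coeff_cong, rule eventually_mono[OF eventually_ray[OF open_B zero_B, of A]])
      fix t assume t: "t *\<^sub>R A \<in> B"
      show "pd w (\<lambda>y. M y A A) (t *\<^sub>R A) = pd A (pd A (pd w \<theta>)) (t *\<^sub>R A) + pd (I A) (pd (I A) (pd w \<theta>)) (t *\<^sub>R A)"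
        unfolding M_def by (simp add: pd_add smooth_onD[OF pd_\<theta>_smooth t] c[OF t])
    qed
    also have "\<dots> = taylor (pd A (pd A (pd w \<theta>))) m A + taylor (pd (I A) (pd (I A) (pd w \<theta>))) m A"
      unfolding taylor_eq_taylor_coeff
      by (rule taylor_coeff_add) (rule smooth_at_0_ray[OF open_B zero_B], intro smooth_on_pd \<theta>_smooth)+
    finally show ?thesis
      by (simp add: taylor_pd_self smooth_on_pd[OF \<theta>_smooth] smooth_on_pd[OF smooth_on_pd[OF \<theta>_smooth]] del: of_nat_Suc)
  qed
  then show ?thesis
    by (simp only:) (intro trig_poly_add trig_poly_scale potential_weights rotated_weights(2))
qed

lemma euler_lagrange_coeff:
  "real (Suc m) * kinetic (Suc m) w (\<lambda>t. E (t *\<^sub>R X)) = force m w (\<lambda>t. E (t *\<^sub>R X)) / 2"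
proof -
  define z where "z = (\<lambda>t. E (t *\<^sub>R X))"
  have z: "smooth_at_0 z" "z 0 \<in> B" unfolding z_def using E_ray_smooth zero_B by (simp_all add: E_0)
  have "real (Suc m) * kinetic (Suc m) w z = taylor_coeff m (pd 1 (\<lambda>t. M (z t) (pd 1 z t) w))"
    using taylor_coeff_pd[OF kinetic_eq(2)[OF z], of m w] by (simp add: kinetic_eq(1)[OF z] del: of_nat_Suc)
  also have "\<dots> = taylor_coeff m (\<lambda>t. pd w (\<lambda>y. M y (pd 1 z t) (pd 1 z t)) (z t) / 2)"
    by (rule taylor_coeff_cong) (use euler_lagrange in \<open>simp add: z_def\<close>)
  also have "\<dots> = force m w z / 2"
  proof -
    note sz = smooth_at_0_compose[OF z(1) open_B z(2)]
    have "smooth_at_0 (\<lambda>t. \<Sum>b\<in>Basis. \<Sum>b'\<in>Basis. (pd 1 z t \<bullet> b) * ((pd 1 z t \<bullet> b') * pd w (\<lambda>y. M y b b') (z t)))"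
      by (intro smooth_at_0_sum smooth_at_0_mult smooth_at_0_inner smooth_at_0_pd z sz(1) smooth_on_pd M_smooth)
    then have "smooth_at_0 (\<lambda>t. pd w (\<lambda>y. M y (pd 1 z t) (pd 1 z t)) (z t))"
      by (rule smooth_at_0_cong)
        (rule eventually_mono[OF sz(2)[OF \<theta>_smooth]], rule pd_M_expand[symmetric])
    from taylor_coeff_bounded_linear[OF bounded_linear_divide[of 2] this, of m]
    show ?thesis by (simp add: force_eq[OF z])
  qed
  finally show ?thesis by (simp add: z_def)
qed

text \<open>In the Euler-Lagrange equation in degree n - 2 the component of E of degree n enters
  only through the top velocity coefficient, paired with the nondegenerate \<open>M 0\<close>. The
  other terms contain lower components, so up to harmless frequencies they can be computed on the
  straight line, where the potential allows no extreme frequency.\<close>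

theorem extreme_weights_vanish:
  "2 \<le> n \<Longrightarrow> b \<in> Basis \<Longrightarrow> trig_poly (n - 1) (\<lambda>\<phi>. taylor E n (rot \<phi> X) \<bullet> b)"
proof (induction n arbitrary: b rule: less_induct)
  case (less n)
  then have IH: "trig_low k (\<lambda>\<phi>. taylor E k (rot \<phi> X) \<bullet> b)" if "2 \<le> k" "k < n" "b \<in> Basis" for k b
    using that by (auto simp: trig_low_def)
  obtain m where n: "n = Suc (Suc m)" using less.prems(1) by (metis Suc_le_D numeral_2_eq_2 Suc_le_mono)
  have Z: "weight_cong l (\<lambda>\<phi>. taylor E l (rot \<phi> X) \<bullet> b) (\<lambda>\<phi>. taylor_coeff l (\<lambda>t. t *\<^sub>R rot \<phi> X) \<bullet> b)"
    if "l < n" "b \<in> Basis" for l b by (rule linear_part_cong[OF IH that])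
  have C: "weight_cong l (\<lambda>\<phi>. taylor_coeff l (\<lambda>t. \<psi> (E (t *\<^sub>R rot \<phi> X)))) (\<lambda>\<phi>. taylor \<psi> l (rot \<phi> X))"
    if "l < n" "smooth_on B \<psi>" for l and \<psi> :: "'a \<Rightarrow> real" by (rule composition_cong[OF IH that])
  have low: "trig_poly (Suc m) a" if "weight_cong n a a'" "trig_poly (Suc m) a'" for a a'
    using that trig_poly_add[of "Suc m" "\<lambda>\<phi>. a \<phi> - a' \<phi>" a'] by (simp add: weight_cong_def trig_low_def n)
  define e where "e = (\<lambda>\<phi> t. E (t *\<^sub>R rot \<phi> X))"
  define r where "r = (\<lambda>\<phi> t. t *\<^sub>R rot \<phi> X)"
  have V: "weight_cong (Suc l) (\<lambda>\<phi>. velocity_coeff (e \<phi>) l b) (\<lambda>\<phi>. velocity_coeff (r \<phi>) l b)"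
    if "Suc l < n" "b \<in> Basis" for l b
    unfolding e_def r_def by (intro weight_cong_scale) (use Z[OF that] in \<open>simp add: taylor_eq_taylor_coeff\<close>)
  have N: "weight_cong l (\<lambda>\<phi>. taylor_coeff l (\<lambda>t. \<psi> (e \<phi> t))) (\<lambda>\<phi>. taylor_coeff l (\<lambda>t. \<psi> (r \<phi> t)))"
    if "l < n" "smooth_on B \<psi>" for l \<psi>
    unfolding e_def r_def using C[OF that] by (simp add: taylor_eq_taylor_coeff)
  \<comment> \<open>The weights of each product add up to (i + 1) + (j + 1) + (m - i - j) = n, and
    no component above degree m + 1 = n - 1 occurs.\<close>
  have F: "weight_cong n (\<lambda>\<phi>. force m w (e \<phi>)) (\<lambda>\<phi>. force m w (r \<phi>))" for w
    unfolding force_def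
  proof (intro weight_cong_sum)
    fix b b' :: 'a and i assume b: "b \<in> Basis" "b' \<in> Basis" and i: "i \<in> {..m}"
    have W: "weight_cong (Suc (m - i)) (\<lambda>\<phi>. \<Sum>j\<le>m - i. velocity_coeff (e \<phi>) j b' * taylor_coeff (m - i - j) (\<lambda>t. pd w (\<lambda>y. M y b b') (e \<phi> t)))
        (\<lambda>\<phi>. \<Sum>j\<le>m - i. velocity_coeff (r \<phi>) j b' * taylor_coeff (m - i - j) (\<lambda>t. pd w (\<lambda>y. M y b b') (r \<phi> t)))"
    proof (intro weight_cong_sum)
      fix j assume j: "j \<in> {..m - i}"
      have "weight_cong (Suc j + (m - i - j)) (\<lambda>\<phi>. velocity_coeff (e \<phi>) j b' * taylor_coeff (m - i - j) (\<lambda>t. pd w (\<lambda>y. M y b b') (e \<phi> t)))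
        (\<lambda>\<phi>. velocity_coeff (r \<phi>) j b' * taylor_coeff (m - i - j) (\<lambda>t. pd w (\<lambda>y. M y b b') (r \<phi> t)))"
        by (intro weight_cong_mult V N b smooth_on_pd M_smooth) (use i j n in auto)
      moreover have "Suc j + (m - i - j) = Suc (m - i)" using j by simp
      ultimately show "weight_cong (Suc (m - i)) (\<lambda>\<phi>. velocity_coeff (e \<phi>) j b' * taylor_coeff (m - i - j) (\<lambda>t. pd w (\<lambda>y. M y b b') (e \<phi> t)))
        (\<lambda>\<phi>. velocity_coeff (r \<phi>) j b' * taylor_coeff (m - i - j) (\<lambda>t. pd w (\<lambda>y. M y b b') (r \<phi> t)))"
        by (simp only:)
    qed
    have i': "Suc i < n" and sum: "Suc i + Suc (m - i) = n" using i n by simp_all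
    from weight_cong_mult[OF V[OF i' b(1)] W] show "weight_cong n (\<lambda>\<phi>. velocity_coeff (e \<phi>) i b * (\<Sum>j\<le>m - i. velocity_coeff (e \<phi>) j b' * taylor_coeff (m - i - j) (\<lambda>t. pd w (\<lambda>y. M y b b') (e \<phi> t))))
        (\<lambda>\<phi>. velocity_coeff (r \<phi>) i b * (\<Sum>j\<le>m - i. velocity_coeff (r \<phi>) j b' * taylor_coeff (m - i - j) (\<lambda>t. pd w (\<lambda>y. M y b b') (r \<phi> t))))"
      unfolding sum .
  qed
  \<comment> \<open>The kinetic term without its top velocity coefficient, the only place where the
    component of degree n appears.\<close>
  define K where "K = (\<lambda>w z. \<Sum>b\<in>Basis. \<Sum>l\<le>m. velocity_coeff z l b * taylor_coeff (Suc m - l) (\<lambda>t. M (z t) b w))"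
  have split: "kinetic (Suc m) w z = K w z + (\<Sum>b\<in>Basis. velocity_coeff z (Suc m) b * M (z 0) b w)" for w z
    by (simp add: kinetic_def K_def sum.distrib del: of_nat_Suc)
  have Kc: "weight_cong n (\<lambda>\<phi>. K w (e \<phi>)) (\<lambda>\<phi>. K w (r \<phi>))" for w
    unfolding K_def
  proof (intro weight_cong_sum)
    fix b :: 'a and l assume b: "b \<in> Basis" and l: "l \<in> {..m}"
    have "weight_cong (Suc l + (Suc m - l)) (\<lambda>\<phi>. velocity_coeff (e \<phi>) l b * taylor_coeff (Suc m - l) (\<lambda>t. M (e \<phi> t) b w))
      (\<lambda>\<phi>. velocity_coeff (r \<phi>) l b * taylor_coeff (Suc m - l) (\<lambda>t. M (r \<phi> t) b w))"
      by (intro weight_cong_mult V N b M_smooth) (use l n in auto)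
    then show "weight_cong n (\<lambda>\<phi>. velocity_coeff (e \<phi>) l b * taylor_coeff (Suc m - l) (\<lambda>t. M (e \<phi> t) b w))
      (\<lambda>\<phi>. velocity_coeff (r \<phi>) l b * taylor_coeff (Suc m - l) (\<lambda>t. M (r \<phi> t) b w))"
      using l n by simp
  qed
  \<comment> \<open>The straight line has no coefficient of degree n >= 2, so the removed term
    vanishes there.\<close>
  have "K w (r \<phi>) = kinetic (Suc m) w (r \<phi>)" for w \<phi>
    unfolding split by (simp add: r_def taylor_coeff_ident_scaleR)
  then have Kr: "trig_poly (Suc m) (\<lambda>\<phi>. K w (e \<phi>))" for w
    by (intro low[OF Kc]) (simp add: r_def kinetic_linear)
  have Fr: "trig_poly (Suc m) (\<lambda>\<phi>. force m w (e \<phi>))" for w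
    by (intro low[OF F]) (simp add: r_def force_linear)
  obtain w where w: "\<And>u. M 0 u w = u \<bullet> b" using M_nondegenerate[OF less.prems(2)] by blast
  \<comment> \<open>The coefficient equation is solved for the component along b, with w dual to b
    under \<open>M 0\<close>.\<close>
  have "taylor E n (rot \<phi> X) \<bullet> b
      = 1 / (2 * real (Suc m) * real n) * force m w (e \<phi>) - 1 / real n * K w (e \<phi>)" for \<phi>
  proof -
    have "(\<Sum>b'\<in>Basis. velocity_coeff (e \<phi>) (Suc m) b' * M (e \<phi> 0) b' w) = real n * (\<Sum>b'\<in>Basis. (taylor E n (rot \<phi> X) \<bullet> b') *\<^sub>R M 0 b' w)"
      by (simp add: e_def E_0 n taylor_eq_taylor_coeff sum_distrib_left mult_ac del: of_nat_Suc)
    also have "\<dots> = real n * (taylor E n (rot \<phi> X) \<bullet> b)"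
      unfolding linear_euclidean_sum[OF M_linear(1)[OF zero_B], symmetric] by (simp add: w)
    finally have *: "(\<Sum>b'\<in>Basis. velocity_coeff (e \<phi>) (Suc m) b' * M (e \<phi> 0) b' w) = real n * (taylor E n (rot \<phi> X) \<bullet> b)" .
    have "real (Suc m) * kinetic (Suc m) w (e \<phi>) = force m w (e \<phi>) / 2"
      unfolding e_def by (rule euler_lagrange_coeff)
    then have "real (Suc m) * (K w (e \<phi>) + real n * (taylor E n (rot \<phi> X) \<bullet> b)) = force m w (e \<phi>) / 2"
      unfolding split * .
    then show ?thesis using n by (simp add: field_simps del: of_nat_Suc)
  qed
  then show ?case
    using trig_poly_diff[OF trig_poly_scale[OF Fr] trig_poly_scale[OF Kr], of "1 / (2 * real (Suc m) * real n)" w "1 / real n" w]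
    by (simp add: n del: of_nat_Suc)
qed

end

section \<open>Curvature order of the coefficients of \<Phi>\<close>

context kaehler_germ
begin

abbreviation Rp :: "nat \<Rightarrow> 'a list \<Rightarrow> 'a" where
  "Rp \<equiv> \<lambda>k. curvature_deriv \<Gamma> k x0"

sublocale composition_algebra I Rp
proof (rule composition_algebra.intro)
  show "linear I" by (rule J_linear[OF x0_dom])
  show "I (I u) = - u" for u by (rule J_square[OF x0_dom])
  show "mlin (k + 3) (Rp k)" for k
    using tensor_field_curvature_deriv[of k] x0_dom by (simp add: tensor_field_def)
qed

lemma Rp_zero: "Rp k (replicate k X @ [X, 0, X]) = 0"
  using linear_0[OF mlinD[OF R_mlin, of "replicate k X @ [X]" "[X]" k]] by simp

text \<open>The term with \<open>jc 0\<close> vanishes and is removed by shifting the index; now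
  every summand starts from \<open>jc (Suc l)\<close>.\<close>

lemma jc_rec':
  "jc (n + 2) X Y = (\<Sum>l<n. (1 / (real ((n + 1) * (n + 2)) * fact (n - Suc l))) *\<^sub>R
    Rp (n - Suc l) (replicate (n - Suc l) X @ [X, jc (Suc l) X Y, X]))"
proof -
  have "jc (n + 2) X Y = (1 / real ((n + 1) * (n + 2))) *\<^sub>R (real ((n + 1) * (n + 2)) *\<^sub>R jc (n + 2) X Y)"
    by (simp del: of_nat_mult)
  also have "\<dots> = (1 / real ((n + 1) * (n + 2))) *\<^sub>R (\<Sum>l<n. (1 / fact (n - Suc l)) *\<^sub>R
      Rp (n - Suc l) (replicate (n - Suc l) X @ [X, jc (Suc l) X Y, X]))"
    unfolding jc_rec sum.atMost_shift by (simp add: jc_0 Rp_zero)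
  finally show ?thesis by (simp add: scaleR_sum_right)
qed

text \<open>Every step of the recursion inserts one curvature factor; only the initial value
  \<open>jc 1\<close>, the identity, has none.\<close>

lemma cps_jc: "cps m (if m = 0 then 0 else 1) (jc (Suc m))"
proof (induction m rule: less_induct)
  case (less m)
  show ?case
  proof (cases m)
    case 0
    have "jc (Suc 0) = (\<lambda>X Y. Y)" by (intro ext jc_1)
    then show ?thesis using 0 cps_id by simp
  next
    case (Suc n)
    have "cps (Suc n) 1 (\<lambda>X Y. Rp (n - Suc l) (replicate (n - Suc l) X @ [X, jc (Suc l) X Y, X]))" if l: "l < n" for l
    proof -
      have "cps l 0 (jc (Suc l))" using less[of l] l Suc cps_mono by auto
      from cps_compose[OF cps_R this, of "n - Suc l"] show ?thesis using l by simp
    qed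
    then have "cps (Suc n) 1 (\<lambda>X Y. jc (n + 2) X Y)"
      unfolding jc_rec' by (intro cps_sum cps_scale) simp
    then show ?thesis using Suc by simp
  qed
qed

lemma jc_2: "jc 2 X Y = 0"
  using jc_rec'[of 0 X Y] by (simp add: numeral_2_eq_2)

text \<open>The summand with \<open>jc 1\<close> is the part linear in the curvature; every other
  summand contains some \<open>jc (l + 2)\<close>, which has a curvature factor of its own.\<close>

lemma cps_jc_remainder:
  "cps (k + 2) 2 (\<lambda>X Y. jc (k + 3) X Y - (real (k + 1) / fact (k + 3)) *\<^sub>R Rp k (replicate k X @ [X, Y, X]))"
proof -
  define c where "c = (\<lambda>l. 1 / (real ((Suc k + 1) * (Suc k + 2)) * fact (k - l)))"
  \<comment> \<open>Since (k + 3)! = (k + 3)(k + 2)(k + 1) k!, the factor 1 / ((k + 2)(k + 3) k!) of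
    the Jacobi recursion is the constant of \<open>linear_term\<close>.\<close>
  have c0: "c 0 = real (k + 1) / fact (k + 3)"
  proof -
    have "fact (k + 3) = real ((Suc k + 1) * (Suc k + 2)) * fact k * real (k + 1)"
      by (simp add: eval_nat_numeral algebra_simps)
    then show ?thesis by (simp add: c_def del: of_nat_mult of_nat_add of_nat_Suc fact_Suc)
  qed
  have "jc (k + 3) X Y - c 0 *\<^sub>R Rp k (replicate k X @ [X, Y, X])
      = (\<Sum>l<k. c (Suc l) *\<^sub>R Rp (k - Suc l) (replicate (k - Suc l) X @ [X, jc (Suc (Suc l)) X Y, X]))" for X Y
    using jc_rec'[of "Suc k" X Y] unfolding sum.lessThan_Suc_shift
    by (simp add: c_def jc_1 numeral_3_eq_3 del: fact_Suc of_nat_mult of_nat_add of_nat_Suc)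
  moreover have "cps (k + 2) 2 (\<lambda>X Y. Rp (k - Suc l) (replicate (k - Suc l) X @ [X, jc (Suc (Suc l)) X Y, X]))"
    if l: "l < k" for l
  proof -
    have "cps (Suc l) 1 (jc (Suc (Suc l)))" using cps_jc[of "Suc l"] by simp
    from cps_compose[OF cps_R this, of "k - Suc l"] show ?thesis using l by (simp add: numeral_2_eq_2)
  qed
  ultimately have "cps (k + 2) 2 (\<lambda>X Y. jc (k + 3) X Y - c 0 *\<^sub>R Rp k (replicate k X @ [X, Y, X]))"
    by (simp only:) (intro cps_sum cps_scale, simp)
  then show ?thesis by (simp only: c0)
qed

text \<open>\<open>yc_rec\<close> in degree n + 1, solved for \<open>yc n\<close>: its coefficient
  \<open>jc 1\<close> is the identity, and the term with \<open>yc (n + 1)\<close> is killed by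
  \<open>jc 0\<close>.\<close>

lemma yc_rec': "yc n X = (if n = 1 then I X else 0) - (\<Sum>l<n. jc (Suc (n - l)) X (yc l X))"
proof -
  have "(\<Sum>l\<le>Suc n. jc (Suc n - l) X (yc l X)) = (\<Sum>l<n. jc (Suc (n - l)) X (yc l X)) + yc n X"
    by (simp add: jc_0 jc_1 lessThan_Suc_atMost[symmetric] Suc_diff_le)
  then show ?thesis using yc_rec[where X=X and n="Suc n"] by (simp add: algebra_simps eval_nat_numeral)
qed

lemma yc_0: "yc 0 X = 0"
  using yc_rec'[of 0 X] by simp

lemma yc_1: "yc (Suc 0) X = I X"
  using yc_rec'[of "Suc 0" X] by (simp add: yc_0 linear_0[OF jc_linear])

lemma cp_yc: "cp n (if n \<le> 1 then 0 else 1) (yc n)"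
proof (induction n rule: less_induct)
  case (less n)
  consider "n = 0" | "n = 1" | "2 \<le> n" by linarith
  then show ?case
  proof cases
    case 1
    have "yc 0 = (\<lambda>X. 0)" by (intro ext yc_0)
    then show ?thesis using 1 comp_poly.zero by simp
  next
    case 2
    have "yc (Suc 0) = I" by (intro ext yc_1)
    then show ?thesis using 2 cp_I_id by simp
  next
    case 3
    have "cp n 1 (\<lambda>X. jc (Suc (n - l)) X (yc l X))" if l: "l < n" for l
    proof -
      have "cp l 0 (yc l)" using less[OF l] cp_mono by (metis le0)
      moreover have "cps (n - l) 1 (jc (Suc (n - l)))" using cps_jc[of "n - l"] l by simp
      ultimately show ?thesis using cps_apply[of "n - l" 1 "jc (Suc (n - l))" l 0 "yc l"] l by simp
    qed
    then have "cp n 1 (\<lambda>X. -1 *\<^sub>R (\<Sum>l<n. jc (Suc (n - l)) X (yc l X)))" by (intro cp_scale cp_sum) simp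
    moreover have "yc n = (\<lambda>X. -1 *\<^sub>R (\<Sum>l<n. jc (Suc (n - l)) X (yc l X)))" using 3 yc_rec'[of n] by auto
    ultimately show ?thesis using 3 by simp
  qed
qed

text \<open>In \<open>yc_rec'\<close> the index 1 gives \<open>jc n X (I X)\<close>; from index 2
  on, both factors contain curvature.\<close>

lemma cp_yc_remainder:
  assumes "2 \<le> n"
  shows "cp n 2 (\<lambda>X. yc n X + jc n X (I X))"
proof -
  obtain m where n: "n = Suc (Suc m)" using assms by (metis Suc_le_D numeral_2_eq_2 Suc_le_mono)
  have "yc n X + jc n X (I X) = -1 *\<^sub>R (\<Sum>l<m. jc (Suc (m - l)) X (yc (Suc (Suc l)) X))" for X
    using yc_rec'[of n X]
    by (simp add: n sum.lessThan_Suc_shift yc_0 yc_1 linear_0[OF jc_linear] del: sum.lessThan_Suc)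
  moreover have "cp n 2 (\<lambda>X. jc (Suc (m - l)) X (yc (Suc (Suc l)) X))" if l: "l < m" for l
  proof -
    have "cp (Suc (Suc l)) 1 (yc (Suc (Suc l)))" using cp_yc[of "Suc (Suc l)"] by simp
    moreover have "cps (m - l) 1 (jc (Suc (m - l)))" using cps_jc[of "m - l"] l by simp
    ultimately show ?thesis
      using cps_apply[of "m - l" 1 "jc (Suc (m - l))" "Suc (Suc l)" 1 "yc (Suc (Suc l))"] l n
      by (simp add: numeral_2_eq_2)
  qed
  ultimately show ?thesis by (simp only:) (intro cp_scale cp_sum, simp)
qed

definition defect :: "nat \<Rightarrow> 'a \<Rightarrow> 'a" where
  "defect n X = taylor (\<lambda>Y. I Y - fpt Y (I Y)) n X"

lemma bounded_linear_I: "bounded_linear I"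
  using I_linear by (rule linear_conv_bounded_linear[THEN iffD1])

lemma smooth_at_0_I_ray: "smooth_at_0 (\<lambda>t. I (t *\<^sub>R X))"
  by (rule smooth_at_0_bounded_linear[OF bounded_linear_I smooth_at_0_linear[OF bounded_linear_scaleR_left]])

lemma defect_smooth: "smooth_at_0 (\<lambda>t. I (t *\<^sub>R X) - fpt (t *\<^sub>R X) (I (t *\<^sub>R X)))"
  using smooth_at_0_add[OF smooth_at_0_I_ray smooth_at_0_minus[OF fpt_smooth_at_0]] by simp

lemma taylor_coeff_I_ray: "taylor_coeff n (\<lambda>t. I (t *\<^sub>R X)) = (if n = 1 then I X else 0)"
  by (simp add: linear_scale[OF I_linear] taylor_coeff_ident_scaleR)

lemma defect_eq: "defect n X = (if n = 1 then I X else 0) - yc n X"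
  using taylor_coeff_add[OF smooth_at_0_I_ray smooth_at_0_minus[OF fpt_smooth_at_0], of n X X]
  by (simp add: defect_def yc_def taylor_eq_taylor_coeff taylor_coeff_I_ray taylor_coeff_minus fpt_smooth_at_0)

lemma defect_low: "n \<le> 1 \<Longrightarrow> defect n X = 0"
  by (cases n) (simp_all add: defect_eq yc_0 yc_1)

lemma cp_defect: "2 \<le> n \<Longrightarrow> cp n 1 (defect n)"
  using cp_scale[OF cp_yc, of n "-1"] by (simp add: defect_eq[abs_def])

text \<open>Up to quadratic terms, (id - \<Phi>(X)) IX in degree n >= 2 is
  \<open>jc n X (I X)\<close>, whose linear part is known. The outer I then moves into the last slot
  of the curvature by \<open>curvature_deriv_commutes_I\<close>.\<close>

lemma cp_defect_remainder: "cp n 2 (\<lambda>X. I (defect n X) - linear_term I Rp n X)"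
proof (cases "n < 3")
  case True
  then have lt: "linear_term I Rp n X = 0" for X by (auto simp: linear_term_def intro!: sum.neutral)
  consider "n \<le> 1" | "n = 2" using True by linarith
  then show ?thesis
  proof cases
    case 1
    then show ?thesis by (simp add: lt defect_low linear_0[OF I_linear] comp_poly.zero)
  next
    case 2
    then show ?thesis
      using cp_I[OF cp_scale[OF cp_yc_remainder[of 2], of "-1"]] by (simp add: lt[unfolded 2] defect_eq jc_2)
  qed
next
  case False
  then obtain k where n: "n = k + 3" by (metis add.commute le_Suc_ex not_less)
  define c where "c = real (k + 1) / fact (k + 3)"
  have lt: "linear_term I Rp n X = c *\<^sub>R Rp k (replicate k X @ [X, I X, I X])" for X
    by (simp add: linear_term_def n c_def)
  have "I (defect n X) - linear_term I Rp n X
      = I (-1 *\<^sub>R (yc n X + jc n X (I X))) + I (jc n X (I X) - c *\<^sub>R Rp k (replicate k X @ [X, I X, X]))" for X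
    unfolding lt curvature_deriv_commutes_I
    by (simp add: defect_eq n linear_add[OF I_linear] linear_diff[OF I_linear] linear_neg[OF I_linear] linear_scale[OF I_linear])
  moreover have "cp n 2 (\<lambda>X. jc n X (I X) - c *\<^sub>R Rp k (replicate k X @ [X, I X, X]))"
    using cps_apply[OF cps_jc_remainder[of k] cp_I_id] by (simp add: n c_def numeral_3_eq_3)
  moreover have "cp n 2 (\<lambda>X. -1 *\<^sub>R (yc n X + jc n X (I X)))"
    by (rule cp_scale[OF cp_yc_remainder]) (simp add: n)
  ultimately show ?thesis by (simp only:) (intro cp_add cp_I)
qed

end

section \<open>The inverse difference element in a chart\<close>

text \<open>Adds the Kaehler normal coordinates k, their inverse ki and a local potential. One
  radius \<rho> and one open set V serve both coordinate systems.\<close>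

locale knc_germ = kaehler_germ \<Omega> g J x0 f fi V \<rho>
  for \<Omega> :: "'a::euclidean_space set" and g J x0 f fi V \<rho> +
  fixes k ki :: "'a \<Rightarrow> 'a" and \<theta> :: "'a \<Rightarrow> real"
  assumes V_dom: "V \<subseteq> \<Omega>"
    and k_smooth: "smooth_on (ball 0 \<rho>) k"
    and k_V: "Z \<in> ball 0 \<rho> \<Longrightarrow> k Z \<in> V"
    and k_0: "k 0 = x0"
    and pd_k_0: "pd v k 0 = v"
    and k_holomorphic: "Z \<in> ball 0 \<rho> \<Longrightarrow> pd (J x0 v) k Z = J (k Z) (pd v k Z)"
    and ki_smooth: "smooth_on V ki"
    and ki_k: "Z \<in> ball 0 \<rho> \<Longrightarrow> ki (k Z) = Z"
    and k_ki: "x \<in> V \<Longrightarrow> k (ki x) = x"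
    and \<theta>_smooth: "smooth_on V \<theta>"
    and \<theta>_potential: "x \<in> V \<Longrightarrow> complex_of_real (g x (J x u) v) = \<i> / 2 * del_del_bar J \<theta> x u v"
    and \<theta>_normal: "(\<lambda>n X. taylor (\<lambda>Z. \<theta> (k Z)) n X - (if n = 2 then g x0 X X else 0)) \<in> Sym_ge_2_2 (J x0)"
begin

abbreviation Bk :: "'a set" where "Bk \<equiv> ball 0 \<rho>"

definition E :: "'a \<Rightarrow> 'a" where "E Z = ki (f Z)"
definition pot :: "'a \<Rightarrow> real" where "pot Z = \<theta> (k Z)"

lemma open_Bk: "open Bk" and zero_Bk: "0 \<in> Bk"
  using rho_pos by auto

lemma E_smooth: "smooth_on Bk E"
  unfolding E_def by (rule smooth_on_compose[OF open_Bk open_V _ f_smooth ki_smooth]) (use f_V in auto)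

lemma pot_smooth: "smooth_on Bk pot"
  unfolding pot_def by (rule smooth_on_compose[OF open_Bk open_V _ k_smooth \<theta>_smooth]) (use k_V in auto)

lemma E_0: "E 0 = 0"
  using ki_k[OF zero_Bk] by (simp add: E_def f_0 k_0)

lemma k_E: "Z \<in> Bk \<Longrightarrow> k (E Z) = f Z"
  unfolding E_def by (rule k_ki[OF f_V])

lemma pd_ki_k: "Z \<in> Bk \<Longrightarrow> pd (pd v k Z) ki (k Z) = v"
proof -
  assume Z: "Z \<in> Bk"
  have "pd (pd v k Z) ki (k Z) = pd v (\<lambda>z. ki (k z)) Z"
    by (rule pd_compose[OF smooth_onD[OF k_smooth Z] smooth_onD[OF ki_smooth k_V[OF Z]], symmetric])
  also have "\<dots> = pd v (\<lambda>z. z) Z" by (rule pd_cong_open[OF open_Bk Z]) (rule ki_k)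
  finally show ?thesis by (simp add: pd_def)
qed

lemma pd_k_ki: "Z \<in> Bk \<Longrightarrow> pd (pd w ki (k Z)) k Z = w"
proof -
  assume Z: "Z \<in> Bk"
  have "inj (\<lambda>v. pd v k Z)" by (rule injI) (metis pd_ki_k[OF Z])
  then have "surj (\<lambda>v. pd v k Z)"
    by (intro linear_injective_imp_surjective[OF pd_linear[OF smooth_onD[OF k_smooth Z]]]) auto
  then obtain v where "w = pd v k Z" by (rule surjE)
  then show ?thesis by (simp only: pd_ki_k[OF Z])
qed

lemma pd_ki_J: "Z \<in> Bk \<Longrightarrow> pd (J (k Z) w) ki (k Z) = I (pd w ki (k Z))"
  using pd_ki_k[of Z "I (pd w ki (k Z))"] by (simp add: k_holomorphic pd_k_ki)

lemma pd_E: "Z \<in> Bk \<Longrightarrow> pd v E Z = pd (pd v f Z) ki (f Z)"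
  unfolding E_def by (rule pd_compose[OF smooth_onD[OF f_smooth] smooth_onD[OF ki_smooth f_V]])

lemma pd_E_0: "pd v E 0 = v"
  using pd_ki_k[OF zero_Bk, of v] by (simp add: pd_E[OF zero_Bk] pd_f_0 pd_k_0 k_0 f_0)

lemma eventually_E_ray: "\<forall>\<^sub>F t in nhds 0. t *\<^sub>R X \<in> Bk \<and> E (t *\<^sub>R X) \<in> Bk"
  by (rule eventually_conj[OF eventually_ray[OF open_Bk zero_Bk]
        smooth_at_0_compose(2)[OF smooth_at_0_ray[OF open_Bk zero_Bk E_smooth] open_Bk _ E_smooth]])
    (simp add: E_0 rho_pos)

text \<open>Holomorphy of ki applied to \<open>eventually_pd_fpt\<close> gives DE(Z)(\<Phi>(Z) IZ) =
  I DE(Z) Z at Z = tX; by I^2 = -1 this is the recursion at the point Z.\<close>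

lemma recursion_pointwise:
  "\<forall>\<^sub>F t in nhds 0. pd (t *\<^sub>R X) E (t *\<^sub>R X) + I (pd (I (t *\<^sub>R X)) E (t *\<^sub>R X))
    = I (pd (I (t *\<^sub>R X) - fpt (t *\<^sub>R X) (I (t *\<^sub>R X))) E (t *\<^sub>R X))"
proof (rule eventually_mono[OF eventually_conj[OF eventually_E_ray eventually_pd_fpt]])
  fix t assume a: "(t *\<^sub>R X \<in> Bk \<and> E (t *\<^sub>R X) \<in> Bk) \<and>
    pd (fpt (t *\<^sub>R X) (I (t *\<^sub>R X))) f (t *\<^sub>R X) = J (f (t *\<^sub>R X)) (pd (t *\<^sub>R X) f (t *\<^sub>R X))"
  define Z where "Z = t *\<^sub>R X"
  have Z: "Z \<in> Bk" "E Z \<in> Bk" using a by (auto simp: Z_def)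
  have "pd (fpt Z (I Z)) f Z = J (f Z) (pd Z f Z)" using a by (simp add: Z_def)
  then have "pd (fpt Z (I Z)) E Z = pd (J (f Z) (pd Z f Z)) ki (f Z)"
    by (simp only: pd_E[OF Z(1)])
  also have "\<dots> = I (pd Z E Z)"
    using pd_ki_J[OF Z(2), of "pd Z f Z"] by (simp add: k_E[OF Z(1)] pd_E[OF Z(1)])
  finally have "pd (fpt Z (I Z)) E Z = I (pd Z E Z)" .
  then show "pd (t *\<^sub>R X) E (t *\<^sub>R X) + I (pd (I (t *\<^sub>R X)) E (t *\<^sub>R X))
      = I (pd (I (t *\<^sub>R X) - fpt (t *\<^sub>R X) (I (t *\<^sub>R X))) E (t *\<^sub>R X))"
    unfolding Z_def[symmetric] linear_diff[OF pd_linear[OF smooth_onD[OF E_smooth Z(1)]]]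
    by (simp add: linear_diff[OF I_linear] I_square)
qed

lemma recursion: "op_N (taylor E) n X + op_Der_I I (taylor E) n X
    = I (series_D (taylor E) (taylor (\<lambda>Y. I Y - fpt Y (I Y))) n X)"
proof -
  note along = taylor_coeff_pd_along[OF open_Bk zero_Bk E_smooth]
  \<comment> \<open>A linear inner series has only the coefficient l = 1, and
    \<open>Suc (n - 1)\<close> equals n except for n = 0, where the component is constant and its
    derivative vanishes.\<close>
  have one: "(\<Sum>l\<le>n. dir_deriv (taylor E (Suc (n - l))) X (if l = 1 then Y else 0)) = dir_deriv (taylor E n) X Y" for Y
  proof -
    have "(\<Sum>l\<le>n. dir_deriv (taylor E (Suc (n - l))) X (if l = 1 then Y else 0))
        = (\<Sum>l\<le>n. if l = 1 then dir_deriv (taylor E (Suc (n - l))) X Y else 0)"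
      by (rule sum.cong[OF refl]) (simp add: dir_deriv_def)
    also have "\<dots> = (if n = 0 then 0 else dir_deriv (taylor E n) X Y)" by simp
    finally show ?thesis by (simp add: dir_deriv_taylor_0)
  qed
  have r: "smooth_at_0 (\<lambda>t. t *\<^sub>R X)" by (rule smooth_at_0_linear[OF bounded_linear_scaleR_left])
  have sm: "smooth_at_0 (\<lambda>t. pd (G t) E (t *\<^sub>R X))" if "smooth_at_0 G" for G
  proof (rule smooth_at_0_cong)
    show "smooth_at_0 (\<lambda>t. \<Sum>b\<in>Basis. (G t \<bullet> b) *\<^sub>R pd b E (t *\<^sub>R X))"
      by (intro smooth_at_0_sum smooth_at_0_scaleR smooth_at_0_inner that
          smooth_at_0_ray[OF open_Bk zero_Bk smooth_on_pd[OF E_smooth]])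
    show "\<forall>\<^sub>F t in nhds 0. (\<Sum>b\<in>Basis. (G t \<bullet> b) *\<^sub>R pd b E (t *\<^sub>R X)) = pd (G t) E (t *\<^sub>R X)"
      by (rule eventually_mono[OF eventually_ray[OF open_Bk zero_Bk]])
        (rule pd_sum_Basis[OF smooth_onD[OF E_smooth], symmetric])
  qed
  have "taylor_coeff n (\<lambda>t. pd (t *\<^sub>R X) E (t *\<^sub>R X) + I (pd (I (t *\<^sub>R X)) E (t *\<^sub>R X)))
      = op_N (taylor E) n X + op_Der_I I (taylor E) n X"
    using one[of X] one[of "I X"]
    by (simp add: taylor_coeff_add taylor_coeff_bounded_linear[OF bounded_linear_I] smooth_at_0_bounded_linear[OF bounded_linear_I]
        sm r smooth_at_0_I_ray along taylor_coeff_ident_scaleR taylor_coeff_I_ray op_N_def op_Der_I_def)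
  moreover have "taylor_coeff n (\<lambda>t. I (pd (I (t *\<^sub>R X) - fpt (t *\<^sub>R X) (I (t *\<^sub>R X))) E (t *\<^sub>R X)))
      = I (series_D (taylor E) (taylor (\<lambda>Y. I Y - fpt Y (I Y))) n X)"
    unfolding taylor_coeff_bounded_linear[OF bounded_linear_I sm[OF defect_smooth]] along[OF defect_smooth]
    by (simp add: series_D_def taylor_eq_taylor_coeff)
  ultimately show ?thesis using taylor_coeff_cong[OF recursion_pointwise] by metis
qed

subsection \<open>The metric in normal coordinates\<close>

text \<open>In the (1,1)-part of the exterior derivative of \<open>del_bar_f J \<theta>\<close>,
  derivatives of J are rewritten by \<open>J_parallel\<close>; the resulting Christoffel terms
  complete the second derivatives of \<theta> to covariant Hessians.\<close>

lemma hessian_metric: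
  assumes x: "x \<in> V"
  shows "4 * g x u v = (pd u (pd v \<theta>) x - pd (\<Gamma> x u v) \<theta> x)
    + (pd (J x u) (pd (J x v) \<theta>) x - pd (\<Gamma> x (J x u) (J x v)) \<theta> x)"
proof -
  have xO: "x \<in> \<Omega>" using x V_dom by blast
  have d\<theta>: "\<theta> differentiable (at x)" "pd w \<theta> differentiable (at x)" for w
    using smooth_onD[OF \<theta>_smooth x] smooth_onD[OF smooth_on_pd[OF \<theta>_smooth] x] by auto
  note lin = pd_linear[OF d\<theta>(1)] and lJ = J_linear[OF xO] and J2 = J_square[OF xO] and G = linear_\<Gamma>[OF xO]
  define D2 where "D2 = (\<lambda>a b. pd a (pd b \<theta>) x)"
  \<comment> \<open>The derivative in direction a of d\<theta>(J b) for constant b, with the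
    derivative of J expressed through \<Gamma>.\<close>
  define c where "c = (\<lambda>a b. D2 a (J x b) + pd (J x (\<Gamma> x a b) - \<Gamma> x a (J x b)) \<theta> x)"
  have D2_sym: "D2 a b = D2 b a" for a b
    unfolding D2_def by (rule pd_commute[OF open_V x \<theta>_smooth])
  have D2_neg: "D2 a (- b) = - D2 a b" for a b
  proof -
    have "linear (\<lambda>b. D2 a b)" unfolding D2_def
      by (rule linear_pd_family[OF open_V x pd_linear[OF smooth_onD[OF \<theta>_smooth]] d\<theta>(2)])
    then show ?thesis by (rule linear_neg)
  qed
  have family: "((\<lambda>y. pd (J y b) \<theta> y) has_derivative (\<lambda>a. c a b)) (at x)" for b
  proof -
    have "((\<lambda>y. pd (J y b) \<theta> y) has_derivative (\<lambda>a. pd a (\<lambda>y. pd (J x b) \<theta> y) x + pd (pd a (\<lambda>y. J y b) x) \<theta> x)) (at x)"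
      by (rule has_derivative_family[OF open_V x pd_linear[OF smooth_onD[OF \<theta>_smooth]] d\<theta>(2)
            has_derivative_pd[OF smooth_onD[OF J_smooth xO]]])
    then show ?thesis by (simp add: c_def D2_def J_parallel[OF xO])
  qed
  have del: "((\<lambda>y. del_bar_f J \<theta> y b) has_derivative (\<lambda>a. (of_real (D2 a b) + \<i> * of_real (c a b)) / 2)) (at x)" for b
  proof -
    have "((\<lambda>y. (complex_of_real (pd b \<theta> y) + \<i> * complex_of_real (pd (J y b) \<theta> y)) / 2) has_derivative
        (\<lambda>a. (of_real (D2 a b) + \<i> * of_real (c a b)) / 2)) (at x)"
      unfolding D2_def
      by (intro bounded_linear.has_derivative[OF bounded_linear_divide] has_derivative_add family
          bounded_linear.has_derivative[OF bounded_linear_mult_right]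
          bounded_linear.has_derivative[OF bounded_linear_of_real] has_derivative_pd[OF d\<theta>(2)])
    then show ?thesis by (simp add: del_bar_f_def[abs_def] pd_def)
  qed
  \<comment> \<open>The real part of the derivative of \<open>del_bar_f\<close> is the symmetric
    \<open>D2\<close>, which drops out.\<close>
  have ext: "ext_deriv (del_bar_f J \<theta>) x a b = \<i> / 2 * of_real (c a b - c b a)" for a b
  proof -
    have "frechet_derivative (\<lambda>y. del_bar_f J \<theta> y b) (at x) a = (of_real (D2 a b) + \<i> * of_real (c a b)) / 2" for a b
      using pd_eqI[OF del, of a b] by (simp add: pd_def)
    then show ?thesis using D2_sym[of a b] by (simp add: ext_deriv_def field_simps)
  qed
  have "complex_of_real (g x (J x a) b) = of_real (- (c a b - c b a + c (J x a) (J x b) - c (J x b) (J x a)) / 8)" for a b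
    unfolding \<theta>_potential[OF x] del_del_bar_def ext by (simp add: field_simps power2_eq_square[symmetric])
  then have "g x (J x a) b = - (c a b - c b a + c (J x a) (J x b) - c (J x b) (J x a)) / 8" for a b
    using of_real_eq_iff by blast
  \<comment> \<open>Since J(-J u) = u, this choice of a isolates g(u, v).\<close>
  from this[of "- J x u" v]
  have "8 * g x u v = - (c (- J x u) v - c v (- J x u) + c u (J x v) - c (J x v) u)"
    by (simp add: linear_neg[OF lJ] J2)
  moreover have "c (- J x u) v = - D2 (J x u) (J x v) - pd (J x (\<Gamma> x (J x u) v)) \<theta> x + pd (\<Gamma> x (J x u) (J x v)) \<theta> x"
    using D2_neg[of "J x v" "J x u"] D2_sym[of "- J x u" "J x v"] D2_sym[of "J x u" "J x v"]
    by (simp add: c_def linear_neg[OF G(2)] linear_diff[OF lin] linear_neg[OF lin] linear_neg[OF lJ])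
  moreover have "c v (- J x u) = D2 u v - pd (J x (\<Gamma> x (J x u) v)) \<theta> x - pd (\<Gamma> x u v) \<theta> x"
    using D2_sym[of v u]
    by (simp add: c_def linear_neg[OF lJ] J2 linear_neg[OF G(1)] linear_neg[OF G(2)] linear_diff[OF lin] linear_neg[OF lin] \<Gamma>_sym[OF xO, of v])
  moreover have "c u (J x v) = - D2 u v + pd (J x (\<Gamma> x u (J x v))) \<theta> x + pd (\<Gamma> x u v) \<theta> x"
    by (simp add: c_def J2 D2_neg linear_neg[OF G(1)] linear_add[OF lin])
  moreover have "c (J x v) u = D2 (J x u) (J x v) + pd (J x (\<Gamma> x u (J x v))) \<theta> x - pd (\<Gamma> x (J x u) (J x v)) \<theta> x"
    using D2_sym[of "J x u" "J x v"]
    by (simp add: c_def linear_diff[OF lin] \<Gamma>_sym[OF xO, of "J x v"])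
  ultimately show ?thesis by (simp add: D2_def)
qed

lemma pd_J_along_k:
  assumes y: "y \<in> Bk" and U: "(U has_derivative U') (at y)"
  shows "pd a (\<lambda>y. J (k y) (U y)) y
    = J (k y) (\<Gamma> (k y) (pd a k y) (U y)) - \<Gamma> (k y) (pd a k y) (J (k y) (U y)) + J (k y) (U' a)"
proof -
  have ky: "k y \<in> \<Omega>" using k_V[OF y] V_dom by blast
  have kd: "k differentiable (at y)" by (rule smooth_onD[OF k_smooth y])
  have "((\<lambda>y. J (k y) (U y)) has_derivative (\<lambda>a. pd a (\<lambda>z. J (k z) (U y)) y + J (k y) (U' a))) (at y)"
    by (rule has_derivative_family[OF open_Bk y _ _ U])
      (use k_V V_dom J_linear in \<open>auto intro!: differentiable_chain_at[unfolded o_def, OF kd] smooth_onD[OF J_smooth ky]\<close>)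
  from pd_eqI[OF this, of a] show ?thesis
    using pd_compose[OF kd smooth_onD[OF J_smooth ky], of a "U y"] by (simp add: J_parallel[OF ky])
qed

text \<open>Differentiating \<open>k_holomorphic\<close> for each of the two arguments, with
  \<open>J_parallel\<close>, shows that the covariant Hessian of k is complex bilinear: its values
  on (u, v) and (Iu, Iv) cancel.\<close>

lemma pd_pd_k:
  assumes y: "y \<in> Bk"
  shows "pd u (pd v k) y + pd (I u) (pd (I v) k) y
    = - \<Gamma> (k y) (pd u k y) (pd v k y) - \<Gamma> (k y) (J (k y) (pd u k y)) (J (k y) (pd v k y))"
proof -
  have ky: "k y \<in> \<Omega>" using k_V[OF y] V_dom by blast
  note lJ = J_linear[OF ky] and J2 = J_square[OF ky]
  define a where "a = pd u k y"
  define b where "b = pd v k y"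
  have d: "(pd w k has_derivative (\<lambda>c. pd c (pd w k) y)) (at y)" for w
    by (rule has_derivative_pd[OF smooth_onD[OF smooth_on_pd[OF k_smooth] y]])
  have step: "pd c (pd (I w) k) y = J (k y) (\<Gamma> (k y) (pd c k y) (pd w k y))
      - \<Gamma> (k y) (pd c k y) (J (k y) (pd w k y)) + J (k y) (pd c (pd w k) y)" for c w
    unfolding pd_J_along_k[OF y d, symmetric]
    by (rule pd_cong_open[OF open_Bk y]) (rule k_holomorphic)
  have 1: "pd (I u) (pd (I v) k) y = J (k y) (\<Gamma> (k y) (J (k y) a) b) - \<Gamma> (k y) (J (k y) a) (J (k y) b)
      + J (k y) (pd v (pd (I u) k) y)"
    unfolding step[of "I u" v] pd_commute[OF open_Bk y k_smooth, of "I u" v] k_holomorphic[OF y] a_def b_def ..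
  have 2: "J (k y) (pd v (pd (I u) k) y) = - \<Gamma> (k y) b a - J (k y) (\<Gamma> (k y) b (J (k y) a)) - pd u (pd v k) y"
    unfolding step[of v u] pd_commute[OF open_Bk y k_smooth, of v u] a_def b_def
    by (simp add: linear_add[OF lJ] linear_diff[OF lJ] J2)
  show ?thesis
    unfolding 1 2 a_def[symmetric] b_def[symmetric] \<Gamma>_sym[OF ky, of b] by simp
qed

definition M :: "'a \<Rightarrow> 'a \<Rightarrow> 'a \<Rightarrow> real" where
  "M = (\<lambda>y u v. pd u (pd v pot) y + pd (I u) (pd (I v) pot) y)"

text \<open>The second derivatives of k from the chain rule supply exactly the Christoffel terms of
  \<open>hessian_metric\<close>.\<close>

lemma M_eq:
  assumes y: "y \<in> Bk"
  shows "M y u v = 4 * g (k y) (pd u k y) (pd v k y)"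
proof -
  have kV: "k y \<in> V" by (rule k_V[OF y])
  have "pd u (pd v pot) y = pd (pd u k y) (pd (pd v k y) \<theta>) (k y) + pd (pd u (pd v k) y) \<theta> (k y)" for u v
  proof -
    have kd: "k differentiable (at y)" by (rule smooth_onD[OF k_smooth y])
    have td: "pd w \<theta> differentiable (at (k y))" for w by (rule smooth_onD[OF smooth_on_pd[OF \<theta>_smooth] kV])
    have "pd u (pd v pot) y = pd u (\<lambda>y. pd (pd v k y) \<theta> (k y)) y"
      unfolding pot_def[abs_def]
      by (rule pd_cong_open[OF open_Bk y])
        (rule pd_compose[OF smooth_onD[OF k_smooth] smooth_onD[OF \<theta>_smooth k_V]])
    also have "((\<lambda>z. pd (pd v k z) \<theta> (k z)) has_derivative
        (\<lambda>u. pd u (\<lambda>z. pd (pd v k y) \<theta> (k z)) y + pd (pd u (pd v k) y) \<theta> (k y))) (at y)"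
      by (rule has_derivative_family[where h="\<lambda>z w. pd w \<theta> (k z)", OF open_Bk y
            pd_linear[OF smooth_onD[OF \<theta>_smooth k_V]] differentiable_chain_at[unfolded o_def, OF kd td]
            has_derivative_pd[OF smooth_onD[OF smooth_on_pd[OF k_smooth] y]]])
    then have "pd u (\<lambda>y. pd (pd v k y) \<theta> (k y)) y
        = pd u (\<lambda>z. pd (pd v k y) \<theta> (k z)) y + pd (pd u (pd v k) y) \<theta> (k y)" by (rule pd_eqI)
    finally show ?thesis by (simp add: pd_compose[OF kd td])
  qed
  moreover have "pd (pd u (pd v k) y) \<theta> (k y) + pd (pd (I u) (pd (I v) k) y) \<theta> (k y)
      = pd (- \<Gamma> (k y) (pd u k y) (pd v k y) - \<Gamma> (k y) (J (k y) (pd u k y)) (J (k y) (pd v k y))) \<theta> (k y)"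
    unfolding pd_pd_k[OF y, symmetric] by (rule linear_add[OF pd_linear[OF smooth_onD[OF \<theta>_smooth kV]], symmetric])
  ultimately show ?thesis
    using hessian_metric[OF kV, of "pd u k y" "pd v k y"]
    by (simp add: M_def k_holomorphic[OF y] linear_diff[OF pd_linear[OF smooth_onD[OF \<theta>_smooth kV]]]
        linear_neg[OF pd_linear[OF smooth_onD[OF \<theta>_smooth kV]]])
qed

text \<open>By \<open>M_eq\<close> both sides become expressions in g along the geodesic f(tX). On
  the left the geodesic equation cancels one Christoffel term; on the right metric compatibility
  yields twice the two terms that remain on the left.\<close>

lemma euler_lagrange_at:
  assumes t: "t *\<^sub>R X \<in> Bk" "E (t *\<^sub>R X) \<in> Bk"
  shows "pd 1 (\<lambda>t. M (E (t *\<^sub>R X)) (pd 1 (\<lambda>t. E (t *\<^sub>R X)) t) w) t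
    = pd w (\<lambda>y. M y (pd 1 (\<lambda>t. E (t *\<^sub>R X)) t) (pd 1 (\<lambda>t. E (t *\<^sub>R X)) t)) (E (t *\<^sub>R X)) / 2"
proof -
  define z where "z = (\<lambda>t. E (t *\<^sub>R X))"
  define x where "x = f (t *\<^sub>R X)"
  define vel where "vel = pd X f (t *\<^sub>R X)"
  define u where "u = pd 1 z t"
  define b where "b = pd w k (z t)"
  define S where "S = {s. s *\<^sub>R X \<in> Bk \<and> E (s *\<^sub>R X) \<in> Bk}"
  have zt: "z t \<in> Bk" and tS: "t \<in> S" using t by (auto simp: z_def S_def)
  have xO: "x \<in> \<Omega>" unfolding x_def by (rule f_dom[OF t(1)])
  have kz: "k (z t) = x" using k_E[OF t(1)] by (simp add: z_def x_def)
  have S: "open S"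
  proof -
    have "open (Bk \<inter> E -` Bk)" by (rule continuous_open_preimage[OF smooth_on_continuous[OF E_smooth] open_Bk open_Bk])
    moreover have "S = (\<lambda>s. s *\<^sub>R X) -` (Bk \<inter> E -` Bk)" by (auto simp: S_def)
    moreover have "continuous_on UNIV (\<lambda>s::real. s *\<^sub>R X)" by (intro continuous_intros)
    ultimately show ?thesis by (simp only: open_vimage)
  qed
  have zd: "(z has_vector_derivative pd X E (s *\<^sub>R X)) (at s)" if "s \<in> S" for s
    unfolding z_def by (rule ray_has_vector_derivative[OF smooth_onD[OF E_smooth]]) (use that in \<open>simp add: S_def\<close>)
  have vel: "pd (pd 1 z s) k (z s) = pd X f (s *\<^sub>R X)" if "s \<in> S" for s
  proof -
    have s: "s *\<^sub>R X \<in> Bk" "E (s *\<^sub>R X) \<in> Bk" using that by (auto simp: S_def)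
    have "pd (pd 1 z s) k (z s) = pd X (\<lambda>Z. k (E Z)) (s *\<^sub>R X)"
      unfolding pd_1_eqI[OF zd[OF that]] unfolding z_def
      by (rule pd_compose[OF smooth_onD[OF E_smooth s(1)] smooth_onD[OF k_smooth s(2)], symmetric])
    also have "\<dots> = pd X f (s *\<^sub>R X)" by (rule pd_cong_open[OF open_Bk s(1)]) (rule k_E)
    finally show ?thesis .
  qed
  have fd: "((\<lambda>t. f (t *\<^sub>R X)) has_vector_derivative vel) (at t)"
    unfolding vel_def by (rule ray_has_vector_derivative[OF smooth_onD[OF f_smooth t(1)]])
  have veld: "((\<lambda>t. pd X f (t *\<^sub>R X)) has_vector_derivative - \<Gamma> x vel vel) (at t)"
    using ray_has_vector_derivative[OF smooth_onD[OF smooth_on_pd[OF f_smooth, of X] t(1)]] f_geodesic[OF t(1)]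
    by (simp add: x_def vel_def)
  have kwd: "((\<lambda>s. pd w k (z s)) has_vector_derivative pd u (pd w k) (z t)) (at t)"
  proof -
    have "pd w k differentiable (at (z t))" by (rule smooth_onD[OF smooth_on_pd[OF k_smooth] zt])
    moreover have "(z has_vector_derivative u) (at t)" using zd[OF tS] pd_1_eqI[OF zd[OF tS]] by (simp add: u_def)
    ultimately show ?thesis
      using has_derivative_compose[of z "\<lambda>s. s *\<^sub>R u" t UNIV "pd w k" "\<lambda>v. pd v (pd w k) (z t)"]
        has_derivative_pd[of "pd w k" "z t"] linear_scale[OF pd_linear[of "pd w k" "z t"]]
      by (simp add: has_vector_derivative_def)
  qed
  note gl = g_linear[OF xO]
  have "((\<lambda>s. g (f (s *\<^sub>R X)) (pd X f (s *\<^sub>R X)) (pd w k (z s))) has_vector_derivative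
      pd vel (\<lambda>y. g y (pd X f (t *\<^sub>R X)) (pd w k (z t))) (f (t *\<^sub>R X)) + g (f (t *\<^sub>R X)) (- \<Gamma> x vel vel) (pd w k (z t))
      + g (f (t *\<^sub>R X)) (pd X f (t *\<^sub>R X)) (pd u (pd w k) (z t))) (at t)"
    by (rule bilinear_along[OF open_dom g_bilinear g_smooth fd _ _ veld kwd]) (use xO in \<open>auto simp: x_def\<close>)
  then have L: "((\<lambda>s. g (f (s *\<^sub>R X)) (pd X f (s *\<^sub>R X)) (pd w k (z s))) has_vector_derivative
      g x vel (\<Gamma> x vel b) + g x vel (pd u (pd w k) (z t))) (at t)"
    unfolding x_def[symmetric] vel_def[symmetric] b_def[symmetric] g_compatible[OF xO] by (simp add: linear_neg[OF gl(2)])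
  have "pd 1 (\<lambda>s. M (z s) (pd 1 z s) w) t = pd 1 (\<lambda>s. 4 * g (f (s *\<^sub>R X)) (pd X f (s *\<^sub>R X)) (pd w k (z s))) t"
  proof (rule pd_cong_open[OF S tS])
    fix s assume s: "s \<in> S"
    then have "z s \<in> Bk" "k (z s) = f (s *\<^sub>R X)" using k_E by (auto simp: S_def z_def)
    then show "M (z s) (pd 1 z s) w = 4 * g (f (s *\<^sub>R X)) (pd X f (s *\<^sub>R X)) (pd w k (z s))"
      by (simp add: M_eq vel[OF s])
  qed
  also have "\<dots> = 4 * (g x vel (\<Gamma> x vel b) + g x vel (pd u (pd w k) (z t)))"
    by (rule pd_1_eqI) (use bounded_linear.has_vector_derivative[OF bounded_linear_mult_right L, of 4] in simp)
  finally have left: "pd 1 (\<lambda>s. M (z s) (pd 1 z s) w) t = 4 * (g x vel (\<Gamma> x vel b) + g x vel (pd u (pd w k) (z t)))" .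
  have "pd w (\<lambda>y. M y u u) (z t) = pd w (\<lambda>y. 4 * g (k y) (pd u k y) (pd u k y)) (z t)"
    by (rule pd_cong_open[OF open_Bk zt]) (rule M_eq)
  also have "\<dots> = 4 * (2 * g x vel (\<Gamma> x vel b) + 2 * g x vel (pd u (pd w k) (z t)))"
  proof -
    define c where "c = (\<lambda>s::real. z t + s *\<^sub>R w)"
    have c: "(c has_vector_derivative w) (at 0)" "c 0 = z t"
      by (auto simp: c_def has_vector_derivative_def intro!: derivative_eq_intros)
    have comp: "((\<lambda>s. h (c s)) has_vector_derivative pd w h (z t)) (at 0)" if "h differentiable (at (z t))"
      for h :: "'a \<Rightarrow> 'c::real_normed_vector"
      using has_derivative_compose[OF c(1)[unfolded has_vector_derivative_def], of h "\<lambda>v. pd v h (z t)"]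
        has_derivative_pd[OF that] linear_scale[OF pd_linear[OF that]]
      by (simp add: c(2) has_vector_derivative_def)
    have kd: "((\<lambda>s. k (c s)) has_vector_derivative b) (at 0)"
      unfolding b_def by (rule comp[OF smooth_onD[OF k_smooth zt]])
    have ud: "((\<lambda>s. pd u k (c s)) has_vector_derivative pd u (pd w k) (z t)) (at 0)"
      using comp[OF smooth_onD[OF smooth_on_pd[OF k_smooth] zt], of u] pd_commute[OF open_Bk zt k_smooth, of w u] by simp
    have uv: "pd u k (z t) = vel" using vel[OF tS] by (simp add: u_def vel_def)
    have "((\<lambda>s. g (k (c s)) (pd u k (c s)) (pd u k (c s))) has_vector_derivative
        pd b (\<lambda>y. g y (pd u k (c 0)) (pd u k (c 0))) (k (c 0)) + g (k (c 0)) (pd u (pd w k) (z t)) (pd u k (c 0))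
        + g (k (c 0)) (pd u k (c 0)) (pd u (pd w k) (z t))) (at 0)"
      by (rule bilinear_along[OF open_dom g_bilinear g_smooth kd _ _ ud ud]) (use xO in \<open>auto simp: c kz\<close>)
    then have "((\<lambda>s. g (k (c s)) (pd u k (c s)) (pd u k (c s))) has_vector_derivative
        2 * g x vel (\<Gamma> x vel b) + 2 * g x vel (pd u (pd w k) (z t))) (at 0)"
      by (simp add: c kz uv g_compatible[OF xO] g_sym[OF xO, of _ vel] \<Gamma>_sym[OF xO, of b vel] add.commute)
    from bounded_linear.has_vector_derivative[OF bounded_linear_mult_right this, of 4]
    have d1: "((\<lambda>s. 4 * g (k (c s)) (pd u k (c s)) (pd u k (c s))) has_vector_derivative
        4 * (2 * g x vel (\<Gamma> x vel b) + 2 * g x vel (pd u (pd w k) (z t)))) (at 0)" .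
    have sg: "smooth_on Bk (\<lambda>y. g (k y) (pd u k y) (pd u k y))"
    proof (rule smooth_on_cong[OF open_Bk])
      show "smooth_on Bk (\<lambda>y. M y u u / 4)"
        unfolding M_def
        by (intro smooth_on_bounded_linear[OF open_Bk bounded_linear_divide] smooth_on_add open_Bk smooth_on_pd pot_smooth)
    qed (simp add: M_eq)
    have d2: "((\<lambda>s. 4 * g (k (c s)) (pd u k (c s)) (pd u k (c s))) has_vector_derivative
        pd w (\<lambda>y. 4 * g (k y) (pd u k y) (pd u k y)) (z t)) (at 0)"
      by (rule comp, rule smooth_onD[OF smooth_on_bounded_linear[OF open_Bk bounded_linear_mult_right sg] zt])
    show ?thesis by (rule vector_derivative_unique_at[OF d2 d1])
  qed
  finally have right: "pd w (\<lambda>y. M y u u) (z t) = 4 * (2 * g x vel (\<Gamma> x vel b) + 2 * g x vel (pd u (pd w k) (z t)))" .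
  have "pd 1 (\<lambda>s. M (z s) (pd 1 z s) w) t = pd w (\<lambda>y. M y u u) (z t) / 2" using left right by simp
  then show ?thesis unfolding u_def unfolding z_def .
qed

subsection \<open>Weights of the potential\<close>

text \<open>\<open>Sym_bideg\<close> gives the derivative on straight lines in direction IX only;
  differentiability allows the chain rule along rotations.\<close>

lemma homogeneous_polynomial_differentiable:
  assumes "homogeneous_polynomial n (\<eta> :: 'a \<Rightarrow> complex)"
  shows "\<eta> differentiable (at X)"
proof -
  obtain a where a: "\<And>X. \<eta> X = (\<Sum>m\<in>{m \<in> multi_indices. (\<Sum>b\<in>Basis. m b) = n}. monomial m X *\<^sub>R a m)"
    using assms unfolding homogeneous_polynomial_def by blast
  have "monomial m differentiable (at X)" for m :: "'a \<Rightarrow> nat"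
  proof -
    have "((\<lambda>X. \<Prod>b\<in>Basis. (X \<bullet> b) ^ m b) has_derivative
        (\<lambda>y. \<Sum>i\<in>Basis. (real (m i) * (y \<bullet> i) * (X \<bullet> i) ^ (m i - 1)) * (\<Prod>j\<in>Basis - {i}. (X \<bullet> j) ^ m j))) (at X)"
      by (rule has_derivative_prod) (auto intro!: derivative_eq_intros)
    then show ?thesis unfolding monomial_def[abs_def] by (rule differentiableI)
  qed
  then have "((\<lambda>X. \<Sum>m\<in>{m \<in> multi_indices. (\<Sum>b\<in>Basis. m b) = n}. monomial m X *\<^sub>R a m) has_derivative
      (\<lambda>y. \<Sum>m\<in>{m \<in> multi_indices. (\<Sum>b\<in>Basis. m b) = n}. pd y (monomial m) X *\<^sub>R a m)) (at X)"
    by (intro has_derivative_sum has_derivative_scaleR_left has_derivative_pd)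
  from differentiableI[OF this]
  have "(\<lambda>X. \<Sum>m\<in>{m \<in> multi_indices. (\<Sum>b\<in>Basis. m b) = n}. monomial m X *\<^sub>R a m) differentiable (at X)" .
  moreover have "\<eta> = (\<lambda>X. \<Sum>m\<in>{m \<in> multi_indices. (\<Sum>b\<in>Basis. m b) = n}. monomial m X *\<^sub>R a m)"
    by (rule ext) (rule a)
  ultimately show ?thesis by simp
qed

text \<open>The infinitesimal weight is a scalar linear differential equation for \<eta> along the
  orbit; multiplied by the inverse exponential, \<eta> becomes constant.\<close>

lemma Sym_bideg_rot:
  assumes "\<eta> \<in> Sym_bideg I \<kappa> \<kappa>'"
  shows "\<eta> (rot \<phi> X) = cis ((real \<kappa> - real \<kappa>') * \<phi>) * \<eta> X"
proof -
  define c where "c = real \<kappa> - real \<kappa>'"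
  have hp: "homogeneous_polynomial (\<kappa> + \<kappa>') \<eta>" and fl: "\<And>X. ((\<lambda>t. \<eta> (X + t *\<^sub>R I X)) has_vector_derivative
        \<i> * (of_nat \<kappa> - of_nat \<kappa>') * \<eta> X) (at 0)" using assms by (auto simp: Sym_bideg_def)
  have along: "((\<lambda>s. \<eta> (A s)) has_vector_derivative pd A' \<eta> (A s)) (at s)"
    if "(A has_vector_derivative A') (at s)" for A A' s
  proof -
    note d = homogeneous_polynomial_differentiable[OF hp, of "A s"]
    from has_derivative_compose[OF that[unfolded has_vector_derivative_def] has_derivative_pd[OF d]]
    show ?thesis using linear_scale[OF pd_linear[OF d]] by (simp add: has_vector_derivative_def)
  qed
  have flow: "pd (I Z) \<eta> Z = \<i> * of_real c * \<eta> Z" for Z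
  proof -
    have "((\<lambda>t. Z + t *\<^sub>R I Z) has_vector_derivative I Z) (at 0)"
      by (auto intro!: derivative_eq_intros simp: has_vector_derivative_def)
    from vector_derivative_unique_at[OF along[OF this] fl[of Z]] show ?thesis by (simp add: c_def)
  qed
  have cd: "((\<lambda>\<phi>. cis (- c * \<phi>)) has_vector_derivative - \<i> * of_real c * cis (- c * \<phi>)) (at \<phi>)" for \<phi>
  proof -
    have "((\<lambda>\<phi>. cis (- c * \<phi>)) has_vector_derivative (- c) *\<^sub>R (\<i> * cis (- c * \<phi>))) (at \<phi>)"
      unfolding cis_conv_exp
      by (auto intro!: derivative_eq_intros has_vector_derivative_real_field simp: scaleR_conv_of_real)
    then show ?thesis by (simp add: scaleR_conv_of_real mult_ac)
  qed
  have "((\<lambda>\<phi>. cis (- c * \<phi>) * \<eta> (rot \<phi> X)) has_vector_derivative 0) (at \<phi> within UNIV)" for \<phi>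
    using has_vector_derivative_mult[OF cd along[OF rot_deriv_1[of X \<phi>]]] by (simp add: flow mult_ac)
  then obtain K where K: "\<And>\<phi>. cis (- c * \<phi>) * \<eta> (rot \<phi> X) = K"
    by (rule has_vector_derivative_zero_constant[OF convex_UNIV]) (rule that, simp)
  have "K = \<eta> X" using K[of 0] by simp
  moreover have "cis (c * \<phi>) * cis (- c * \<phi>) = 1" by (simp add: cis_mult)
  ultimately have "\<eta> (rot \<phi> X) = cis (c * \<phi>) * \<eta> X" using K[of \<phi>] by (metis mult.assoc mult.left_neutral)
  then show ?thesis by (simp add: c_def)
qed

text \<open>The real part is half the sum with the conjugate and has the frequencies j and -j; the
  hypothesis makes both exponents m + j and m - j natural numbers.\<close>

lemma trig_poly_Re_cis:
  assumes "\<bar>j\<bar> \<le> int m"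
  shows "trig_poly m (\<lambda>\<phi>. Re (cis (real_of_int j * \<phi>) * \<alpha>))"
  unfolding trig_poly_def
proof (intro exI[of _ "monom (\<alpha> / 2) (nat (int m + j)) + monom (cnj \<alpha> / 2) (nat (int m - j))"] conjI allI)
  show "degree (monom (\<alpha> / 2) (nat (int m + j)) + monom (cnj \<alpha> / 2) (nat (int m - j))) \<le> 2 * m"
    by (intro degree_add_le order_trans[OF degree_monom_le]) (use assms in auto)
  fix \<phi>
  have "complex_of_real (Re z) = z / 2 + cnj z / 2" for z by (simp add: complex_eq_iff)
  from this[of "cis (real_of_int j * \<phi>) * \<alpha>"]
  have "complex_of_real (Re (cis (real_of_int j * \<phi>) * \<alpha>)) * cis (real m * \<phi>)
      = cis (real_of_int j * \<phi>) * cis (real m * \<phi>) * \<alpha> / 2 + cis (- (real_of_int j * \<phi>)) * cis (real m * \<phi>) * cnj \<alpha> / 2"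
    by (simp add: algebra_simps cis_cnj)
  moreover have "cis \<phi> ^ nat (int m + j) = cis (real_of_int j * \<phi>) * cis (real m * \<phi>)"
    "cis \<phi> ^ nat (int m - j) = cis (- (real_of_int j * \<phi>)) * cis (real m * \<phi>)"
    using assms by (simp_all add: Complex.DeMoivre cis_mult algebra_simps)
  ultimately show "complex_of_real (Re (cis (real_of_int j * \<phi>) * \<alpha>)) * cis (real m * \<phi>)
      = poly (monom (\<alpha> / 2) (nat (int m + j)) + monom (cnj \<alpha> / 2) (nat (int m - j))) (cis \<phi>)"
    by (simp add: poly_monom mult.commute)
qed

lemma rot_linear: "rot \<phi> (u + s *\<^sub>R v) = rot \<phi> u + s *\<^sub>R rot \<phi> v"
  by (simp add: rot_def linear_add[OF I_linear] linear_scale[OF I_linear] algebra_simps)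

text \<open>When the direction rotates along with the point, only the frequencies 2\<kappa> - n of
  the potential occur, and \<kappa>, n - \<kappa> >= 2 keeps them within m. Expressing the fixed
  direction w by rotating ones costs one more frequency.\<close>

lemma pot_weights: "trig_poly (Suc m) (\<lambda>\<phi>. taylor (pd w pot) (Suc (Suc m)) (rot \<phi> X))"
proof -
  \<comment> \<open>A first derivative in degree m + 2 stems from the potential in degree m + 3,
    which exceeds 2, so the metric term is absent.\<close>
  define n where "n = Suc (Suc (Suc m))"
  obtain \<eta> where \<eta>: "\<And>\<kappa> \<kappa>'. \<eta> \<kappa> \<kappa>' \<in> Sym_bideg I \<kappa> \<kappa>'" "\<And>\<kappa> \<kappa>'. \<kappa> < 2 \<or> \<kappa>' < 2 \<Longrightarrow> \<eta> \<kappa> \<kappa>' = (\<lambda>X. 0)"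
    "\<And>n X. complex_of_real (taylor pot n X - (if n = 2 then g x0 X X else 0)) = (\<Sum>\<kappa>\<le>n. \<eta> \<kappa> (n - \<kappa>) X)"
    using \<theta>_normal unfolding Sym_ge_2_2_def pot_def[abs_def] by blast
  have tn: "taylor pot n Z = Re (\<Sum>\<kappa>\<le>n. \<eta> \<kappa> (n - \<kappa>) Z)" for Z
    using arg_cong[OF \<eta>(3)[of n Z], of Re] by (simp add: n_def del: sum.atMost_Suc Re_sum)
  have part: "trig_poly m (\<lambda>\<phi>. taylor (pd (rot \<phi> U) pot) (Suc (Suc m)) (rot \<phi> X))" for U
  proof -
    define \<alpha> where "\<alpha> = (\<lambda>\<kappa>. pd U (\<eta> \<kappa> (n - \<kappa>)) X)"
    have d\<eta>: "((\<lambda>s. \<eta> \<kappa> (n - \<kappa>) (X + s *\<^sub>R U)) has_vector_derivative \<alpha> \<kappa>) (at 0)" for \<kappa>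
    proof -
      have "homogeneous_polynomial (\<kappa> + (n - \<kappa>)) (\<eta> \<kappa> (n - \<kappa>))" using \<eta>(1) by (auto simp: Sym_bideg_def)
      note d = homogeneous_polynomial_differentiable[OF this, of X]
      have "((\<lambda>s. X + s *\<^sub>R U) has_derivative (\<lambda>s. s *\<^sub>R U)) (at 0)" by (auto intro!: derivative_eq_intros)
      from has_derivative_compose[OF this, of "\<eta> \<kappa> (n - \<kappa>)" "\<lambda>v. pd v (\<eta> \<kappa> (n - \<kappa>)) X"] show ?thesis
        using has_derivative_pd[OF d] linear_scale[OF pd_linear[OF d]] by (simp add: has_vector_derivative_def \<alpha>_def)
    qed
    have val: "taylor (pd (rot \<phi> U) pot) (Suc (Suc m)) (rot \<phi> X)
        = (\<Sum>\<kappa>\<le>n. Re (cis (real_of_int (2 * int \<kappa> - int n) * \<phi>) * \<alpha> \<kappa>))" for \<phi>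
    proof -
      have "((\<lambda>s. rot \<phi> X + s *\<^sub>R rot \<phi> U) has_vector_derivative rot \<phi> U) (at 0)"
        by (auto intro!: derivative_eq_intros simp: has_vector_derivative_def)
      from taylor_has_vector_derivative[OF open_Bk zero_Bk pot_smooth this, of "Suc (Suc m)"]
      have 1: "((\<lambda>s. taylor pot n (rot \<phi> (X + s *\<^sub>R U))) has_vector_derivative
          taylor (pd (rot \<phi> U) pot) (Suc (Suc m)) (rot \<phi> X)) (at 0)" by (simp add: n_def rot_linear)
      have "taylor pot n (rot \<phi> (X + s *\<^sub>R U))
          = (\<Sum>\<kappa>\<le>n. Re (cis (real_of_int (2 * int \<kappa> - int n) * \<phi>) * \<eta> \<kappa> (n - \<kappa>) (X + s *\<^sub>R U)))" for s
        unfolding tn Re_sum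
        by (rule sum.cong[OF refl]) (simp add: Sym_bideg_rot[OF \<eta>(1)] of_nat_diff)
      moreover have "((\<lambda>s. \<Sum>\<kappa>\<le>n. Re (cis (real_of_int (2 * int \<kappa> - int n) * \<phi>) * \<eta> \<kappa> (n - \<kappa>) (X + s *\<^sub>R U))) has_vector_derivative
          (\<Sum>\<kappa>\<le>n. Re (cis (real_of_int (2 * int \<kappa> - int n) * \<phi>) * \<alpha> \<kappa>))) (at 0)"
        by (intro has_vector_derivative_sum bounded_linear.has_vector_derivative[OF bounded_linear_Re]
            bounded_linear.has_vector_derivative[OF bounded_linear_mult_right] d\<eta>)
      ultimately have "((\<lambda>s. taylor pot n (rot \<phi> (X + s *\<^sub>R U))) has_vector_derivative
          (\<Sum>\<kappa>\<le>n. Re (cis (real_of_int (2 * int \<kappa> - int n) * \<phi>) * \<alpha> \<kappa>))) (at 0)" by (simp only:)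
      from vector_derivative_unique_at[OF 1 this] show ?thesis .
    qed
    have "trig_poly m (\<lambda>\<phi>. Re (cis (real_of_int (2 * int \<kappa> - int n) * \<phi>) * \<alpha> \<kappa>))" if \<kappa>: "\<kappa> \<le> n" for \<kappa>
    proof (cases "\<kappa> < 2 \<or> n - \<kappa> < 2")
      case True
      then have "\<alpha> \<kappa> = 0" by (simp add: \<alpha>_def \<eta>(2))
      then show ?thesis by (simp add: trig_poly_const)
    next
      case False
      then show ?thesis by (intro trig_poly_Re_cis) (use \<kappa> in \<open>auto simp: n_def\<close>)
    qed
    then show ?thesis unfolding val by (intro trig_poly_sum) simp
  qed
  have "taylor (pd w pot) (Suc (Suc m)) (rot \<phi> X) = cos \<phi> * taylor (pd (rot \<phi> w) pot) (Suc (Suc m)) (rot \<phi> X)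
      - sin \<phi> * taylor (pd (rot \<phi> (I w)) pot) (Suc (Suc m)) (rot \<phi> X)" for \<phi>
  proof -
    note l = linear_taylor_pd[OF open_Bk zero_Bk pot_smooth, of "Suc (Suc m)" "rot \<phi> X"]
    \<comment> \<open>Rotation by -\<phi>, with its coefficients taken outside by linearity,
      recovers w from the rotating directions.\<close>
    have "cos \<phi> *\<^sub>R rot \<phi> w - sin \<phi> *\<^sub>R rot \<phi> (I w) = (cos \<phi> * cos \<phi>) *\<^sub>R w + (sin \<phi> * sin \<phi>) *\<^sub>R w"
      by (simp add: rot_def I_square algebra_simps)
    then have "w = cos \<phi> *\<^sub>R rot \<phi> w - sin \<phi> *\<^sub>R rot \<phi> (I w)"
      by (simp only: scaleR_add_left[symmetric] sin_cos_squared_add3 scaleR_one)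
    from arg_cong[OF this, of "\<lambda>w. taylor (pd w pot) (Suc (Suc m)) (rot \<phi> X)"]
    show ?thesis by (simp add: linear_diff[OF l] linear_scale[OF l])
  qed
  then show ?thesis
    using trig_poly_diff[OF trig_poly_mult[OF trig_poly_cos part] trig_poly_mult[OF trig_poly_sin part]] by simp
qed

sublocale knc: knc_potential I Rp pot E \<rho> M
proof (rule knc_potential.intro[OF composition_algebra_axioms knc_potential_axioms.intro])
  \<comment> \<open>At 0 the differential of k is the identity, so \<open>M 0\<close> is four times
    g at x0, hence the quarter in the dual vector.\<close>
  show "\<exists>w. \<forall>u. M 0 u w = u \<bullet> b" if "b \<in> Basis" for b
  proof (intro exI allI)
    fix u
    have "M 0 u (sharp x0 (b /\<^sub>R 4)) = 4 * g x0 (sharp x0 (b /\<^sub>R 4)) u"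
      by (simp add: M_eq[OF zero_Bk] pd_k_0 k_0 g_sym[OF x0_dom])
    then show "M 0 u (sharp x0 (b /\<^sub>R 4)) = u \<bullet> b" by (simp add: g_sharp[OF x0_dom] inner_commute)
  qed
  show "\<forall>\<^sub>F t in nhds 0. pd 1 (\<lambda>t. M (E (t *\<^sub>R X)) (pd 1 (\<lambda>t. E (t *\<^sub>R X)) t) w) t =
      pd w (\<lambda>y. M y (pd 1 (\<lambda>t. E (t *\<^sub>R X)) t) (pd 1 (\<lambda>t. E (t *\<^sub>R X)) t)) (E (t *\<^sub>R X)) / 2" for X w
    by (rule eventually_mono[OF eventually_E_ray]) (use euler_lagrange_at in blast)
qed (rule rho_pos pot_smooth E_smooth E_0 pd_E_0 M_def pot_weights)+

section \<open>Curvature order of the inverse difference element\<close>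

lemma series_eq: "series_D (taylor E) (taylor (\<lambda>Y. I Y - fpt Y (I Y))) n X
    = (\<Sum>l\<le>n. dir_deriv (taylor E (Suc (n - l))) X (defect l X))"
  by (simp add: series_D_def defect_def)

lemma dir_deriv_zero: "dir_deriv h X 0 = 0"
  by (simp add: dir_deriv_def)

text \<open>Since \<open>defect\<close> starts in degree 2, the right hand side of the recursion in
  degree m + 1 involves only components of E of degree at most m, and each term has a curvature
  factor from \<open>defect\<close>. \<open>cp_of_weight_op\<close> inverts the left hand side; its
  frequency hypothesis is \<open>extreme_weights_vanish\<close>.\<close>

lemma cp_taylor_E: "cp (Suc m) (if m = 0 then 0 else 1) (taylor E (Suc m))"
proof (induction m rule: less_induct)
  case (less m)
  show ?case
  proof (cases m)
    case 0
    have "taylor E (Suc 0) = (\<lambda>X. X)" by (intro ext knc.taylor_E_1)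
    then show ?thesis using 0 cp_id by simp
  next
    case (Suc m')
    have "cp (Suc m) 1 (taylor E (Suc m))"
    proof (rule cp_of_weight_op)
      show "((\<lambda>s. taylor E (Suc m) (A s)) has_vector_derivative dir_deriv (taylor E (Suc m)) (A s) A') (at s)"
        if "(A has_vector_derivative A') (at s)" for A A' s
        using taylor_has_vector_derivative[OF open_Bk zero_Bk E_smooth that]
        by (simp add: dir_deriv_taylor[OF open_Bk zero_Bk E_smooth])
      show "trig_poly m (\<lambda>\<phi>. taylor E (Suc m) (rot \<phi> X) \<bullet> b)" if "b \<in> Basis" for X b
        using knc.extreme_weights_vanish[of "Suc m" b X] that Suc by simp
      have eq: "weight_op (Suc m) (taylor E (Suc m)) X
          = I (\<Sum>l\<le>Suc m. dir_deriv (taylor E (Suc (Suc m - l))) X (defect l X))" for X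
      proof -
        \<comment> \<open>Euler's identity replaces N by the degree, as \<open>weight_op\<close>
          expects.\<close>
        have "real (Suc m) *\<^sub>R taylor E (Suc m) X = dir_deriv (taylor E (Suc m)) X X"
          unfolding dir_deriv_taylor[OF open_Bk zero_Bk E_smooth] taylor_eq_pow_pd[OF open_Bk zero_Bk E_smooth]
            taylor_eq_pow_pd[OF open_Bk zero_Bk smooth_on_pd[OF E_smooth]]
          by (simp add: funpow_swap1 del: of_nat_Suc)
        then show ?thesis
          using recursion[of "Suc m" X] by (simp only: weight_op_def op_N_def op_Der_I_def series_eq)
      qed
      have "cp (Suc m) 1 (\<lambda>X. dir_deriv (taylor E (Suc (Suc m - l))) X (defect l X))" if l: "l \<le> Suc m" for l
      proof (cases "l \<le> 1")
        case True
        then show ?thesis by (simp add: defect_low dir_deriv_zero comp_poly.zero)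
      next
        case False
        then have "Suc m - l < m" using l Suc by simp
        from less[OF this] have "cp (Suc (Suc m - l)) 0 (taylor E (Suc (Suc m - l)))"
          by (rule cp_mono) simp
        from cp_dir_deriv_apply[OF this cp_defect[of l]] False l show ?thesis by simp
      qed
      then show "cp (Suc m) 1 (weight_op (Suc m) (taylor E (Suc m)))"
        unfolding eq[abs_def] by (intro cp_I cp_sum) simp
    qed
    then show ?thesis using Suc by simp
  qed
qed

text \<open>The linear component of E is the identity and reproduces \<open>I (defect n X)\<close>.
  In the other terms \<open>defect\<close> and a component of E of degree at least 2 each carry a
  curvature factor.\<close>

lemma cp_remainder:
  "cp n 2 (\<lambda>X. I (series_D (taylor E) (taylor (\<lambda>Y. I Y - fpt Y (I Y))) n X) - linear_term I Rp n X)"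
proof -
  have "I (series_D (taylor E) (taylor (\<lambda>Y. I Y - fpt Y (I Y))) n X) - linear_term I Rp n X
      = I (\<Sum>l<n. dir_deriv (taylor E (Suc (n - l))) X (defect l X)) + (I (defect n X) - linear_term I Rp n X)" for X
  proof -
    have "dir_deriv (taylor E (Suc 0)) X Y = Y" for Y
      by (rule dir_deriv_eqI[where P'="\<lambda>_ Y. Y"]) (simp add: knc.taylor_E_1)
    then show ?thesis
      by (simp add: series_eq lessThan_Suc_atMost[symmetric] linear_add[OF I_linear])
  qed
  moreover have "cp n 2 (\<lambda>X. dir_deriv (taylor E (Suc (n - l))) X (defect l X))" if l: "l < n" for l
  proof (cases "l \<le> 1")
    case True
    then show ?thesis by (simp add: defect_low dir_deriv_zero comp_poly.zero)
  next
    case False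
    have "cp (Suc (n - l)) 1 (taylor E (Suc (n - l)))" using cp_taylor_E[of "n - l"] l by simp
    from cp_dir_deriv_apply[OF this cp_defect[of l]] False l show ?thesis by (simp add: numeral_2_eq_2)
  qed
  ultimately show ?thesis
    by (simp only:) (intro cp_add cp_I cp_sum cp_defect_remainder, simp)
qed

theorem expansion:
  "\<exists>Q\<in>O_R2 I Rp. \<forall>n X. I (series_D (taylor E) (taylor (\<lambda>Y. I Y - fpt Y (I Y))) n X) = linear_term I Rp n X + Q n X"
proof (intro bexI allI)
  define Q where "Q = (\<lambda>n X. I (series_D (taylor E) (taylor (\<lambda>Y. I Y - fpt Y (I Y))) n X) - linear_term I Rp n X)"
  show "I (series_D (taylor E) (taylor (\<lambda>Y. I Y - fpt Y (I Y))) n X) = linear_term I Rp n X + Q n X" for n X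
    by (simp add: Q_def)
  show "Q \<in> O_R2 I Rp"
    unfolding O_R2_def mem_Collect_eq
  proof
    fix n
    show "\<exists>(N::nat) a F r. (\<forall>i<N. iter n (r i) (F i) \<and> 2 \<le> r i) \<and> (\<forall>X. Q n X = (\<Sum>i<N. a i *\<^sub>R F i (replicate n X)))"
      using cp_imp_linear_combination[OF cp_remainder[of n]] unfolding Q_def by blast
  qed
qed

end

section \<open>From the manifold to a chart\<close>

lemma taylor_cong_open:
  assumes "open S" "0 \<in> S" "\<And>x. x \<in> S \<Longrightarrow> F x = G x"
  shows "taylor F = taylor (G :: 'a::euclidean_space \<Rightarrow> 'b::real_normed_vector)"
proof (intro ext)
  fix n X
  show "taylor F n X = taylor G n X"
    unfolding taylor_eq_taylor_coeff
    by (rule taylor_coeff_cong, rule eventually_mono[OF eventually_ray[OF assms(1,2)]]) (rule assms(3))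
qed

lemma is_chart_open_image:
  assumes "is_chart c" "open U" "U \<subseteq> chart_dom c"
  shows "open (chart_map c ` U)"
proof -
  have h: "homeomorphism (chart_dom c) (chart_img c) (chart_map c) (chart_inv c)"
    and o: "open (chart_dom c)" "open (chart_img c)" using assms by (auto simp: is_chart_def)
  have "openin (top_of_set (chart_img c)) (chart_map c ` U)"
    by (rule homeomorphism_imp_open_map[OF h]) (use assms o in \<open>simp add: openin_open_eq\<close>)
  then show ?thesis using o by (simp add: openin_open_eq)
qed

lemma is_chart_inv: "is_chart c \<Longrightarrow> q \<in> chart_dom c \<Longrightarrow> chart_inv c (chart_map c q) = q"
  by (auto simp: is_chart_def homeomorphism_def)

text \<open>Both sides are quadratic in X, so r^2 cancels.\<close>

lemma geodesic_equation_rescale: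
  fixes f :: "'a::euclidean_space \<Rightarrow> 'a"
  assumes S: "open S" "Z \<in> S" and f: "smooth_on S f" and G: "bilinear G" and r: "r \<noteq> 0"
    and eq: "pd (r *\<^sub>R X) (pd (r *\<^sub>R X) f) Z = - G (pd (r *\<^sub>R X) f Z) (pd (r *\<^sub>R X) f Z)"
  shows "pd X (pd X f) Z = - G (pd X f Z) (pd X f Z)"
proof -
  have sc: "pd (r *\<^sub>R X) h y = r *\<^sub>R pd X h y" if "h differentiable (at y)" for h :: "'a \<Rightarrow> 'a" and y
    using linear_scale[OF pd_linear[OF that]] by blast
  note d = smooth_onD[OF f S(2)] smooth_onD[OF smooth_on_pd[OF f] S(2)]
  have "pd (r *\<^sub>R X) (pd (r *\<^sub>R X) f) Z = pd (r *\<^sub>R X) (\<lambda>y. r *\<^sub>R pd X f y) Z"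
    by (rule pd_cong_open[OF S]) (rule sc[OF smooth_onD[OF f]])
  also have "\<dots> = r *\<^sub>R r *\<^sub>R pd X (pd X f) Z"
    by (simp only: pd_bounded_linear[OF bounded_linear_scaleR_right d(2)] sc[OF d(2)])
  finally have "r *\<^sub>R r *\<^sub>R pd X (pd X f) Z = r *\<^sub>R r *\<^sub>R (- G (pd X f Z) (pd X f Z))"
    unfolding eq sc[OF d(1)] using bilinear_lmul[OF G] bilinear_rmul[OF G] by simp
  then show ?thesis by (simp only: scaleR_cancel_left) (simp add: r)
qed

lemma geodesic_at_chart:
  fixes expp :: "'a::euclidean_space \<Rightarrow> 'm::topological_space"
  assumes geo: "geodesic_at A g (\<lambda>s. expp (s *\<^sub>R Y)) t" and c: "c \<in> A" "expp (t *\<^sub>R Y) \<in> chart_dom c"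
    and S: "open S" "t *\<^sub>R Y \<in> S" and f: "smooth_on S (chart_map c \<circ> expp)"
  shows "pd Y (pd Y (chart_map c \<circ> expp)) (t *\<^sub>R Y) = - christoffel (g c) ((chart_map c \<circ> expp) (t *\<^sub>R Y))
    (pd Y (chart_map c \<circ> expp) (t *\<^sub>R Y)) (pd Y (chart_map c \<circ> expp) (t *\<^sub>R Y))"
proof -
  define h where "h = chart_map c \<circ> expp"
  have f: "smooth_on S h" using f by (simp add: h_def)
  define x where "x = (\<lambda>s. h (s *\<^sub>R Y))"
  define x' where "x' = (\<lambda>s. vector_derivative x (at s))"
  have "chart_map c \<circ> (\<lambda>s. expp (s *\<^sub>R Y)) = x" by (auto simp: x_def h_def)
  then have d: "(x' has_vector_derivative - christoffel (g c) (x t) (x' t) (x' t)) (at t)"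
    using geo c unfolding geodesic_at_def by (auto simp: Let_def x'_def)
  have v: "x' s = pd Y h (s *\<^sub>R Y)" if "s *\<^sub>R Y \<in> S" for s
    unfolding x'_def x_def by (rule vector_derivative_at[OF ray_has_vector_derivative[OF smooth_onD[OF f that]]])
  have "open ((\<lambda>s. s *\<^sub>R Y) -` S)" by (rule open_vimage[OF S(1)]) (intro continuous_intros)
  then have "((\<lambda>s. pd Y h (s *\<^sub>R Y)) has_vector_derivative - christoffel (g c) (x t) (x' t) (x' t)) (at t)"
    by (rule has_vector_derivative_transform_within_open[OF d]) (use S v in auto)
  from vector_derivative_unique_at[OF ray_has_vector_derivative[OF smooth_onD[OF smooth_on_pd[OF f] S(2)]] this]
  show ?thesis using v[OF S(2)] by (simp add: x_def h_def)
qed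

text \<open>\<open>exponential_coordinates\<close> speaks about X in UE and times between 0 and 1.
  For nonzero t the vector tX is used at time 1, for t = 0 a small multiple of X at time 0;
  rescaling returns to X.\<close>

lemma exponential_coordinates_geodesic:
  fixes expp :: "'a::euclidean_space \<Rightarrow> 'm::topological_space"
  assumes e: "exponential_coordinates A g c p UE expp" and c: "c \<in> A"
    and B: "ball 0 \<rho> \<subseteq> UE" "\<And>Z. Z \<in> ball 0 \<rho> \<Longrightarrow> expp Z \<in> chart_dom c" "0 < \<rho>"
    and f: "smooth_on (ball 0 \<rho>) (chart_map c \<circ> expp)"
    and G: "\<And>Z. Z \<in> ball 0 \<rho> \<Longrightarrow> bilinear (christoffel (g c) ((chart_map c \<circ> expp) Z))"
    and t: "t *\<^sub>R X \<in> ball 0 \<rho>"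
  shows "pd X (pd X (chart_map c \<circ> expp)) (t *\<^sub>R X) = - christoffel (g c) ((chart_map c \<circ> expp) (t *\<^sub>R X))
    (pd X (chart_map c \<circ> expp) (t *\<^sub>R X)) (pd X (chart_map c \<circ> expp) (t *\<^sub>R X))"
proof -
  have "\<exists>r s. r \<noteq> 0 \<and> s \<in> {0..1::real} \<and> r *\<^sub>R X \<in> UE \<and> s *\<^sub>R r *\<^sub>R X = t *\<^sub>R X"
  proof (cases "t = 0")
    case True
    define d where "d = norm X + 1"
    have d: "d > 0" "norm X \<le> d" by (simp_all add: d_def add_nonneg_pos)
    define r where "r = \<rho> / 2 / d"
    have r: "r > 0" using d B(3) by (simp add: r_def)
    have "r * norm X \<le> r * d" using r d by (intro mult_left_mono) auto
    also have "\<dots> = \<rho> / 2" using d by (simp add: r_def)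
    also have "\<dots> < \<rho>" using B(3) by simp
    finally have "r *\<^sub>R X \<in> ball 0 \<rho>" using r by simp
    then show ?thesis using True r B(1) by (intro exI[of _ r] exI[of _ 0]) auto
  next
    case False
    then show ?thesis using t B(1) by (intro exI[of _ t] exI[of _ 1]) auto
  qed
  then obtain r s where rs: "r \<noteq> 0" "s \<in> {0..1::real}" "r *\<^sub>R X \<in> UE" "s *\<^sub>R r *\<^sub>R X = t *\<^sub>R X" by blast
  have "geodesic_at A g (\<lambda>u. expp (u *\<^sub>R r *\<^sub>R X)) s"
    using e rs unfolding exponential_coordinates_def by blast
  from geodesic_at_chart[OF this c _ open_ball _ f] rs t B(2)
  have "pd (r *\<^sub>R X) (pd (r *\<^sub>R X) (chart_map c \<circ> expp)) (t *\<^sub>R X) = - christoffel (g c) ((chart_map c \<circ> expp) (t *\<^sub>R X))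
    (pd (r *\<^sub>R X) (chart_map c \<circ> expp) (t *\<^sub>R X)) (pd (r *\<^sub>R X) (chart_map c \<circ> expp) (t *\<^sub>R X))"
    by (simp only:)
  from geodesic_equation_rescale[OF open_ball t f G[OF t] rs(1) this] show ?thesis .
qed

lemma anchored_coordinates_chart:
  assumes a: "anchored_coordinates A c p U \<phi>" and c: "c \<in> A" "is_chart c"
  shows "smooth_on (U \<inter> \<phi> -` chart_dom c) (chart_map c \<circ> \<phi>)"
    and "smooth_on (chart_map c ` (chart_dom c \<inter> \<phi> ` U)) (inv_into U \<phi> \<circ> chart_inv c)"
    and "pd v (chart_map c \<circ> \<phi>) 0 = v"
    and "open N \<Longrightarrow> open (U \<inter> \<phi> -` N)"
proof -
  show "smooth_on (U \<inter> \<phi> -` chart_dom c) (chart_map c \<circ> \<phi>)"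
    "smooth_on (chart_map c ` (chart_dom c \<inter> \<phi> ` U)) (inv_into U \<phi> \<circ> chart_inv c)"
    using a c by (auto simp: anchored_coordinates_def smooth_into_def smooth_on_mfd_def)
  show "pd v (chart_map c \<circ> \<phi>) 0 = v"
    by (rule pd_eqI[where f'="\<lambda>v. v"]) (use a in \<open>unfold anchored_coordinates_def, blast\<close>)
  show "open N \<Longrightarrow> open (U \<inter> \<phi> -` N)"
    using a by (auto simp: anchored_coordinates_def smooth_into_def intro: continuous_open_preimage)
qed

text \<open>At points whose image is reached by both coordinate systems, injectivity determines the
  values of all the choice functions involved, so the inverse of \<open>difference_element\<close>
  is the expected composition.\<close>

lemma inverse_difference_element_eq:
  assumes "inj_on expp UE" "inj_on knc UK" "Y \<in> UE" "expp Y \<in> knc ` UK"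
  shows "inverse_difference_element UE expp UK knc Y = inv_into UK knc (expp Y)"
  unfolding inverse_difference_element_def
proof (rule inv_into_f_eq)
  show "inj_on (difference_element UE expp knc) (UK \<inter> knc -` (expp ` UE))"
    using assms(2) by (auto simp: difference_element_def inj_on_def dest!: inv_into_injective)
  show "inv_into UK knc (expp Y) \<in> UK \<inter> knc -` (expp ` UE)"
    using assms by (auto simp: f_inv_into_f inv_into_into)
  show "difference_element UE expp knc (inv_into UK knc (expp Y)) = Y"
    using assms by (simp add: difference_element_def f_inv_into_f)
qed

theorem mainTheorem5:
  fixes A :: "('m::{t2_space,second_countable_topology}, 'a::euclidean_space) chart set"
    and g :: "('m, 'a) metric" and J :: "('m, 'a) endo_field"
    and c :: "('m, 'a) chart" and p :: 'm
    and UE UK :: "'a set" and expp knc :: "'a \<Rightarrow> 'm"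
    and Ip :: "'a \<Rightarrow> 'a" and R :: "nat \<Rightarrow> 'a list \<Rightarrow> 'a"
    and Kinv :: "'a \<Rightarrow> 'a" and \<Phi> :: "'a \<Rightarrow> 'a \<Rightarrow> 'a"
  assumes "kaehler_manifold A g J" and "real_analytic_metric A g"
    and "c \<in> A" and "p \<in> chart_dom c"
    and "exponential_coordinates A g c p UE expp"
    and "kaehler_normal_coordinates A g J c p UK knc"
    and "Ip = J c (chart_map c p)"
    and "R = (\<lambda>k. curvature_deriv (christoffel (g c)) k (chart_map c p))"
    and "Kinv = inverse_difference_element UE expp UK knc"
    and "\<Phi> = forward_PT g c expp"
  shows "(\<forall>n X. op_N (taylor Kinv) n X + op_Der_I Ip (taylor Kinv) n X
            = Ip (series_D (taylor Kinv) (taylor (\<lambda>Y. Ip Y - \<Phi> Y (Ip Y))) n X)) \<and>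
         (\<exists>Q \<in> O_R2 Ip R. \<forall>n X.
            Ip (series_D (taylor Kinv) (taylor (\<lambda>Y. Ip Y - \<Phi> Y (Ip Y))) n X)
            = linear_term Ip R n X + Q n X)"
proof -
  define \<Omega> where "\<Omega> = chart_img c"
  define x0 where "x0 = chart_map c p"
  define f where "f = chart_map c \<circ> expp"
  define k where "k = chart_map c \<circ> knc"
  have manifold: "smooth_atlas A" "riemannian_metric A g" "almost_complex_structure A J"
    "\<And>x Z Y. x \<in> \<Omega> \<Longrightarrow> cov_deriv (christoffel (g c)) (\<lambda>y ys. J c y (ys ! 0)) x [Z, Y] = 0"
    using assms(1,3) by (auto simp: kaehler_manifold_def \<Omega>_def)
  have chart: "is_chart c" using manifold(1) assms(3) by (simp add: smooth_atlas_def)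
  have aE: "anchored_coordinates A c p UE expp" using assms(5) by (simp add: exponential_coordinates_def)
  have aK: "anchored_coordinates A c p UK knc" "holomorphic_coordinates A J c p UK knc"
    using assms(6) by (simp_all add: kaehler_normal_coordinates_def)
  obtain \<theta> W where pot: "p \<in> W" "local_potential A g J W \<theta>"
    "(\<lambda>n X. taylor (\<theta> \<circ> knc) n X - (if n = 2 then g c (chart_map c p) X X else 0)) \<in> Sym_ge_2_2 (J c (chart_map c p))"
    using assms(6) unfolding kaehler_normal_coordinates_def by blast
  note E = anchored_coordinates_chart[OF aE assms(3) chart]
  note K = anchored_coordinates_chart[OF aK(1) assms(3) chart]
  have U: "open UE" "0 \<in> UE" "inj_on expp UE" "open (expp ` UE)" "expp 0 = p"
    "open UK" "0 \<in> UK" "inj_on knc UK" "open (knc ` UK)" "knc 0 = p"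
    using aE aK(1) by (auto simp: anchored_coordinates_def)
  \<comment> \<open>A neighborhood of p on which the chart, both coordinate systems and the
    potential are available together.\<close>
  define N where "N = chart_dom c \<inter> expp ` UE \<inter> knc ` UK \<inter> W"
  have N: "open N" "p \<in> N" "N \<subseteq> chart_dom c"
  proof -
    show "open N" unfolding N_def
      using U chart pot by (intro open_Int) (auto simp: is_chart_def local_potential_def)
    have "p \<in> expp ` UE" "p \<in> knc ` UK" using U by (metis imageI)+
    then show "p \<in> N" using pot assms(4) by (simp add: N_def)
  qed (auto simp: N_def)
  define V where "V = chart_map c ` N"
  have "open ((UE \<inter> expp -` N) \<inter> (UK \<inter> knc -` N))" by (intro open_Int E(4) K(4) N)
  moreover have "0 \<in> (UE \<inter> expp -` N) \<inter> (UK \<inter> knc -` N)" using U N by simp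
  ultimately obtain \<rho> where \<rho>: "\<rho> > 0" "ball 0 \<rho> \<subseteq> (UE \<inter> expp -` N) \<inter> (UK \<inter> knc -` N)"
    using open_contains_ball by blast
  have in_N: "Z \<in> UE" "Z \<in> UK" "expp Z \<in> N" "knc Z \<in> N" if "Z \<in> ball 0 \<rho>" for Z
    using that \<rho>(2) by auto
  have in_dom: "expp Z \<in> chart_dom c" "knc Z \<in> chart_dom c" if "Z \<in> ball 0 \<rho>" for Z
    using in_N(3,4)[OF that] N(3) by auto
  have VO: "V \<subseteq> \<Omega>" unfolding V_def \<Omega>_def chart_img_def using N(3) by auto
  have f_V: "f Z \<in> V" and k_V: "k Z \<in> V" if "Z \<in> ball 0 \<rho>" for Z
    using in_N[OF that] by (auto simp: V_def f_def k_def)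
  define fi where "fi = inv_into UE expp \<circ> chart_inv c"
  define ki where "ki = inv_into UK knc \<circ> chart_inv c"
  define \<theta>c where "\<theta>c = \<theta> \<circ> chart_inv c"
  have inv: "chart_inv c (chart_map c q) = q" if "q \<in> N" for q
    by (rule is_chart_inv[OF chart]) (use that N in auto)
  have f_smooth: "smooth_on (ball 0 \<rho>) f"
    unfolding f_def by (rule smooth_on_subset[OF E(1)]) (use in_N in_dom in auto)
  have "local_metric \<Omega> (g c)"
    by (rule local_metric.intro)
      (use manifold(2) assms(3) chart in \<open>auto simp: riemannian_metric_def \<Omega>_def is_chart_def\<close>)
  then interpret local_metric \<Omega> "g c" .
  \<comment> \<open>The chart representation of all data; from here on the argument takes place in
    the model space.\<close>
  have "knc_germ \<Omega> (g c) (J c) x0 f fi V \<rho> k ki \<theta>c"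
  proof (intro knc_germ.intro kaehler_germ.intro local_metric_axioms kaehler_germ_axioms.intro knc_germ_axioms.intro)
    fix x u v Z Y assume x: "x \<in> \<Omega>"
    show "linear (J c x)" "J c x (J c x u) = - u"
      using manifold(3) assms(3) x by (auto simp: almost_complex_structure_def \<Omega>_def)
    show "pd Z (\<lambda>y. J c y Y) x = J c x (\<Gamma> x Z Y) - \<Gamma> x Z (J c x Y)"
      using manifold(4)[OF x, of Z Y] by (simp add: pd_def algebra_simps)
  next
    show "smooth_on \<Omega> (\<lambda>x. J c x u)" for u
      using manifold(3) assms(3) by (auto simp: almost_complex_structure_def \<Omega>_def)
    show "0 < \<rho>" "smooth_on (ball 0 \<rho>) f" by (fact \<rho> f_smooth)+
    show "f 0 = x0" "k 0 = x0" by (simp_all add: f_def k_def x0_def U)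
    show "pd v f 0 = v" "pd v k 0 = v" for v unfolding f_def k_def by (fact E(3) K(3))+
    show "open V" unfolding V_def by (rule is_chart_open_image[OF chart N(1,3)])
    show "smooth_on V fi" "smooth_on V ki"
      unfolding fi_def ki_def V_def by (rule smooth_on_subset[OF E(2)] smooth_on_subset[OF K(2)], force simp: N_def)+
    show "smooth_on (ball 0 \<rho>) k"
      unfolding k_def by (rule smooth_on_subset[OF K(1)]) (use in_N in_dom in auto)
    show "V \<subseteq> \<Omega>" by (fact VO)
    show "smooth_on V \<theta>c"
    proof (rule smooth_on_subset)
      show "smooth_on (chart_map c ` (chart_dom c \<inter> W)) \<theta>c"
        using pot(2) assms(3) by (auto simp: local_potential_def smooth_on_mfd_def \<theta>c_def)
    qed (auto simp: V_def N_def)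
  next
    fix Z :: 'a assume Z: "Z \<in> ball 0 \<rho>"
    show "f Z \<in> V" "k Z \<in> V" "f Z \<in> \<Omega>" using f_V[OF Z] k_V[OF Z] VO by auto
    show "fi (f Z) = Z" "ki (k Z) = Z"
      using in_N[OF Z] U by (simp_all add: fi_def ki_def f_def k_def inv)
    show "pd (J c x0 v) k Z = J c (k Z) (pd v k Z)" for v
      using aK(2) assms(3) in_N[OF Z] in_dom[OF Z]
      unfolding holomorphic_coordinates_def pd_def k_def x0_def by auto
  next
    fix t and X :: 'a assume t: "t *\<^sub>R X \<in> ball 0 \<rho>"
    show "pd X (pd X f) (t *\<^sub>R X) = - \<Gamma> (f (t *\<^sub>R X)) (pd X f (t *\<^sub>R X)) (pd X f (t *\<^sub>R X))"
      unfolding f_def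
    proof (rule exponential_coordinates_geodesic[OF assms(5,3) _ _ \<rho>(1) _ _ t])
      show "bilinear (\<Gamma> ((chart_map c \<circ> expp) Z))" if "Z \<in> ball 0 \<rho>" for Z
        using bilinear_\<Gamma> f_V[OF that] VO by (auto simp: f_def)
    qed (use in_N in_dom f_smooth in \<open>auto simp: f_def\<close>)
  next
    fix x assume x: "x \<in> V"
    then obtain q where q: "q \<in> N" "x = chart_map c q" by (auto simp: V_def)
    show "k (ki x) = x" using q inv[OF q(1)] by (simp add: k_def ki_def N_def f_inv_into_f)
    show "complex_of_real (g c x (J c x u) v) = \<i> / 2 * del_del_bar (J c) \<theta>c x u v" for u v
      using pot(2) assms(3) q by (auto simp: local_potential_def kaehler_form_def \<theta>c_def N_def)
  next
    \<comment> \<open>Near 0 the points knc Z lie in N, where \<open>chart_inv\<close> undoes the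
      chart, and a Taylor series depends on the germ only.\<close>
    have "taylor (\<lambda>Z. \<theta>c (k Z)) = taylor (\<theta> \<circ> knc)"
      by (rule taylor_cong_open[OF open_ball centre_in_ball[THEN iffD2, OF \<rho>(1)]])
        (use in_N in \<open>simp add: \<theta>c_def k_def inv\<close>)
    then show "(\<lambda>n X. taylor (\<lambda>Z. \<theta>c (k Z)) n X - (if n = 2 then g c x0 X X else 0)) \<in> Sym_ge_2_2 (J c x0)"
      using pot(3) unfolding x0_def by (simp only:)
  qed
  then interpret knc_germ \<Omega> "g c" "J c" x0 f fi V \<rho> k ki \<theta>c .
  \<comment> \<open>The two maps agree on the ball of radius \<rho>, which is all that their Taylor
    series see.\<close>
  have Kinv: "taylor Kinv = taylor local.E"
  proof (rule taylor_cong_open[OF open_Bk zero_Bk])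
    fix Y :: 'a assume Y: "Y \<in> ball 0 \<rho>"
    show "Kinv Y = local.E Y"
      unfolding assms(9) local.E_def
      using in_N[OF Y] U by (subst inverse_difference_element_eq) (auto simp: N_def ki_def f_def inv)
  qed
  \<comment> \<open>An identity of functions and not only of germs: \<open>fpt\<close> is the same
    expression with f in place of the composition of the chart with \<open>expp\<close>.\<close>
  have Phi: "\<Phi> Y = fpt Y" for Y
    unfolding assms(10) forward_PT_def fpt_def backward_PT_def bpt_def by (simp add: f_def)
  show ?thesis
    using recursion expansion unfolding assms(7,8) x0_def[symmetric] Kinv Phi by blast
qed

end
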